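(* Let $X$ be a spectrally negative Lévy process (non-monotone paths) whose Lévy measure $\Pi$ has a density $\pi$ with respect to Lebesgue measure. For $q,\beta\ge 0$ and for positive numbers $x,y,z,a$ and $b$ such that $z<b\le a\wedge x\wedge y$, $a>x$, $a>y$, $$E_x\big(e^{-qT-\beta(T_0-T)},\ X(T-)\in dy,\ |X(T)|\in dz,\ I_{T_0}>-b,\ S_{T_0}\le a,\ T_0<\infty\big)=K_x(y,z,a)\,\frac{W^{(\beta)}(-z+b)}{W^{(\beta)}(b)}\,dy\,dz,$$ where $$K_x(y,z,a)=\pi(-z-y)\left(\frac{W^{(q)}(x)}{W^{(q)}(a)}\,W^{(q)}(a-y)-W^{(q)}(x-y)\right).$$
   Context: $X=\{X(t),t\ge 0\}$ is a real-valued spectrally negative Lévy process (càdlàg paths, no positive jumps, stationary independent increments) on a filtered probability space satisfying the usual conditions; the case of monotone paths is excluded. $P_x$ is the law of $X$ with $X(0)=x$, and $E_x$ the corresponding expectation. The Laplace exponent $\varphi$ is defined by $E_0 e^{\alpha X(t)}=e^{t\varphi(\alpha)}$, $\alpha\ge 0$, with $$\varphi(\alpha)=\mu\alpha+\tfrac12\sigma^2\alpha^2+\int_{-\infty}^0\big(e^{\alpha x}-1-\alpha x 1_{(x>-1)}\big)\Pi(dx),$$ where $\mu\in\mathbb{R}$, $\sigma\ge 0$ and the Lévy measure $\Pi$ on $(-\infty,0)$ satisfies $\int_{-\infty}^0(x^2\wedge 1)\Pi(dx)<\infty$. Standing assumption: $\Pi(dx)=\pi(x)dx$. For $q\ge 0$,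 $\Phi(q)=\sup\{\alpha\ge 0:\varphi(\alpha)=q\}$. The $q$-scale function $W^{(q)}:(-\infty,\infty)\to[0,\infty)$ is the unique function that is identically zero for $x<0$, continuous on $(0,\infty)$, and has Laplace transform $\int_0^\infty e^{-\alpha x}W^{(q)}(x)dx=\frac{1}{\varphi(\alpha)-q}$ for $\alpha>\Phi(q)$. $I_t=\inf_{0\le s\le t}X(s)$, $S_t=\sup_{0\le s\le t}X(s)$; $X(T-)$ denotes the left limit at $T$. $T=\inf\{t\ge 0:X(t)<0\}$ and $T_0=\inf\{t:t>T,\ X(t)=0\}$ is the time of recovery (with $\inf\emptyset=\infty$). The notation $E_x(Y,A)$ means $E_x(Y1_A)$, and the identity is an identity of measures in $(y,z)$ on the indicated range. *)

theory Defs
  imports "HOL-Probability.Probability"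
begin

section \<open>Path functionals\<close>

definition left_limit :: "(real \<Rightarrow> real) \<Rightarrow> real \<Rightarrow> real" where
  "left_limit p t = Lim (at_left t) p"

definition cadlag :: "(real \<Rightarrow> real) \<Rightarrow> bool" where
  "cadlag p \<longleftrightarrow>
     (\<forall>t\<ge>0. continuous (at_right t) p) \<and> (\<forall>t>0. \<exists>l. (p \<longlongrightarrow> l) (at_left t))"

definition no_positive_jumps :: "(real \<Rightarrow> real) \<Rightarrow> bool" where
  "no_positive_jumps p \<longleftrightarrow> (\<forall>t>0. p t - left_limit p t \<le> 0)"

definition running_inf :: "(real \<Rightarrow> real) \<Rightarrow> real \<Rightarrow> real" where
  "running_inf p t = (INF s\<in>{0..t}. p s)"

definition running_sup :: "(real \<Rightarrow> real) \<Rightarrow> real \<Rightarrow> real" where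
  "running_sup p t = (SUP s\<in>{0..t}. p s)"

text \<open>In the extended reals, \<^term>\<open>Inf {} = (\<infinity>::ereal)\<close>.\<close>

definition ruin_time :: "(real \<Rightarrow> real) \<Rightarrow> ereal" where
  "ruin_time p = Inf {ereal t | t. 0 \<le> t \<and> p t < 0}"

definition recovery_time :: "(real \<Rightarrow> real) \<Rightarrow> ereal" where
  "recovery_time p = Inf {ereal t | t. ruin_time p < ereal t \<and> p t = 0}"

section \<open>Spectrally negative Levy processes\<close>

definition laplace_exponent :: "real \<Rightarrow> real \<Rightarrow> real measure \<Rightarrow> real \<Rightarrow> real" where
  "laplace_exponent \<mu> \<sigma> \<nu> \<alpha> =
     \<mu> * \<alpha> + \<sigma>\<^sup>2 * \<alpha>\<^sup>2 / 2
     + (\<integral>x. (exp (\<alpha> * x) - 1 - \<alpha> * x * indicator {-1<..} x) \<partial>\<nu>)"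

text \<open>
  The process starts at \<open>0\<close>, so the underlying measure \<open>M\<close> plays the role of \<open>P\<^sub>0\<close>, and the
  process under \<open>P\<^sub>x\<close> is \<open>\<lambda>t \<omega>. x + X t \<omega>\<close>. Only times \<open>t \<ge> 0\<close> matter; a filtration indexed by
  \<open>[0, \<infinity>)\<close> is extended to negative times by, say, \<open>F t = F 0\<close>.
  No integrability condition is needed in \<open>laplace\<close>: the Bochner integral of a non-integrable
  function is \<open>0\<close>, whereas the right-hand side is positive.
\<close>

locale spectrally_negative_levy = prob_space M + complete_measure M + filtration "space M" F
  for M :: "'a measure" and F :: "real \<Rightarrow> 'a measure" +
  fixes X :: "real \<Rightarrow> 'a \<Rightarrow> real" and \<mu> \<sigma> :: real and \<nu> :: "real measure"
  assumes subalgebra_F: "\<And>t. 0 \<le> t \<Longrightarrow> subalgebra M (F t)"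
    and right_continuous_F: "\<And>t. 0 \<le> t \<Longrightarrow> sets (F t) = (\<Inter>s\<in>{t<..}. sets (F s))"
    and complete_F: "null_sets M \<subseteq> sets (F 0)"
    and adapted: "\<And>t. 0 \<le> t \<Longrightarrow> X t \<in> borel_measurable (F t)"
    and start: "AE \<omega> in M. X 0 \<omega> = 0"
    and cadlag_paths: "AE \<omega> in M. cadlag (\<lambda>t. X t \<omega>)"
    and spectrally_negative: "AE \<omega> in M. no_positive_jumps (\<lambda>t. X t \<omega>)"
    and independent_increments: "\<And>s t. 0 \<le> s \<Longrightarrow> s \<le> t \<Longrightarrow>
      indep_set (sets (F s)) (sets (vimage_algebra (space M) (\<lambda>\<omega>. X t \<omega> - X s \<omega>) borel))"
    and stationary_increments: "\<And>s t. 0 \<le> s \<Longrightarrow> s \<le> t \<Longrightarrow>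
      distr M borel (\<lambda>\<omega>. X t \<omega> - X s \<omega>) = distr M borel (\<lambda>\<omega>. X (t - s) \<omega> - X 0 \<omega>)"
    and not_increasing: "\<not> (AE \<omega> in M. mono_on {0..} (\<lambda>t. X t \<omega>))"
    and not_decreasing: "\<not> (AE \<omega> in M. antimono_on {0..} (\<lambda>t. X t \<omega>))"
    and sigma_nonneg: "0 \<le> \<sigma>"
    and sets_Levy_measure: "sets \<nu> = sets borel"
    and Levy_measure_support: "emeasure \<nu> {0..} = 0"
    and Levy_measure_finite: "(\<integral>\<^sup>+x. ennreal (min (x\<^sup>2) 1) \<partial>\<nu>) < \<infinity>"
    and laplace: "\<And>\<alpha> t. 0 \<le> \<alpha> \<Longrightarrow> 0 \<le> t \<Longrightarrow>
      expectation (\<lambda>\<omega>. exp (\<alpha> * X t \<omega>)) = exp (t * laplace_exponent \<mu> \<sigma> \<nu> \<alpha>)"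

section \<open>Scale functions\<close>

definition right_inverse_exponent :: "(real \<Rightarrow> real) \<Rightarrow> real \<Rightarrow> real" where
  "right_inverse_exponent \<phi> q = Sup {\<alpha>. 0 \<le> \<alpha> \<and> \<phi> \<alpha> = q}"

text \<open>These conditions determine \<open>W\<close> except for the value \<open>W 0\<close>, which is left arbitrary.\<close>

definition is_scale_function :: "(real \<Rightarrow> real) \<Rightarrow> real \<Rightarrow> (real \<Rightarrow> real) \<Rightarrow> bool" where
  "is_scale_function \<phi> q W \<longleftrightarrow>
     (\<forall>x. 0 \<le> W x) \<and> (\<forall>x<0. W x = 0) \<and> continuous_on {0<..} W \<and>
     (\<forall>\<alpha>>right_inverse_exponent \<phi> q.
        has_bochner_integral lborel (\<lambda>x. indicator {0<..} x * (exp (- \<alpha> * x) * W x))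
          (1 / (\<phi> \<alpha> - q)))"

definition ruin_kernel ::
    "(real \<Rightarrow> real) \<Rightarrow> (real \<Rightarrow> real) \<Rightarrow> real \<Rightarrow> real \<Rightarrow> real \<Rightarrow> real \<Rightarrow> real" where
  "ruin_kernel \<pi> Wq x y z a =
     \<pi> (- z - y) * (Wq x / Wq a * Wq (a - y) - Wq (x - y))"

text \<open>
  The random variable inside \<open>E\<^sub>x(exp (-q T - \<beta> (T\<^sub>0 - T)), (X(T-), |X(T)|) \<in> A, I > -b, S \<le> a, T\<^sub>0 < \<infinity>)\<close>,
  where \<open>I\<close> and \<open>S\<close> are taken at \<open>T\<^sub>0\<close>, as a function of the path \<open>p\<close>. Since \<open>T \<le> T\<^sub>0\<close>,
  both times are real on the event.
\<close>

definition ruin_functional ::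
    "real \<Rightarrow> real \<Rightarrow> real \<Rightarrow> real \<Rightarrow> (real \<times> real) set \<Rightarrow> (real \<Rightarrow> real) \<Rightarrow> real" where
  "ruin_functional q \<beta> a b A p =
     (let T = real_of_ereal (ruin_time p); T0 = real_of_ereal (recovery_time p)
      in if recovery_time p < \<infinity> \<and> (left_limit p T, \<bar>p T\<bar>) \<in> A
            \<and> running_inf p T0 > - b \<and> running_sup p T0 \<le> a
         then exp (- q * T - \<beta> * (T0 - T)) else 0)"

end

theory Submission
  imports Defs
begin

text \<open>
  The path is observed along a mesh \<open>h\<close>. Telescoping the exponential martingale up to the first mesh
  point outside \<open>[l, u]\<close> and letting \<open>h \<longrightarrow> 0\<close> gives Dynkin's formula
  \<open>(\<phi> \<alpha> - q) \<integral>exp (\<alpha> y) V(dy) + E exp (\<alpha> Y\<^sub>0) = E exp (\<alpha> Y\<^sub>D - q D)\<close> for the exit time \<open>D\<close> and the killed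
  potential measure \<open>V\<close>. Since \<open>1 / (\<phi> \<alpha> - q)\<close> is the Laplace transform of the scale function, uniqueness of
  Laplace transforms expresses \<open>V\<close> by the scale function, and letting \<open>y\<close> tend to the lower boundary gives the
  exit probabilities at the top.

  The compensation formula at the ruin time is replaced by the limit of the mesh sum over the last mesh point
  before ruin, the increment across zero and the subsequent recovery: \<open>\<kappa>\<^sub>h / h\<close> converges to the
  Levy measure away from \<open>0\<close>, and the sum over the mesh points converges to \<open>V\<close>.

  Finally the recovery functional is squeezed between functionals in which recovery is replaced by an exit at the
  top from \<open>[-c, 0]\<close> with \<open>c\<close> increasing to \<open>b\<close> (lower bound) or from \<open>[-b, -d]\<close> with \<open>d\<close> decreasing to \<open>0\<close> (upper bound). Both expectations
  converge to the same integral, so the functional is almost surely equal to a measurable one, and completeness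
  makes it measurable.
\<close>

section \<open>Laplace transforms of measures\<close>

text \<open>Conditioning happens only at deterministic mesh times; random times enter through
  pointwise limits of paths. Such limits need continuous payoffs, so indicators are first replaced
  by continuous functions and recovered afterwards. At a mesh exit the position may overshoot the
  top, so exponentials are not bounded there; their second moments are, by the same formula at twice
  the exponent.

  The law of the exit position at the bottom is unknown. Above the lower boundary it drops out,
  because a scale function vanishes on the negative axis; below that boundary its contribution still
  has a sign. These two facts pinch the exit probability at the top from both sides, by continuity
  of the scale function away from 0.

  Recovery needs two bounds because a path may touch 0 without exceeding it, so that recovery is not
  an exit from \<open>[-b, 0]\<close>. An exit from \<open>[-c, 0]\<close> at the top ends in 0 and
  forces recovery; recovery forces an earlier exit from \<open>[-b, -d]\<close> at the top.\<close>

definition add_measure :: "'a measure \<Rightarrow> 'a measure \<Rightarrow> 'a measure" where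
  "add_measure A B = measure_of (space A) (sets A) (\<lambda>S. emeasure A S + emeasure B S)"

lemma space_add_measure[simp]: "space (add_measure A B) = space A"
  and sets_add_measure[simp, measurable_cong]: "sets (add_measure A B) = sets A"
  unfolding add_measure_def by (auto simp: sets.space_closed)

text \<open>Sums keep the resolvent identity free of subtraction: the killed potential is a
  difference of two scale convolutions, whose total masses may be infinite.\<close>

lemma emeasure_add_measure:
  assumes "sets B = sets A" "S \<in> sets A"
  shows "emeasure (add_measure A B) S = emeasure A S + emeasure B S"
proof (rule emeasure_measure_of[OF add_measure_def])
  show "sets A \<subseteq> Pow (space A)" by (rule sets.space_closed)
  show "S \<in> sets (add_measure A B)" using assms by simp
  show "positive (sets (add_measure A B)) (\<lambda>S. emeasure A S + emeasure B S)"
    by (simp add: positive_def)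
  show "countably_additive (sets (add_measure A B)) (\<lambda>S. emeasure A S + emeasure B S)"
  proof (rule countably_additiveI)
    fix S :: "nat \<Rightarrow> 'a set"
    assume S: "range S \<subseteq> sets (add_measure A B)" "disjoint_family S"
    have "(\<Sum>i. emeasure A (S i) + emeasure B (S i)) = (\<Sum>i. emeasure A (S i)) + (\<Sum>i. emeasure B (S i))"
      by (rule suminf_add[symmetric]) auto
    then show "(\<Sum>i. emeasure A (S i) + emeasure B (S i)) = emeasure A (\<Union> (range S)) + emeasure B (\<Union> (range S))"
      using S assms(1) by (simp add: suminf_emeasure)
  qed
qed

lemma nn_integral_add_measure:
  assumes "sets B = sets A" and f: "f \<in> borel_measurable A"
  shows "(\<integral>\<^sup>+x. f x \<partial>add_measure A B) = (\<integral>\<^sup>+x. f x \<partial>A) + (\<integral>\<^sup>+x. f x \<partial>B)"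
proof -
  have sp: "space B = space A" using assms(1) by (rule sets_eq_imp_space_eq)
  show ?thesis using f
  proof (induction rule: borel_measurable_induct)
    case (cong f g)
    then show ?case by (simp cong: nn_integral_cong_simp add: sp)
  next
    case (set S)
    then show ?case using assms(1) by (simp add: emeasure_add_measure)
  next
    case (mult u c)
    moreover have "u \<in> borel_measurable B" "u \<in> borel_measurable (add_measure A B)"
      using mult(2) assms(1) by (simp_all cong: measurable_cong_sets)
    ultimately show ?case by (simp add: nn_integral_cmult distrib_left)
  next
    case (add u v)
    moreover have "u \<in> borel_measurable B" "u \<in> borel_measurable (add_measure A B)"
      "v \<in> borel_measurable B" "v \<in> borel_measurable (add_measure A B)"
      using add(1,3) add.hyps assms(1) by (auto cong: measurable_cong_sets)
    ultimately show ?case by (simp add: nn_integral_add ac_simps)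
  next
    case (seq U)
    have m: "U i \<in> borel_measurable B" "U i \<in> borel_measurable (add_measure A B)" for i
      using seq(1)[of i] assms(1) by (auto cong: measurable_cong_sets)
    have s: "(SUP i. U i) = (\<lambda>x. SUP i. U i x)" by (rule ext) (simp add: image_comp)
    have i: "incseq (\<lambda>i. \<integral>\<^sup>+x. U i x \<partial>A)" "incseq (\<lambda>i. \<integral>\<^sup>+x. U i x \<partial>B)"
      using seq(3) by (auto intro!: incseq_SucI nn_integral_mono simp: incseq_def le_fun_def)
    show ?case
      using seq m i by (simp add: s nn_integral_monotone_convergence_SUP ennreal_SUP_add)
  qed
qed

lemma polynomial_approximation:
  fixes f :: "real \<Rightarrow> real"
  assumes "continuous_on {l..u} f" "0 < e"
  obtains c n where "\<And>x. x \<in> {l..u} \<Longrightarrow> \<bar>f x - (\<Sum>i\<le>n. c i * x ^ i)\<bar> < e"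
proof -
  obtain g where g: "real_polynomial_function g" "\<And>x. x \<in> {l..u} \<Longrightarrow> \<bar>f x - g x\<bar> < e"
    using Stone_Weierstrass_real_polynomial_function[OF compact_Icc assms] by metis
  from g(1) obtain c n where "g = (\<lambda>x. \<Sum>i\<le>n. c i * x ^ i)"
    unfolding real_polynomial_function_iff_sum by blast
  with g(2) have "\<bar>f x - (\<Sum>i\<le>n. c i * x ^ i)\<bar> < e" if "x \<in> {l..u}" for x
    using that by simp
  then show ?thesis by (rule that)
qed

text \<open>Moments fix the integrals of polynomials, hence by uniform approximation on
  \<open>[0, 1]\<close> those of bounded continuous functions, hence the masses of open
  half-lines.\<close>

lemma finite_measure_eq_moments:
  fixes A B :: "real measure"
  assumes A: "finite_measure A" "sets A = sets borel" "AE x in A. x \<in> {0..1}"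
    and B: "finite_measure B" "sets B = sets borel" "AE x in B. x \<in> {0..1}"
    and eq: "\<And>j. (\<integral>\<^sup>+x. ennreal (x ^ j) \<partial>A) = (\<integral>\<^sup>+x. ennreal (x ^ j) \<partial>B)"
  shows "A = B"
proof -
  interpret A: finite_measure A by fact
  interpret B: finite_measure B by fact
  note [measurable_cong] = A(2) B(2)
  have mom: "(\<integral>x. x ^ j \<partial>A) = (\<integral>x. x ^ j \<partial>B)" for j
  proof -
    have "AE x in A. 0 \<le> x ^ j" using A(3) by eventually_elim simp
    then have "(\<integral>x. x ^ j \<partial>A) = enn2real (\<integral>\<^sup>+x. ennreal (x ^ j) \<partial>A)"
      by (rule integral_eq_nn_integral[rotated]) measurable
    moreover have "AE x in B. 0 \<le> x ^ j" using B(3) by eventually_elim simp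
    then have "(\<integral>x. x ^ j \<partial>B) = enn2real (\<integral>\<^sup>+x. ennreal (x ^ j) \<partial>B)"
      by (rule integral_eq_nn_integral[rotated]) measurable
    ultimately show ?thesis by (simp only: eq)
  qed
  have intA: "integrable A f" if "f \<in> borel_measurable borel" "\<And>x. x \<in> {0..1} \<Longrightarrow> \<bar>f x\<bar> \<le> C"
    for f :: "real \<Rightarrow> real" and C
    using A(3) that by (intro A.integrable_const_bound[where B = C]) (auto simp: measurable_cong_sets[OF A(2) refl])
  have intB: "integrable B f" if "f \<in> borel_measurable borel" "\<And>x. x \<in> {0..1} \<Longrightarrow> \<bar>f x\<bar> \<le> C"
    for f :: "real \<Rightarrow> real" and C
    using B(3) that by (intro B.integrable_const_bound[where B = C]) (auto simp: measurable_cong_sets[OF B(2) refl])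
  have pw: "\<bar>x ^ j\<bar> \<le> 1" if "x \<in> {0..1}" for x :: real and j
    using that by (auto simp: power_abs power_le_one)
  have cont: "(\<integral>x. f x \<partial>A) = (\<integral>x. f x \<partial>B)" if f: "continuous_on UNIV f" and bd: "\<And>x. \<bar>f x\<bar> \<le> C"
    for f :: "real \<Rightarrow> real" and C
  proof -
    have [measurable]: "f \<in> borel_measurable borel" using f by (rule borel_measurable_continuous_onI)
    have "\<bar>(\<integral>x. f x \<partial>A) - (\<integral>x. f x \<partial>B)\<bar> \<le> e" if "e > 0" for e :: real
    proof -
      \<comment> \<open>The summand 1 keeps the quotient meaningful when both measures
        vanish.\<close>
      define d where "d = e / (measure A UNIV + measure B UNIV + 1)"
      have d: "d > 0" "d * (measure A UNIV + measure B UNIV) \<le> e"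
        using \<open>e > 0\<close> by (auto simp: d_def divide_simps add_nonneg_pos mult_left_mono)
      obtain c n where cn: "\<And>x. x \<in> {0..1} \<Longrightarrow> \<bar>f x - (\<Sum>i\<le>n. c i * x ^ i)\<bar> < d"
        using polynomial_approximation[OF continuous_on_subset[OF f] d(1)] by (metis subset_UNIV)
      let ?p = "\<lambda>x. \<Sum>i\<le>n. c i * x ^ i"
      have pA: "integrable A (\<lambda>x. c i * x ^ i)" and pB: "integrable B (\<lambda>x. c i * x ^ i)" for i
        by (intro integrable_mult_right intA[where C = 1] intB[where C = 1] pw; simp)+
      have fA: "integrable A f" and fB: "integrable B f"
        using bd by (auto intro: intA[where C = C] intB[where C = C])
      have "\<bar>(\<integral>x. f x \<partial>A) - (\<integral>x. ?p x \<partial>A)\<bar> = \<bar>\<integral>x. f x - ?p x \<partial>A\<bar>"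
        using fA pA by simp
      also have "\<dots> \<le> (\<integral>x. \<bar>f x - ?p x\<bar> \<partial>A)" by (rule integral_abs_bound)
      also have "\<dots> \<le> (\<integral>x. d \<partial>A)"
        using cn A(3) fA pA by (intro integral_mono_AE) (auto intro: less_imp_le)
      also have "\<dots> = d * measure A UNIV" using sets_eq_imp_space_eq[OF A(2)] by simp
      finally have 1: "\<bar>(\<integral>x. f x \<partial>A) - (\<integral>x. ?p x \<partial>A)\<bar> \<le> d * measure A UNIV" .
      have "\<bar>(\<integral>x. f x \<partial>B) - (\<integral>x. ?p x \<partial>B)\<bar> = \<bar>\<integral>x. f x - ?p x \<partial>B\<bar>"
        using fB pB by simp
      also have "\<dots> \<le> (\<integral>x. \<bar>f x - ?p x\<bar> \<partial>B)" by (rule integral_abs_bound)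
      also have "\<dots> \<le> (\<integral>x. d \<partial>B)"
        using cn B(3) fB pB by (intro integral_mono_AE) (auto intro: less_imp_le)
      also have "\<dots> = d * measure B UNIV" using sets_eq_imp_space_eq[OF B(2)] by simp
      finally have 2: "\<bar>(\<integral>x. f x \<partial>B) - (\<integral>x. ?p x \<partial>B)\<bar> \<le> d * measure B UNIV" .
      have "(\<integral>x. ?p x \<partial>A) = (\<integral>x. ?p x \<partial>B)" using pA pB mom by simp
      then show ?thesis using 1 2 d(2) by (simp add: distrib_left)
    qed
    then have "\<bar>(\<integral>x. f x \<partial>A) - (\<integral>x. f x \<partial>B)\<bar> \<le> 0"
      by (metis add_0 field_le_epsilon)
    then show ?thesis by simp
  qed
  show ?thesis
  proof (rule measure_eqI_lessThan)
    fix t :: real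
    show "emeasure A {t<..} < \<infinity>" by (simp add: A.emeasure_eq_measure)
    \<comment> \<open>Ramps rising from 0 at \<open>t\<close> to 1 at \<open>t + 1 / n\<close>;
      their limit is the indicator of the open half-line.\<close>
    define g where "g n x = min 1 (max 0 (real n * (x - t)))" for n x
    have gm[measurable]: "g n \<in> borel_measurable borel" for n unfolding g_def by measurable
    have gc: "continuous_on UNIV (g n)" for n unfolding g_def by (intro continuous_intros)
    have gb: "\<bar>g n x\<bar> \<le> 1" for n x unfolding g_def by auto
    have gl: "(\<lambda>n. g n x) \<longlonglongrightarrow> indicator {t<..} x" for x
    proof (cases "x > t")
      case True
      obtain N :: nat where "1 / (x - t) \<le> real N" using real_arch_simple by blast
      then have "g n x = 1" if "n \<ge> N" for n
      proof -
        have "1 \<le> real N * (x - t)" using \<open>1 / (x - t) \<le> real N\<close> True by (simp add: divide_simps)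
        also have "\<dots> \<le> real n * (x - t)" using that True by (intro mult_right_mono) auto
        finally show ?thesis by (simp add: g_def)
      qed
      then show ?thesis using True by (intro tendsto_eventually) (auto simp: eventually_sequentially)
    next
      case False
      then have "g n x = 0" for n unfolding g_def by (simp add: mult_nonneg_nonpos max_absorb1)
      then show ?thesis using False by simp
    qed
    have "(\<lambda>n. \<integral>x. g n x \<partial>A) \<longlonglongrightarrow> (\<integral>x. indicator {t<..} x \<partial>A)"
      by (rule integral_dominated_convergence[where w = "\<lambda>_. 1"]) (use gl gb in auto)
    moreover have "(\<lambda>n. \<integral>x. g n x \<partial>B) \<longlonglongrightarrow> (\<integral>x. indicator {t<..} x \<partial>B)"
      by (rule integral_dominated_convergence[where w = "\<lambda>_. 1"]) (use gl gb in auto)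
    ultimately have "(\<integral>x. indicator {t<..} x \<partial>A) = (\<integral>x. indicator {t<..} x \<partial>B :: real)"
      using cont[OF gc gb] by (auto intro: LIMSEQ_unique)
    then show "emeasure A {t<..} = emeasure B {t<..}"
      using sets_eq_imp_space_eq[OF A(2)] sets_eq_imp_space_eq[OF B(2)]
      by (simp add: A.emeasure_eq_measure B.emeasure_eq_measure)
  qed (use A B in auto)
qed

text \<open>The substitution \<open>exp (y - u)\<close> carries \<open>{..u}\<close> into the unit
  interval, and the weight \<open>exp (c * y)\<close> makes the measures finite. The j-th moment is
  then the transform at \<open>c + j\<close>, up to the factor \<open>exp (- j * u)\<close> common
  to both measures.\<close>

lemma measure_eq_laplace_transform:
  fixes A B :: "real measure"
  assumes A: "sets A = sets borel" "AE y in A. y \<le> u"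
    and B: "sets B = sets borel" "AE y in B. y \<le> u"
    and eq: "\<And>\<alpha>. c \<le> \<alpha> \<Longrightarrow> (\<integral>\<^sup>+y. ennreal (exp (\<alpha> * y)) \<partial>A) = (\<integral>\<^sup>+y. ennreal (exp (\<alpha> * y)) \<partial>B)"
    and fin: "(\<integral>\<^sup>+y. ennreal (exp (c * y)) \<partial>A) < \<infinity>"
  shows "A = B"
proof -
  note [measurable_cong] = A(1) B(1)
  define T where "T C = distr (density C (\<lambda>y. ennreal (exp (c * y)))) borel (\<lambda>y. exp (y - u))" for C :: "real measure"
  have int: "(\<integral>\<^sup>+x. f x \<partial>T C) = (\<integral>\<^sup>+y. ennreal (exp (c * y)) * f (exp (y - u)) \<partial>C)"
    if C[measurable_cong]: "sets C = sets borel" and [measurable]: "f \<in> borel_measurable borel" for f C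
  proof -
    have "(\<integral>\<^sup>+x. f x \<partial>T C) = (\<integral>\<^sup>+y. f (exp (y - u)) \<partial>density C (\<lambda>y. ennreal (exp (c * y))))"
      unfolding T_def by (rule nn_integral_distr) measurable
    also have "\<dots> = (\<integral>\<^sup>+y. ennreal (exp (c * y)) * f (exp (y - u)) \<partial>C)"
      by (rule nn_integral_density) measurable
    finally show ?thesis .
  qed
  have sT: "sets (T C) = sets borel" "space (T C) = UNIV" for C by (auto simp: T_def)
  have fT: "finite_measure (T C)" if "sets C = sets borel" "(\<integral>\<^sup>+y. ennreal (exp (c * y)) \<partial>C) < \<infinity>" for C
  proof
    have "emeasure (T C) (space (T C)) = (\<integral>\<^sup>+x. 1 \<partial>T C)" by simp
    also have "\<dots> = (\<integral>\<^sup>+y. ennreal (exp (c * y)) \<partial>C)"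
      using int[OF that(1), of "\<lambda>_. 1"] by simp
    finally show "emeasure (T C) (space (T C)) \<noteq> \<infinity>" using that by simp
  qed
  have AET: "AE x in T C. x \<in> {0..1}" if C[measurable_cong]: "sets C = sets borel" and "AE y in C. y \<le> u" for C
  proof -
    have "AE y in density C (\<lambda>y. ennreal (exp (c * y))). exp (y - u) \<in> {0..1}"
      using that(2) by (subst AE_density) auto
    then show ?thesis unfolding T_def by (subst AE_distr_iff) auto
  qed
  have "T A = T B"
  proof (rule finite_measure_eq_moments)
    fix j :: nat
    have "(\<integral>\<^sup>+x. ennreal (x ^ j) \<partial>T C) = ennreal (exp (- real j * u)) * (\<integral>\<^sup>+y. ennreal (exp ((c + j) * y)) \<partial>C)"
      if C[measurable_cong]: "sets C = sets borel" for C
    proof -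
      have "ennreal (exp (c * y)) * ennreal (exp (y - u) ^ j) = ennreal (exp (- real j * u)) * ennreal (exp ((c + j) * y))" for y
      proof -
        have "exp (c * y) * exp (y - u) ^ j = exp (- real j * u) * exp ((c + j) * y)"
          unfolding exp_of_nat_mult[symmetric] exp_add[symmetric] by (simp add: algebra_simps)
        then show ?thesis by (simp add: ennreal_mult[symmetric])
      qed
      then have "(\<integral>\<^sup>+x. ennreal (x ^ j) \<partial>T C) = (\<integral>\<^sup>+y. ennreal (exp (- real j * u)) * ennreal (exp ((c + j) * y)) \<partial>C)"
        using int[OF C, of "\<lambda>x. ennreal (x ^ j)"] by simp
      then show ?thesis by (simp add: nn_integral_cmult)
    qed
    from this[OF A(1)] this[OF B(1)] eq[of "c + j"]
    show "(\<integral>\<^sup>+x. ennreal (x ^ j) \<partial>T A) = (\<integral>\<^sup>+x. ennreal (x ^ j) \<partial>T B)"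
      by simp
  qed (use A B fin eq[of c] fT AET sT in auto)
  show ?thesis
  proof (rule measure_eqI)
    fix S assume S: "S \<in> sets A"
    then have [measurable]: "S \<in> sets borel" using A by simp
    \<comment> \<open>Substitution and weight are both invertible, so \<open>T C\<close> determines
      \<open>C\<close>.\<close>
    have "emeasure C S = (\<integral>\<^sup>+x. ennreal (exp (- c * (ln x + u))) * indicator S (ln x + u) \<partial>T C)"
      if C[measurable_cong]: "sets C = sets borel" for C
    proof -
      have pt: "ennreal (exp (c * y)) * (ennreal (exp (- c * (ln (exp (y - u)) + u))) *
          indicator S (ln (exp (y - u)) + u)) = indicator S y" for y
      proof -
        have "ennreal (exp (c * y)) * ennreal (exp (- c * y)) = 1"
          by (simp add: ennreal_mult[symmetric] exp_add[symmetric])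
        then show ?thesis by (simp add: mult.assoc[symmetric])
      qed
      have "emeasure C S = (\<integral>\<^sup>+y. indicator S y \<partial>C)" using C by simp
      also have "\<dots> = (\<integral>\<^sup>+y. ennreal (exp (c * y)) * (ennreal (exp (- c * (ln (exp (y - u)) + u))) *
          indicator S (ln (exp (y - u)) + u)) \<partial>C)"
        by (intro nn_integral_cong) (rule pt[symmetric])
      also have "\<dots> = (\<integral>\<^sup>+x. ennreal (exp (- c * (ln x + u))) * indicator S (ln x + u) \<partial>T C)"
        by (rule int[OF C, symmetric]) measurable
      finally show ?thesis .
    qed
    then show "emeasure A S = emeasure B S" using A B \<open>T A = T B\<close> by simp
  qed (use A B in simp)
qed

text \<open>A Vitali-type theorem: bounded second moments give uniform integrability.\<close>

lemma nn_integral_LIMSEQ_bounded_second_moment: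
  fixes f :: "nat \<Rightarrow> 'a \<Rightarrow> real"
  assumes "finite_measure M"
    and [measurable]: "\<And>n. f n \<in> borel_measurable M" "g \<in> borel_measurable M"
    and nonneg: "\<And>n x. 0 \<le> f n x"
    and lim: "\<And>x. x \<in> space M \<Longrightarrow> (\<lambda>n. f n x) \<longlonglongrightarrow> g x"
    and sq: "\<And>n. (\<integral>\<^sup>+x. ennreal ((f n x)\<^sup>2) \<partial>M) \<le> ennreal C"
  shows "(\<lambda>n. \<integral>\<^sup>+x. ennreal (f n x) \<partial>M) \<longlonglongrightarrow> (\<integral>\<^sup>+x. ennreal (g x) \<partial>M)"
proof -
  interpret finite_measure M by fact
  have g0: "0 \<le> g x" if "x \<in> space M" for x
    using lim[OF that] nonneg by (intro LIMSEQ_le_const[of _ "g x" 0]) auto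
  let ?C = "max C 0"
  \<comment> \<open>Where \<open>K \<le> f n x\<close> one has
    \<open>f n x \<le> (f n x)\<^sup>2 / K\<close>, so truncation at \<open>K\<close> costs at most
    \<open>?C / K\<close>, uniformly in \<open>n\<close>.\<close>
  have up: "(\<integral>\<^sup>+x. ennreal (f n x) \<partial>M) \<le> (\<integral>\<^sup>+x. ennreal (min (f n x) K) \<partial>M) + ennreal (?C / K)" if K: "0 < K" for n and K :: real
  proof -
    have "(\<integral>\<^sup>+x. ennreal (f n x) \<partial>M) \<le> (\<integral>\<^sup>+x. ennreal (min (f n x) K) + ennreal ((f n x)\<^sup>2) / ennreal K \<partial>M)"
    proof (intro nn_integral_mono)
      fix x
      have "f n x \<le> (f n x)\<^sup>2 / K" if "K \<le> f n x"
        using K that mult_right_mono[OF that nonneg[of n x]] by (simp add: field_simps power2_eq_square)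
      then have "f n x \<le> min (f n x) K + (f n x)\<^sup>2 / K"
        using K nonneg[of n x] by (cases "K \<le> f n x") (auto simp: min_def intro: add_increasing)
      then show "ennreal (f n x) \<le> ennreal (min (f n x) K) + ennreal ((f n x)\<^sup>2) / ennreal K"
        using K nonneg[of n x] by (simp add: divide_ennreal ennreal_plus[symmetric] ennreal_leI del: ennreal_plus)
    qed
    also have "\<dots> = (\<integral>\<^sup>+x. ennreal (min (f n x) K) \<partial>M) + (\<integral>\<^sup>+x. ennreal ((f n x)\<^sup>2) \<partial>M) / ennreal K"
      by (subst nn_integral_add) (auto simp: nn_integral_divide)
    also have "\<dots> \<le> (\<integral>\<^sup>+x. ennreal (min (f n x) K) \<partial>M) + ennreal ?C / ennreal K"
      by (intro add_left_mono divide_right_mono_ennreal order_trans[OF sq]) (simp add: ennreal_leI)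
    also have "ennreal ?C / ennreal K = ennreal (?C / K)" using K by (intro divide_ennreal) auto
    finally show ?thesis .
  qed
  have trunc: "(\<lambda>n. \<integral>\<^sup>+x. ennreal (min (f n x) K) \<partial>M) \<longlonglongrightarrow> (\<integral>\<^sup>+x. ennreal (min (g x) K) \<partial>M)" for K
  proof (rule nn_integral_dominated_convergence[where w = "\<lambda>_. ennreal K"])
    show "(\<integral>\<^sup>+x. ennreal K \<partial>M) < \<infinity>"
      using emeasure_finite[of "space M"] by (simp add: less_top[symmetric] ennreal_mult_eq_top_iff)
    show "AE x in M. (\<lambda>n. ennreal (min (f n x) K)) \<longlonglongrightarrow> ennreal (min (g x) K)"
      by (intro AE_I2 tendsto_ennrealI tendsto_min lim tendsto_const)
  qed (auto intro!: ennreal_leI)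
  have "limsup (\<lambda>n. \<integral>\<^sup>+x. ennreal (f n x) \<partial>M) \<le> (\<integral>\<^sup>+x. ennreal (g x) \<partial>M)"
  proof (rule ennreal_le_epsilon)
    fix e :: real assume e: "0 < e"
    define K where "K = (?C + 1) / e"
    have K: "0 < K" using e by (auto simp: K_def)
    have Ke: "?C / K \<le> e" using e by (auto simp: K_def divide_simps)
    have "limsup (\<lambda>n. \<integral>\<^sup>+x. ennreal (f n x) \<partial>M) \<le> limsup (\<lambda>n. (\<integral>\<^sup>+x. ennreal (min (f n x) K) \<partial>M) + ennreal (?C / K))"
      by (intro Limsup_mono always_eventually allI up K)
    also have "\<dots> = (\<integral>\<^sup>+x. ennreal (min (g x) K) \<partial>M) + ennreal (?C / K)"
      by (intro lim_imp_Limsup tendsto_add trunc) auto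
    also have "\<dots> \<le> (\<integral>\<^sup>+x. ennreal (g x) \<partial>M) + ennreal e"
      by (intro add_mono nn_integral_mono ennreal_leI Ke) auto
    finally show "limsup (\<lambda>n. \<integral>\<^sup>+x. ennreal (f n x) \<partial>M) \<le> (\<integral>\<^sup>+x. ennreal (g x) \<partial>M) + ennreal e" .
  qed
  moreover have "(\<integral>\<^sup>+x. ennreal (g x) \<partial>M) \<le> liminf (\<lambda>n. \<integral>\<^sup>+x. ennreal (f n x) \<partial>M)"
  proof -
    have "(\<integral>\<^sup>+x. ennreal (g x) \<partial>M) = (\<integral>\<^sup>+x. liminf (\<lambda>n. ennreal (f n x)) \<partial>M)"
      by (intro nn_integral_cong lim_imp_Liminf[symmetric] tendsto_ennrealI lim) auto
    also have "\<dots> \<le> liminf (\<lambda>n. \<integral>\<^sup>+x. ennreal (f n x) \<partial>M)"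
      by (intro nn_integral_liminf) auto
    finally show ?thesis .
  qed
  moreover have "liminf (\<lambda>n. \<integral>\<^sup>+x. ennreal (f n x) \<partial>M) \<le> limsup (\<lambda>n. \<integral>\<^sup>+x. ennreal (f n x) \<partial>M)"
    by (intro Liminf_le_Limsup) auto
  ultimately show ?thesis
    by (intro Liminf_eq_Limsup) (auto intro: antisym)
qed

section \<open>Exit times of paths\<close>

definition right_continuous :: "(real \<Rightarrow> real) \<Rightarrow> bool" where
  "right_continuous p \<longleftrightarrow> (\<forall>t\<ge>0. continuous (at_right t) p)"

definition shift_path :: "(real \<Rightarrow> real) \<Rightarrow> real \<Rightarrow> real \<Rightarrow> real" where
  "shift_path p s t = p (s + t)"

definition exit_set :: "(real \<Rightarrow> real) \<Rightarrow> real \<Rightarrow> real \<Rightarrow> real set" where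
  "exit_set p l u = {t. 0 \<le> t \<and> p t \<notin> {l..u}}"

definition exit_time :: "(real \<Rightarrow> real) \<Rightarrow> real \<Rightarrow> real \<Rightarrow> real" where
  "exit_time p l u = Inf (exit_set p l u)"

text \<open>The value 0 on paths that never leave restricts every expectation to finite exit times;
  this matters at \<open>q = 0\<close>, where the discount factor does not do it.\<close>

definition exit_val :: "real \<Rightarrow> (real \<Rightarrow> real) \<Rightarrow> (real \<Rightarrow> real) \<Rightarrow> real \<Rightarrow> real \<Rightarrow> real" where
  "exit_val q g p l u =
     (if exit_set p l u = {} then 0 else exp (- q * exit_time p l u) * g (p (exit_time p l u)))"

definition stays :: "(real \<Rightarrow> real) \<Rightarrow> real \<Rightarrow> real \<Rightarrow> real \<Rightarrow> nat \<Rightarrow> bool" where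
  "stays p l u h k \<longleftrightarrow> (\<forall>j\<le>k. p (real j * h) \<in> {l..u})"

definition first_exit :: "(real \<Rightarrow> real) \<Rightarrow> real \<Rightarrow> real \<Rightarrow> real \<Rightarrow> nat \<Rightarrow> bool" where
  "first_exit p l u h k \<longleftrightarrow> (\<forall>j<k. p (real j * h) \<in> {l..u}) \<and> p (real k * h) \<notin> {l..u}"

lemma cadlag_right_continuous: "cadlag p \<Longrightarrow> right_continuous p"
  by (simp add: cadlag_def right_continuous_def)

lemma right_continuousD:
  assumes "right_continuous p" "0 \<le> t" "\<And>n. t \<le> s n" "s \<longlonglongrightarrow> t"
  shows "(\<lambda>n. p (s n)) \<longlonglongrightarrow> p t"
proof -
  have "continuous (at t within {t..}) p"
  proof -
    have "(p \<longlongrightarrow> p t) (at t within {t<..})"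
      using assms by (auto simp: right_continuous_def continuous_within)
    then have "(p \<longlongrightarrow> p t) (at t within {t..})"
      by (simp add: at_within_Ici_at_right)
    then show ?thesis by (simp add: continuous_within)
  qed
  then show ?thesis
    using assms(3,4) by (auto simp: continuous_within_sequentially o_def)
qed

lemma left_limit_LIMSEQ:
  assumes "cadlag p" "0 < t" "\<And>n. s n < t" "s \<longlonglongrightarrow> t"
  shows "(\<lambda>n. p (s n)) \<longlonglongrightarrow> left_limit p t"
proof -
  obtain l where l: "(p \<longlongrightarrow> l) (at_left t)" using assms by (auto simp: cadlag_def)
  then have "left_limit p t = l"
    unfolding left_limit_def by (intro tendsto_Lim) auto
  moreover have "filterlim s (at_left t) sequentially"
    using assms(3,4) by (auto simp: filterlim_at intro!: always_eventually)
  ultimately show ?thesis using filterlim_compose[OF l] by auto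
qed

lemma right_continuous_shift:
  assumes "right_continuous p" "0 \<le> s" shows "right_continuous (shift_path p s)"
  unfolding right_continuous_def
proof (intro allI impI)
  fix t :: real assume "0 \<le> t"
  then have "(p \<longlongrightarrow> p (s + t)) (at_right (s + t))"
    using assms by (auto simp: right_continuous_def continuous_within)
  then have "((\<lambda>x. p (x + s)) \<longlongrightarrow> p (s + t)) (at_right t)"
    using filterlim_at_right_to_0[of p "nhds (p (s+t))" "s+t"]
      filterlim_at_right_to_0[of "\<lambda>x. p (x + s)" "nhds (p (s+t))" t] by (simp add: ac_simps)
  then show "continuous (at_right t) (shift_path p s)"
    by (simp add: continuous_within shift_path_def[abs_def] add.commute)
qed

lemma left_limit_shift:
  "left_limit (shift_path p s) t = left_limit p (s + t)"
  and left_limit_shift_exists: "((shift_path p s) \<longlongrightarrow> l) (at_left t) \<longleftrightarrow> (p \<longlongrightarrow> l) (at_left (s + t))"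
proof -
  have *: "((shift_path p s) \<longlongrightarrow> l) (at_left t) \<longleftrightarrow> (p \<longlongrightarrow> l) (at_left (s + t))" for l
    unfolding filterlim_at_left_to_right[of _ _ t] filterlim_at_left_to_right[of _ _ "s + t"]
      filterlim_at_right_to_0[of _ _ "- t"] filterlim_at_right_to_0[of _ _ "- (s + t)"]
    by (simp add: shift_path_def algebra_simps)
  show "((shift_path p s) \<longlongrightarrow> l) (at_left t) \<longleftrightarrow> (p \<longlongrightarrow> l) (at_left (s + t))" by (rule *)
  show "left_limit (shift_path p s) t = left_limit p (s + t)"
    \<comment> \<open>\<open>Lim\<close> is a definite description, so the equality holds also where
      no left limit exists.\<close>
    unfolding left_limit_def Topological_Spaces.Lim_def by (simp add: *)
qed

lemma cadlag_shift: "cadlag p \<Longrightarrow> 0 \<le> s \<Longrightarrow> cadlag (shift_path p s)"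
  using right_continuous_shift[of p s]
  by (auto simp: cadlag_def right_continuous_def left_limit_shift_exists)

lemma no_positive_jumps_shift: "no_positive_jumps p \<Longrightarrow> 0 \<le> s \<Longrightarrow> no_positive_jumps (shift_path p s)"
  by (auto simp: no_positive_jumps_def left_limit_shift) (simp add: shift_path_def)

section \<open>Exit times and their approximation along a mesh\<close>

lemma exit_set_bdd: "bdd_below (exit_set p l u)"
  by (rule bdd_belowI[of _ 0]) (auto simp: exit_set_def)

lemma exit_time_le: "t \<in> exit_set p l u \<Longrightarrow> exit_time p l u \<le> t"
  unfolding exit_time_def by (rule cInf_lower[OF _ exit_set_bdd])

lemma exit_time_nonneg: "exit_set p l u \<noteq> {} \<Longrightarrow> 0 \<le> exit_time p l u"
  unfolding exit_time_def by (rule cInf_greatest) (auto simp: exit_set_def)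

lemma before_exit_time:
  "0 \<le> t \<Longrightarrow> t < exit_time p l u \<or> exit_set p l u = {} \<Longrightarrow> p t \<in> {l..u}"
  using exit_time_le[of t p l u] by (auto simp: exit_set_def not_le[symmetric])

lemma exit_time_approx:
  assumes "exit_set p l u \<noteq> {}" "0 < e"
  obtains t where "t \<in> exit_set p l u" "exit_time p l u \<le> t" "t < exit_time p l u + e"
  using assms exit_time_le[of _ p l u] cInf_less_iff[OF assms(1) exit_set_bdd, of "exit_time p l u + e"]
  by (auto simp: exit_time_def)

lemma exit_time_eqI:
  assumes "0 \<le> d" "\<And>t. 0 \<le> t \<Longrightarrow> t < d \<Longrightarrow> p t \<in> {l..u}"
    and "\<And>e. 0 < e \<Longrightarrow> \<exists>t\<in>exit_set p l u. t < d + e"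
  shows "exit_time p l u = d"
proof (rule antisym)
  show "exit_time p l u \<le> d"
  proof (rule field_le_epsilon)
    fix e :: real assume "0 < e"
    from assms(3)[OF this] show "exit_time p l u \<le> d + e" using exit_time_le by force
  qed
  show "d \<le> exit_time p l u"
    unfolding exit_time_def using assms(2) assms(3)[of 1]
    by (intro cInf_greatest) (auto simp: exit_set_def not_less[symmetric])
qed

lemma first_exit_unique: "first_exit p l u h k \<Longrightarrow> first_exit p l u h k' \<Longrightarrow> k = k'"
  by (metis first_exit_def nat_neq_iff)

lemma stays_first_exit: "first_exit p l u h (Suc k) \<longleftrightarrow> stays p l u h k \<and> p (real (Suc k) * h) \<notin> {l..u}"
  by (auto simp: first_exit_def stays_def less_Suc_eq_le)

lemma first_exit_exists:
  assumes "p (real k * h) \<notin> {l..u}"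
  shows "\<exists>j\<le>k. first_exit p l u h j"
proof -
  define j where "j = (LEAST j. p (real j * h) \<notin> {l..u})"
  have "p (real j * h) \<notin> {l..u}" "j \<le> k"
    unfolding j_def by (rule LeastI, rule assms, rule Least_le, rule assms)
  moreover have "p (real i * h) \<in> {l..u}" if "i < j" for i
    using not_less_Least[of i "\<lambda>j. p (real j * h) \<notin> {l..u}"] that unfolding j_def by blast
  ultimately show ?thesis unfolding first_exit_def by blast
qed

lemma right_continuous_exit_nbhd:
  assumes p: "right_continuous p" and t: "0 \<le> t" and U: "open U" "p t \<in> U"
  obtains d where "0 < d" "\<And>s. t \<le> s \<Longrightarrow> s < t + d \<Longrightarrow> p s \<in> U"
proof -
  have "(p \<longlongrightarrow> p t) (at_right t)"
    using p t by (auto simp: right_continuous_def continuous_within)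
  from topological_tendstoD[OF this U]
  obtain b where "b > t" "\<And>s. t < s \<Longrightarrow> s < b \<Longrightarrow> p s \<in> U"
    unfolding eventually_at_right_field by auto
  then show ?thesis using U(2) by (intro that[of "b - t"]) (auto simp: le_less)
qed

lemma grid_point_exists:
  assumes "0 < h" "0 \<le> (t::real)"
  obtains k :: nat where "t \<le> real k * h" "real k * h < t + h" 
proof
  let ?k = "nat \<lceil>t / h\<rceil>"
  have "0 \<le> t / h" using assms by simp
  then have "t / h \<le> real ?k" "real ?k < t / h + 1" by linarith+
  then have "t / h * h \<le> real ?k * h" "real ?k * h < (t / h + 1) * h"
    using assms(1) by (auto simp del: times_divide_eq_left intro!: mult_right_mono mult_strict_right_mono)
  then show "t \<le> real ?k * h" "real ?k * h < t + h"
    using assms(1) by (simp_all add: distrib_right)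
qed

text \<open>The complement of a closed interval is open, so right continuity keeps the path outside
  for a whole period after some exit instant; a mesh finer than this period cannot miss it. Mesh
  points never precede the exit time, so approximation is from the right.\<close>

lemma eventually_first_exit:
  assumes p: "right_continuous p" and ne: "exit_set p l u \<noteq> {}"
    and h: "\<And>n. 0 < h n" "h \<longlonglongrightarrow> 0" and e: "0 < e"
  shows "\<forall>\<^sub>F n in sequentially. \<exists>k. first_exit p l u (h n) k \<and>
     exit_time p l u \<le> real k * h n \<and> real k * h n < exit_time p l u + e"
proof -
  let ?D = "exit_time p l u"
  obtain t where t: "t \<in> exit_set p l u" "?D \<le> t" "t < ?D + e"
    using exit_time_approx[OF ne e] .
  have "open (- {l..u})" by auto
  from right_continuous_exit_nbhd[OF p _ this, of t] t(1)
  obtain d where d: "0 < d" "\<And>s. t \<le> s \<Longrightarrow> s < t + d \<Longrightarrow> p s \<in> - {l..u}"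
    by (auto simp: exit_set_def)
  \<comment> \<open>Leaves room both for the path to stay outside and for the mesh point to come
    before \<open>?D + e\<close>.\<close>
  define d' where "d' = min d (?D + e - t)"
  have d': "0 < d'" using d t by (auto simp: d'_def)
  show ?thesis using order_tendstoD(2)[OF h(2) d']
  proof eventually_elim
    case (elim n)
    have t0: "0 \<le> t" using t(1) by (simp add: exit_set_def)
    obtain k :: nat where k: "t \<le> real k * h n" "real k * h n < t + h n"
      using grid_point_exists[OF h(1) t0] .
    have "p (real k * h n) \<notin> {l..u}" using d(2)[OF k(1)] k elim by (auto simp: d'_def)
    then obtain j where j: "j \<le> k" "first_exit p l u (h n) j" using first_exit_exists by blast
    have "real j * h n \<in> exit_set p l u"
      using j(2) h(1)[of n] by (auto simp: first_exit_def exit_set_def)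
    moreover have "real j * h n \<le> real k * h n" using j(1) h(1)[of n] by simp
    then have "real j * h n < exit_time p l u + e"
      by (rule order_le_less_trans) (use k elim in \<open>simp add: d'_def\<close>)
    ultimately show ?case using j exit_time_le[of "real j * h n" p l u] by blast
  qed
qed

lemma first_exit_in_exit_set: "first_exit p l u h k \<Longrightarrow> 0 \<le> h \<Longrightarrow> real k * h \<in> exit_set p l u"
  by (auto simp: first_exit_def exit_set_def)

lemma suminf_first_exit:
  fixes v :: "nat \<Rightarrow> ennreal"
  assumes "first_exit p l u h K"
  shows "(\<Sum>k. if first_exit p l u h k then v k else 0) = v K"
proof -
  have "first_exit p l u h k \<longleftrightarrow> k = K" for k
    using assms first_exit_unique by blast
  then have "(\<lambda>k. if first_exit p l u h k then v k else 0) = (\<lambda>k. if k = K then v k else 0)"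
    by (simp only:)
  then show ?thesis using sums_unique[OF sums_single[of K v]] by simp
qed

lemma grid_exit_times:
  assumes p: "right_continuous p" and ne: "exit_set p l u \<noteq> {}"
    and h: "\<And>n. 0 < h n" "h \<longlonglongrightarrow> 0"
  obtains K :: "nat \<Rightarrow> nat" and s :: "nat \<Rightarrow> real"
  where "\<forall>\<^sub>F n in sequentially. first_exit p l u (h n) (K n) \<and> s n = real (K n) * h n"
    "\<And>n. exit_time p l u \<le> s n" "s \<longlonglongrightarrow> exit_time p l u"
proof -
  define K where "K n = (LEAST k. p (real k * h n) \<notin> {l..u})" for n
  \<comment> \<open>For the finitely many \<open>n\<close> without a mesh exit, the default keeps
    the sequence at or above the exit time and does not disturb the limit.\<close>
  define s where "s n = (if first_exit p l u (h n) (K n) then real (K n) * h n else exit_time p l u)" for n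
  have K: "K n = k" if "first_exit p l u (h n) k" for n k
    unfolding K_def using that by (intro Least_equality) (auto simp: first_exit_def not_less[symmetric])
  show ?thesis
  proof
    show ge: "exit_time p l u \<le> s n" for n
      using exit_time_le first_exit_in_exit_set h(1)[of n] by (auto simp: s_def)
    show "s \<longlonglongrightarrow> exit_time p l u"
    proof (rule order_tendstoI)
      fix a assume "a < exit_time p l u"
      then show "\<forall>\<^sub>F n in sequentially. a < s n" using ge by (intro always_eventually) (auto intro: less_le_trans)
    next
      fix a assume a: "exit_time p l u < a"
      then have "0 < a - exit_time p l u" by simp
      from eventually_first_exit[OF p ne h this] show "\<forall>\<^sub>F n in sequentially. s n < a"
      proof eventually_elim
        case (elim n)
        then obtain k where k: "first_exit p l u (h n) k" "real k * h n < a" by auto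
        with K[OF k(1)] show ?case by (simp add: s_def)
      qed
    qed
    show "\<forall>\<^sub>F n in sequentially. first_exit p l u (h n) (K n) \<and> s n = real (K n) * h n"
      using eventually_first_exit[OF p ne h zero_less_one]
    proof eventually_elim
      case (elim n)
      then obtain k where k: "first_exit p l u (h n) k" by auto
      with K[OF k] show ?case by (simp add: s_def)
    qed
  qed
qed

text \<open>At most one term of the series is nonzero, that of the mesh exit. Mesh exits approach
  the exit time from the right, so right continuity gives convergence of the position.\<close>

lemma exit_val_LIMSEQ:
  assumes p: "right_continuous p" and h: "\<And>n. 0 < h n" "h \<longlonglongrightarrow> 0" and g: "\<And>x. isCont g x"
  shows "(\<lambda>n. \<Sum>k. if first_exit p l u (h n) k
            then ennreal (exp (- q * (real k * h n)) * g (p (real k * h n))) else 0)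
         \<longlonglongrightarrow> ennreal (exit_val q g p l u)"
proof (cases "exit_set p l u = {}")
  case True
  then have "\<not> first_exit p l u (h n) k" for n k
    using first_exit_in_exit_set h(1)[of n] by (metis empty_iff less_imp_le)
  then show ?thesis using True by (simp add: exit_val_def)
next
  case False
  obtain K s where Ks: "\<forall>\<^sub>F n in sequentially. first_exit p l u (h n) (K n) \<and> s n = real (K n) * h n"
    and s: "\<And>n. exit_time p l u \<le> s n" "s \<longlonglongrightarrow> exit_time p l u"
    by (rule grid_exit_times[OF p False h]) blast
  have "(\<lambda>n. p (s n)) \<longlonglongrightarrow> p (exit_time p l u)"
    using right_continuousD[OF p exit_time_nonneg[OF False] s] .
  then have "(\<lambda>n. ennreal (exp (- q * s n) * g (p (s n)))) \<longlonglongrightarrow> ennreal (exp (- q * exit_time p l u) * g (p (exit_time p l u)))"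
    using s g by (intro tendsto_ennrealI tendsto_intros isCont_tendsto_compose[OF g])
  moreover have "\<forall>\<^sub>F n in sequentially. ennreal (exp (- q * s n) * g (p (s n))) =
      (\<Sum>k. if first_exit p l u (h n) k then ennreal (exp (- q * (real k * h n)) * g (p (real k * h n))) else 0)"
    using Ks by eventually_elim (auto simp: suminf_first_exit)
  ultimately show ?thesis using False by (simp add: exit_val_def Lim_transform_eventually)
qed

text \<open>A position strictly inside is impossible, since right continuity would prolong the stay.
  A position above \<open>u\<close> is impossible, since the left limit is at most \<open>u\<close>
  and there is no upward jump. At the bottom a jump may overshoot, so only \<open>\<le>\<close>
  remains.\<close>

lemma exit_position:
  assumes p: "cadlag p" "no_positive_jumps p" and p0: "p 0 \<le> u" and ne: "exit_set p l u \<noteq> {}" and "l \<le> u"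
  shows "p (exit_time p l u) \<le> l \<or> p (exit_time p l u) = u"
proof (rule ccontr)
  let ?D = "exit_time p l u"
  note rc = cadlag_right_continuous[OF p(1)]
  have D0: "0 \<le> ?D" using exit_time_nonneg[OF ne] .
  assume "\<not> (p ?D \<le> l \<or> p ?D = u)"
  then consider "p ?D \<in> {l<..<u}" | "u < p ?D" by force
  then show False
  proof cases
    case 1
    obtain d where d: "0 < d" "\<And>s. ?D \<le> s \<Longrightarrow> s < ?D + d \<Longrightarrow> p s \<in> {l<..<u}"
      using right_continuous_exit_nbhd[OF rc D0 _ 1] by auto
    obtain t where "t \<in> exit_set p l u" "?D \<le> t" "t < ?D + d" using exit_time_approx[OF ne d(1)] .
    then show False using d(2)[of t] by (auto simp: exit_set_def)
  next
    case 2
    then have D: "0 < ?D" using p0 D0 by (cases "?D = 0") auto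
    define s where "s n = ?D - ?D * inverse (real (Suc n))" for n
    have s: "s n < ?D" "0 \<le> s n" for n
      using D by (auto simp: s_def field_simps)
    have "s \<longlonglongrightarrow> ?D - ?D * 0"
      unfolding s_def by (intro tendsto_intros LIMSEQ_inverse_real_of_nat)
    then have lim: "s \<longlonglongrightarrow> ?D" by simp
    have "p (s n) \<le> u" for n using before_exit_time[of "s n" p l u] s[of n] by auto
    then have "left_limit p ?D \<le> u"
      by (intro LIMSEQ_le_const2[OF left_limit_LIMSEQ[OF p(1) D s(1) lim]]) auto
    then show False using 2 p(2) D by (auto simp: no_positive_jumps_def)
  qed
qed

text \<open>The mesh point of index \<open>k n\<close> overshoots \<open>t\<close> by at most one
  mesh width, and survival at \<open>t\<close> is strict, so a fine mesh still stops short of the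
  exit.\<close>

lemma stays_eventually:
  assumes p: "right_continuous p" and h: "\<And>n. 0 < h n" "h \<longlonglongrightarrow> 0"
    and t: "0 \<le> t" "t < exit_time p l u \<or> exit_set p l u = {}"
    and k: "\<And>n. t < real (k n) * h n" "\<And>n. real (k n) * h n \<le> t + h n"
  shows "\<forall>\<^sub>F n in sequentially. stays p l u (h n) (k n)"
proof -
  have "\<forall>\<^sub>F n in sequentially. t + h n < exit_time p l u \<or> exit_set p l u = {}"
    using t(2)
  proof
    assume "t < exit_time p l u"
    then have "\<forall>\<^sub>F n in sequentially. h n < exit_time p l u - t" by (intro order_tendstoD(2)[OF h(2)]) simp
    then show ?thesis by eventually_elim auto
  qed simp
  then show ?thesis
  proof (rule eventually_mono)
    fix n assume elim: "t + h n < exit_time p l u \<or> exit_set p l u = {}"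
    show "stays p l u (h n) (k n)" unfolding stays_def
    proof (intro allI impI)
      fix j assume "j \<le> k n"
      then have "real j * h n \<le> real (k n) * h n" using h(1)[of n] by simp
      then have "real j * h n \<le> t + h n" using k(2)[of n] by (rule order_trans)
      then show "p (real j * h n) \<in> {l..u}"
        using elim h(1)[of n] by (intro before_exit_time[of "real j * h n"]) (auto intro: order_le_less_trans)
    qed
  qed
qed

lemma not_stays_eventually:
  assumes p: "right_continuous p" and h: "\<And>n. 0 < h n" "h \<longlonglongrightarrow> 0"
    and t: "exit_time p l u < t" "exit_set p l u \<noteq> {}" and k: "\<And>n. t < real (k n) * h n"
  shows "\<forall>\<^sub>F n in sequentially. \<not> stays p l u (h n) (k n)"
proof -
  have "0 < t - exit_time p l u" using t by simp
  from eventually_first_exit[OF p t(2) h this] show ?thesis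
  proof eventually_elim
    case (elim n)
    then obtain j where j: "first_exit p l u (h n) j" "real j * h n < t" by auto
    then have "real j * h n < real (k n) * h n" using k[of n] by simp
    then have "j \<le> k n" using h(1)[of n] by simp
    then show ?case using j(1) by (auto simp: stays_def first_exit_def)
  qed
qed

text \<open>A path that starts strictly inside stays there for a while; a shift within this period
  moves the exit time and changes nothing else. It shows that the recovery functional depends
  continuously on the small delay with which a mesh detects ruin.\<close>

lemma exit_val_shift:
  assumes p: "right_continuous p" and p0: "p 0 \<in> {l<..<u}"
  obtains d where "0 < d" "\<And>s. 0 \<le> s \<Longrightarrow> s < d \<Longrightarrow>
     exit_val q g (shift_path p s) l u = exp (q * s) * exit_val q g p l u"
proof (cases "exit_set p l u = {}")
  case True
  then have "exit_set (shift_path p s) l u = {}" if "0 \<le> s" for s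
    using that by (auto simp: exit_set_def shift_path_def)
  then show ?thesis using True by (intro that[of 1]) (auto simp: exit_val_def)
next
  case False
  let ?D = "exit_time p l u"
  obtain d where d: "0 < d" "\<And>s. 0 \<le> s \<Longrightarrow> s < 0 + d \<Longrightarrow> p s \<in> {l<..<u}"
    using right_continuous_exit_nbhd[OF p _ _ p0] by auto
  have D: "d \<le> ?D"
    unfolding exit_time_def using False d(2)
    by (intro cInf_greatest) (force simp: exit_set_def not_less[symmetric])+
  show ?thesis
  proof (rule that[OF d(1)])
    fix s assume s: "0 \<le> s" "s < d"
    have ex: "\<exists>t\<in>exit_set (shift_path p s) l u. t < ?D - s + e" if "0 < e" for e
    proof -
      obtain t where "t \<in> exit_set p l u" "?D \<le> t" "t < ?D + e" using exit_time_approx[OF False \<open>0 < e\<close>] .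
      then show ?thesis using s D by (intro bexI[of _ "t - s"]) (auto simp: exit_set_def shift_path_def)
    qed
    have D': "exit_time (shift_path p s) l u = ?D - s"
    proof (rule exit_time_eqI)
      show "shift_path p s t \<in> {l..u}" if "0 \<le> t" "t < ?D - s" for t
        using before_exit_time[of "s + t" p l u] that s by (auto simp: shift_path_def)
    qed (use s D ex in auto)
    have "exit_set (shift_path p s) l u \<noteq> {}" using ex[of 1] by auto
    then have "exit_val q g (shift_path p s) l u = exp (- q * (?D - s)) * g (p ?D)"
      by (simp add: exit_val_def D' shift_path_def del: diff_add_eq)
    also have "exp (- q * (?D - s)) = exp (q * s) * exp (- q * ?D)"
      by (simp add: exp_add[symmetric] right_diff_distrib)
    finally show "exit_val q g (shift_path p s) l u = exp (q * s) * exit_val q g p l u"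
      using False by (simp add: exit_val_def)
  qed
qed

section \<open>Exit from an interval\<close>

text \<open>
  The total mass is arbitrary and the initial value is random, so that the locale is stable under weighting by an
  \<open>F s\<close>-measurable function followed by a time shift; this replaces the Markov property.
\<close>

locale exit_process = finite_measure M
  for M :: "'a measure" +
  fixes F :: "real \<Rightarrow> 'a measure" and Y :: "real \<Rightarrow> 'a \<Rightarrow> real"
    and \<kappa> :: "real \<Rightarrow> real measure" and \<phi> :: "real \<Rightarrow> real"
  assumes subalgebra_F: "\<And>t. 0 \<le> t \<Longrightarrow> subalgebra M (F t)"
    and F_mono: "\<And>s t. 0 \<le> s \<Longrightarrow> s \<le> t \<Longrightarrow> sets (F s) \<subseteq> sets (F t)"
    and adapted: "\<And>t. 0 \<le> t \<Longrightarrow> Y t \<in> borel_measurable (F t)"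
    and cadlag_path: "\<And>\<omega>. \<omega> \<in> space M \<Longrightarrow> cadlag (\<lambda>t. Y t \<omega>)"
    and no_positive_jumps_path: "\<And>\<omega>. \<omega> \<in> space M \<Longrightarrow> no_positive_jumps (\<lambda>t. Y t \<omega>)"
    and prob_\<kappa>: "\<And>t. 0 \<le> t \<Longrightarrow> prob_space (\<kappa> t)"
    and sets_\<kappa>: "\<And>t. sets (\<kappa> t) = sets borel"
    and increments: "\<And>s t A B. 0 \<le> s \<Longrightarrow> 0 \<le> t \<Longrightarrow> A \<in> sets (F s) \<Longrightarrow> B \<in> sets borel \<Longrightarrow>
      emeasure M (A \<inter> {\<omega>\<in>space M. Y (s + t) \<omega> - Y s \<omega> \<in> B}) = emeasure M A * emeasure (\<kappa> t) B"
    and laplace_\<kappa>: "\<And>\<alpha> t. 0 \<le> \<alpha> \<Longrightarrow> 0 \<le> t \<Longrightarrow>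
      (\<integral>\<^sup>+u. ennreal (exp (\<alpha> * u)) \<partial>\<kappa> t) = ennreal (exp (t * \<phi> \<alpha>))"
    and \<phi>_at_top: "filterlim \<phi> at_top at_top"
begin

section \<open>The Markov property over one step and survival along a mesh\<close>

abbreviation path :: "'a \<Rightarrow> real \<Rightarrow> real" where "path \<omega> \<equiv> (\<lambda>t. Y t \<omega>)"

lemma rc_path: "\<omega> \<in> space M \<Longrightarrow> right_continuous (path \<omega>)"
  by (intro cadlag_right_continuous cadlag_path)

lemma space_F: "0 \<le> t \<Longrightarrow> space (F t) = space M"
  using subalgebra_F by (auto simp: subalgebra_def)

lemma F_measurable_M: "0 \<le> t \<Longrightarrow> f \<in> measurable (F t) N \<Longrightarrow> f \<in> measurable M N"
  using measurable_from_subalg[OF subalgebra_F] .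

lemma F_measurable_mono:
  assumes "0 \<le> s" "s \<le> t" "f \<in> measurable (F s) N" shows "f \<in> measurable (F t) N"
proof -
  have "subalgebra (F t) (F s)" using assms F_mono space_F by (simp add: subalgebra_def)
  then show ?thesis using assms(3) by (rule measurable_from_subalg)
qed

lemma Y_measurable: "0 \<le> t \<Longrightarrow> Y t \<in> borel_measurable M"
  using F_measurable_M adapted by blast

text \<open>Read on rectangles, \<open>increments\<close> says that the past up to \<open>s\<close>
  and the next increment have a product law; uniqueness of product measures extends it to all
  measurable functions of the pair.\<close>

lemma nn_integral_increment:
  assumes s: "0 \<le> s" and t: "0 \<le> t" and f: "f \<in> borel_measurable (F s \<Otimes>\<^sub>M borel)"
  shows "(\<integral>\<^sup>+\<omega>. f (\<omega>, Y (s + t) \<omega> - Y s \<omega>) \<partial>M) = (\<integral>\<^sup>+\<omega>. \<integral>\<^sup>+u. f (\<omega>, u) \<partial>\<kappa> t \<partial>M)"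
proof -
  interpret K: prob_space "\<kappa> t" using prob_\<kappa>[OF t] .
  \<comment> \<open>The past enters as \<open>M\<close> restricted to \<open>F s\<close>;
    independence of the increment is available for events of \<open>F s\<close> only.\<close>
  define R where "R = restr_to_subalg M (F s)"
  have sub: "subalgebra M (F s)" using subalgebra_F[OF s] .
  have sR: "sets R = sets (F s)" unfolding R_def by (rule sets_restr_to_subalg[OF sub])
  have spR: "space R = space M" unfolding R_def by (rule space_restr_to_subalg)
  interpret R: finite_measure R unfolding R_def by (rule finite_measure_restr_to_subalg[OF sub]) unfold_locales
  have inc[measurable]: "(\<lambda>\<omega>. Y (s + t) \<omega> - Y s \<omega>) \<in> borel_measurable M"
    using s t by (intro borel_measurable_diff Y_measurable) auto
  have id: "(\<lambda>\<omega>. \<omega>) \<in> measurable M (F s)"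
    using measurable_ident_sets[OF refl, of "F s"] sub by (intro F_measurable_M[OF s]) (simp add: id_def)
  have pm: "(\<lambda>\<omega>. (\<omega>, Y (s + t) \<omega> - Y s \<omega>)) \<in> measurable M (F s \<Otimes>\<^sub>M borel)"
    using id inc by (rule measurable_Pair)
  have eq: "R \<Otimes>\<^sub>M \<kappa> t = distr M (F s \<Otimes>\<^sub>M borel) (\<lambda>\<omega>. (\<omega>, Y (s + t) \<omega> - Y s \<omega>))"
  proof (rule pair_measure_eqI)
    show "sigma_finite_measure R" "sigma_finite_measure (\<kappa> t)" by unfold_locales
    show "sets (R \<Otimes>\<^sub>M \<kappa> t) = sets (distr M (F s \<Otimes>\<^sub>M borel) (\<lambda>\<omega>. (\<omega>, Y (s + t) \<omega> - Y s \<omega>)))"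
      using sets_pair_measure_cong[OF sR sets_\<kappa>[of t]] by simp
    fix A B assume "A \<in> sets R" "B \<in> sets (\<kappa> t)"
    then have A: "A \<in> sets (F s)" and B: "B \<in> sets borel" using sR sets_\<kappa> by auto
    have AM: "A \<subseteq> space M" using sets.sets_into_space[OF A] space_F[OF s] by simp
    have "emeasure (distr M (F s \<Otimes>\<^sub>M borel) (\<lambda>\<omega>. (\<omega>, Y (s + t) \<omega> - Y s \<omega>))) (A \<times> B)
        = emeasure M ((\<lambda>\<omega>. (\<omega>, Y (s + t) \<omega> - Y s \<omega>)) -` (A \<times> B) \<inter> space M)"
      using pm A B by (intro emeasure_distr) auto
    also have "(\<lambda>\<omega>. (\<omega>, Y (s + t) \<omega> - Y s \<omega>)) -` (A \<times> B) \<inter> space M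
        = A \<inter> {\<omega>\<in>space M. Y (s + t) \<omega> - Y s \<omega> \<in> B}" using AM by auto
    also have "emeasure M \<dots> = emeasure R A * emeasure (\<kappa> t) B"
      unfolding increments[OF s t A B] R_def emeasure_restr_to_subalg[OF sub A] ..
    finally show "emeasure R A * emeasure (\<kappa> t) B =
      emeasure (distr M (F s \<Otimes>\<^sub>M borel) (\<lambda>\<omega>. (\<omega>, Y (s + t) \<omega> - Y s \<omega>))) (A \<times> B)" by simp
  qed
  have f': "f \<in> borel_measurable (R \<Otimes>\<^sub>M \<kappa> t)"
    using f unfolding measurable_cong_sets[OF sets_pair_measure_cong[OF sR sets_\<kappa>[of t]] refl] .
  have "(\<integral>\<^sup>+\<omega>. f (\<omega>, Y (s + t) \<omega> - Y s \<omega>) \<partial>M)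
      = (\<integral>\<^sup>+z. f z \<partial>distr M (F s \<Otimes>\<^sub>M borel) (\<lambda>\<omega>. (\<omega>, Y (s + t) \<omega> - Y s \<omega>)))"
    by (rule nn_integral_distr[symmetric]) (use pm f in auto)
  also have "\<dots> = (\<integral>\<^sup>+z. f z \<partial>(R \<Otimes>\<^sub>M \<kappa> t))" by (simp only: eq)
  also have "\<dots> = (\<integral>\<^sup>+\<omega>. \<integral>\<^sup>+u. f (\<omega>, u) \<partial>\<kappa> t \<partial>R)"
    by (rule K.nn_integral_fst[symmetric]) (rule f')
  also have "\<dots> = (\<integral>\<^sup>+\<omega>. \<integral>\<^sup>+u. f (\<omega>, u) \<partial>\<kappa> t \<partial>M)"
    unfolding R_def
  proof (rule nn_integral_subalgebra2[OF sub])
    have "(\<lambda>\<omega>. \<integral>\<^sup>+u. f (\<omega>, u) \<partial>\<kappa> t) \<in> borel_measurable R"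
      by (rule K.borel_measurable_nn_integral_fst[OF f'])
    then show "(\<lambda>\<omega>. \<integral>\<^sup>+u. f (\<omega>, u) \<partial>\<kappa> t) \<in> borel_measurable (F s)"
      unfolding measurable_cong_sets[OF sR refl] .
  qed
  finally show ?thesis .
qed

text \<open>The Markov property over one step, at a deterministic time.\<close>

lemma nn_integral_step:
  assumes s: "0 \<le> s" and t: "0 \<le> t"
    and Z[measurable]: "Z \<in> borel_measurable (F s)"
    and g[measurable]: "case_prod g \<in> borel_measurable (borel \<Otimes>\<^sub>M borel)"
  shows "(\<integral>\<^sup>+\<omega>. Z \<omega> * g (Y s \<omega>) (Y (s + t) \<omega>) \<partial>M)
       = (\<integral>\<^sup>+\<omega>. Z \<omega> * (\<integral>\<^sup>+u. g (Y s \<omega>) (Y s \<omega> + u) \<partial>\<kappa> t) \<partial>M)"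
proof -
  have [measurable]: "Y s \<in> borel_measurable (F s)" using adapted[OF s] .
  have "(\<integral>\<^sup>+\<omega>. Z \<omega> * g (Y s \<omega>) (Y (s + t) \<omega>) \<partial>M) =
     (\<integral>\<^sup>+\<omega>. (\<lambda>(\<omega>, u). Z \<omega> * g (Y s \<omega>) (Y s \<omega> + u)) (\<omega>, Y (s + t) \<omega> - Y s \<omega>) \<partial>M)" by simp
  also have "\<dots> = (\<integral>\<^sup>+\<omega>. \<integral>\<^sup>+u. (\<lambda>(\<omega>, u). Z \<omega> * g (Y s \<omega>) (Y s \<omega> + u)) (\<omega>, u) \<partial>\<kappa> t \<partial>M)"
    by (rule nn_integral_increment[OF s t]) measurable
  also have "\<dots> = (\<integral>\<^sup>+\<omega>. Z \<omega> * (\<integral>\<^sup>+u. g (Y s \<omega>) (Y s \<omega> + u) \<partial>\<kappa> t) \<partial>M)"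
  proof (intro nn_integral_cong)
    fix \<omega>
    have "(\<lambda>u. g (Y s \<omega>) (Y s \<omega> + u)) \<in> borel_measurable borel" by measurable
    then have "(\<lambda>u. g (Y s \<omega>) (Y s \<omega> + u)) \<in> borel_measurable (\<kappa> t)"
      by (simp add: measurable_cong_sets[OF sets_\<kappa> refl])
    then show "(\<integral>\<^sup>+u. (\<lambda>(\<omega>, u). Z \<omega> * g (Y s \<omega>) (Y s \<omega> + u)) (\<omega>, u) \<partial>\<kappa> t)
        = Z \<omega> * (\<integral>\<^sup>+u. g (Y s \<omega>) (Y s \<omega> + u) \<partial>\<kappa> t)"
      by (simp add: nn_integral_cmult)
  qed
  finally show ?thesis .
qed

definition alive :: "real \<Rightarrow> real \<Rightarrow> real \<Rightarrow> nat \<Rightarrow> 'a \<Rightarrow> ennreal" where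
  "alive l u h k \<omega> = (if stays (path \<omega>) l u h k then 1 else 0)"

lemma alive_measurable_F:
  assumes "0 \<le> h" shows "alive l u h k \<in> borel_measurable (F (real k * h))"
proof -
  have "{\<omega> \<in> space (F (real k * h)). Y (real j * h) \<omega> \<in> {l..u}} \<in> sets (F (real k * h))" if "j \<le> k" for j
  proof -
    have "real j * h \<le> real k * h" using that assms by (intro mult_right_mono) auto
    then have [measurable]: "Y (real j * h) \<in> borel_measurable (F (real k * h))"
      using assms by (intro F_measurable_mono[OF _ _ adapted]) auto
    show ?thesis by measurable
  qed
  then have "{\<omega> \<in> space (F (real k * h)). \<forall>j\<in>{..k}. Y (real j * h) \<omega> \<in> {l..u}} \<in> sets (F (real k * h))"
    by (intro sets.sets_Collect_finite_All) auto
  also have "{\<omega> \<in> space (F (real k * h)). \<forall>j\<in>{..k}. Y (real j * h) \<omega> \<in> {l..u}}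
      = {\<omega> \<in> space (F (real k * h)). stays (path \<omega>) l u h k}" unfolding stays_def by blast
  finally have [measurable]: "Measurable.pred (F (real k * h)) (\<lambda>\<omega>. stays (path \<omega>) l u h k)"
    unfolding pred_def .
  show ?thesis unfolding alive_def by measurable
qed

lemma alive_measurable: "0 \<le> h \<Longrightarrow> alive l u h k \<in> borel_measurable M"
  by (rule F_measurable_M[OF _ alive_measurable_F]) auto

lemma alive_Suc:
  "alive l u h k \<omega> = alive l u h (Suc k) \<omega> + (if first_exit (path \<omega>) l u h (Suc k) then 1 else 0)"
  unfolding alive_def stays_first_exit by (auto simp: stays_def le_Suc_eq)

lemma first_exit_measurable:
  assumes "0 \<le> h" shows "(\<lambda>\<omega>. if first_exit (path \<omega>) l u h k then 1 else 0 :: ennreal) \<in> borel_measurable M"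
proof -
  have Ym[measurable]: "Y (real j * h) \<in> borel_measurable M" for j
    using assms by (intro Y_measurable) auto
  have "{\<omega> \<in> space M. \<forall>j\<in>{..<k}. Y (real j * h) \<omega> \<in> {l..u}} \<in> sets M"
    by (intro sets.sets_Collect_finite_All) auto
  moreover have "{\<omega> \<in> space M. Y (real k * h) \<omega> \<notin> {l..u}} \<in> sets M" by measurable
  ultimately have "{\<omega> \<in> space M. \<forall>j\<in>{..<k}. Y (real j * h) \<omega> \<in> {l..u}} \<inter> {\<omega> \<in> space M. Y (real k * h) \<omega> \<notin> {l..u}} \<in> sets M"
    by (rule sets.Int)
  also have "{\<omega> \<in> space M. \<forall>j\<in>{..<k}. Y (real j * h) \<omega> \<in> {l..u}} \<inter> {\<omega> \<in> space M. Y (real k * h) \<omega> \<notin> {l..u}}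
     = {\<omega> \<in> space M. first_exit (path \<omega>) l u h k}" by (auto simp: first_exit_def)
  finally have [measurable]: "Measurable.pred M (\<lambda>\<omega>. first_exit (path \<omega>) l u h k)"
    by (simp add: pred_def)
  show ?thesis by measurable
qed

text \<open>One mesh step multiplies the mean of \<open>exp (\<alpha> * Y)\<close> over surviving
  paths by \<open>exp (h * \<phi> \<alpha>)\<close>; the result splits into what exits at the next
  mesh point and what survives it. Discounting and summing over all steps telescopes.
  \<open>U\<close> stands on both sides because its finiteness is not yet known.\<close>

lemma discrete_dynkin:
  fixes q l u h \<alpha> :: real
  assumes h: "0 < h" and \<alpha>: "0 \<le> \<alpha>"
  defines "U \<equiv> (\<Sum>k. ennreal (exp (- q * (real k * h))) *
      (\<integral>\<^sup>+\<omega>. alive l u h k \<omega> * ennreal (exp (\<alpha> * Y (real k * h) \<omega>)) \<partial>M))"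
  shows "U * ennreal (exp (h * (\<phi> \<alpha> - q))) + (\<integral>\<^sup>+\<omega>. alive l u h 0 \<omega> * ennreal (exp (\<alpha> * Y 0 \<omega>)) \<partial>M)
     = (\<integral>\<^sup>+\<omega>. (\<Sum>k. if first_exit (path \<omega>) l u h (Suc k)
          then ennreal (exp (- q * (real (Suc k) * h)) * exp (\<alpha> * Y (real (Suc k) * h) \<omega>)) else 0) \<partial>M) + U"
proof -
  have Ym[measurable]: "Y (real j * h) \<in> borel_measurable M" for j
    using h by (intro Y_measurable) auto
  have Ym'[measurable]: "Y (real (Suc j) * h) \<in> borel_measurable M" for j
    using Ym[of "Suc j"] .
  note [measurable] = alive_measurable[OF less_imp_le[OF h]] first_exit_measurable[OF less_imp_le[OF h]]
  define v where "v k = ennreal (exp (- q * (real k * h))) *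
      (\<integral>\<^sup>+\<omega>. alive l u h k \<omega> * ennreal (exp (\<alpha> * Y (real k * h) \<omega>)) \<partial>M)" for k
  define e where "e k \<omega> = (if first_exit (path \<omega>) l u h k then 1 else 0) *
      ennreal (exp (- q * (real k * h)) * exp (\<alpha> * Y (real k * h) \<omega>))" for k \<omega>
  have em[measurable]: "e (Suc k) \<in> borel_measurable M" for k unfolding e_def by measurable
  \<comment> \<open>The balance of a single step: the discounted mass of step \<open>k\<close>,
    advanced by one factor, equals the mass exiting at \<open>Suc k\<close> plus the mass surviving
    it.\<close>
  have step: "v k * ennreal (exp (h * (\<phi> \<alpha> - q))) = (\<integral>\<^sup>+\<omega>. e (Suc k) \<omega> \<partial>M) + v (Suc k)" for k
  proof -
    let ?s = "real k * h"
    have sh: "?s + h = real (Suc k) * h" by (simp add: algebra_simps)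
    have s0: "0 \<le> ?s" using h by simp
    have k: "(\<integral>\<^sup>+v. ennreal (exp (\<alpha> * (y + v))) \<partial>\<kappa> h) = ennreal (exp (\<alpha> * y)) * ennreal (exp (h * \<phi> \<alpha>))" for y
    proof -
      have "(\<integral>\<^sup>+v. ennreal (exp (\<alpha> * (y + v))) \<partial>\<kappa> h) = (\<integral>\<^sup>+v. ennreal (exp (\<alpha> * y)) * ennreal (exp (\<alpha> * v)) \<partial>\<kappa> h)"
        by (simp add: distrib_left exp_add ennreal_mult)
      also have "\<dots> = ennreal (exp (\<alpha> * y)) * (\<integral>\<^sup>+v. ennreal (exp (\<alpha> * v)) \<partial>\<kappa> h)"
        by (rule nn_integral_cmult) (simp add: measurable_cong_sets[OF sets_\<kappa> refl])
      finally show ?thesis using laplace_\<kappa>[OF \<alpha>, of h] h by simp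
    qed
    have "(\<integral>\<^sup>+\<omega>. alive l u h k \<omega> * ennreal (exp (\<alpha> * Y (real (Suc k) * h) \<omega>)) \<partial>M)
        = (\<integral>\<^sup>+\<omega>. alive l u h k \<omega> * (\<integral>\<^sup>+v. ennreal (exp (\<alpha> * (Y ?s \<omega> + v))) \<partial>\<kappa> h) \<partial>M)"
      using nn_integral_step[OF s0 less_imp_le[OF h] alive_measurable_F[OF less_imp_le[OF h]],
          of "\<lambda>_ y. ennreal (exp (\<alpha> * y))" l u] unfolding sh by simp
    also have "\<dots> = (\<integral>\<^sup>+\<omega>. alive l u h k \<omega> * ennreal (exp (\<alpha> * Y ?s \<omega>)) * ennreal (exp (h * \<phi> \<alpha>)) \<partial>M)"
      by (simp only: k mult.assoc)
    also have "\<dots> = (\<integral>\<^sup>+\<omega>. alive l u h k \<omega> * ennreal (exp (\<alpha> * Y ?s \<omega>)) \<partial>M) * ennreal (exp (h * \<phi> \<alpha>))"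
      by (rule nn_integral_multc) measurable
    finally have 1: "(\<integral>\<^sup>+\<omega>. alive l u h k \<omega> * ennreal (exp (\<alpha> * Y (real (Suc k) * h) \<omega>)) \<partial>M)
      = (\<integral>\<^sup>+\<omega>. alive l u h k \<omega> * ennreal (exp (\<alpha> * Y ?s \<omega>)) \<partial>M) * ennreal (exp (h * \<phi> \<alpha>))" .
    have "exp (- q * ?s) * exp (h * (\<phi> \<alpha> - q)) = exp (- q * (real (Suc k) * h)) * exp (h * \<phi> \<alpha>)"
      by (simp add: exp_add[symmetric] algebra_simps)
    then have 2: "ennreal (exp (- q * ?s)) * ennreal (exp (h * (\<phi> \<alpha> - q)))
        = ennreal (exp (- q * (real (Suc k) * h))) * ennreal (exp (h * \<phi> \<alpha>))"
      by (simp only: ennreal_mult[symmetric] exp_ge_zero)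
    have "v k * ennreal (exp (h * (\<phi> \<alpha> - q)))
        = (ennreal (exp (- q * ?s)) * ennreal (exp (h * (\<phi> \<alpha> - q)))) *
          (\<integral>\<^sup>+\<omega>. alive l u h k \<omega> * ennreal (exp (\<alpha> * Y ?s \<omega>)) \<partial>M)"
      unfolding v_def by (simp only: ac_simps)
    also have "\<dots> = ennreal (exp (- q * (real (Suc k) * h))) *
        (\<integral>\<^sup>+\<omega>. alive l u h k \<omega> * ennreal (exp (\<alpha> * Y (real (Suc k) * h) \<omega>)) \<partial>M)"
      unfolding 2 1 by (simp only: ac_simps)
    also have "\<dots> = (\<integral>\<^sup>+\<omega>. ennreal (exp (- q * (real (Suc k) * h))) *
        (alive l u h k \<omega> * ennreal (exp (\<alpha> * Y (real (Suc k) * h) \<omega>))) \<partial>M)"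
      by (rule nn_integral_cmult[symmetric]) measurable
    also have "\<dots> = (\<integral>\<^sup>+\<omega>. e (Suc k) \<omega> + ennreal (exp (- q * (real (Suc k) * h))) *
        (alive l u h (Suc k) \<omega> * ennreal (exp (\<alpha> * Y (real (Suc k) * h) \<omega>))) \<partial>M)"
      unfolding alive_Suc[of l u h k] e_def by (simp add: ennreal_mult distrib_left distrib_right ac_simps)
    also have "\<dots> = (\<integral>\<^sup>+\<omega>. e (Suc k) \<omega> \<partial>M) + v (Suc k)"
    proof -
      let ?f = "\<lambda>\<omega>. alive l u h (Suc k) \<omega> * ennreal (exp (\<alpha> * Y (real (Suc k) * h) \<omega>))"
      have f: "?f \<in> borel_measurable M" by measurable
      show ?thesis
        unfolding v_def nn_integral_cmult[OF f, symmetric]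
        by (rule nn_integral_add[OF em]) (use f in measurable)
    qed
    finally show ?thesis .
  qed
  have U: "U = (\<Sum>k. v k)" by (simp add: U_def v_def)
  have "U * ennreal (exp (h * (\<phi> \<alpha> - q))) = (\<Sum>k. (\<integral>\<^sup>+\<omega>. e (Suc k) \<omega> \<partial>M) + v (Suc k))"
    unfolding U by (simp add: step[symmetric])
  also have "\<dots> = (\<Sum>k. (\<integral>\<^sup>+\<omega>. e (Suc k) \<omega> \<partial>M)) + (\<Sum>k. v (Suc k))"
    by (rule suminf_add[symmetric]) auto
  finally have 3: "U * ennreal (exp (h * (\<phi> \<alpha> - q))) = (\<Sum>k. (\<integral>\<^sup>+\<omega>. e (Suc k) \<omega> \<partial>M)) + (\<Sum>k. v (Suc k))" .
  have 4: "v 0 + (\<Sum>k. v (Suc k)) = U"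
    unfolding U using suminf_offset[of v 1] by simp
  have v0: "v 0 = (\<integral>\<^sup>+\<omega>. alive l u h 0 \<omega> * ennreal (exp (\<alpha> * Y 0 \<omega>)) \<partial>M)"
    by (simp add: v_def)
  have 5: "(\<Sum>k. (\<integral>\<^sup>+\<omega>. e (Suc k) \<omega> \<partial>M)) = (\<integral>\<^sup>+\<omega>. (\<Sum>k. e (Suc k) \<omega>) \<partial>M)"
    by (rule nn_integral_suminf[symmetric]) measurable
  have 6: "e (Suc k) \<omega> = (if first_exit (path \<omega>) l u h (Suc k)
          then ennreal (exp (- q * (real (Suc k) * h)) * exp (\<alpha> * Y (real (Suc k) * h) \<omega>)) else 0)" for k \<omega>
    by (simp add: e_def)
  show ?thesis unfolding 3 v0[symmetric] 5 unfolding 6 using 4 by (simp add: ac_simps)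
qed

text \<open>An increment larger than \<open>u - l\<close> leaves the interval from any point of it,
  so each step is survived with conditional probability at most
  \<open>\<kappa> h {..u - l}\<close>.\<close>

lemma alive_geometric:
  assumes h: "0 \<le> h"
  shows "(\<integral>\<^sup>+\<omega>. alive l u h k \<omega> \<partial>M) \<le> emeasure M (space M) * emeasure (\<kappa> h) {..u - l} ^ k"
proof (induction k)
  case 0
  have "(\<integral>\<^sup>+\<omega>. alive l u h 0 \<omega> \<partial>M) \<le> (\<integral>\<^sup>+\<omega>. 1 \<partial>M)"
    by (intro nn_integral_mono) (auto simp: alive_def)
  then show ?case by simp
next
  case (Suc k)
  let ?s = "real k * h"
  have sh: "?s + h = real (Suc k) * h" by (simp add: algebra_simps)
  have s0: "0 \<le> ?s" using h by simp
  have "(\<integral>\<^sup>+\<omega>. alive l u h (Suc k) \<omega> \<partial>M) \<le>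
      (\<integral>\<^sup>+\<omega>. alive l u h k \<omega> * indicator {..u - l} (Y (real (Suc k) * h) \<omega> - Y ?s \<omega>) \<partial>M)"
  proof (intro nn_integral_mono)
    fix \<omega>
    show "alive l u h (Suc k) \<omega> \<le> alive l u h k \<omega> * indicator {..u - l} (Y (real (Suc k) * h) \<omega> - Y ?s \<omega>)"
    proof (cases "stays (path \<omega>) l u h (Suc k)")
      case True
      then have "stays (path \<omega>) l u h k" "Y (real (Suc k) * h) \<omega> \<le> u" "l \<le> Y ?s \<omega>"
        by (auto simp: stays_def)
      then show ?thesis by (auto simp: alive_def indicator_def)
    qed (simp add: alive_def)
  qed
  also have "\<dots> = (\<integral>\<^sup>+\<omega>. \<integral>\<^sup>+v. alive l u h k \<omega> * indicator {..u - l} v \<partial>\<kappa> h \<partial>M)"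
  proof -
    have [measurable]: "alive l u h k \<in> borel_measurable (F ?s)" by (rule alive_measurable_F[OF h])
    show ?thesis
      using nn_integral_increment[OF s0 h, of "\<lambda>(\<omega>, v). alive l u h k \<omega> * indicator {..u - l} v"]
      unfolding sh by simp
  qed
  also have "\<dots> = (\<integral>\<^sup>+\<omega>. alive l u h k \<omega> * emeasure (\<kappa> h) {..u - l} \<partial>M)"
    by (simp add: nn_integral_cmult_indicator sets_\<kappa>)
  also have "\<dots> = (\<integral>\<^sup>+\<omega>. alive l u h k \<omega> \<partial>M) * emeasure (\<kappa> h) {..u - l}"
    by (rule nn_integral_multc) (rule alive_measurable[OF h])
  also have "\<dots> \<le> emeasure M (space M) * emeasure (\<kappa> h) {..u - l} ^ k * emeasure (\<kappa> h) {..u - l}"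
    by (rule mult_right_mono[OF Suc.IH]) simp
  finally show ?case by (simp add: ac_simps)
qed

text \<open>If increments over time \<open>h\<close> never exceeded \<open>L\<close>, the
  exponential moment would be at most \<open>exp (\<alpha> * L)\<close>, whereas it equals
  \<open>exp (h * \<phi> \<alpha>)\<close>. The width found may be large; it starts the dyadic
  refinement and makes survival decay geometrically.\<close>

lemma exit_mesh_exists:
  assumes "0 \<le> L"
  obtains h where "0 < h" "emeasure (\<kappa> h) {..L} < 1"
proof -
  have "\<forall>\<^sub>F \<alpha> in at_top. 1 \<le> \<phi> \<alpha>" using \<phi>_at_top by (simp add: filterlim_at_top)
  then have "\<forall>\<^sub>F \<alpha> in at_top. 0 < \<alpha> \<and> 1 \<le> \<phi> \<alpha>"
    using eventually_gt_at_top[of 0] by eventually_elim simp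
  then obtain \<alpha> where \<alpha>: "0 < \<alpha>" "1 \<le> \<phi> \<alpha>"
    using eventually_happens'[OF trivial_limit_at_top_linorder] by blast
  \<comment> \<open>As \<open>\<phi> \<alpha> \<ge> 1\<close>, this choice makes
    \<open>h * \<phi> \<alpha>\<close> exceed \<open>\<alpha> * L\<close>.\<close>
  define h where "h = \<alpha> * L + 1"
  have h: "0 < h" using \<alpha> assms by (simp add: h_def add_nonneg_pos)
  interpret K: prob_space "\<kappa> h" using prob_\<kappa> h by simp
  have spK: "space (\<kappa> h) = UNIV" using sets_eq_imp_space_eq[OF sets_\<kappa>] by simp
  have "emeasure (\<kappa> h) {..L} < 1"
  proof (rule ccontr)
    assume "\<not> emeasure (\<kappa> h) {..L} < 1"
    then have "K.prob {..L} = 1" using K.emeasure_eq_measure K.prob_le_1[of "{..L}"]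
      by (simp add: ennreal_less_one_iff not_less)
    then have "AE v in \<kappa> h. v \<in> {..L}" using K.prob_eq_1[of "{..L}"] sets_\<kappa> by simp
    then have "AE v in \<kappa> h. ennreal (exp (\<alpha> * v)) \<le> ennreal (exp (\<alpha> * L))"
      by eventually_elim (use \<alpha> in \<open>auto intro!: ennreal_leI\<close>)
    then have "(\<integral>\<^sup>+v. ennreal (exp (\<alpha> * v)) \<partial>\<kappa> h) \<le> (\<integral>\<^sup>+v. ennreal (exp (\<alpha> * L)) \<partial>\<kappa> h)"
      by (rule nn_integral_mono_AE)
    then have "exp (h * \<phi> \<alpha>) \<le> exp (\<alpha> * L)"
      using laplace_\<kappa>[of \<alpha> h] \<alpha> h by (simp add: K.emeasure_space_1)
    then have "h * \<phi> \<alpha> \<le> \<alpha> * L" by simp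
    moreover have "h * 1 \<le> h * \<phi> \<alpha>" using \<alpha> h by (intro mult_left_mono) auto
    ultimately show False by (simp add: h_def)
  qed
  then show ?thesis using h that by blast
qed

end

section \<open>The killed potential as a limit of Riemann sums\<close>

definition survives :: "(real \<Rightarrow> real) \<Rightarrow> real \<Rightarrow> real \<Rightarrow> real \<Rightarrow> bool" where
  "survives p l u t \<longleftrightarrow> exit_set p l u = {} \<or> t < exit_time p l u"

text \<open>With \<open>q = 1\<close> and payoff 1, \<open>exit_val\<close> is
  \<open>exp (- D)\<close>, and 0 for \<open>D = \<infinity>\<close>. This expresses survival by one
  measurable function of the path and makes it jointly measurable in path and time.\<close>

lemma survives_iff: "survives p l u t \<longleftrightarrow> exit_val 1 (\<lambda>_. 1) p l u < exp (- t)"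
  by (auto simp: survives_def exit_val_def)

lemma exit_val_nonneg: "(\<And>x. 0 \<le> g x) \<Longrightarrow> 0 \<le> exit_val q g p l u"
  by (auto simp: exit_val_def)

lemma grid_cell_iff:
  assumes "0 < h" "0 \<le> t"
  shows "t \<in> {real k * h..<real (Suc k) * h} \<longleftrightarrow> k = nat \<lfloor>t / h\<rfloor>"
proof -
  have "t \<in> {real k * h..<real (Suc k) * h} \<longleftrightarrow> real k \<le> t / h \<and> t / h < real k + 1"
    using assms(1) by (auto simp: pos_le_divide_eq pos_divide_less_eq algebra_simps)
  also have "\<dots> \<longleftrightarrow> \<lfloor>t / h\<rfloor> = int k" by (simp add: floor_eq_iff)
  also have "\<dots> \<longleftrightarrow> k = nat \<lfloor>t / h\<rfloor>"
  proof -
    have "0 \<le> \<lfloor>t / h\<rfloor>" using assms by simp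
    then show ?thesis by linarith
  qed
  finally show ?thesis .
qed

lemma grid_cell:
  assumes "0 < h" "0 \<le> t"
  shows "real (nat \<lfloor>t / h\<rfloor>) * h \<le> t" "t < real (Suc (nat \<lfloor>t / h\<rfloor>)) * h"
  using grid_cell_iff[OF assms, THEN iffD2, OF refl] by (simp_all only: atLeastLessThan_iff)

lemma suminf_delta: "(\<Sum>k. if k = K then v k else (0::ennreal)) = v K"
  using sums_unique[OF sums_single[of K v]] by simp

lemma mesh_LIMSEQ: "(\<lambda>n. t / 2 ^ n) \<longlonglongrightarrow> (0::real)"
proof -
  have "(\<lambda>n. t * (1/2) ^ n) \<longlonglongrightarrow> t * 0"
    by (intro tendsto_mult tendsto_const LIMSEQ_power_zero) simp
  then show ?thesis by (simp add: power_one_over)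
qed

context exit_process
begin

text \<open>A pointwise limit of mesh sums, each of which involves countably many times
  only.\<close>

lemma exit_val_measurable:
  assumes g: "\<And>x. isCont g x" "\<And>x. 0 \<le> g x"
  shows "(\<lambda>\<omega>. exit_val q g (path \<omega>) l u) \<in> borel_measurable M"
proof -
  have [measurable]: "g \<in> borel_measurable borel"
    using g(1) by (intro borel_measurable_continuous_onI) (simp add: continuous_at_imp_continuous_on)
  define h where "h n = (1 / 2 ^ n :: real)" for n
  have h: "0 < h n" for n by (simp add: h_def)
  have [measurable]: "Y (real k * h n) \<in> borel_measurable M" for k n
    using h[of n] by (intro Y_measurable) auto
  note [measurable] = first_exit_measurable[OF less_imp_le[OF h]]
  have "(\<lambda>\<omega>. \<Sum>k. (if first_exit (path \<omega>) l u (h n) k then 1 else 0) *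
      ennreal (exp (- q * (real k * h n)) * g (Y (real k * h n) \<omega>))) \<in> borel_measurable M" for n
    by measurable
  also have "(\<lambda>\<omega>. \<Sum>k. (if first_exit (path \<omega>) l u (h n) k then 1 else 0) *
      ennreal (exp (- q * (real k * h n)) * g (Y (real k * h n) \<omega>)))
    = (\<lambda>\<omega>. \<Sum>k. if first_exit (path \<omega>) l u (h n) k
         then ennreal (exp (- q * (real k * h n)) * g (path \<omega> (real k * h n))) else 0)" for n
    by (intro ext arg_cong[where f = suminf]) auto
  finally have m: "(\<lambda>\<omega>. \<Sum>k. if first_exit (path \<omega>) l u (h n) k
         then ennreal (exp (- q * (real k * h n)) * g (path \<omega> (real k * h n))) else 0) \<in> borel_measurable M" for n .
  have "(\<lambda>\<omega>. ennreal (exit_val q g (path \<omega>) l u)) \<in> borel_measurable M"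
  proof (rule borel_measurable_LIMSEQ_order[OF _ m])
    fix \<omega> assume "\<omega> \<in> space M"
    then show "(\<lambda>n. \<Sum>k. if first_exit (path \<omega>) l u (h n) k
         then ennreal (exp (- q * (real k * h n)) * g (path \<omega> (real k * h n))) else 0)
      \<longlonglongrightarrow> ennreal (exit_val q g (path \<omega>) l u)"
      using mesh_LIMSEQ[of 1] by (intro exit_val_LIMSEQ rc_path h g(1)) (auto simp: h_def)
  qed
  then have "(\<lambda>\<omega>. enn2real (ennreal (exit_val q g (path \<omega>) l u))) \<in> borel_measurable M" by measurable
  then show ?thesis using exit_val_nonneg[OF g(2)] by simp
qed

lemma Y_joint_measurable: "(\<lambda>(\<omega>, t). Y (max 0 t) \<omega>) \<in> borel_measurable (M \<Otimes>\<^sub>M borel)"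
proof -
  define h where "h n = (1 / 2 ^ n :: real)" for n
  have h: "0 < h n" for n by (simp add: h_def)
  \<comment> \<open>\<open>Suc\<close> selects the mesh point strictly to the right of
    \<open>t\<close>, the side on which paths are continuous.\<close>
  define k where "k n t = Suc (nat \<lfloor>max 0 t / h n\<rfloor>)" for n t
  have [measurable]: "k n \<in> measurable borel (count_space UNIV)" for n unfolding k_def by measurable
  have "(\<lambda>z. Y (real (k n (snd z)) * h n) (fst z)) \<in> borel_measurable (M \<Otimes>\<^sub>M borel)" for n
  proof (rule measurable_compose_countable[where f = "\<lambda>i z. Y (real i * h n) (fst z)"])
    fix i :: nat
    have [measurable]: "Y (real i * h n) \<in> borel_measurable M" using h[of n] by (intro Y_measurable) auto
    show "(\<lambda>z. Y (real i * h n) (fst z)) \<in> borel_measurable (M \<Otimes>\<^sub>M borel)" by measurable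
  qed measurable
  then have "(\<lambda>z. Y (max 0 (snd z)) (fst z)) \<in> borel_measurable (M \<Otimes>\<^sub>M borel)"
  proof (rule borel_measurable_LIMSEQ_metric)
    fix z assume "z \<in> space (M \<Otimes>\<^sub>M (borel :: real measure))"
    then have \<omega>: "fst z \<in> space M" by (auto simp: space_pair_measure)
    let ?t = "max 0 (snd z)"
    have b: "?t \<in> {real (nat \<lfloor>?t / h n\<rfloor>) * h n..<real (k n (snd z)) * h n}" for n
      using grid_cell[OF h, of ?t n] unfolding k_def by (simp only: atLeastLessThan_iff max.cobounded1)
    have lim: "(\<lambda>n. real (k n (snd z)) * h n) \<longlonglongrightarrow> ?t"
    proof (rule tendsto_sandwich[where f = "\<lambda>_. ?t" and h = "\<lambda>n. ?t + h n"])
      have "(\<lambda>n. ?t + h n) \<longlonglongrightarrow> ?t + 0"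
        using mesh_LIMSEQ[of 1] by (intro tendsto_add tendsto_const) (simp add: h_def[abs_def])
      then show "(\<lambda>n. ?t + h n) \<longlonglongrightarrow> ?t" by simp
    qed (use b in \<open>auto simp: k_def algebra_simps less_imp_le intro!: always_eventually\<close>)
    show "(\<lambda>n. Y (real (k n (snd z)) * h n) (fst z)) \<longlonglongrightarrow> Y ?t (fst z)"
      by (rule right_continuousD[OF rc_path[OF \<omega>] _ _ lim]) (use b in \<open>auto simp: less_imp_le\<close>)
  qed
  then show ?thesis by (simp add: case_prod_unfold)
qed

text \<open>Times are restricted to \<open>[0, \<infinity>)\<close> by \<open>occupation\<close>; \<open>max 0 t\<close> only serves joint measurability on all of the real line.\<close>

definition occupation :: "real \<Rightarrow> real \<Rightarrow> real \<Rightarrow> 'a \<times> real \<Rightarrow> ennreal" where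
  "occupation q l u z = (if 0 \<le> snd z \<and> survives (path (fst z)) l u (snd z) then ennreal (exp (- q * snd z)) else 0)"

text \<open>The \<open>q\<close>-potential killed on leaving \<open>[l, u]\<close>: the mean over
  paths of the integral of \<open>exp (- q * t) * indicator S (Y t)\<close> over times before the
  exit.\<close>

definition potential :: "real \<Rightarrow> real \<Rightarrow> real \<Rightarrow> real measure" where
  "potential q l u = distr (density (M \<Otimes>\<^sub>M lborel) (occupation q l u)) borel (\<lambda>(\<omega>, t). Y (max 0 t) \<omega>)"

lemma Y_joint_measurable_lborel: "(\<lambda>(\<omega>, t). Y (max 0 t) \<omega>) \<in> borel_measurable (M \<Otimes>\<^sub>M lborel)"
  using Y_joint_measurable by (simp cong: measurable_cong_sets add: measurable_cong_sets[OF sets_pair_measure_cong[OF refl sets_lborel] refl])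

lemma occupation_measurable: "occupation q l u \<in> borel_measurable (M \<Otimes>\<^sub>M lborel)"
proof -
  have [measurable]: "(\<lambda>\<omega>. exit_val 1 (\<lambda>_. 1) (path \<omega>) l u) \<in> borel_measurable M"
    by (rule exit_val_measurable) auto
  show ?thesis unfolding occupation_def survives_iff by measurable
qed

lemma sets_potential: "sets (potential q l u) = sets borel"
  by (simp add: potential_def)

lemma nn_integral_potential:
  assumes [measurable]: "f \<in> borel_measurable borel"
  shows "(\<integral>\<^sup>+y. f y \<partial>potential q l u) =
    (\<integral>\<^sup>+z. occupation q l u z * f (Y (max 0 (snd z)) (fst z)) \<partial>(M \<Otimes>\<^sub>M lborel))"
proof -
  note [measurable] = Y_joint_measurable_lborel[unfolded case_prod_unfold] occupation_measurable
  show ?thesis unfolding potential_def case_prod_unfold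
    by (subst nn_integral_distr, simp, simp, subst nn_integral_density) auto
qed

text \<open>Survival along the mesh may fail to converge only at the exit instant itself, a single
  time for each path; Fubini makes the exceptional set null.\<close>

lemma exit_instant_null:
  "AE z in M \<Otimes>\<^sub>M lborel. exit_val 1 (\<lambda>_. 1) (path (fst z)) l u \<noteq> exp (- snd z)"
proof (rule AE_I)
  have [measurable]: "(\<lambda>\<omega>. exit_val 1 (\<lambda>_. 1) (path \<omega>) l u) \<in> borel_measurable M"
    by (rule exit_val_measurable) auto
  let ?N = "{z \<in> space (M \<Otimes>\<^sub>M lborel). exit_val 1 (\<lambda>_. 1) (path (fst z)) l u = exp (- snd z)}"
  show N: "?N \<in> sets (M \<Otimes>\<^sub>M lborel)" by measurable
  have "emeasure lborel (Pair \<omega> -` ?N) = 0" for \<omega>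
  proof -
    have "Pair \<omega> -` ?N \<subseteq> {- ln (exit_val 1 (\<lambda>_. 1) (path \<omega>) l u)}" by auto
    then show ?thesis by (rule emeasure_lborel_countable[OF countable_subset]) simp
  qed
  then show "emeasure (M \<Otimes>\<^sub>M lborel) ?N = 0"
    using lborel.emeasure_pair_measure_alt[OF N] by simp
qed auto

text \<open>The sums are Riemann sums with right end points, where right continuity yields the
  limit. The integrand may vary with \<open>n\<close>, since in \<open>ruin_core\<close> it is a
  jump intensity over the current mesh width. All meshes refine the mesh \<open>t0\<close>, so
  survival on that coarse mesh dominates every one of them.\<close>

lemma potential_LIMSEQ:
  fixes g :: "nat \<Rightarrow> real \<Rightarrow> real" and G :: "real \<Rightarrow> real"
  assumes lu: "l \<le> u" and q: "0 \<le> q" and t0: "0 < t0" "emeasure (\<kappa> t0) {..u - l} < 1"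
    and g[measurable]: "\<And>n. g n \<in> borel_measurable borel" and G[measurable]: "G \<in> borel_measurable borel"
    and C: "\<And>n y. y \<in> {l..u} \<Longrightarrow> g n y \<le> C" "0 \<le> C"
    and conv: "\<And>y s. y \<in> {l..u} \<Longrightarrow> (\<And>n. s n \<in> {l..u}) \<Longrightarrow> s \<longlonglongrightarrow> y \<Longrightarrow> (\<lambda>n. g n (s n)) \<longlonglongrightarrow> G y"
  defines "h \<equiv> \<lambda>n. t0 / 2 ^ n"
  defines "L \<equiv> \<lambda>n. \<integral>\<^sup>+\<omega>. (\<Sum>k. alive l u (h n) (Suc k) \<omega> *
      ennreal (exp (- q * (real (Suc k) * h n)) * g n (Y (real (Suc k) * h n) \<omega>)) * ennreal (h n)) \<partial>M"
  shows "L \<longlonglongrightarrow> (\<integral>\<^sup>+y. ennreal (G y) \<partial>potential q l u)"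
    and "\<exists>B<\<infinity>. \<forall>n. L n \<le> B"
proof -
  have h: "0 < h n" for n using t0 by (simp add: h_def)
  have h0: "h \<longlonglongrightarrow> 0" unfolding h_def by (rule mesh_LIMSEQ)
  note [measurable] = alive_measurable[OF less_imp_le[OF h]] Y_joint_measurable_lborel[unfolded case_prod_unfold]
    occupation_measurable alive_measurable[OF less_imp_le[OF t0(1)]]
  have [measurable]: "Y (real (Suc k) * h n) \<in> borel_measurable M" for k n
    using h[of n] by (intro Y_measurable) auto
  define a where "a n k \<omega> = alive l u (h n) (Suc k) \<omega> *
            ennreal (exp (- q * (real (Suc k) * h n)) * g n (Y (real (Suc k) * h n) \<omega>))" for n k \<omega>
  have [measurable]: "a n k \<in> borel_measurable M" for n k unfolding a_def by measurable
  \<comment> \<open>The step function of the Riemann sum: on the cell starting at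
    \<open>k * h n\<close> it takes the value at the right end \<open>Suc k * h n\<close>.\<close>
  define r where "r n z = (\<Sum>k. indicator {real k * h n..<real (Suc k) * h n} (snd z) * a n k (fst z))" for n and z :: "'a \<times> real"
  \<comment> \<open>The majorant: survival on the coarse mesh, taken at the left end of each cell.
    It is integrable by a geometric series.\<close>
  define w where "w z = (\<Sum>k. indicator {real k * t0..<real (Suc k) * t0} (snd z) * (ennreal C * alive l u t0 k (fst z)))" for z :: "'a \<times> real"
  have rm[measurable]: "r n \<in> borel_measurable (M \<Otimes>\<^sub>M lborel)" for n unfolding r_def by measurable
  have wm[measurable]: "w \<in> borel_measurable (M \<Otimes>\<^sub>M lborel)" unfolding w_def by measurable
  have cell: "(\<integral>\<^sup>+t. (\<Sum>k. indicator {real k * d..<real (Suc k) * d} t * v k) \<partial>lborel) = (\<Sum>k. v k * ennreal d)"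
    if "0 < d" for d :: real and v :: "nat \<Rightarrow> ennreal"
  proof -
    have "(\<integral>\<^sup>+t. (\<Sum>k. indicator {real k * d..<real (Suc k) * d} t * v k) \<partial>lborel)
        = (\<Sum>k. \<integral>\<^sup>+t. indicator {real k * d..<real (Suc k) * d} t * v k \<partial>lborel)"
      by (rule nn_integral_suminf) measurable
    also have "\<dots> = (\<Sum>k. v k * ennreal d)"
    proof (rule arg_cong[where f = suminf], rule ext)
      fix k
      have "(\<integral>\<^sup>+t. indicator {real k * d..<real (Suc k) * d} t * v k \<partial>lborel)
          = emeasure lborel {real k * d..<real (Suc k) * d} * v k"
        by (subst nn_integral_multc) auto
      also have "emeasure lborel {real k * d..<real (Suc k) * d} = ennreal d"
        using that by (subst emeasure_lborel_Ico) (auto simp: algebra_simps)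
      finally show "(\<integral>\<^sup>+t. indicator {real k * d..<real (Suc k) * d} t * v k \<partial>lborel) = v k * ennreal d"
        by (simp add: mult.commute)
    qed
    finally show ?thesis .
  qed
  have val: "(\<Sum>k. indicator {real k * d..<real (Suc k) * d} t * v k) = (if 0 \<le> t then v (nat \<lfloor>t / d\<rfloor>) else 0)"
    if d: "0 < d" for d t :: real and v :: "nat \<Rightarrow> ennreal"
  proof (cases "0 \<le> t")
    case True
    have "(\<lambda>k. indicator {real k * d..<real (Suc k) * d} t * v k) = (\<lambda>k. if k = nat \<lfloor>t / d\<rfloor> then v k else 0)"
      using grid_cell_iff[OF d True] by (intro ext) (simp only: indicator_def of_bool_def, simp)
    then show ?thesis using True by (simp add: suminf_delta)
  next
    case False
    have "0 \<le> real k * d" for k using d by simp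
    then have "t \<notin> {real k * d..<real (Suc k) * d}" for k using False
      by (meson atLeastLessThan_iff order_trans)
    then show ?thesis using False by simp
  qed
  have r_val: "r n z = (if 0 \<le> snd z then a n (nat \<lfloor>snd z / h n\<rfloor>) (fst z) else 0)" for n z
    unfolding r_def by (rule val[OF h])
  have w_val: "w z = (if 0 \<le> snd z then ennreal C * alive l u t0 (nat \<lfloor>snd z / t0\<rfloor>) (fst z) else 0)" for z
    unfolding w_def by (rule val[OF t0(1)])
  have lhs: "L n = (\<integral>\<^sup>+z. r n z \<partial>(M \<Otimes>\<^sub>M lborel))" for n
    unfolding lborel.nn_integral_fst[OF rm, symmetric] by (simp only: L_def a_def[symmetric] r_def fst_conv snd_conv cell[OF h])
  have wfin: "(\<integral>\<^sup>+z. w z \<partial>(M \<Otimes>\<^sub>M lborel)) < \<infinity>"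
  proof -
    obtain \<rho> where \<rho>: "emeasure (\<kappa> t0) {..u - l} = ennreal \<rho>" "0 \<le> \<rho>" "\<rho> < 1"
      using t0(2) by (cases "emeasure (\<kappa> t0) {..u - l}") (auto simp: ennreal_less_one_iff)
    have "(\<integral>\<^sup>+z. w z \<partial>(M \<Otimes>\<^sub>M lborel)) = (\<integral>\<^sup>+\<omega>. (\<Sum>k. ennreal C * alive l u t0 k \<omega> * ennreal t0) \<partial>M)"
      unfolding lborel.nn_integral_fst[OF wm, symmetric] by (simp only: w_def fst_conv snd_conv cell[OF t0(1)])
    also have "\<dots> = (\<Sum>k. \<integral>\<^sup>+\<omega>. ennreal C * alive l u t0 k \<omega> * ennreal t0 \<partial>M)"
      by (rule nn_integral_suminf) measurable
    also have "\<dots> = (\<Sum>k. (ennreal C * ennreal t0) * (\<integral>\<^sup>+\<omega>. alive l u t0 k \<omega> \<partial>M))"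
      by (simp add: nn_integral_multc nn_integral_cmult ac_simps)
    also have "\<dots> \<le> (\<Sum>k. (ennreal C * ennreal t0) * (emeasure M (space M) * emeasure (\<kappa> t0) {..u - l} ^ k))"
      using alive_geometric[of t0 l u] t0 by (intro suminf_le mult_left_mono) auto
    also have "\<dots> = (ennreal C * ennreal t0 * emeasure M (space M)) * (\<Sum>k. ennreal \<rho> ^ k)"
      unfolding \<rho>(1) by (simp only: mult.assoc ennreal_suminf_cmult[symmetric])
    also have "\<dots> < \<infinity>"
    proof -
      have "(\<Sum>k. ennreal \<rho> ^ k) = ennreal (\<Sum>k. \<rho> ^ k)"
        unfolding ennreal_power[OF \<rho>(2)] using \<rho> by (intro suminf_ennreal2 summable_geometric) auto
      moreover have "emeasure M (space M) < \<top>" by (simp add: less_top[symmetric])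
      ultimately show ?thesis by (simp add: ennreal_mult_less_top)
    qed
    finally show ?thesis .
  qed
  \<comment> \<open>Each coarse point \<open>j * t0\<close> is the fine point
    \<open>(j * 2 ^ n) * h n\<close>. Hence survival up to the fine right end entails survival up to
    the coarse left end.\<close>
  have dom: "r n z \<le> w z" for n z
  proof (cases "0 \<le> snd z")
    case True
    let ?K = "nat \<lfloor>snd z / h n\<rfloor>" and ?J = "nat \<lfloor>snd z / t0\<rfloor>"
    have K: "snd z < real (Suc ?K) * h n" by (rule grid_cell(2)[OF h True])
    have J: "real ?J * t0 \<le> snd z" by (rule grid_cell(1)[OF t0(1) True])
    have "a n ?K (fst z) \<le> ennreal C * alive l u t0 ?J (fst z)"
    proof (cases "stays (path (fst z)) l u (h n) (Suc ?K)")
      case st: True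
      have "stays (path (fst z)) l u t0 ?J"
        unfolding stays_def
      proof (intro allI impI)
        fix j assume "j \<le> ?J"
        have e: "real j * t0 = real (j * 2 ^ n) * h n" by (simp add: h_def)
        have "real j * t0 \<le> real ?J * t0" using \<open>j \<le> ?J\<close> t0 by simp
        then have "real (j * 2 ^ n) * h n < real (Suc ?K) * h n" using J K unfolding e by linarith
        then have "j * 2 ^ n \<le> Suc ?K" using h[of n] by (metis less_imp_le mult_less_cancel_right_pos of_nat_less_iff)
        from st[unfolded stays_def, rule_format, OF this]
        show "path (fst z) (real j * t0) \<in> {l..u}" unfolding e .
      qed
      moreover have "exp (- q * (real (Suc ?K) * h n)) * g n (Y (real (Suc ?K) * h n) (fst z)) \<le> 1 * C"
      proof (cases "0 \<le> g n (Y (real (Suc ?K) * h n) (fst z))")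
        case True
        have "g n (Y (real (Suc ?K) * h n) (fst z)) \<le> C" by (rule C(1)[OF st[unfolded stays_def, rule_format, OF order_refl]])
        moreover have "exp (- q * (real (Suc ?K) * h n)) \<le> 1" using q h[of n] by simp
        ultimately show ?thesis using True C(2) by (intro mult_mono) auto
      next
        case False
        then have "exp (- q * (real (Suc ?K) * h n)) * g n (Y (real (Suc ?K) * h n) (fst z)) \<le> 0"
          by (intro mult_nonneg_nonpos) auto
        then show ?thesis using C(2) by simp
      qed
      ultimately show ?thesis unfolding a_def alive_def by (simp add: st ennreal_leI)
    qed (simp add: a_def alive_def)
    then show ?thesis unfolding r_val w_val using True by simp
  qed (simp add: r_val w_val)
  have conv_r: "AE z in M \<Otimes>\<^sub>M lborel. (\<lambda>n. r n z) \<longlonglongrightarrow> occupation q l u z * ennreal (G (Y (max 0 (snd z)) (fst z)))"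
    using exit_instant_null[of l u] AE_space
  proof eventually_elim
    case (elim z)
    obtain \<omega> t where z: "z = (\<omega>, t)" by fastforce
    have \<omega>: "\<omega> \<in> space M" using elim z by (simp add: space_pair_measure)
    note rc = rc_path[OF \<omega>]
    show ?case
    proof (cases "0 \<le> t")
      case False
      then show ?thesis by (simp add: z r_val occupation_def)
    next
      case t: True
      let ?K = "\<lambda>n. Suc (nat \<lfloor>t / h n\<rfloor>)"
      have K: "t < real (?K n) * h n" "real (?K n) * h n \<le> t + h n" for n
        using grid_cell[OF h t, of n] by (auto simp: algebra_simps)
      have r: "r n z = a n (nat \<lfloor>t / h n\<rfloor>) \<omega>" for n using t by (simp add: z r_val)
      have lim: "(\<lambda>n. real (?K n) * h n) \<longlonglongrightarrow> t"
      proof (rule tendsto_sandwich[where f = "\<lambda>_. t" and h = "\<lambda>n. t + h n"])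
        show "(\<lambda>n. t + h n) \<longlonglongrightarrow> t" using tendsto_add[OF tendsto_const h0, of t] by simp
      qed (use K less_imp_le in \<open>auto intro!: always_eventually\<close>)
      show ?thesis
      proof (cases "survives (path \<omega>) l u t")
        case True
        have yt: "Y t \<omega> \<in> {l..u}" using before_exit_time[of t "path \<omega>" l u] t True by (auto simp: survives_def)
        have ev: "\<forall>\<^sub>F n in sequentially. stays (path \<omega>) l u (h n) (?K n)"
          using True by (intro stays_eventually[OF rc h h0 t _ K]) (auto simp: survives_def)
        \<comment> \<open>\<open>conv\<close> speaks of sequences inside \<open>[l, u]\<close>; the
          finitely many mesh values outside are replaced by the limit point.\<close>
        define s where "s n = (if Y (real (?K n) * h n) \<omega> \<in> {l..u} then Y (real (?K n) * h n) \<omega> else Y t \<omega>)" for n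
        have evs: "\<forall>\<^sub>F n in sequentially. Y (real (?K n) * h n) \<omega> = s n"
          using ev by eventually_elim (auto simp: s_def stays_def)
        have "(\<lambda>n. Y (real (?K n) * h n) \<omega>) \<longlonglongrightarrow> Y t \<omega>"
          by (rule right_continuousD[OF rc t _ lim]) (use K less_imp_le in blast)
        then have "s \<longlonglongrightarrow> Y t \<omega>" using Lim_transform_eventually evs by fast
        then have gs: "(\<lambda>n. g n (s n)) \<longlonglongrightarrow> G (Y t \<omega>)"
          by (rule conv[OF yt, rotated]) (use yt in \<open>simp add: s_def del: of_nat_Suc\<close>)
        have "(\<lambda>n. ennreal (exp (- q * (real (?K n) * h n)) * g n (s n))) \<longlonglongrightarrow> ennreal (exp (- q * t) * G (Y t \<omega>))"
          by (intro tendsto_ennrealI tendsto_mult tendsto_exp tendsto_const lim gs)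
        moreover have "\<forall>\<^sub>F n in sequentially. ennreal (exp (- q * (real (?K n) * h n)) * g n (s n)) = r n z"
          using ev evs by eventually_elim (simp add: r a_def alive_def)
        ultimately have "(\<lambda>n. r n z) \<longlonglongrightarrow> ennreal (exp (- q * t) * G (Y t \<omega>))"
          by (rule Lim_transform_eventually)
        then show ?thesis using t True by (simp add: z occupation_def ennreal_mult' max_absorb2)
      next
        case False
        then have "exit_set (path \<omega>) l u \<noteq> {}" "exit_time (path \<omega>) l u \<le> t" by (auto simp: survives_def)
        moreover have "exit_time (path \<omega>) l u \<noteq> t"
          using elim(1) \<open>exit_set (path \<omega>) l u \<noteq> {}\<close> by (auto simp: z exit_val_def)
        ultimately have "\<forall>\<^sub>F n in sequentially. \<not> stays (path \<omega>) l u (h n) (?K n)"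
          by (intro not_stays_eventually[OF rc h h0 _ _ K(1)]) auto
        then have "\<forall>\<^sub>F n in sequentially. r n z = 0"
          by eventually_elim (simp add: r a_def alive_def)
        then have "(\<lambda>n. r n z) \<longlonglongrightarrow> 0" by (rule tendsto_eventually)
        then show ?thesis using False by (simp add: z occupation_def)
      qed
    qed
  qed
  have "(\<lambda>n. \<integral>\<^sup>+z. r n z \<partial>(M \<Otimes>\<^sub>M lborel)) \<longlonglongrightarrow>
      (\<integral>\<^sup>+z. occupation q l u z * ennreal (G (Y (max 0 (snd z)) (fst z))) \<partial>(M \<Otimes>\<^sub>M lborel))"
    by (rule nn_integral_dominated_convergence[where w = w]) (use dom wfin conv_r in auto)
  then show "L \<longlonglongrightarrow> (\<integral>\<^sup>+y. ennreal (G y) \<partial>potential q l u)"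
    unfolding lhs[symmetric] using nn_integral_potential[of "\<lambda>y. ennreal (G y)" q l u] by simp
  have "(\<integral>\<^sup>+z. r n z \<partial>(M \<Otimes>\<^sub>M lborel)) \<le> (\<integral>\<^sup>+z. w z \<partial>(M \<Otimes>\<^sub>M lborel))" for n
    by (intro nn_integral_mono dom)
  then show "\<exists>B<\<infinity>. \<forall>n. L n \<le> B"
    unfolding lhs[symmetric] using wfin by blast
qed

end

text \<open>
  A continuous function which, at the exit position, is the indicator of an exit at the top: that position is
  either at most \<open>l\<close> or equal to \<open>u\<close>.
\<close>

definition top_weight :: "real \<Rightarrow> real \<Rightarrow> real \<Rightarrow> real" where
  "top_weight l u w = max 0 (min 1 ((w - l) / (u - l)))"

lemma top_weight_cont: "isCont (top_weight l u) x"
  unfolding top_weight_def[abs_def] divide_inverse by (intro continuous_intros)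

lemma top_weight_nonneg: "0 \<le> top_weight l u w"
  and top_weight_le_1: "top_weight l u w \<le> 1"
  by (auto simp: top_weight_def)

lemma top_weight_top: "l < u \<Longrightarrow> top_weight l u u = 1"
  by (simp add: top_weight_def)

lemma top_weight_bot: "l < u \<Longrightarrow> w \<le> l \<Longrightarrow> top_weight l u w = 0"
  using divide_nonpos_pos[of "w - l" "u - l"] by (simp add: top_weight_def)

section \<open>Dynkin's formula\<close>

context exit_process
begin

definition exit_sum :: "real \<Rightarrow> (real \<Rightarrow> real) \<Rightarrow> real \<Rightarrow> real \<Rightarrow> real \<Rightarrow> 'a \<Rightarrow> ennreal" where
  "exit_sum q g l u h \<omega> = (\<Sum>k. if first_exit (path \<omega>) l u h k
      then ennreal (exp (- q * (real k * h)) * g (Y (real k * h) \<omega>)) else 0)"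

lemma exit_sum_measurable:
  assumes h: "0 < h" and [measurable]: "g \<in> borel_measurable borel"
  shows "exit_sum q g l u h \<in> borel_measurable M"
proof -
  have [measurable]: "Y (real k * h) \<in> borel_measurable M" for k
    using h by (intro Y_measurable) auto
  note [measurable] = first_exit_measurable[OF less_imp_le[OF h]]
  have "(\<lambda>\<omega>. \<Sum>k. (if first_exit (path \<omega>) l u h k then 1 else 0) *
      ennreal (exp (- q * (real k * h)) * g (Y (real k * h) \<omega>))) \<in> borel_measurable M"
    by measurable
  also have "(\<lambda>\<omega>. \<Sum>k. (if first_exit (path \<omega>) l u h k then 1 else 0) *
      ennreal (exp (- q * (real k * h)) * g (Y (real k * h) \<omega>))) = exit_sum q g l u h"
    unfolding exit_sum_def by (intro ext arg_cong[where f = suminf]) auto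
  finally show ?thesis .
qed

lemma exit_sum_Suc:
  assumes "Y 0 \<omega> \<in> {l..u}"
  shows "exit_sum q g l u h \<omega> = (\<Sum>k. if first_exit (path \<omega>) l u h (Suc k)
      then ennreal (exp (- q * (real (Suc k) * h)) * g (Y (real (Suc k) * h) \<omega>)) else 0)"
proof -
  define v where "v k = (if first_exit (path \<omega>) l u h k
      then ennreal (exp (- q * (real k * h)) * g (Y (real k * h) \<omega>)) else 0)" for k
  have "v 0 = 0" using assms by (simp add: v_def first_exit_def)
  then have "(\<Sum>k. v k) = (\<Sum>k. v (Suc k))" using suminf_offset[of v 1] by simp
  then show ?thesis unfolding exit_sum_def v_def .
qed

text \<open>Only one term can be nonzero, so squaring acts on it alone: the exponent doubles and the
  squared discount only becomes smaller. It feeds the uniform integrability in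
  \<open>dynkin\<close>.\<close>

lemma exit_sum_square_le:
  assumes q: "0 \<le> q" and h: "0 < h"
  shows "exit_sum q (\<lambda>y. exp (\<alpha> * y)) l u h \<omega> < \<top>"
    and "ennreal ((enn2real (exit_sum q (\<lambda>y. exp (\<alpha> * y)) l u h \<omega>))\<^sup>2) \<le> exit_sum q (\<lambda>y. exp (2 * \<alpha> * y)) l u h \<omega>"
proof -
  have *: "exit_sum q (\<lambda>y. exp (\<alpha> * y)) l u h \<omega> < \<top> \<and>
    ennreal ((enn2real (exit_sum q (\<lambda>y. exp (\<alpha> * y)) l u h \<omega>))\<^sup>2) \<le> exit_sum q (\<lambda>y. exp (2 * \<alpha> * y)) l u h \<omega>"
  proof (cases "\<exists>k. first_exit (path \<omega>) l u h k")
    case True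
    then obtain k where k: "first_exit (path \<omega>) l u h k" by auto
    let ?e = "exp (- q * (real k * h))" and ?y = "Y (real k * h) \<omega>"
    have "?e \<le> 1" using q h by simp
    then have "?e\<^sup>2 \<le> ?e" by (simp add: power2_eq_square)
    then have "?e\<^sup>2 * (exp (\<alpha> * ?y))\<^sup>2 \<le> ?e * (exp (\<alpha> * ?y))\<^sup>2" by (intro mult_right_mono) auto
    moreover have "(exp (\<alpha> * ?y))\<^sup>2 = exp (2 * \<alpha> * ?y)"
      by (simp add: power2_eq_square exp_add[symmetric])
    ultimately have "(?e * exp (\<alpha> * ?y))\<^sup>2 \<le> ?e * exp (2 * \<alpha> * ?y)" by (simp add: power_mult_distrib)
    then show ?thesis unfolding exit_sum_def suminf_first_exit[OF k] by (simp add: ennreal_leI)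
  next
    case False
    then show ?thesis by (simp add: exit_sum_def)
  qed
  show "exit_sum q (\<lambda>y. exp (\<alpha> * y)) l u h \<omega> < \<top>" using * by blast
  show "ennreal ((enn2real (exit_sum q (\<lambda>y. exp (\<alpha> * y)) l u h \<omega>))\<^sup>2) \<le> exit_sum q (\<lambda>y. exp (2 * \<alpha> * y)) l u h \<omega>"
    using * by blast
qed

text \<open>In \<open>discrete_dynkin\<close> the sum \<open>U n\<close> cancels up to the factor
  \<open>exp (h n * c) - 1\<close>. Dividing this factor by \<open>h n\<close> leaves a difference
  quotient with limit \<open>c\<close>, and multiplying \<open>U n\<close> by \<open>h n\<close>
  leaves a Riemann sum of the potential. As \<open>q < \<phi> \<alpha>\<close>, all terms stay
  nonnegative.\<close>

lemma exit_sum_LIMSEQ_integral: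
  assumes lu: "l \<le> u" and q: "0 \<le> q" and t0: "0 < t0" "emeasure (\<kappa> t0) {..u - l} < 1"
    and Y0: "AE \<omega> in M. Y 0 \<omega> \<in> {l..u}" and \<alpha>: "0 \<le> \<alpha>" "q < \<phi> \<alpha>"
  shows "(\<lambda>n. \<integral>\<^sup>+\<omega>. exit_sum q (\<lambda>y. exp (\<alpha> * y)) l u (t0 / 2 ^ n) \<omega> \<partial>M) \<longlonglongrightarrow>
      (\<integral>\<^sup>+y. ennreal (exp (\<alpha> * y)) \<partial>potential q l u) * ennreal (\<phi> \<alpha> - q) + (\<integral>\<^sup>+\<omega>. ennreal (exp (\<alpha> * Y 0 \<omega>)) \<partial>M)"
    and "(\<integral>\<^sup>+y. ennreal (exp (\<alpha> * y)) \<partial>potential q l u) < \<infinity>"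
    and "(\<integral>\<^sup>+\<omega>. ennreal (exp (\<alpha> * Y 0 \<omega>)) \<partial>M) < \<infinity>"
proof -
  define h where "h n = t0 / 2 ^ n" for n
  have h: "0 < h n" for n using t0 by (simp add: h_def)
  have h0: "h \<longlonglongrightarrow> 0" unfolding h_def by (rule mesh_LIMSEQ)
  let ?g = "\<lambda>y. exp (\<alpha> * y)"
  let ?V = "\<integral>\<^sup>+y. ennreal (?g y) \<partial>potential q l u" and ?E = "\<integral>\<^sup>+\<omega>. ennreal (exp (\<alpha> * Y 0 \<omega>)) \<partial>M"
  define c where "c = \<phi> \<alpha> - q"
  have c: "0 < c" using \<alpha> by (simp add: c_def)
  define H where "H n = (\<integral>\<^sup>+\<omega>. (\<Sum>k. alive l u (h n) (Suc k) \<omega> *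
            ennreal (exp (- q * (real (Suc k) * h n)) * ?g (Y (real (Suc k) * h n) \<omega>)) * ennreal (h n)) \<partial>M)" for n
  have gb: "?g y \<le> exp (\<alpha> * u)" if "y \<in> {l..u}" for y using that \<alpha> by (simp add: mult_left_mono)
  have HV: "H \<longlonglongrightarrow> ?V" and HB: "\<exists>B<\<infinity>. \<forall>n. H n \<le> B"
    unfolding H_def[abs_def] h_def
    by (rule potential_LIMSEQ[OF lu q t0, where C = "exp (\<alpha> * u)"]; (use gb in \<open>auto intro!: tendsto_intros\<close>)?)+
  then obtain B where B: "B < \<infinity>" "\<And>n. H n \<le> B" by blast
  have "?V \<le> B" using HV by (rule LIMSEQ_le_const2) (use B in auto)
  then show Vfin: "?V < \<infinity>" using B by (auto intro: le_less_trans)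
  have "?E \<le> (\<integral>\<^sup>+\<omega>. ennreal (exp (\<alpha> * u)) \<partial>M)"
  proof (rule nn_integral_mono_AE)
    show "AE \<omega> in M. ennreal (exp (\<alpha> * Y 0 \<omega>)) \<le> ennreal (exp (\<alpha> * u))"
      using Y0 by eventually_elim (intro ennreal_leI gb)
  qed
  also have "\<dots> < \<infinity>" by (simp add: ennreal_mult_eq_top_iff less_top[symmetric])
  finally show Efin: "?E < \<infinity>" .
  have alive0: "(\<integral>\<^sup>+\<omega>. alive l u (h n) 0 \<omega> * ennreal (exp (\<alpha> * Y 0 \<omega>)) \<partial>M) = ?E" for n
  proof (rule nn_integral_cong_AE)
    show "AE \<omega> in M. alive l u (h n) 0 \<omega> * ennreal (exp (\<alpha> * Y 0 \<omega>)) = ennreal (exp (\<alpha> * Y 0 \<omega>))"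
      using Y0 by eventually_elim (simp add: alive_def stays_def)
  qed
  define U where "U n = (\<Sum>k. ennreal (exp (- q * (real k * h n))) *
      (\<integral>\<^sup>+\<omega>. alive l u (h n) k \<omega> * ennreal (exp (\<alpha> * Y (real k * h n) \<omega>)) \<partial>M))" for n
  have [measurable]: "Y (real k * h n) \<in> borel_measurable M" for k n
    using h[of n] by (intro Y_measurable) auto
  have [measurable]: "Y (real (Suc k) * h n) \<in> borel_measurable M" for k n
    using h[of n] by (intro Y_measurable) auto
  note [measurable] = alive_measurable[OF less_imp_le[OF h]]
  \<comment> \<open>\<open>H n\<close> starts at mesh index 1, \<open>U n\<close> at index 0; the
    missing term is the mean of the initial exponential and vanishes after multiplication by
    \<open>h n\<close>.\<close>
  have HU: "H n + ?E * ennreal (h n) = U n * ennreal (h n)" for n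
  proof -
    define v where "v k = ennreal (exp (- q * (real k * h n))) *
      (\<integral>\<^sup>+\<omega>. alive l u (h n) k \<omega> * ennreal (exp (\<alpha> * Y (real k * h n) \<omega>)) \<partial>M)" for k
    have vS: "(\<integral>\<^sup>+\<omega>. alive l u (h n) (Suc k) \<omega> * ennreal (exp (- q * (real (Suc k) * h n)) * ?g (Y (real (Suc k) * h n) \<omega>)) * ennreal (h n) \<partial>M)
       = v (Suc k) * ennreal (h n)" for k
    proof -
      let ?f = "\<lambda>\<omega>. alive l u (h n) (Suc k) \<omega> * ennreal (?g (Y (real (Suc k) * h n) \<omega>))"
      let ?c = "ennreal (exp (- q * (real (Suc k) * h n)))"
      have f: "?f \<in> borel_measurable M" by measurable
      have "(\<integral>\<^sup>+\<omega>. alive l u (h n) (Suc k) \<omega> * ennreal (exp (- q * (real (Suc k) * h n)) * ?g (Y (real (Suc k) * h n) \<omega>)) * ennreal (h n) \<partial>M)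
        = (\<integral>\<^sup>+\<omega>. ?c * ennreal (h n) * ?f \<omega> \<partial>M)"
        by (simp add: ennreal_mult ac_simps)
      also have "\<dots> = ?c * ennreal (h n) * (\<integral>\<^sup>+\<omega>. ?f \<omega> \<partial>M)" by (rule nn_integral_cmult[OF f])
      finally show ?thesis unfolding v_def by (simp only: ac_simps)
    qed
    have "H n = (\<Sum>k. v (Suc k) * ennreal (h n))"
      unfolding H_def vS[symmetric] by (rule nn_integral_suminf) measurable
    also have "\<dots> = (\<Sum>k. v (Suc k)) * ennreal (h n)" by (rule ennreal_suminf_multc)
    finally have "H n = (\<Sum>k. v (Suc k)) * ennreal (h n)" .
    moreover have "v 0 = ?E" using alive0[of n] by (simp add: v_def)
    moreover have "U n = v 0 + (\<Sum>k. v (Suc k))"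
      unfolding U_def v_def[symmetric] using suminf_offset[of v 1] by (simp add: ac_simps)
    ultimately show ?thesis by (simp only: distrib_right add.commute)
  qed
  \<comment> \<open>Finiteness, needed to cancel \<open>U n\<close> in the extended nonnegative
    reals.\<close>
  have Ufin: "U n < \<top>" for n
  proof (rule ccontr)
    assume "\<not> U n < \<top>"
    then have "U n * ennreal (h n) = \<top>" using h[of n] by (simp add: less_top[symmetric] ennreal_top_mult)
    then have "H n + ?E * ennreal (h n) = \<top>" using HU by simp
    moreover have "H n < \<top>" using B(2)[of n] B(1) by (auto intro: le_less_trans)
    ultimately show False using Efin by (auto simp: ennreal_mult_eq_top_iff)
  qed
  define X where "X n = (\<integral>\<^sup>+\<omega>. exit_sum q ?g l u (h n) \<omega> \<partial>M)" for n
  have X: "X n = U n * ennreal (h n) * ennreal ((exp (h n * c) - 1) / h n) + ?E" for n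
  proof -
    have "X n = (\<integral>\<^sup>+\<omega>. (\<Sum>k. if first_exit (path \<omega>) l u (h n) (Suc k)
          then ennreal (exp (- q * (real (Suc k) * h n)) * exp (\<alpha> * Y (real (Suc k) * h n) \<omega>)) else 0) \<partial>M)"
      unfolding X_def
    proof (rule nn_integral_cong_AE)
      show "AE \<omega> in M. exit_sum q ?g l u (h n) \<omega> = (\<Sum>k. if first_exit (path \<omega>) l u (h n) (Suc k)
          then ennreal (exp (- q * (real (Suc k) * h n)) * exp (\<alpha> * Y (real (Suc k) * h n) \<omega>)) else 0)"
        using Y0 by eventually_elim (rule exit_sum_Suc)
    qed
    then have "X n + U n = U n * ennreal (exp (h n * c)) + ?E"
      using discrete_dynkin[OF h[of n] \<alpha>(1), where l = l and u = u and q = q] unfolding alive0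
      by (simp add: U_def c_def add.commute del: of_nat_Suc)
    \<comment> \<open>Splits off exactly the copy of \<open>U n\<close> that stands on the other
      side.\<close>
    also have "ennreal (exp (h n * c)) = 1 + ennreal (exp (h n * c) - 1)"
    proof -
      have "1 \<le> exp (h n * c)" using h[of n] c by simp
      then have "ennreal 1 + ennreal (exp (h n * c) - 1) = ennreal (exp (h n * c))"
        by (subst ennreal_plus[symmetric]) auto
      then show ?thesis by simp
    qed
    finally have "U n + X n = U n + (U n * ennreal (exp (h n * c) - 1) + ?E)"
      by (simp add: distrib_left ac_simps)
    then have "X n = U n * ennreal (exp (h n * c) - 1) + ?E"
      using Ufin[of n] by (simp add: ennreal_add_left_cancel less_top[symmetric])
    also have "ennreal (exp (h n * c) - 1) = ennreal (h n) * ennreal ((exp (h n * c) - 1) / h n)"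
      using h[of n] c by (subst ennreal_mult[symmetric]) auto
    finally show ?thesis by (simp add: mult.assoc)
  qed
  have UV: "(\<lambda>n. U n * ennreal (h n)) \<longlonglongrightarrow> ?V"
  proof -
    have "(\<lambda>n. ?E * ennreal (h n)) \<longlonglongrightarrow> ?E * ennreal 0"
      by (intro tendsto_mult_ennreal tendsto_const tendsto_ennrealI h0) (use Efin in auto)
    then have "(\<lambda>n. H n + ?E * ennreal (h n)) \<longlonglongrightarrow> ?V + ?E * ennreal 0"
      by (intro tendsto_add HV)
    then show ?thesis by (simp add: HU)
  qed
  have "(\<lambda>n. (exp (h n * c) - 1) / h n) \<longlonglongrightarrow> c"
  proof -
    have "((\<lambda>x. exp (x * c)) has_real_derivative c) (at 0)" by (auto intro!: derivative_eq_intros)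
    then have "((\<lambda>x. (exp (x * c) - 1) / x) \<longlongrightarrow> c) (at 0)" by (simp add: has_field_derivative_iff)
    moreover have "filterlim h (at 0) sequentially"
      using h0 h by (auto simp: filterlim_at less_imp_neq[THEN not_sym] intro!: always_eventually)
    ultimately show ?thesis by (rule filterlim_compose)
  qed
  then have "X \<longlonglongrightarrow> ?V * ennreal c + ?E"
    unfolding X by (intro tendsto_add tendsto_const tendsto_mult_ennreal UV tendsto_ennrealI) (use Vfin in auto)
  then show "(\<lambda>n. \<integral>\<^sup>+\<omega>. exit_sum q ?g l u (t0 / 2 ^ n) \<omega> \<partial>M) \<longlonglongrightarrow> ?V * ennreal (\<phi> \<alpha> - q) + ?E"
    by (simp add: X_def[abs_def] h_def c_def)
qed

text \<open>A mesh exit may overshoot \<open>u\<close>, so the exponentials have no pointwise bound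
  and the limit cannot be moved inside by domination. Convergence of the means at
  \<open>2 * \<alpha>\<close> bounds the second moments instead, which explains the condition on
  \<open>\<phi> (2 * \<alpha>)\<close>.\<close>

lemma dynkin:
  assumes lu: "l \<le> u" and q: "0 \<le> q"
    and Y0: "AE \<omega> in M. Y 0 \<omega> \<in> {l..u}" and \<alpha>: "0 \<le> \<alpha>" "q < \<phi> \<alpha>" "q < \<phi> (2 * \<alpha>)"
  shows "(\<integral>\<^sup>+y. ennreal (exp (\<alpha> * y)) \<partial>potential q l u) * ennreal (\<phi> \<alpha> - q) + (\<integral>\<^sup>+\<omega>. ennreal (exp (\<alpha> * Y 0 \<omega>)) \<partial>M)
    = (\<integral>\<^sup>+\<omega>. ennreal (exit_val q (\<lambda>y. exp (\<alpha> * y)) (path \<omega>) l u) \<partial>M)"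
    and "(\<integral>\<^sup>+y. ennreal (exp (\<alpha> * y)) \<partial>potential q l u) < \<infinity>"
    and "(\<integral>\<^sup>+\<omega>. ennreal (exp (\<alpha> * Y 0 \<omega>)) \<partial>M) < \<infinity>"
proof -
  obtain t0 where t0: "0 < t0" "emeasure (\<kappa> t0) {..u - l} < 1"
    using exit_mesh_exists[of "u - l"] lu by auto
  define h where "h n = t0 / 2 ^ n" for n
  have h: "0 < h n" for n using t0 by (simp add: h_def)
  have h0: "h \<longlonglongrightarrow> 0" unfolding h_def by (rule mesh_LIMSEQ)
  note 1 = exit_sum_LIMSEQ_integral[OF lu q t0 Y0 \<alpha>(1,2)]
  have \<alpha>2: "0 \<le> 2 * \<alpha>" using \<alpha> by simp
  note 2 = exit_sum_LIMSEQ_integral[OF lu q t0 Y0 \<alpha>2 \<alpha>(3)]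
  show "(\<integral>\<^sup>+y. ennreal (exp (\<alpha> * y)) \<partial>potential q l u) < \<infinity>" "(\<integral>\<^sup>+\<omega>. ennreal (exp (\<alpha> * Y 0 \<omega>)) \<partial>M) < \<infinity>"
    using 1 by auto
  define R where "R = (\<integral>\<^sup>+y. ennreal (exp (2 * \<alpha> * y)) \<partial>potential q l u) * ennreal (\<phi> (2 * \<alpha>) - q) + (\<integral>\<^sup>+\<omega>. ennreal (exp (2 * \<alpha> * Y 0 \<omega>)) \<partial>M)"
  have R: "R < \<top>" unfolding R_def using 2(2,3) by (simp add: ennreal_mult_eq_top_iff less_top[symmetric])
  have "R < R + 1" using R by (cases R) (auto simp: ennreal_less_iff simp flip: ennreal_1 ennreal_plus)
  from order_tendstoD(2)[OF 2(1)[folded R_def] this]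
  obtain N where N: "\<And>n. N \<le> n \<Longrightarrow> (\<integral>\<^sup>+\<omega>. exit_sum q (\<lambda>y. exp (2 * \<alpha> * y)) l u (h n) \<omega> \<partial>M) < R + 1"
    unfolding eventually_sequentially h_def by blast
  obtain C where C: "R + 1 = ennreal C" using R by (cases "R + 1") auto
  \<comment> \<open>The second moments are known to be bounded only from \<open>N\<close>
    on.\<close>
  define f where "f n \<omega> = enn2real (exit_sum q (\<lambda>y. exp (\<alpha> * y)) l u (h (n + N)) \<omega>)" for n \<omega>
  have ef: "ennreal (f n \<omega>) = exit_sum q (\<lambda>y. exp (\<alpha> * y)) l u (h (n + N)) \<omega>" for n \<omega>
    unfolding f_def by (rule ennreal_enn2real[OF exit_sum_square_le(1)[OF q h]])
  note [measurable] = exit_sum_measurable[OF h]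
  have "(\<lambda>n. \<integral>\<^sup>+\<omega>. ennreal (f n \<omega>) \<partial>M) \<longlonglongrightarrow> (\<integral>\<^sup>+\<omega>. ennreal (exit_val q (\<lambda>y. exp (\<alpha> * y)) (path \<omega>) l u) \<partial>M)"
  proof (rule nn_integral_LIMSEQ_bounded_second_moment)
    show "finite_measure M" by unfold_locales
    show "f n \<in> borel_measurable M" for n unfolding f_def by measurable
    show "(\<lambda>\<omega>. exit_val q (\<lambda>y. exp (\<alpha> * y)) (path \<omega>) l u) \<in> borel_measurable M"
      by (rule exit_val_measurable) (auto intro!: continuous_intros)
    show "0 \<le> f n \<omega>" for n \<omega> by (simp add: f_def)
    fix \<omega> assume \<omega>: "\<omega> \<in> space M"
    have "(\<lambda>n. exit_sum q (\<lambda>y. exp (\<alpha> * y)) l u (h n) \<omega>) \<longlonglongrightarrow> ennreal (exit_val q (\<lambda>y. exp (\<alpha> * y)) (path \<omega>) l u)"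
      unfolding exit_sum_def by (rule exit_val_LIMSEQ[OF rc_path[OF \<omega>] h h0]) (auto intro!: continuous_intros)
    then have "(\<lambda>n. exit_sum q (\<lambda>y. exp (\<alpha> * y)) l u (h (n + N)) \<omega>) \<longlonglongrightarrow> ennreal (exit_val q (\<lambda>y. exp (\<alpha> * y)) (path \<omega>) l u)"
      by (rule LIMSEQ_ignore_initial_segment)
    then show "(\<lambda>n. f n \<omega>) \<longlonglongrightarrow> exit_val q (\<lambda>y. exp (\<alpha> * y)) (path \<omega>) l u"
      unfolding f_def using tendsto_enn2real[OF _ exit_val_nonneg] by force
  next
    fix n
    have "(\<integral>\<^sup>+\<omega>. ennreal ((f n \<omega>)\<^sup>2) \<partial>M) \<le> (\<integral>\<^sup>+\<omega>. exit_sum q (\<lambda>y. exp (2 * \<alpha> * y)) l u (h (n + N)) \<omega> \<partial>M)"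
      unfolding f_def by (intro nn_integral_mono exit_sum_square_le(2)[OF q h])
    also have "\<dots> \<le> R + 1" using N[of "n + N"] by simp
    finally show "(\<integral>\<^sup>+\<omega>. ennreal ((f n \<omega>)\<^sup>2) \<partial>M) \<le> ennreal C" unfolding C .
  qed
  moreover have "(\<lambda>n. \<integral>\<^sup>+\<omega>. ennreal (f n \<omega>) \<partial>M) \<longlonglongrightarrow>
      (\<integral>\<^sup>+y. ennreal (exp (\<alpha> * y)) \<partial>potential q l u) * ennreal (\<phi> \<alpha> - q) + (\<integral>\<^sup>+\<omega>. ennreal (exp (\<alpha> * Y 0 \<omega>)) \<partial>M)"
    unfolding ef using LIMSEQ_ignore_initial_segment[OF 1(1), of N] by (simp add: h_def)
  ultimately show "(\<integral>\<^sup>+y. ennreal (exp (\<alpha> * y)) \<partial>potential q l u) * ennreal (\<phi> \<alpha> - q) + (\<integral>\<^sup>+\<omega>. ennreal (exp (\<alpha> * Y 0 \<omega>)) \<partial>M)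
    = (\<integral>\<^sup>+\<omega>. ennreal (exit_val q (\<lambda>y. exp (\<alpha> * y)) (path \<omega>) l u) \<partial>M)"
    by (rule LIMSEQ_unique[symmetric])
qed

end

section \<open>Resolvent and exit identities\<close>

text \<open>Removes the arbitrary value \<open>W 0\<close>.\<close>

definition pos_part_scale :: "(real \<Rightarrow> real) \<Rightarrow> real \<Rightarrow> real" where
  "pos_part_scale W x = indicator {0<..} x * W x"

lemma scale_measurable:
  assumes "is_scale_function \<phi> q W"
  shows "pos_part_scale W \<in> borel_measurable borel"
proof -
  have "(\<lambda>x. indicator {0<..} x *\<^sub>R W x) \<in> borel_measurable borel"
    using assms by (intro borel_measurable_continuous_on_indicator) (auto simp: is_scale_function_def)
  then show ?thesis by (simp add: pos_part_scale_def[abs_def])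
qed

lemma pos_part_scale_nonneg: "is_scale_function \<phi> q W \<Longrightarrow> 0 \<le> pos_part_scale W x"
  by (simp add: pos_part_scale_def is_scale_function_def)

lemma pos_part_scale_pos: "0 < x \<Longrightarrow> pos_part_scale W x = W x"
  and pos_part_scale_neg: "x \<le> 0 \<Longrightarrow> pos_part_scale W x = 0"
  by (simp_all add: pos_part_scale_def)

lemma scale_isCont: "is_scale_function \<phi> q W \<Longrightarrow> 0 < x \<Longrightarrow> isCont W x"
  by (auto simp: is_scale_function_def continuous_on_eq_continuous_at)

lemma scale_laplace:
  assumes W: "is_scale_function \<phi> q W" and \<phi>: "filterlim \<phi> at_top at_top"
  obtains c where "0 \<le> c" "\<And>\<alpha>. c \<le> \<alpha> \<Longrightarrow> q < \<phi> \<alpha>"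
    "\<And>\<alpha>. c \<le> \<alpha> \<Longrightarrow> (\<integral>\<^sup>+x. ennreal (exp (- \<alpha> * x) * pos_part_scale W x) \<partial>lborel) = ennreal (1 / (\<phi> \<alpha> - q))"
proof -
  have "\<forall>\<^sub>F \<alpha> in at_top. q < \<phi> \<alpha>" using \<phi> filterlim_at_top_dense by blast
  then obtain N where N: "\<And>\<alpha>. N \<le> \<alpha> \<Longrightarrow> q < \<phi> \<alpha>" by (auto simp: eventually_at_top_linorder)
  \<comment> \<open>\<open>N\<close> secures \<open>q < \<phi> \<alpha>\<close> by growth of
    \<open>\<phi>\<close>; the other bound puts \<open>\<alpha>\<close> where the scale function has
    its Laplace transform.\<close>
  define c where "c = max (max 0 N) (right_inverse_exponent \<phi> q + 1)"
  show ?thesis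
  proof (rule that[of c])
    fix \<alpha> assume "c \<le> \<alpha>"
    then have a: "N \<le> \<alpha>" "right_inverse_exponent \<phi> q < \<alpha>" by (auto simp: c_def)
    show "q < \<phi> \<alpha>" using N a by blast
    have "has_bochner_integral lborel (\<lambda>x. indicator {0<..} x * (exp (- \<alpha> * x) * W x)) (1 / (\<phi> \<alpha> - q))"
      using W a by (simp add: is_scale_function_def)
    moreover have "(\<lambda>x. indicator {0<..} x * (exp (- \<alpha> * x) * W x)) = (\<lambda>x. exp (- \<alpha> * x) * pos_part_scale W x)"
      by (simp add: pos_part_scale_def fun_eq_iff)
    ultimately have hb: "has_bochner_integral lborel (\<lambda>x. exp (- \<alpha> * x) * pos_part_scale W x) (1 / (\<phi> \<alpha> - q))"
      by simp
    show "(\<integral>\<^sup>+x. ennreal (exp (- \<alpha> * x) * pos_part_scale W x) \<partial>lborel) = ennreal (1 / (\<phi> \<alpha> - q))"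
      using nn_integral_eq_integral[OF integrable.intros[OF hb]] has_bochner_integral_integral_eq[OF hb]
        pos_part_scale_nonneg[OF W] by simp
  qed (simp add: c_def)
qed

text \<open>The density whose exponential transform at \<open>\<alpha>\<close> is that of
  \<open>m\<close> divided by \<open>\<phi> \<alpha> - q\<close>; see
  \<open>nn_integral_exp_scale_convolution\<close>.\<close>

definition scale_convolution :: "(real \<Rightarrow> real) \<Rightarrow> real measure \<Rightarrow> real \<Rightarrow> ennreal" where
  "scale_convolution W m y = (\<integral>\<^sup>+w. ennreal (pos_part_scale W (w - y)) \<partial>m)"

lemma scale_convolution_measurable:
  assumes W: "is_scale_function \<phi> q W" and "sigma_finite_measure m" and sm[measurable_cong]: "sets m = sets borel"
  shows "scale_convolution W m \<in> borel_measurable borel"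
proof -
  interpret sigma_finite_measure m by fact
  note [measurable] = scale_measurable[OF W]
  show ?thesis unfolding scale_convolution_def by measurable
qed

lemma nn_integral_exp_scale_convolution:
  assumes W: "is_scale_function \<phi> q W" and m: "sigma_finite_measure m" and sm[measurable_cong]: "sets m = sets borel"
    and L: "(\<integral>\<^sup>+x. ennreal (exp (- \<alpha> * x) * pos_part_scale W x) \<partial>lborel) = ennreal R"
  shows "(\<integral>\<^sup>+y. ennreal (exp (\<alpha> * y)) * scale_convolution W m y \<partial>lborel) = (\<integral>\<^sup>+w. ennreal (exp (\<alpha> * w)) \<partial>m) * ennreal R"
proof -
  interpret m: sigma_finite_measure m by fact
  interpret pair_sigma_finite lborel m by unfold_locales
  note [measurable] = scale_measurable[OF W]
  have "(\<integral>\<^sup>+y. ennreal (exp (\<alpha> * y)) * scale_convolution W m y \<partial>lborel)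
    = (\<integral>\<^sup>+y. \<integral>\<^sup>+w. ennreal (exp (\<alpha> * y)) * ennreal (pos_part_scale W (w - y)) \<partial>m \<partial>lborel)"
    unfolding scale_convolution_def by (intro nn_integral_cong nn_integral_cmult[symmetric]) measurable
  also have "\<dots> = (\<integral>\<^sup>+w. \<integral>\<^sup>+y. ennreal (exp (\<alpha> * y)) * ennreal (pos_part_scale W (w - y)) \<partial>lborel \<partial>m)"
    by (rule Fubini'[symmetric]) measurable
  also have "\<dots> = (\<integral>\<^sup>+w. ennreal (exp (\<alpha> * w)) * ennreal R \<partial>m)"
  proof (rule nn_integral_cong)
    fix w
    have "(\<integral>\<^sup>+y. ennreal (exp (\<alpha> * y)) * ennreal (pos_part_scale W (w - y)) \<partial>lborel)
       = (\<integral>\<^sup>+x. ennreal (exp (\<alpha> * (w - x))) * ennreal (pos_part_scale W x) \<partial>lborel)"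
      by (subst nn_integral_real_affine[where c = "-1" and t = w]) auto
    also have "\<dots> = (\<integral>\<^sup>+x. ennreal (exp (\<alpha> * w)) * ennreal (exp (- \<alpha> * x) * pos_part_scale W x) \<partial>lborel)"
    proof (rule nn_integral_cong)
      fix x
      have "exp (\<alpha> * (w - x)) = exp (\<alpha> * w) * exp (- \<alpha> * x)" by (simp add: exp_add[symmetric] algebra_simps)
      then show "ennreal (exp (\<alpha> * (w - x))) * ennreal (pos_part_scale W x) = ennreal (exp (\<alpha> * w)) * ennreal (exp (- \<alpha> * x) * pos_part_scale W x)"
        using pos_part_scale_nonneg[OF W, of x] by (simp add: ennreal_mult mult.assoc)
    qed
    also have "\<dots> = ennreal (exp (\<alpha> * w)) * ennreal R"
      unfolding L[symmetric] by (rule nn_integral_cmult) measurable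
    finally show "(\<integral>\<^sup>+y. ennreal (exp (\<alpha> * y)) * ennreal (pos_part_scale W (w - y)) \<partial>lborel) = ennreal (exp (\<alpha> * w)) * ennreal R" .
  qed
  also have "\<dots> = (\<integral>\<^sup>+w. ennreal (exp (\<alpha> * w)) \<partial>m) * ennreal R"
    by (rule nn_integral_multc) measurable
  finally show ?thesis .
qed

section \<open>The exit law and the resolvent identity\<close>

context exit_process
begin

text \<open>On paths that never leave \<open>[l, u]\<close> the value is the junk value \<open>ln 0\<close>; these paths carry no mass in \<open>exit_law\<close>.\<close>

definition exit_pos :: "real \<Rightarrow> real \<Rightarrow> 'a \<Rightarrow> real" where
  "exit_pos l u \<omega> = ln (exit_val 0 exp (path \<omega>) l u)"

text \<open>The law of the position at the exit time \<open>D\<close>, weighted by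
  \<open>exp (- q * D)\<close> on paths that exit.\<close>

definition exit_law :: "real \<Rightarrow> real \<Rightarrow> real \<Rightarrow> real measure" where
  "exit_law q l u = distr (density M (\<lambda>\<omega>. ennreal (exit_val q (\<lambda>_. 1) (path \<omega>) l u))) borel (exit_pos l u)"

lemma exit_pos_measurable: "exit_pos l u \<in> borel_measurable M"
proof -
  have [measurable]: "(\<lambda>\<omega>. exit_val 0 exp (path \<omega>) l u) \<in> borel_measurable M"
    by (rule exit_val_measurable) auto
  show ?thesis unfolding exit_pos_def[abs_def] by measurable
qed

lemma exit_val_eq: "exit_val q g (path \<omega>) l u = exit_val q (\<lambda>_. 1) (path \<omega>) l u * g (exit_pos l u \<omega>)"
  by (simp add: exit_val_def exit_pos_def)

lemma nn_integral_exit_law: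
  assumes [measurable]: "f \<in> borel_measurable borel"
  shows "(\<integral>\<^sup>+w. f w \<partial>exit_law q l u)
     = (\<integral>\<^sup>+\<omega>. ennreal (exit_val q (\<lambda>_. 1) (path \<omega>) l u) * f (exit_pos l u \<omega>) \<partial>M)"
proof -
  have [measurable]: "(\<lambda>\<omega>. exit_val q (\<lambda>_. 1) (path \<omega>) l u) \<in> borel_measurable M"
    by (rule exit_val_measurable) auto
  note [measurable] = exit_pos_measurable
  show ?thesis unfolding exit_law_def
    by (subst nn_integral_distr, simp, simp, subst nn_integral_density) auto
qed

lemma nn_integral_exit_law_real:
  assumes "g \<in> borel_measurable borel" "\<And>x. 0 \<le> g x"
  shows "(\<integral>\<^sup>+w. ennreal (g w) \<partial>exit_law q l u) = (\<integral>\<^sup>+\<omega>. ennreal (exit_val q g (path \<omega>) l u) \<partial>M)"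
proof -
  have "(\<integral>\<^sup>+w. ennreal (g w) \<partial>exit_law q l u)
     = (\<integral>\<^sup>+\<omega>. ennreal (exit_val q (\<lambda>_. 1) (path \<omega>) l u) * ennreal (g (exit_pos l u \<omega>)) \<partial>M)"
    using assms by (intro nn_integral_exit_law) simp
  also have "\<dots> = (\<integral>\<^sup>+\<omega>. ennreal (exit_val q g (path \<omega>) l u) \<partial>M)"
    unfolding exit_val_eq[of q g] using exit_val_nonneg[of "\<lambda>_. 1"] assms by (simp add: ennreal_mult)
  finally show ?thesis .
qed

lemma sets_exit_law: "sets (exit_law q l u) = sets borel"
  by (simp add: exit_law_def)

lemma exit_val_le_1: "0 \<le> q \<Longrightarrow> (\<And>x. 0 \<le> g x \<and> g x \<le> 1) \<Longrightarrow> exit_val q g p l u \<le> 1"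
  using exit_time_nonneg[of p l u] mult_le_one[of "exp (- q * exit_time p l u)" "g (p (exit_time p l u))"]
  by (auto simp: exit_val_def)

lemma finite_measure_exit_law:
  assumes "0 \<le> q" shows "finite_measure (exit_law q l u)"
proof
  have "emeasure (exit_law q l u) (space (exit_law q l u)) = (\<integral>\<^sup>+w. ennreal 1 \<partial>exit_law q l u)" by simp
  also have "\<dots> = (\<integral>\<^sup>+\<omega>. ennreal (exit_val q (\<lambda>_. 1) (path \<omega>) l u) \<partial>M)"
    by (rule nn_integral_exit_law_real) auto
  also have "\<dots> \<le> (\<integral>\<^sup>+\<omega>. 1 \<partial>M)"
    using exit_val_le_1[OF assms] by (intro nn_integral_mono) (simp add: ennreal_leI flip: ennreal_1)
  finally show "emeasure (exit_law q l u) (space (exit_law q l u)) \<noteq> \<infinity>"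
    using emeasure_finite[of "space M"] by (auto simp: top_unique)
qed

text \<open>\<open>Q\<close> carries a property of the start that holds only almost surely to the
  place where a single path is examined.\<close>

lemma AE_exit_law:
  assumes "Measurable.pred borel P"
    and "\<And>\<omega>. \<omega> \<in> space M \<Longrightarrow> exit_set (path \<omega>) l u \<noteq> {} \<Longrightarrow> Q \<omega> \<Longrightarrow> P (path \<omega> (exit_time (path \<omega>) l u))"
    and "AE \<omega> in M. Q \<omega>"
  shows "AE w in exit_law q l u. P w"
proof -
  have [measurable]: "(\<lambda>\<omega>. exit_val q (\<lambda>_. 1) (path \<omega>) l u) \<in> borel_measurable M"
    by (rule exit_val_measurable) auto
  have "AE \<omega> in M. 0 < ennreal (exit_val q (\<lambda>_. 1) (path \<omega>) l u) \<longrightarrow> P (exit_pos l u \<omega>)"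
    using assms(3) AE_space
  proof eventually_elim
    case (elim \<omega>)
    then show ?case using assms(2)[of \<omega>] by (auto simp: exit_val_def exit_pos_def split: if_splits)
  qed
  then have "AE \<omega> in density M (\<lambda>\<omega>. ennreal (exit_val q (\<lambda>_. 1) (path \<omega>) l u)). P (exit_pos l u \<omega>)"
    by (subst AE_density) auto
  then show ?thesis
    unfolding exit_law_def using assms(1) exit_pos_measurable
    by (subst AE_distr_iff) (auto simp: pred_def)
qed

lemma AE_potential:
  "AE y in potential q l u. y \<in> {l..u}"
proof -
  note [measurable] = Y_joint_measurable_lborel occupation_measurable
  have "AE z in M \<Otimes>\<^sub>M lborel. 0 < occupation q l u z \<longrightarrow> (case z of (\<omega>, t) \<Rightarrow> Y (max 0 t) \<omega>) \<in> {l..u}"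
  proof (intro AE_I2)
    fix z :: "'a \<times> real"
    show "0 < occupation q l u z \<longrightarrow> (case z of (\<omega>, t) \<Rightarrow> Y (max 0 t) \<omega>) \<in> {l..u}"
      using before_exit_time[of "snd z" "path (fst z)" l u]
      by (auto simp: occupation_def survives_def max_absorb2 split: if_splits prod.splits)
  qed
  then have "AE z in density (M \<Otimes>\<^sub>M lborel) (occupation q l u). (case z of (\<omega>, t) \<Rightarrow> Y (max 0 t) \<omega>) \<in> {l..u}"
    by (subst AE_density) auto
  then show ?thesis unfolding potential_def by (subst AE_distr_iff) auto
qed

text \<open>Dividing Dynkin's formula by \<open>\<phi> \<alpha> - q\<close> turns every term into an
  exponential transform for all large \<open>\<alpha>\<close>: the potential plus the convolution of
  the starting law on one side, the convolution of the exit law on the other. Both sides live on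
  \<open>{..u}\<close>, so equal transforms give equal measures.\<close>

lemma scale_identity:
  assumes lu: "l \<le> u" and q: "0 \<le> q" and Y0: "AE \<omega> in M. Y 0 \<omega> \<in> {l..u}"
    and W: "is_scale_function \<phi> q W"
    and S: "S \<in> sets borel"
  shows "emeasure (potential q l u) S + (\<integral>\<^sup>+y\<in>S. scale_convolution W (distr M borel (Y 0)) y \<partial>lborel)
       = (\<integral>\<^sup>+y\<in>S. scale_convolution W (exit_law q l u) y \<partial>lborel)"
proof -
  obtain c where c: "0 \<le> c" "\<And>\<alpha>. c \<le> \<alpha> \<Longrightarrow> q < \<phi> \<alpha>"
    "\<And>\<alpha>. c \<le> \<alpha> \<Longrightarrow> (\<integral>\<^sup>+x. ennreal (exp (- \<alpha> * x) * pos_part_scale W x) \<partial>lborel) = ennreal (1 / (\<phi> \<alpha> - q))"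
    by (rule scale_laplace[OF W \<phi>_at_top]) blast
  define m0 where "m0 = distr M borel (Y 0)"
  define m1 where "m1 = exit_law q l u"
  have [measurable]: "Y 0 \<in> borel_measurable M" by (rule Y_measurable) simp
  interpret m0: finite_measure m0 unfolding m0_def by (rule finite_measure_distr) simp
  interpret m1: finite_measure m1 unfolding m1_def by (rule finite_measure_exit_law[OF q])
  have sm: "sets m0 = sets borel" "sets m1 = sets borel" by (simp_all add: m0_def m1_def sets_exit_law)
  note [measurable_cong] = sm
  have cm[measurable]: "scale_convolution W m0 \<in> borel_measurable borel" "scale_convolution W m1 \<in> borel_measurable borel"
    using scale_convolution_measurable[OF W m0.sigma_finite_measure_axioms sm(1)]
      scale_convolution_measurable[OF W m1.sigma_finite_measure_axioms sm(2)] by blast+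
  define A where "A = add_measure (potential q l u) (density lborel (scale_convolution W m0))"
  define B where "B = density lborel (scale_convolution W m1)"
  have sA: "sets (density lborel (scale_convolution W m0)) = sets (potential q l u)" by (simp add: sets_potential)
  have le_u: "AE y in density lborel (scale_convolution W m). y \<le> u"
    if m: "sigma_finite_measure m" "sets m = sets borel" "AE w in m. w \<le> u" for m
  proof -
    have "scale_convolution W m y = 0" if "u < y" for y
    proof -
      have "scale_convolution W m y = (\<integral>\<^sup>+w. 0 \<partial>m)"
        unfolding scale_convolution_def
      proof (rule nn_integral_cong_AE)
        show "AE w in m. ennreal (pos_part_scale W (w - y)) = 0"
          using m(3) by eventually_elim (use that in \<open>simp add: pos_part_scale_neg\<close>)
      qed
      then show ?thesis by simp
    qed
    then show ?thesis
      using scale_convolution_measurable[OF W m(1,2)] by (subst AE_density) (auto simp: not_less[symmetric])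
  qed
  have m0u: "AE w in m0. w \<le> u" unfolding m0_def using Y0 by (subst AE_distr_iff) (auto elim!: eventually_mono)
  have m1u: "AE w in m1. w \<le> u" unfolding m1_def
  proof (rule AE_exit_law[OF _ _ Y0])
    fix \<omega> assume "\<omega> \<in> space M" "exit_set (path \<omega>) l u \<noteq> {}" "Y 0 \<omega> \<in> {l..u}"
    then show "path \<omega> (exit_time (path \<omega>) l u) \<le> u"
      using exit_position[OF cadlag_path no_positive_jumps_path, of \<omega> u l] lu by fastforce
  qed measurable
  have tr: "(\<integral>\<^sup>+y. ennreal (exp (\<alpha> * y)) \<partial>A) = (\<integral>\<^sup>+y. ennreal (exp (\<alpha> * y)) \<partial>B) \<and> (\<integral>\<^sup>+y. ennreal (exp (\<alpha> * y)) \<partial>A) < \<infinity>"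
    if \<alpha>: "c \<le> \<alpha>" for \<alpha>
  proof -
    \<comment> \<open>\<open>dynkin\<close> needs both \<open>\<alpha>\<close> and
      \<open>2 * \<alpha>\<close> beyond the threshold; \<open>c \<ge> 0\<close> provides the
      second.\<close>
    have \<alpha>0: "0 \<le> \<alpha>" and "c \<le> 2 * \<alpha>" using \<alpha> c(1) by auto
    note d = dynkin[OF lu q Y0 \<alpha>0 c(2)[OF \<alpha>] c(2)[OF \<open>c \<le> 2 * \<alpha>\<close>]]
    have pos: "0 < \<phi> \<alpha> - q" using c(2)[OF \<alpha>] by simp
    have conv: "(\<integral>\<^sup>+y. ennreal (exp (\<alpha> * y)) \<partial>density lborel (scale_convolution W m)) =
        (\<integral>\<^sup>+w. ennreal (exp (\<alpha> * w)) \<partial>m) * ennreal (1 / (\<phi> \<alpha> - q))"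
      if "sigma_finite_measure m" "sets m = sets borel" for m
    proof -
      note [measurable] = scale_convolution_measurable[OF W that]
      have "(\<integral>\<^sup>+y. ennreal (exp (\<alpha> * y)) \<partial>density lborel (scale_convolution W m)) =
         (\<integral>\<^sup>+y. ennreal (exp (\<alpha> * y)) * scale_convolution W m y \<partial>lborel)"
        by (subst nn_integral_density) (auto simp: mult.commute)
      then show ?thesis using nn_integral_exp_scale_convolution[OF W that c(3)[OF \<alpha>]] by simp
    qed
    have e0: "(\<integral>\<^sup>+w. ennreal (exp (\<alpha> * w)) \<partial>m0) = (\<integral>\<^sup>+\<omega>. ennreal (exp (\<alpha> * Y 0 \<omega>)) \<partial>M)"
      unfolding m0_def by (subst nn_integral_distr) auto
    have e1: "(\<integral>\<^sup>+w. ennreal (exp (\<alpha> * w)) \<partial>m1) = (\<integral>\<^sup>+\<omega>. ennreal (exit_val q (\<lambda>y. exp (\<alpha> * y)) (path \<omega>) l u) \<partial>M)"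
      unfolding m1_def by (rule nn_integral_exit_law_real) auto
    let ?V = "\<integral>\<^sup>+y. ennreal (exp (\<alpha> * y)) \<partial>potential q l u" and ?E = "\<integral>\<^sup>+\<omega>. ennreal (exp (\<alpha> * Y 0 \<omega>)) \<partial>M"
    have A: "(\<integral>\<^sup>+y. ennreal (exp (\<alpha> * y)) \<partial>A) = ?V + ?E * ennreal (1 / (\<phi> \<alpha> - q))"
      unfolding A_def
      by (subst nn_integral_add_measure[OF sA])
         (simp_all add: measurable_cong_sets[OF sets_potential refl] conv[OF _ sm(1)] m0.sigma_finite_measure_axioms e0)
    have B: "(\<integral>\<^sup>+y. ennreal (exp (\<alpha> * y)) \<partial>B) = (?V * ennreal (\<phi> \<alpha> - q) + ?E) * ennreal (1 / (\<phi> \<alpha> - q))"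
      unfolding B_def d(1) e1[symmetric] by (rule conv) (use sm m1.sigma_finite_measure_axioms in auto)
    have "ennreal (\<phi> \<alpha> - q) * ennreal (1 / (\<phi> \<alpha> - q)) = 1"
      using pos by (simp flip: ennreal_mult)
    then have "(?V * ennreal (\<phi> \<alpha> - q) + ?E) * ennreal (1 / (\<phi> \<alpha> - q)) = ?V + ?E * ennreal (1 / (\<phi> \<alpha> - q))"
      by (simp add: distrib_right mult.assoc)
    then show ?thesis unfolding A B using d(2,3) by (simp add: ennreal_mult_eq_top_iff less_top[symmetric])
  qed
  have "A = B"
  proof (rule measure_eq_laplace_transform)
    show "sets A = sets borel" "sets B = sets borel" by (simp_all add: A_def B_def sets_potential)
    show "AE y in A. y \<le> u"
    proof -
      have N1: "emeasure (potential q l u) {u<..} = 0"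
      proof -
        have "AE y in potential q l u. y \<notin> {u<..}" using AE_potential by eventually_elim auto
        then show ?thesis by (subst (asm) AE_iff_measurable[of "{u<..}"])
          (auto simp: sets_potential sets_eq_imp_space_eq[OF sets_potential])
      qed
      have N2: "emeasure (density lborel (scale_convolution W m0)) {u<..} = 0"
      proof -
        have "AE y in density lborel (scale_convolution W m0). y \<notin> {u<..}"
          using le_u[OF _ sm(1) m0u] m0.sigma_finite_measure_axioms by auto
        then show ?thesis by (subst (asm) AE_iff_measurable[of "{u<..}"]) auto
      qed
      have "emeasure A {u<..} = 0"
        unfolding A_def by (subst emeasure_add_measure[OF sA]) (simp_all add: sets_potential N1 N2)
      then show ?thesis
        by (intro AE_I[of _ _ "{u<..}"]) (auto simp: A_def sets_potential)
    qed
    show "AE y in B. y \<le> u" unfolding B_def by (rule le_u) (use sm m1u m1.sigma_finite_measure_axioms in auto)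
    show "(\<integral>\<^sup>+y. ennreal (exp (\<alpha> * y)) \<partial>A) = (\<integral>\<^sup>+y. ennreal (exp (\<alpha> * y)) \<partial>B)" if "c \<le> \<alpha>" for \<alpha>
      using tr[OF that] by blast
    show "(\<integral>\<^sup>+y. ennreal (exp (c * y)) \<partial>A) < \<infinity>" using tr[of c] by blast
  qed
  then have "emeasure A S = emeasure B S" by simp
  moreover have "emeasure A S = emeasure (potential q l u) S + (\<integral>\<^sup>+y\<in>S. scale_convolution W m0 y \<partial>lborel)"
    unfolding A_def using S by (subst emeasure_add_measure[OF sA]) (simp_all add: sets_potential emeasure_density)
  moreover have "emeasure B S = (\<integral>\<^sup>+y\<in>S. scale_convolution W m1 y \<partial>lborel)"
    unfolding B_def using S by (simp add: emeasure_density)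
  ultimately show ?thesis by (simp add: m0_def m1_def)
qed

end

text \<open>It extracts one point near the boundary from an inequality that is known only after
  integration.\<close>

lemma exists_le_of_set_nn_integral_le:
  fixes f g :: "real \<Rightarrow> ennreal"
  assumes [measurable]: "f \<in> borel_measurable borel" "g \<in> borel_measurable borel" "S \<in> sets borel"
    and S: "0 < emeasure lborel S"
    and le: "(\<integral>\<^sup>+y\<in>S. f y \<partial>lborel) \<le> (\<integral>\<^sup>+y\<in>S. g y \<partial>lborel)"
    and fin: "(\<integral>\<^sup>+y\<in>S. g y \<partial>lborel) \<noteq> \<infinity>"
  shows "\<exists>y\<in>S. f y \<le> g y"
proof (rule ccontr)
  assume "\<not> (\<exists>y\<in>S. f y \<le> g y)"
  then have less: "g y < f y" if "y \<in> S" for y using that by (auto simp: not_le)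
  have "(\<integral>\<^sup>+y\<in>S. g y \<partial>lborel) < (\<integral>\<^sup>+y\<in>S. f y \<partial>lborel)"
  proof (rule nn_integral_less)
    show "AE y in lborel. g y * indicator S y \<le> f y * indicator S y"
      using less by (auto simp: indicator_def less_imp_le)
    show "\<not> (AE y in lborel. f y * indicator S y \<le> g y * indicator S y)"
    proof
      assume "AE y in lborel. f y * indicator S y \<le> g y * indicator S y"
      then have "AE y in lborel. y \<notin> S"
        by eventually_elim (use less in \<open>force simp: indicator_def not_le[symmetric]\<close>)
      then have "emeasure lborel S = 0" by (subst (asm) AE_iff_measurable[of S]) auto
      then show False using S by simp
    qed
  qed (use fin in auto)
  then show False using le by simp
qed

section \<open>Exit at the top, and the process restarted at a fixed time\<close>

context exit_process
begin

text \<open>For a start in \<open>[l, u]\<close> with \<open>l < u\<close> this is the mean of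
  \<open>exp (- q * D)\<close> over paths that leave at the top.\<close>

abbreviation top_mass :: "real \<Rightarrow> real \<Rightarrow> real \<Rightarrow> ennreal" where
  "top_mass q l u \<equiv> (\<integral>\<^sup>+\<omega>. ennreal (exit_val q (top_weight l u) (path \<omega>) l u) \<partial>M)"

lemma top_weight_measurable: "top_weight l u \<in> borel_measurable borel"
  by (intro borel_measurable_continuous_onI) (simp add: continuous_at_imp_continuous_on top_weight_cont)

lemma AE_exit_law_position:
  assumes "l < u" "AE \<omega> in M. Y 0 \<omega> \<in> {l..u}"
  shows "AE w in exit_law q l u. w \<le> l \<or> w = u"
proof (rule AE_exit_law[OF _ _ assms(2)])
  fix \<omega> assume "\<omega> \<in> space M" "exit_set (path \<omega>) l u \<noteq> {}" "Y 0 \<omega> \<in> {l..u}"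
  then show "path \<omega> (exit_time (path \<omega>) l u) \<le> l \<or> path \<omega> (exit_time (path \<omega>) l u) = u"
    using assms(1) by (intro exit_position[OF cadlag_path no_positive_jumps_path]) auto
qed measurable

text \<open>Exit positions are at most \<open>l\<close> or equal to \<open>u\<close>. For
  \<open>y > l\<close> the low ones see the scale function at negative arguments, where it is 0; for
  \<open>y \<le> l\<close> they can only add to the contribution of \<open>u\<close>.\<close>

lemma scale_convolution_exit_law:
  assumes lu: "l < u" and Y0: "AE \<omega> in M. Y 0 \<omega> \<in> {l..u}" and W: "is_scale_function \<phi> q W"
  shows "top_mass q l u * ennreal (pos_part_scale W (u - y)) \<le> scale_convolution W (exit_law q l u) y"
    and "l < y \<Longrightarrow> scale_convolution W (exit_law q l u) y = top_mass q l u * ennreal (pos_part_scale W (u - y))"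
proof -
  note [measurable] = top_weight_measurable
  note [measurable_cong] = sets_exit_law
  have p: "top_mass q l u * ennreal (pos_part_scale W (u - y))
     = (\<integral>\<^sup>+w. ennreal (top_weight l u w) * ennreal (pos_part_scale W (u - y)) \<partial>exit_law q l u)"
    unfolding nn_integral_exit_law_real[OF top_weight_measurable top_weight_nonneg, symmetric]
    by (rule nn_integral_multc[symmetric]) measurable
  note pos = AE_exit_law_position[OF lu Y0, of q]
  show "top_mass q l u * ennreal (pos_part_scale W (u - y)) \<le> scale_convolution W (exit_law q l u) y"
    unfolding p scale_convolution_def
  proof (rule nn_integral_mono_AE)
    show "AE w in exit_law q l u. ennreal (top_weight l u w) * ennreal (pos_part_scale W (u - y)) \<le> ennreal (pos_part_scale W (w - y))"
      using pos by eventually_elim (use lu in \<open>auto simp: top_weight_top top_weight_bot\<close>)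
  qed
  assume y: "l < y"
  show "scale_convolution W (exit_law q l u) y = top_mass q l u * ennreal (pos_part_scale W (u - y))"
    unfolding p scale_convolution_def
  proof (rule nn_integral_cong_AE)
    show "AE w in exit_law q l u. ennreal (pos_part_scale W (w - y)) = ennreal (top_weight l u w) * ennreal (pos_part_scale W (u - y))"
      using pos by eventually_elim (use lu y in \<open>auto simp: top_weight_top top_weight_bot pos_part_scale_neg\<close>)
  qed
qed

lemma scale_convolution_start:
  assumes W: "is_scale_function \<phi> q W"
  shows "scale_convolution W (distr M borel (Y 0)) y = (\<integral>\<^sup>+\<omega>. ennreal (pos_part_scale W (Y 0 \<omega> - y)) \<partial>M)"
proof -
  note [measurable] = scale_measurable[OF W] Y_measurable[OF order_refl]
  show ?thesis unfolding scale_convolution_def by (subst nn_integral_distr) auto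
qed

text \<open>On \<open>{l<..}\<close> the unknown lower part of the exit law is invisible, and one
  unknown number remains: \<open>top_mass\<close>.\<close>

lemma scale_resolvent:
  assumes lu: "l < u" and q: "0 \<le> q" and Y0: "AE \<omega> in M. Y 0 \<omega> \<in> {l..u}" and W: "is_scale_function \<phi> q W"
    and S: "S \<in> sets borel" "S \<subseteq> {l<..}"
  shows "emeasure (potential q l u) S + (\<integral>\<^sup>+y\<in>S. (\<integral>\<^sup>+\<omega>. ennreal (pos_part_scale W (Y 0 \<omega> - y)) \<partial>M) \<partial>lborel)
    = (\<integral>\<^sup>+y\<in>S. top_mass q l u * ennreal (pos_part_scale W (u - y)) \<partial>lborel)"
proof -
  have "(\<integral>\<^sup>+y\<in>S. scale_convolution W (exit_law q l u) y \<partial>lborel)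
     = (\<integral>\<^sup>+y\<in>S. top_mass q l u * ennreal (pos_part_scale W (u - y)) \<partial>lborel)"
    by (intro nn_integral_cong) (use scale_convolution_exit_law(2)[OF lu Y0 W] S(2) in \<open>auto simp: indicator_def\<close>)
  then show ?thesis
    using scale_identity[OF less_imp_le[OF lu] q Y0 W S(1)] by (simp add: scale_convolution_start[OF W])
qed

lemma top_mass_finite: "0 \<le> q \<Longrightarrow> top_mass q l u < \<infinity>"
proof -
  assume q: "0 \<le> q"
  have "top_mass q l u \<le> (\<integral>\<^sup>+\<omega>. 1 \<partial>M)"
    using exit_val_le_1[OF q, of "top_weight l u"] top_weight_nonneg top_weight_le_1
    by (intro nn_integral_mono) (simp add: ennreal_leI flip: ennreal_1)
  then show ?thesis using emeasure_finite[of "space M"] by (auto simp: less_top[symmetric] top_unique)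
qed

text \<open>Write \<open>w\<close> for the convolution of the starting law and \<open>v\<close> for
  the contribution of the top exit. Just above \<open>l\<close> the potential is nonnegative, so
  \<open>w \<le> v\<close> at some points near \<open>l\<close>. Just below \<open>l\<close> the
  potential vanishes and low exits contribute nonnegatively, so \<open>v \<le> w\<close> at some
  points near \<open>l\<close>. Continuity gives equality at \<open>l\<close>.\<close>

lemma scale_exit:
  assumes lu: "l < u" and q: "0 \<le> q" and \<delta>: "0 < \<delta>" "l + \<delta> \<le> u"
    and Y0: "AE \<omega> in M. Y 0 \<omega> \<in> {l + \<delta>..u}" and W: "is_scale_function \<phi> q W"
  shows "top_mass q l u * ennreal (W (u - l)) = (\<integral>\<^sup>+\<omega>. ennreal (W (Y 0 \<omega> - l)) \<partial>M)"
proof -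
  have Y0': "AE \<omega> in M. Y 0 \<omega> \<in> {l..u}" using Y0 by eventually_elim (use \<delta> in auto)
  note [measurable] = scale_measurable[OF W] Y_measurable[OF order_refl]
  define w where "w y = (\<integral>\<^sup>+\<omega>. ennreal (pos_part_scale W (Y 0 \<omega> - y)) \<partial>M)" for y
  define v where "v y = top_mass q l u * ennreal (pos_part_scale W (u - y))" for y
  have wm[measurable]: "w \<in> borel_measurable borel" unfolding w_def by measurable
  have vm[measurable]: "v \<in> borel_measurable borel" unfolding v_def by measurable
  \<comment> \<open>Starts are at least \<open>\<delta>\<close> above \<open>l\<close> and
    \<open>y\<close> stays within \<open>min (\<delta> / 2) 1\<close> of \<open>l\<close>, so all
    arguments of \<open>W\<close> lie in this compact set away from 0.\<close>
  have "continuous_on {\<delta> / 2..u - l + 1} W"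
    using W \<delta> by (auto simp: is_scale_function_def intro: continuous_on_subset)
  then have "bounded (W ` {\<delta> / 2..u - l + 1})"
    by (intro compact_imp_bounded compact_continuous_image) auto
  then obtain B where B: "\<And>x. x \<in> {\<delta> / 2..u - l + 1} \<Longrightarrow> \<bar>W x\<bar> \<le> B"
    unfolding bounded_iff by (metis image_eqI real_norm_def)
  define \<eta> where "\<eta> n = min (\<delta> / 2) 1 * inverse (real (Suc n))" for n
  have m0: "0 < min (\<delta> / 2) 1" using \<delta> by simp
  have \<eta>: "0 < \<eta> n" "\<eta> n \<le> \<delta> / 2" "\<eta> n \<le> 1" for n
  proof -
    show "0 < \<eta> n" unfolding \<eta>_def using m0 by simp
    have "\<eta> n \<le> min (\<delta> / 2) 1" unfolding \<eta>_def using m0 by (intro mult_left_le) (auto simp: inverse_le_1_iff)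
    then show "\<eta> n \<le> \<delta> / 2" "\<eta> n \<le> 1" by auto
  qed
  have \<eta>0: "\<eta> \<longlonglongrightarrow> 0"
    unfolding \<eta>_def[abs_def] using tendsto_mult[OF tendsto_const LIMSEQ_inverse_real_of_nat, of "min (\<delta> / 2) 1"] by simp
  have Bnd: "pos_part_scale W (x - y) \<le> B" "pos_part_scale W (x - y) = W (x - y)"
    if "x \<in> {l + \<delta>..u}" "\<bar>y - l\<bar> \<le> \<eta> n" for x y n
  proof -
    have "x - y \<in> {\<delta> / 2..u - l + 1}" using that \<eta>(2,3)[of n] by auto
    moreover then have "0 < x - y" using \<delta> by auto
    ultimately show "pos_part_scale W (x - y) \<le> B" "pos_part_scale W (x - y) = W (x - y)"
      using B[of "x - y"] by (simp_all add: pos_part_scale_pos abs_le_iff)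
  qed
  have wB: "w y \<le> ennreal B * emeasure M (space M)" if "\<bar>y - l\<bar> \<le> \<eta> n" for y n
  proof -
    have "w y \<le> (\<integral>\<^sup>+\<omega>. ennreal B \<partial>M)" unfolding w_def
    proof (rule nn_integral_mono_AE)
      show "AE \<omega> in M. ennreal (pos_part_scale W (Y 0 \<omega> - y)) \<le> ennreal B"
        using Y0 by eventually_elim (rule ennreal_leI, rule Bnd(1)[OF _ that])
    qed
    then show ?thesis by simp
  qed
  have vB: "v y \<le> top_mass q l u * ennreal B" if "\<bar>y - l\<bar> \<le> \<eta> n" for y n
    unfolding v_def by (intro mult_left_mono ennreal_leI Bnd(1)[OF _ that]) (use \<delta> in auto)
  have wlim: "(\<lambda>n. w (y n)) \<longlonglongrightarrow> w l" if y: "\<And>n. \<bar>y n - l\<bar> \<le> \<eta> n" for y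
  proof -
    have yl: "y \<longlonglongrightarrow> l"
    proof -
      have "(\<lambda>n. y n - l) \<longlonglongrightarrow> 0" by (rule Lim_null_comparison[OF _ \<eta>0]) (use y in auto)
      then show ?thesis by (simp add: LIM_zero_iff)
    qed
    show ?thesis unfolding w_def
    proof (rule nn_integral_dominated_convergence[where w = "\<lambda>_. ennreal B"])
      show "AE \<omega> in M. ennreal (pos_part_scale W (Y 0 \<omega> - y n)) \<le> ennreal B" for n
        using Y0 by eventually_elim (rule ennreal_leI, rule Bnd(1)[OF _ y])
      show "(\<integral>\<^sup>+\<omega>. ennreal B \<partial>M) < \<infinity>" by (simp add: ennreal_mult_eq_top_iff less_top[symmetric])
      show "AE \<omega> in M. (\<lambda>n. ennreal (pos_part_scale W (Y 0 \<omega> - y n))) \<longlonglongrightarrow> ennreal (pos_part_scale W (Y 0 \<omega> - l))"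
        using Y0
      proof eventually_elim
        case (elim \<omega>)
        have "isCont W (Y 0 \<omega> - l)" using scale_isCont[OF W] elim \<delta> by auto
        then have "(\<lambda>n. W (Y 0 \<omega> - y n)) \<longlonglongrightarrow> W (Y 0 \<omega> - l)"
          by (rule isCont_tendsto_compose) (intro tendsto_intros yl)
        then show ?case using Bnd(2)[OF elim y] Bnd(2)[OF elim, of l 0] \<eta>(1)[of 0]
          by (intro tendsto_ennrealI) simp
      qed
    qed measurable
  qed
  have vlim: "(\<lambda>n. v (y n)) \<longlonglongrightarrow> v l" if y: "\<And>n. \<bar>y n - l\<bar> \<le> \<eta> n" for y
  proof -
    have yl: "y \<longlonglongrightarrow> l"
    proof -
      have "(\<lambda>n. y n - l) \<longlonglongrightarrow> 0" by (rule Lim_null_comparison[OF _ \<eta>0]) (use y in auto)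
      then show ?thesis by (simp add: LIM_zero_iff)
    qed
    have u: "u \<in> {l + \<delta>..u}" using \<delta> by simp
    have "isCont W (u - l)" using scale_isCont[OF W] lu by auto
    then have "(\<lambda>n. W (u - y n)) \<longlonglongrightarrow> W (u - l)"
      by (rule isCont_tendsto_compose) (intro tendsto_intros yl)
    then have "(\<lambda>n. pos_part_scale W (u - y n)) \<longlonglongrightarrow> pos_part_scale W (u - l)"
      using Bnd(2)[OF u y] Bnd(2)[OF u, of l 0] \<eta>(1)[of 0] by simp
    then show ?thesis unfolding v_def using top_mass_finite[OF q, of l u]
      by (intro tendsto_mult_ennreal tendsto_const tendsto_ennrealI) auto
  qed
  have int_fin: "(\<integral>\<^sup>+y\<in>S. f y \<partial>lborel) \<noteq> \<infinity>" if "D < \<infinity>" "\<And>y. y \<in> S \<Longrightarrow> f y \<le> D" "S \<in> sets borel" "emeasure lborel S < \<infinity>" for f :: "real \<Rightarrow> ennreal" and D S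
  proof -
    have "(\<integral>\<^sup>+y\<in>S. f y \<partial>lborel) \<le> (\<integral>\<^sup>+y\<in>S. D \<partial>lborel)"
      by (intro nn_integral_mono) (use that(2) in \<open>auto simp: indicator_def\<close>)
    also have "\<dots> = D * emeasure lborel S" using that(3) by (simp add: nn_integral_cmult_indicator)
    also have "\<dots> < \<infinity>" using that by (simp add: ennreal_mult_eq_top_iff less_top[symmetric])
    finally show ?thesis by simp
  qed
  have S: "emeasure lborel {l<..<l + \<eta> n} = ennreal (\<eta> n)" "emeasure lborel {l - \<eta> n<..<l} = ennreal (\<eta> n)" for n
    using \<eta>(1)[of n] by simp_all
  \<comment> \<open>Above \<open>l\<close>: the resolvent identity, with the potential
    dropped.\<close>
  have "\<exists>y\<in>{l<..<l + \<eta> n}. w y \<le> v y" for n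
  proof (rule exists_le_of_set_nn_integral_le[OF wm vm])
    show "(\<integral>\<^sup>+y\<in>{l<..<l + \<eta> n}. w y \<partial>lborel) \<le> (\<integral>\<^sup>+y\<in>{l<..<l + \<eta> n}. v y \<partial>lborel)"
    proof -
      have "{l<..<l + \<eta> n} \<subseteq> {l<..}" by auto
      then have "emeasure (potential q l u) {l<..<l + \<eta> n} + (\<integral>\<^sup>+y\<in>{l<..<l + \<eta> n}. w y \<partial>lborel)
          = (\<integral>\<^sup>+y\<in>{l<..<l + \<eta> n}. v y \<partial>lborel)"
        unfolding w_def v_def by (intro scale_resolvent[OF lu q Y0' W]) auto
      then show ?thesis by (rule subst) (rule add_increasing, simp_all)
    qed
    show "(\<integral>\<^sup>+y\<in>{l<..<l + \<eta> n}. v y \<partial>lborel) \<noteq> \<infinity>"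
      by (rule int_fin[where D = "top_mass q l u * ennreal B"])
        (use top_mass_finite[OF q, of l u] S \<eta>(1)[of n] in \<open>auto simp: ennreal_mult_eq_top_iff less_top[symmetric] intro!: vB[of _ n]\<close>)
  qed (use S \<eta>(1)[of n] in auto)
  then obtain y where y: "\<And>n. y n \<in> {l<..<l + \<eta> n}" "\<And>n. w (y n) \<le> v (y n)" by metis
  have yb: "\<bar>y n - l\<bar> \<le> \<eta> n" for n using y(1)[of n] by auto
  have "w l \<le> v l" by (rule LIMSEQ_le[OF wlim[OF yb] vlim[OF yb]]) (use y(2) in auto)
  \<comment> \<open>Below \<open>l\<close>: the potential has no mass, and only the contribution of
    the top exit is kept.\<close>
  have "\<exists>y\<in>{l - \<eta> n<..<l}. v y \<le> w y" for n
  proof (rule exists_le_of_set_nn_integral_le[OF vm wm])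
    have "emeasure (potential q l u) {l - \<eta> n<..<l} = 0"
    proof -
      have "AE y in potential q l u. y \<notin> {l - \<eta> n<..<l}" using AE_potential by eventually_elim auto
      then show ?thesis by (subst (asm) AE_iff_measurable[of "{l - \<eta> n<..<l}"])
        (auto simp: sets_potential sets_eq_imp_space_eq[OF sets_potential])
    qed
    then have e: "(\<integral>\<^sup>+y\<in>{l - \<eta> n<..<l}. w y \<partial>lborel) = (\<integral>\<^sup>+y\<in>{l - \<eta> n<..<l}. scale_convolution W (exit_law q l u) y \<partial>lborel)"
      using scale_identity[OF less_imp_le[OF lu] q Y0' W, of "{l - \<eta> n<..<l}"]
      by (simp add: scale_convolution_start[OF W] w_def)
    show "(\<integral>\<^sup>+y\<in>{l - \<eta> n<..<l}. v y \<partial>lborel) \<le> (\<integral>\<^sup>+y\<in>{l - \<eta> n<..<l}. w y \<partial>lborel)"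
      unfolding e v_def by (intro nn_integral_mono mult_right_mono scale_convolution_exit_law(1)[OF lu Y0' W]) auto
    show "(\<integral>\<^sup>+y\<in>{l - \<eta> n<..<l}. w y \<partial>lborel) \<noteq> \<infinity>"
      by (rule int_fin[where D = "ennreal B * emeasure M (space M)"])
        (use S \<eta>(1)[of n] in \<open>auto simp: ennreal_mult_eq_top_iff less_top[symmetric] intro!: wB[of _ n]\<close>)
  qed (use S \<eta>(1)[of n] in auto)
  then obtain z where z: "\<And>n. z n \<in> {l - \<eta> n<..<l}" "\<And>n. v (z n) \<le> w (z n)" by metis
  have zb: "\<bar>z n - l\<bar> \<le> \<eta> n" for n using z(1)[of n] by auto
  have "v l \<le> w l" by (rule LIMSEQ_le[OF vlim[OF zb] wlim[OF zb]]) (use z(2) in auto)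
  with \<open>w l \<le> v l\<close> have "v l = w l" by simp
  moreover have "w l = (\<integral>\<^sup>+\<omega>. ennreal (W (Y 0 \<omega> - l)) \<partial>M)"
    unfolding w_def
  proof (rule nn_integral_cong_AE)
    show "AE \<omega> in M. ennreal (pos_part_scale W (Y 0 \<omega> - l)) = ennreal (W (Y 0 \<omega> - l))"
      using Y0 by eventually_elim (use \<delta> in \<open>auto simp: pos_part_scale_pos\<close>)
  qed
  ultimately show ?thesis using lu by (simp add: v_def pos_part_scale_pos)
qed

text \<open>If \<open>W\<close> vanished on the whole range, the resolvent identity would give the
  open interval no occupation; but a right-continuous path from an inner point stays inside for a
  positive time.\<close>

lemma scale_not_zero:
  assumes lu: "l < u" and q: "0 \<le> q" and x: "x \<in> {l<..<u}" "\<And>\<omega>. \<omega> \<in> space M \<Longrightarrow> Y 0 \<omega> = x"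
    and W: "is_scale_function \<phi> q W" and M: "emeasure M (space M) \<noteq> 0"
  shows "\<exists>y\<in>{0<..<u - l}. W y \<noteq> 0"
proof (rule ccontr)
  assume "\<not> (\<exists>y\<in>{0<..<u - l}. W y \<noteq> 0)"
  then have W0: "W y = 0" if "y \<in> {0<..<u - l}" for y using that by blast
  have Y0: "AE \<omega> in M. Y 0 \<omega> \<in> {l..u}" using x by (intro AE_I2) auto
  have "(\<integral>\<^sup>+y\<in>{l<..<u}. top_mass q l u * ennreal (pos_part_scale W (u - y)) \<partial>lborel) = (\<integral>\<^sup>+y. 0 \<partial>(lborel :: real measure))"
    by (intro nn_integral_cong) (auto simp: indicator_def pos_part_scale_pos W0)
  then have p0: "emeasure (potential q l u) {l<..<u} = 0"
    using scale_resolvent[OF lu q Y0 W, of "{l<..<u}"] by (auto simp: subset_eq)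
  have m: "(\<lambda>y. indicator {l<..<u} y :: ennreal) \<in> borel_measurable borel" by measurable
  have Om: "(\<lambda>z. occupation q l u z * indicator {l<..<u} (Y (max 0 (snd z)) (fst z))) \<in> borel_measurable (M \<Otimes>\<^sub>M lborel)"
    using Y_joint_measurable_lborel[unfolded case_prod_unfold] occupation_measurable by measurable
  have "(\<integral>\<^sup>+z. occupation q l u z * indicator {l<..<u} (Y (max 0 (snd z)) (fst z)) \<partial>(M \<Otimes>\<^sub>M lborel)) = 0"
    using p0 nn_integral_potential[OF m, of q l u] by (simp add: sets_potential)
  then have J0: "(\<integral>\<^sup>+\<omega>. \<integral>\<^sup>+t. occupation q l u (\<omega>, t) * indicator {l<..<u} (Y (max 0 t) \<omega>) \<partial>lborel \<partial>M) = 0"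
    using lborel.nn_integral_fst[OF Om] by simp
  define J where "J \<omega> = (\<integral>\<^sup>+t. occupation q l u (\<omega>, t) * indicator {l<..<u} (Y (max 0 t) \<omega>) \<partial>lborel)" for \<omega>
  have Jpos: "0 < (\<integral>\<^sup>+t. occupation q l u (\<omega>, t) * indicator {l<..<u} (Y (max 0 t) \<omega>) \<partial>lborel)" if \<omega>: "\<omega> \<in> space M" for \<omega>
  proof -
    obtain d where d: "0 < d" "\<And>s. 0 \<le> s \<Longrightarrow> s < 0 + d \<Longrightarrow> path \<omega> s \<in> {l<..<u}"
      using right_continuous_exit_nbhd[OF rc_path[OF \<omega>] order_refl, of "{l<..<u}"] x \<omega> by auto
    have sv: "survives (path \<omega>) l u t" if "0 \<le> t" "t < d" for t
    proof (cases "exit_set (path \<omega>) l u = {}")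
      case False
      have "d \<le> exit_time (path \<omega>) l u" unfolding exit_time_def using False d(2)
        by (intro cInf_greatest) (force simp: exit_set_def not_less[symmetric])+
      then show ?thesis using that by (simp add: survives_def)
    qed (simp add: survives_def)
    have "0 < ennreal (exp (- q * d)) * ennreal d" using d(1) by (simp add: ennreal_zero_less_mult_iff)
    also have "\<dots> = (\<integral>\<^sup>+t. ennreal (exp (- q * d)) * indicator {0..<d} t \<partial>lborel)"
      using d(1) by (simp add: nn_integral_cmult_indicator)
    also have "\<dots> \<le> (\<integral>\<^sup>+t. occupation q l u (\<omega>, t) * indicator {l<..<u} (Y (max 0 t) \<omega>) \<partial>lborel)"
    proof (rule nn_integral_mono)
      fix t
      show "ennreal (exp (- q * d)) * indicator {0..<d} t \<le> occupation q l u (\<omega>, t) * indicator {l<..<u} (Y (max 0 t) \<omega>)"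
        using sv[of t] d(2)[of t] q by (auto simp: indicator_def occupation_def max_absorb2 intro!: ennreal_leI mult_left_mono)
    qed
    finally show ?thesis .
  qed
  have "J \<in> borel_measurable M"
    unfolding J_def using lborel.borel_measurable_nn_integral_fst[OF Om] by simp
  moreover have "(\<integral>\<^sup>+\<omega>. J \<omega> \<partial>M) = 0" unfolding J_def by (rule J0)
  ultimately have "AE \<omega> in M. J \<omega> = 0" by (simp add: nn_integral_0_iff_AE)
  then have "AE \<omega> in M. False"
    using AE_space
  proof eventually_elim
    case (elim \<omega>)
    then show ?case using Jpos[of \<omega>] by (simp add: J_def)
  qed
  then have "emeasure M (space M) = 0" by (simp add: AE_iff_null null_setsD1)
  then show False using M by simp
qed

text \<open>A weight known at time \<open>s\<close> is known at every later time, so increments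
  after \<open>s + r\<close> remain independent of the past and keep the law \<open>\<kappa>\<close>
  under the weighted measure. The bound on \<open>Z\<close> keeps that measure finite.\<close>

lemma weighted_shift:
  assumes s: "0 \<le> s" and Z[measurable]: "Z \<in> borel_measurable (F s)" and C: "\<And>\<omega>. Z \<omega> \<le> ennreal C"
  shows "exit_process (density M Z) (\<lambda>t. F (s + t)) (\<lambda>t. Y (s + t)) \<kappa> \<phi>"
proof -
  have ZM[measurable]: "Z \<in> borel_measurable M" using F_measurable_M[OF s Z] .
  show ?thesis
  proof (intro exit_process.intro exit_process_axioms.intro finite_measureI)
    have "emeasure (density M Z) (space (density M Z)) = (\<integral>\<^sup>+\<omega>. Z \<omega> * indicator (space M) \<omega> \<partial>M)"
      by (simp add: emeasure_density)
    also have "\<dots> \<le> (\<integral>\<^sup>+\<omega>. ennreal C \<partial>M)"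
      by (intro nn_integral_mono) (use C in \<open>auto simp: indicator_def\<close>)
    finally show "emeasure (density M Z) (space (density M Z)) \<noteq> \<infinity>"
      by (auto simp: top_unique ennreal_mult_eq_top_iff)
    fix t :: real
    show "prob_space (\<kappa> t)" if "0 \<le> t" using prob_\<kappa> that .
    show "sets (\<kappa> t) = sets borel" by (rule sets_\<kappa>)
    show "subalgebra (density M Z) (F (s + t))" if "0 \<le> t"
      using subalgebra_F[of "s + t"] s that by (simp add: subalgebra_def)
    show "Y (s + t) \<in> borel_measurable (F (s + t))" if "0 \<le> t" using adapted s that by simp
    show "sets (F (s + r)) \<subseteq> sets (F (s + t))" if "0 \<le> r" "r \<le> t" for r
      using F_mono[of "s + r" "s + t"] s that by simp
    show "(\<integral>\<^sup>+u. ennreal (exp (\<alpha> * u)) \<partial>\<kappa> t) = ennreal (exp (t * \<phi> \<alpha>))" if "0 \<le> \<alpha>" "0 \<le> t" for \<alpha>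
      using laplace_\<kappa> that .
    show "filterlim \<phi> at_top at_top" by (rule \<phi>_at_top)
    show "cadlag (\<lambda>t. Y (s + t) \<omega>)" if "\<omega> \<in> space (density M Z)" for \<omega>
      using cadlag_shift[OF cadlag_path s, of \<omega>] that by (simp add: shift_path_def[abs_def])
    show "no_positive_jumps (\<lambda>t. Y (s + t) \<omega>)" if "\<omega> \<in> space (density M Z)" for \<omega>
      using no_positive_jumps_shift[OF no_positive_jumps_path s, of \<omega>] that by (simp add: shift_path_def[abs_def])
    fix r :: real and A B assume r: "0 \<le> r" and t: "0 \<le> t" and A: "A \<in> sets (F (s + r))" and B[measurable]: "B \<in> sets (borel :: real measure)"
    have sr: "0 \<le> s + r" using s r by simp
    have AM[measurable]: "A \<in> sets M" using A subalgebra_F[OF sr] by (auto simp: subalgebra_def)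
    have [measurable]: "Y (s + r) \<in> borel_measurable M" "Y (s + r + t) \<in> borel_measurable M"
      "Y (s + (r + t)) \<in> borel_measurable M"
      using Y_measurable sr t by (auto simp: add.assoc)
    have [measurable]: "Z \<in> borel_measurable (F (s + r))" using F_measurable_mono[OF s _ Z] r by simp
    note [measurable] = A
    have "emeasure (density M Z) (A \<inter> {\<omega> \<in> space (density M Z). Y (s + (r + t)) \<omega> - Y (s + r) \<omega> \<in> B})
      = (\<integral>\<^sup>+\<omega>. Z \<omega> * indicator (A \<inter> {\<omega> \<in> space M. Y (s + r + t) \<omega> - Y (s + r) \<omega> \<in> B}) \<omega> \<partial>M)"
      by (subst emeasure_density) (simp_all add: add.assoc sets.Int)
    also have "\<dots> = (\<integral>\<^sup>+\<omega>. (\<lambda>(\<omega>, v). Z \<omega> * indicator A \<omega> * indicator B v) (\<omega>, Y (s + r + t) \<omega> - Y (s + r) \<omega>) \<partial>M)"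
      by (intro nn_integral_cong) (auto simp: indicator_def)
    also have "\<dots> = (\<integral>\<^sup>+\<omega>. \<integral>\<^sup>+v. (\<lambda>(\<omega>, v). Z \<omega> * indicator A \<omega> * indicator B v) (\<omega>, v) \<partial>\<kappa> t \<partial>M)"
      by (rule nn_integral_increment[OF sr t]) measurable
    also have "\<dots> = (\<integral>\<^sup>+\<omega>. Z \<omega> * indicator A \<omega> * emeasure (\<kappa> t) B \<partial>M)"
      by (simp add: nn_integral_cmult_indicator sets_\<kappa>)
    also have "\<dots> = emeasure (density M Z) A * emeasure (\<kappa> t) B"
      by (subst nn_integral_multc) (simp_all add: emeasure_density)
    finally show "emeasure (density M Z) (A \<inter> {\<omega> \<in> space (density M Z). Y (s + (r + t)) \<omega> - Y (s + r) \<omega> \<in> B})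
      = emeasure (density M Z) A * emeasure (\<kappa> t) B" .
  qed
qed

lemma exit_val_shift_measurable:
  assumes s: "0 \<le> s"
  shows "(\<lambda>\<omega>. exit_val q (top_weight l u) (shift_path (path \<omega>) s) l u) \<in> borel_measurable M"
proof -
  \<comment> \<open>The weight 1 changes nothing, but it presents the shifted process as an instance
    of the locale.\<close>
  interpret S: exit_process "density M (\<lambda>_. 1)" "\<lambda>t. F (s + t)" "\<lambda>t. Y (s + t)" \<kappa> \<phi>
    by (rule weighted_shift[OF s, where C = 1]) auto
  have "(\<lambda>\<omega>. exit_val q (top_weight l u) (\<lambda>t. Y (s + t) \<omega>) l u) \<in> borel_measurable (density M (\<lambda>_. 1))"
    by (rule S.exit_val_measurable) (simp_all add: top_weight_cont top_weight_nonneg)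
  then show ?thesis by (simp add: shift_path_def[abs_def])
qed

text \<open>\<open>scale_exit\<close> conditionally on \<open>F s\<close>, with conditioning
  expressed by arbitrary weights. The weight confines the position at time \<open>s\<close>, which
  then serves as a start away from the lower boundary.\<close>

lemma scale_exit_shift:
  assumes lu: "l < u" and q: "0 \<le> q" and \<delta>: "0 < \<delta>" "l + \<delta> \<le> u" and W: "is_scale_function \<phi> q W"
    and s: "0 \<le> s" and Z[measurable]: "Z \<in> borel_measurable (F s)" and C: "\<And>\<omega>. Z \<omega> \<le> ennreal C"
    and supp: "\<And>\<omega>. Z \<omega> \<noteq> 0 \<Longrightarrow> Y s \<omega> \<in> {l + \<delta>..u}"
  shows "(\<integral>\<^sup>+\<omega>. Z \<omega> * ennreal (exit_val q (top_weight l u) (shift_path (path \<omega>) s) l u) \<partial>M) * ennreal (W (u - l))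
     = (\<integral>\<^sup>+\<omega>. Z \<omega> * ennreal (W (Y s \<omega> - l)) \<partial>M)"
proof -
  have ZM[measurable]: "Z \<in> borel_measurable M" using F_measurable_M[OF s Z] .
  have [measurable]: "Y s \<in> borel_measurable M" by (rule Y_measurable[OF s])
  note [measurable] = scale_measurable[OF W] exit_val_shift_measurable[OF s]
  interpret S: exit_process "density M Z" "\<lambda>t. F (s + t)" "\<lambda>t. Y (s + t)" \<kappa> \<phi>
    by (rule weighted_shift[OF s Z C])
  have "AE \<omega> in density M Z. Y (s + 0) \<omega> \<in> {l + \<delta>..u}"
    using supp by (subst AE_density) (auto simp: zero_less_iff_neq_zero)
  note 1 = S.scale_exit[OF lu q \<delta> this W]
  have "S.top_mass q l u = (\<integral>\<^sup>+\<omega>. Z \<omega> * ennreal (exit_val q (top_weight l u) (shift_path (path \<omega>) s) l u) \<partial>M)"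
  proof -
    have sp: "(\<lambda>t. Y (s + t) \<omega>) = shift_path (path \<omega>) s" for \<omega> by (simp add: shift_path_def fun_eq_iff)
    show ?thesis unfolding sp by (rule nn_integral_density) measurable
  qed
  moreover have "(\<integral>\<^sup>+\<omega>. ennreal (W (Y (s + 0) \<omega> - l)) \<partial>density M Z) = (\<integral>\<^sup>+\<omega>. Z \<omega> * ennreal (W (Y s \<omega> - l)) \<partial>M)"
  proof -
    have "AE \<omega> in density M Z. ennreal (W (Y (s + 0) \<omega> - l)) = ennreal (pos_part_scale W (Y s \<omega> - l))"
      using \<open>AE \<omega> in density M Z. Y (s + 0) \<omega> \<in> {l + \<delta>..u}\<close>
      by eventually_elim (use \<delta> in \<open>auto simp: pos_part_scale_pos\<close>)
    then have "(\<integral>\<^sup>+\<omega>. ennreal (W (Y (s + 0) \<omega> - l)) \<partial>density M Z) = (\<integral>\<^sup>+\<omega>. ennreal (pos_part_scale W (Y s \<omega> - l)) \<partial>density M Z)"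
      by (rule nn_integral_cong_AE)
    also have "\<dots> = (\<integral>\<^sup>+\<omega>. Z \<omega> * ennreal (pos_part_scale W (Y s \<omega> - l)) \<partial>M)"
      by (subst nn_integral_density) auto
    also have "\<dots> = (\<integral>\<^sup>+\<omega>. Z \<omega> * ennreal (W (Y s \<omega> - l)) \<partial>M)"
    proof (rule nn_integral_cong)
      fix \<omega>
      show "Z \<omega> * ennreal (pos_part_scale W (Y s \<omega> - l)) = Z \<omega> * ennreal (W (Y s \<omega> - l))"
        using supp[of \<omega>] \<delta> by (cases "Z \<omega> = 0") (auto simp: pos_part_scale_pos)
    qed
    finally show ?thesis .
  qed
  ultimately show ?thesis using 1 by simp
qed

end

lemma abs_diff_divide_le:
  fixes a b h :: real
  assumes "\<bar>a - b\<bar> \<le> d * c + d * c'" "0 < h"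
  shows "\<bar>a / h - b / h\<bar> \<le> d * (c / h) + d * (c' / h)"
proof -
  have "\<bar>a / h - b / h\<bar> = \<bar>a - b\<bar> / h" using assms(2) by (simp add: diff_divide_distrib[symmetric])
  also have "\<dots> \<le> (d * c + d * c') / h" using assms by (intro divide_right_mono) auto
  finally show ?thesis by (simp add: add_divide_distrib)
qed

section \<open>Increments over short times\<close>

text \<open>Only the laws of the increments enter here, not the paths; \<open>levy_exit\<close>
  joins both.\<close>

locale levy_semigroup =
  fixes \<mu> \<sigma> :: real and \<nu> :: "real measure" and \<kappa> :: "real \<Rightarrow> real measure"
  assumes sets_\<nu>: "sets \<nu> = sets borel"
    and \<nu>_support: "emeasure \<nu> {0..} = 0"
    and \<nu>_finite: "(\<integral>\<^sup>+x. ennreal (min (x\<^sup>2) 1) \<partial>\<nu>) < \<infinity>"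
    and prob_\<kappa>': "\<And>t. 0 \<le> t \<Longrightarrow> prob_space (\<kappa> t)"
    and sets_\<kappa>': "\<And>t. sets (\<kappa> t) = sets borel"
    and laplace_\<kappa>': "\<And>\<alpha> t. 0 \<le> \<alpha> \<Longrightarrow> 0 \<le> t \<Longrightarrow>
      (\<integral>\<^sup>+u. ennreal (exp (\<alpha> * u)) \<partial>\<kappa> t) = ennreal (exp (t * laplace_exponent \<mu> \<sigma> \<nu> \<alpha>))"
begin

abbreviation \<psi> :: "real \<Rightarrow> real" where "\<psi> \<equiv> laplace_exponent \<mu> \<sigma> \<nu>"

lemma AE_\<nu>_neg: "AE x in \<nu>. x < 0"
  using \<nu>_support by (intro AE_I[of _ _ "{0..}"]) (auto simp: sets_\<nu>)

lemma integrable_\<nu>: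
  assumes f: "f \<in> borel_measurable borel" and b: "\<And>x. x < 0 \<Longrightarrow> \<bar>f x\<bar> \<le> C * min (x\<^sup>2) 1"
  shows "integrable \<nu> f"
proof -
  have [measurable]: "f \<in> borel_measurable \<nu>" "(\<lambda>x. min (x\<^sup>2) (1::real)) \<in> borel_measurable \<nu>"
    using f by (simp_all add: measurable_cong_sets[OF sets_\<nu> refl])
  have "integrable \<nu> (\<lambda>x. min (x\<^sup>2) 1)"
    using \<nu>_finite by (intro integrableI_nonneg) auto
  then have "integrable \<nu> (\<lambda>x. C * min (x\<^sup>2) 1)" by simp
  then show ?thesis
  proof (rule Bochner_Integration.integrable_bound)
    show "AE x in \<nu>. norm (f x) \<le> norm (C * min (x\<^sup>2) 1)"
      using AE_\<nu>_neg by eventually_elim (use b in \<open>force intro: order_trans\<close>)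
  qed simp
qed

lemma integrable_exponent:
  assumes \<alpha>: "0 \<le> \<alpha>"
  shows "integrable \<nu> (\<lambda>x. exp (\<alpha> * x) - 1 - \<alpha> * x * indicator {-1<..} x)"
\<comment> \<open>\<open>\<alpha>\<^sup>2\<close> serves the second-order remainder on
  \<open>(-1, 0)\<close>; the 1 serves the large jumps, where the integrand is at most 1 in absolute
  value and the minimum equals 1.\<close>
proof (rule integrable_\<nu>[where C = "\<alpha>\<^sup>2 + 1"])
  fix x :: real assume x: "x < 0"
  show "\<bar>exp (\<alpha> * x) - 1 - \<alpha> * x * indicator {-1<..} x\<bar> \<le> (\<alpha>\<^sup>2 + 1) * min (x\<^sup>2) 1"
  proof (cases "x > -1")
    case True
    let ?y = "\<alpha> * x"
    have y: "?y \<le> 0" using \<alpha> x by (simp add: mult_nonneg_nonpos)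
    have 1: "0 \<le> exp ?y - 1 - ?y" using exp_ge_add_one_self[of ?y] by linarith
    have "1 - ?y \<le> exp (- ?y)" using exp_ge_add_one_self[of "- ?y"] by linarith
    then have "exp ?y * (1 - ?y) \<le> exp ?y * exp (- ?y)" by (intro mult_left_mono) auto
    then have "exp ?y \<le> 1 / (1 - ?y)" using y by (simp add: exp_add[symmetric] pos_le_divide_eq)
    \<comment> \<open>After multiplication by \<open>1 - ?y\<close> this reads
      \<open>1 \<le> 1 - ?y ^ 3\<close>, which holds because \<open>?y \<le> 0\<close>.\<close>
    also have "\<dots> \<le> 1 + ?y + ?y\<^sup>2"
    proof -
      have "?y\<^sup>2 * ?y \<le> 0" by (rule mult_nonneg_nonpos[OF zero_le_power2 y])
      moreover have "(1 + ?y + ?y\<^sup>2) * (1 - ?y) = 1 - ?y\<^sup>2 * ?y" by (simp add: algebra_simps power2_eq_square)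
      ultimately have "1 \<le> (1 + ?y + ?y\<^sup>2) * (1 - ?y)" by linarith
      then show ?thesis using y by (simp add: pos_divide_le_eq)
    qed
    finally have 2: "exp ?y - 1 - ?y \<le> \<alpha>\<^sup>2 * x\<^sup>2" by (simp add: power_mult_distrib)
    have "\<bar>x\<bar> \<le> 1" using True x by simp
    then have "x\<^sup>2 \<le> 1" by (simp add: abs_square_le_1)
    moreover have "\<bar>exp ?y - 1 - ?y\<bar> \<le> \<alpha>\<^sup>2 * x\<^sup>2 + x\<^sup>2"
      using 1 2 zero_le_power2[of x] by linarith
    ultimately show ?thesis using True by (simp add: distrib_right)
  next
    case False
    have "exp (\<alpha> * x) \<le> 1" using \<alpha> x by (simp add: mult_nonneg_nonpos)
    then have "\<bar>exp (\<alpha> * x) - 1\<bar> \<le> 1" using exp_gt_zero[of "\<alpha> * x"] by linarith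
    moreover have "1 \<le> x\<^sup>2" using False power_mono[of 1 "- x" 2] by simp
    ultimately show ?thesis using False by (simp add: add_increasing)
  qed
qed measurable

text \<open>It vanishes to second order at 0, which makes the weighted Levy measure finite, and it
  is a polynomial in \<open>exp u\<close>, which makes its integrals under \<open>\<kappa> t\<close>
  explicit.\<close>

abbreviation weight :: "real \<Rightarrow> real" where "weight u \<equiv> (1 - exp u)\<^sup>2"

lemma weight_bound: "x < 0 \<Longrightarrow> weight x \<le> min (x\<^sup>2) 1"
proof -
  assume x: "x < 0"
  have "exp x \<le> 1" using x by simp
  then have "0 \<le> 1 - exp x" "1 - exp x \<le> - x" "1 - exp x \<le> 1"
    using exp_ge_add_one_self[of x] exp_gt_zero[of x] by linarith+
  then have "weight x \<le> (- x)\<^sup>2" "weight x \<le> 1\<^sup>2" by (intro power_mono; simp)+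
  then show "weight x \<le> min (x\<^sup>2) 1" by simp
qed

lemma integrable_weight:
  assumes "f \<in> borel_measurable borel" "\<And>x. x < 0 \<Longrightarrow> \<bar>f x\<bar> \<le> C"
  shows "integrable \<nu> (\<lambda>x. weight x * f x)"
proof (rule integrable_\<nu>[where C = C])
  fix x :: real assume x: "x < 0"
  have C: "0 \<le> C" using assms(2)[OF x] abs_ge_zero by (rule order_trans[rotated])
  have "\<bar>weight x * f x\<bar> \<le> min (x\<^sup>2) 1 * C"
    unfolding abs_mult using weight_bound[OF x] assms(2)[OF x] by (intro mult_mono) auto
  then show "\<bar>weight x * f x\<bar> \<le> C * min (x\<^sup>2) 1" by (simp add: mult.commute)
qed (use assms(1) in measurable)

section \<open>Second differences of the Laplace exponent and short-time limits\<close>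

lemma exp_shift: "exp (real j * x) = exp x ^ j" "exp ((real j + 1) * x) = exp x ^ j * exp x"
  "exp ((real j + 2) * x) = exp x ^ j * (exp x)\<^sup>2" for x :: real
  by (simp_all add: distrib_right exp_add exp_of_nat_mult exp_double)

text \<open>The moments, in the variable \<open>s = exp u\<close>, of the limit of the weighted laws
  \<open>\<kappa> h\<close> divided by \<open>h\<close>. The Gaussian part is an atom of mass
  \<open>\<sigma>\<^sup>2\<close> at \<open>s = 1\<close>.\<close>

definition weighted_moment :: "nat \<Rightarrow> real" where
  "weighted_moment j = \<sigma>\<^sup>2 + (\<integral>x. weight x * exp x ^ j \<partial>\<nu>)"

lemma integrable_weighted_moment: "integrable \<nu> (\<lambda>x. weight x * exp x ^ j)"
  by (rule integrable_weight[where C = 1]) (auto simp: power_le_one)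

text \<open>A second difference annihilates the drift and the compensator, which are linear in the
  exponent; it turns the quadratic term into \<open>\<sigma>\<^sup>2\<close> and
  \<open>exp (\<alpha> * x)\<close> into \<open>weight x\<close> times a power of
  \<open>exp x\<close>.\<close>

lemma second_difference: "\<psi> (real j) - 2 * \<psi> (real j + 1) + \<psi> (real j + 2) = weighted_moment j"
proof -
  let ?f = "\<lambda>\<alpha> x. exp (\<alpha> * x) - 1 - \<alpha> * x * indicator {-1<..} x"
  have pt: "?f (real j) x - 2 * ?f (real j + 1) x + ?f (real j + 2) x = weight x * exp x ^ j" for x
    unfolding exp_shift by (simp add: power2_eq_square algebra_simps)
  have i: "integrable \<nu> (?f (real j))" "integrable \<nu> (?f (real j + 1))" "integrable \<nu> (?f (real j + 2))"
    by (intro integrable_exponent; simp)+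
  have "(\<integral>x. weight x * exp x ^ j \<partial>\<nu>) = (\<integral>x. ?f (real j) x \<partial>\<nu>) - 2 * (\<integral>x. ?f (real j + 1) x \<partial>\<nu>) + (\<integral>x. ?f (real j + 2) x \<partial>\<nu>)"
    unfolding pt[symmetric]
      Bochner_Integration.integral_add[OF Bochner_Integration.integrable_diff[OF i(1) integrable_mult_right[OF i(2), of 2]] i(3)]
      Bochner_Integration.integral_diff[OF i(1) integrable_mult_right[OF i(2), of 2]] integral_mult_right_zero ..
  moreover define I where "I \<alpha> = (\<integral>x. ?f \<alpha> x \<partial>\<nu>)" for \<alpha>
  moreover have "\<psi> \<alpha> = \<mu> * \<alpha> + \<sigma>\<^sup>2 * \<alpha>\<^sup>2 / 2 + I \<alpha>" for \<alpha>
    by (simp add: laplace_exponent_def I_def)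
  ultimately have "weighted_moment j = \<sigma>\<^sup>2 + (I (real j) - 2 * I (real j + 1) + I (real j + 2))"
    "\<psi> (real j) - 2 * \<psi> (real j + 1) + \<psi> (real j + 2) = \<sigma>\<^sup>2 + (I (real j) - 2 * I (real j + 1) + I (real j + 2))"
    by (simp_all only: weighted_moment_def) (simp add: power2_eq_square field_simps)
  then show ?thesis by simp
qed

lemma has_integral_exp_\<kappa>:
  assumes "0 \<le> \<alpha>" "0 \<le> t"
  shows "integrable (\<kappa> t) (\<lambda>u. exp (\<alpha> * u))" "(\<integral>u. exp (\<alpha> * u) \<partial>\<kappa> t) = exp (t * \<psi> \<alpha>)"
proof -
  have m: "(\<lambda>u. exp (\<alpha> * u)) \<in> borel_measurable (\<kappa> t)" by (simp add: measurable_cong_sets[OF sets_\<kappa>' refl])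
  show "integrable (\<kappa> t) (\<lambda>u. exp (\<alpha> * u))"
    using m laplace_\<kappa>'[OF assms] by (intro integrableI_nonneg) auto
  show "(\<integral>u. exp (\<alpha> * u) \<partial>\<kappa> t) = exp (t * \<psi> \<alpha>)"
    using m laplace_\<kappa>'[OF assms] by (subst integral_eq_nn_integral) auto
qed

lemma weighted_\<kappa>:
  assumes t: "0 \<le> t"
  shows "integrable (\<kappa> t) (\<lambda>u. weight u * exp u ^ j)"
    "(\<integral>u. weight u * exp u ^ j \<partial>\<kappa> t) = exp (t * \<psi> (real j)) - 2 * exp (t * \<psi> (real j + 1)) + exp (t * \<psi> (real j + 2))"
proof -
  have pt: "weight u * exp u ^ j = exp (real j * u) - 2 * exp ((real j + 1) * u) + exp ((real j + 2) * u)" for u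
    unfolding exp_shift by (simp add: power2_eq_square algebra_simps)
  note i = has_integral_exp_\<kappa>(1)[OF _ t] and e = has_integral_exp_\<kappa>(2)[OF _ t]
  have i3: "integrable (\<kappa> t) (\<lambda>u. exp (real j * u))" "integrable (\<kappa> t) (\<lambda>u. 2 * exp ((real j + 1) * u))"
    "integrable (\<kappa> t) (\<lambda>u. exp ((real j + 2) * u))"
    by (auto intro!: i integrable_mult_right)
  show "integrable (\<kappa> t) (\<lambda>u. weight u * exp u ^ j)"
    unfolding pt by (intro Bochner_Integration.integrable_add Bochner_Integration.integrable_diff i3)
  have "(\<integral>u. weight u * exp u ^ j \<partial>\<kappa> t)
      = (\<integral>u. exp (real j * u) \<partial>\<kappa> t) - (\<integral>u. 2 * exp ((real j + 1) * u) \<partial>\<kappa> t) + (\<integral>u. exp ((real j + 2) * u) \<partial>\<kappa> t)"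
    unfolding pt by (simp only: Bochner_Integration.integral_add[OF Bochner_Integration.integrable_diff[OF i3(1,2)] i3(3)]
      Bochner_Integration.integral_diff[OF i3(1,2)])
  then show "(\<integral>u. weight u * exp u ^ j \<partial>\<kappa> t) = exp (t * \<psi> (real j)) - 2 * exp (t * \<psi> (real j + 1)) + exp (t * \<psi> (real j + 2))"
    using e[of "real j"] e[of "real j + 1"] e[of "real j + 2"] by simp
qed

text \<open>The coefficients 1, -2, 1 sum to 0, so each exponential may be reduced by 1; three
  difference quotients at time 0 remain.\<close>

lemma weighted_\<kappa>_LIMSEQ:
  assumes h: "\<And>n. 0 < h n" "h \<longlonglongrightarrow> 0"
  shows "(\<lambda>n. (\<integral>u. weight u * exp u ^ j \<partial>\<kappa> (h n)) / h n) \<longlonglongrightarrow> weighted_moment j"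
proof -
  have d: "(\<lambda>n. (exp (h n * c) - 1) / h n) \<longlonglongrightarrow> c" for c :: real
  proof -
    have "((\<lambda>x. exp (x * c)) has_real_derivative c) (at 0)" by (auto intro!: derivative_eq_intros)
    then have "((\<lambda>x. (exp (x * c) - 1) / x) \<longlongrightarrow> c) (at 0)" by (simp add: has_field_derivative_iff)
    moreover have "filterlim h (at 0) sequentially"
      using h by (auto simp: filterlim_at less_imp_neq[THEN not_sym] intro!: always_eventually)
    ultimately show ?thesis by (rule filterlim_compose)
  qed
  have "(\<integral>u. weight u * exp u ^ j \<partial>\<kappa> (h n)) / h n =
     (exp (h n * \<psi> (real j)) - 1) / h n - 2 * ((exp (h n * \<psi> (real j + 1)) - 1) / h n) + (exp (h n * \<psi> (real j + 2)) - 1) / h n" for n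
    unfolding weighted_\<kappa>(2)[OF less_imp_le[OF h(1)]] by (simp add: diff_divide_distrib add_divide_distrib)
  then show ?thesis
    unfolding second_difference[symmetric] by (simp only:) (intro tendsto_intros d)
qed

text \<open>Convergence of the weighted moments passes from polynomials in \<open>exp u\<close> to
  \<open>g / weight\<close> by uniform approximation. The laws \<open>\<kappa> (h n)\<close> also
  charge positive \<open>u\<close>, where \<open>exp u\<close> is unbounded and the approximation
  breaks down; there a sufficiently high moment absorbs the polynomial.\<close>

lemma small_time_limit:
  assumes h: "\<And>n. 0 < h n" "h \<longlonglongrightarrow> 0"
    and g: "\<And>x. isCont g x" and \<epsilon>: "0 < \<epsilon>" and supp: "\<And>u. g u \<noteq> 0 \<Longrightarrow> - R \<le> u \<and> u \<le> - \<epsilon>"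
  shows "(\<lambda>n. (\<integral>u. g u \<partial>\<kappa> (h n)) / h n) \<longlonglongrightarrow> (\<integral>u. g u \<partial>\<nu>)"
proof -
  define \<delta> where "\<delta> = exp (- R - 1)"
  define \<eta> where "\<eta> = exp (- \<epsilon>)"
  have \<eta>: "\<eta> < 1" "0 < \<eta>" using \<epsilon> by (auto simp: \<eta>_def)
  have \<delta>: "0 < \<delta>" by (simp add: \<delta>_def)
  \<comment> \<open>\<open>g / weight\<close> in the variable \<open>s = exp u\<close>, made
    continuous on the whole line: clamping at \<open>\<delta>\<close> avoids the logarithm near 0,
    clamping at \<open>\<eta>\<close> avoids the zero of the denominator at \<open>s = 1\<close>.
    Both clamps act only where \<open>g\<close> vanishes.\<close>
  define k where "k s = g (ln (max s \<delta>)) / (1 - min s \<eta>)\<^sup>2" for s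
  have k1: "k s = 0" if "\<eta> < s" for s
  proof -
    have "0 < s" using that \<eta> by simp
    then have "ln \<eta> < ln s" "ln s \<le> ln (max s \<delta>)" using that \<eta> by simp_all
    then have "- \<epsilon> < ln (max s \<delta>)" by (simp add: \<eta>_def)
    then show ?thesis using supp[of "ln (max s \<delta>)"] by (auto simp: k_def)
  qed
  have gk: "g u = weight u * k (exp u)" for u
  proof (cases "- R \<le> u \<and> u \<le> - \<epsilon>")
    case True
    then have "max (exp u) \<delta> = exp u" "min (exp u) \<eta> = exp u" by (auto simp: \<delta>_def \<eta>_def max_def min_def)
    moreover have "exp u \<noteq> 1" using True \<epsilon> by simp
    ultimately show ?thesis by (simp add: k_def)
  next
    case False
    have "g u = 0" using supp[of u] False by blast
    moreover have "g (ln (max (exp u) \<delta>)) = 0"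
    proof (cases "exp u \<le> \<delta>")
      case True
      then show ?thesis using supp[of "- R - 1"] by (auto simp: max_absorb2 \<delta>_def)
    qed (use \<open>g u = 0\<close> in \<open>simp add: max_def\<close>)
    ultimately show ?thesis by (simp add: k_def)
  qed
  have cont_k: "continuous_on UNIV k"
  proof -
    have cg: "continuous_on UNIV g" using g by (simp add: continuous_at_imp_continuous_on)
    have "continuous_on UNIV (\<lambda>s. g (ln (max s \<delta>)))"
      using \<delta> by (intro continuous_on_compose2[OF cg] continuous_intros) (auto simp: max_def)
    moreover have "1 - min s \<eta> \<noteq> 0" for s using \<eta> by (auto simp: min_def)
    ultimately show ?thesis unfolding k_def[abs_def] by (intro continuous_intros) auto
  qed
  then have [measurable]: "k \<in> borel_measurable borel" by (rule borel_measurable_continuous_onI)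
  define m1 where "m1 = weighted_moment 0"
  have m1: "0 \<le> m1" unfolding m1_def weighted_moment_def by (intro add_nonneg_nonneg integral_nonneg) auto
  have mj: "weighted_moment j \<le> m1" for j
    unfolding m1_def weighted_moment_def
    by (intro add_left_mono integral_mono_AE integrable_weighted_moment)
       (use AE_\<nu>_neg in \<open>eventually_elim, auto intro!: mult_left_le power_le_one\<close>)
  show ?thesis
  proof (rule LIMSEQ_I)
    fix e :: real assume e: "0 < e"
    \<comment> \<open>The error consists of \<open>d\<close>, \<open>d * m1\<close> and twice
      \<open>d * (m1 + 1)\<close>, which together stay below five times
      \<open>d * (m1 + 1)\<close>.\<close>
    define d where "d = e / (5 * (m1 + 1))"
    have d: "0 < d" "5 * (d * (m1 + 1)) = e" using e m1 by (auto simp: d_def field_simps)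
    \<comment> \<open>The interval reaches beyond \<open>s = 1\<close> because of positive
      increments; beyond 2 the powers of \<open>s / 2\<close> are at least 1.\<close>
    obtain c N where P: "\<And>x. x \<in> {0..2} \<Longrightarrow> \<bar>k x - (\<Sum>i\<le>N. c i * x ^ i)\<bar> < d"
      using polynomial_approximation[OF continuous_on_subset[OF cont_k subset_UNIV] d(1)] by blast
    define p where "p x = (\<Sum>i\<le>N. c i * x ^ i)" for x
    define C where "C = (\<Sum>i\<le>N. \<bar>c i\<bar>)"
    have "(\<lambda>i. C * (1/2) ^ i) \<longlonglongrightarrow> C * 0" by (intro tendsto_intros LIMSEQ_power_zero) simp
    then have "\<forall>\<^sub>F i in sequentially. C * (1/2) ^ i < d" by (intro order_tendstoD(2)) (use d in auto)
    then obtain i where i: "C * (1/2) ^ i < d" by (auto simp: eventually_sequentially)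
    have C0: "0 \<le> C" by (simp add: C_def sum_nonneg)
    \<comment> \<open>For \<open>s > 2\<close> the function \<open>k\<close> vanishes and the
      polynomial is at most \<open>C * s ^ N\<close>. The factor \<open>(s / 2) ^ i \<ge> 1\<close>
      trades degree for smallness, by the choice of \<open>i\<close>.\<close>
    have dom: "\<bar>k s - p s\<bar> \<le> d + d * s ^ (N + i)" if s: "0 < s" for s
    proof (cases "s \<le> 2")
      case True
      then show ?thesis using P[of s] s d by (simp add: p_def add_increasing2 less_imp_le)
    next
      case False
      have "\<bar>p s\<bar> \<le> (\<Sum>i\<le>N. \<bar>c i\<bar> * s ^ N)"
        unfolding p_def using False
        by (intro order_trans[OF sum_abs] sum_mono) (auto simp: abs_mult power_increasing intro!: mult_left_mono)
      also have "\<dots> = C * s ^ N" by (simp add: C_def sum_distrib_right)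
      also have "\<dots> \<le> C * s ^ N * (s / 2) ^ i" 
        using False C0 mult_left_mono[OF one_le_power[of "s / 2" i], of "C * s ^ N"] by simp
      also have "\<dots> = C * (1/2) ^ i * s ^ (N + i)" by (simp add: power_add power_divide)
      also have "\<dots> \<le> d * s ^ (N + i)" using i s by (intro mult_right_mono) auto
      finally have "\<bar>p s\<bar> \<le> d * s ^ (N + i)" .
      moreover have "k s = 0" using False \<eta> by (intro k1) simp
      ultimately show ?thesis using d by simp
    qed
    have pm[measurable]: "p \<in> borel_measurable borel" unfolding p_def by measurable
    have ip: "integrable \<nu> (\<lambda>u. weight u * p (exp u))"
      and ipv: "(\<integral>u. weight u * p (exp u) \<partial>\<nu>) = (\<Sum>i\<le>N. c i * (\<integral>u. weight u * exp u ^ i \<partial>\<nu>))"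
    proof -
      have pt: "weight u * p (exp u) = (\<Sum>i\<le>N. c i * (weight u * exp u ^ i))" for u
        by (simp add: p_def sum_distrib_left ac_simps)
      show "integrable \<nu> (\<lambda>u. weight u * p (exp u))" unfolding pt
        by (intro Bochner_Integration.integrable_sum integrable_mult_right integrable_weighted_moment)
      show "(\<integral>u. weight u * p (exp u) \<partial>\<nu>) = (\<Sum>i\<le>N. c i * (\<integral>u. weight u * exp u ^ i \<partial>\<nu>))"
        unfolding pt by (subst Bochner_Integration.integral_sum)
          (auto intro!: integrable_mult_right integrable_weighted_moment)
    qed
    have ik: "integrable \<nu> g"
    proof -
      have "bounded (k ` {0..1})"
        using cont_k by (intro compact_imp_bounded compact_continuous_image) (auto intro: continuous_on_subset)
      then obtain B where "\<And>s. s \<in> {0..1} \<Longrightarrow> \<bar>k s\<bar> \<le> B" unfolding bounded_iff by (metis image_eqI real_norm_def)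
      then show ?thesis unfolding gk[abs_def] by (intro integrable_weight[where C = B]) auto
    qed
    have mp: "(\<Sum>i\<le>N. c i * weighted_moment i) = \<sigma>\<^sup>2 * p 1 + (\<integral>u. weight u * p (exp u) \<partial>\<nu>)"
    proof -
      have "(\<Sum>i\<le>N. c i * weighted_moment i) = (\<Sum>i\<le>N. c i * \<sigma>\<^sup>2) + (\<integral>u. weight u * p (exp u) \<partial>\<nu>)"
        unfolding ipv weighted_moment_def by (simp add: distrib_left sum.distrib)
      moreover have "(\<Sum>i\<le>N. c i * \<sigma>\<^sup>2) = \<sigma>\<^sup>2 * p 1"
        unfolding p_def by (simp add: sum_distrib_right[symmetric] mult.commute)
      ultimately show ?thesis by simp
    qed
    have lim_err: "\<bar>(\<Sum>i\<le>N. c i * weighted_moment i) - (\<integral>u. g u \<partial>\<nu>)\<bar> \<le> d * m1"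
    proof -
      \<comment> \<open>The Gaussian atom sits at \<open>s = 1\<close>, where \<open>k\<close>
        vanishes, so the polynomial assigns it almost no weight.\<close>
      have p1: "\<bar>p 1\<bar> \<le> d" using P[of 1] k1[of 1] \<eta> by (simp add: p_def)
      have "\<bar>(\<integral>u. weight u * p (exp u) \<partial>\<nu>) - (\<integral>u. g u \<partial>\<nu>)\<bar> = \<bar>\<integral>u. weight u * p (exp u) - g u \<partial>\<nu>\<bar>"
        using ip ik by simp
      also have "\<dots> \<le> (\<integral>u. \<bar>weight u * p (exp u) - g u\<bar> \<partial>\<nu>)" by (rule integral_abs_bound)
      also have "\<dots> \<le> (\<integral>u. d * (weight u * exp u ^ 0) \<partial>\<nu>)"
      proof (rule integral_mono_AE)
        show "integrable \<nu> (\<lambda>u. \<bar>weight u * p (exp u) - g u\<bar>)" using ip ik by simp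
        show "integrable \<nu> (\<lambda>u. d * (weight u * exp u ^ 0))"
          by (intro integrable_mult_right integrable_weighted_moment)
        show "AE u in \<nu>. \<bar>weight u * p (exp u) - g u\<bar> \<le> d * (weight u * exp u ^ 0)"
          using AE_\<nu>_neg
        proof eventually_elim
          case (elim u)
          have "\<bar>weight u * p (exp u) - g u\<bar> = weight u * \<bar>k (exp u) - p (exp u)\<bar>"
            unfolding gk[of u] right_diff_distrib[symmetric] abs_mult by (simp add: abs_minus_commute)
          also have "weight u * \<bar>k (exp u) - p (exp u)\<bar> \<le> weight u * d"
          proof (rule mult_left_mono)
            have "exp u \<le> exp 0" using elim by (intro exp_le_cancel_iff[THEN iffD2]) simp
            then have "exp u \<le> 2" unfolding exp_zero by linarith
            then have "exp u \<in> {0..2}" by simp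
            from P[OF this] show "\<bar>k (exp u) - p (exp u)\<bar> \<le> d" by (simp add: p_def)
          qed simp
          finally show ?case by (simp add: mult.commute)
        qed
      qed
      also have "\<dots> = d * (\<integral>u. weight u * exp u ^ 0 \<partial>\<nu>)" by (rule integral_mult_right_zero)
      finally have 1: "\<bar>(\<integral>u. weight u * p (exp u) \<partial>\<nu>) - (\<integral>u. g u \<partial>\<nu>)\<bar> \<le> d * (\<integral>u. weight u * exp u ^ 0 \<partial>\<nu>)" .
      have "\<bar>\<sigma>\<^sup>2 * p 1\<bar> \<le> \<sigma>\<^sup>2 * d" unfolding abs_mult using p1 by (intro mult_mono) auto
      then have "\<bar>\<sigma>\<^sup>2 * p 1\<bar> \<le> d * \<sigma>\<^sup>2" by (simp only: mult.commute)
      then show ?thesis using 1 unfolding mp m1_def weighted_moment_def[of 0] distrib_left by linarith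
    qed
    define E where "E f n = (\<integral>u. weight u * f (exp u) \<partial>\<kappa> (h n)) / h n" for f :: "real \<Rightarrow> real" and n
    have Ej: "(\<lambda>n. E (\<lambda>s. s ^ j) n) \<longlonglongrightarrow> weighted_moment j" for j
      unfolding E_def by (rule weighted_\<kappa>_LIMSEQ[OF h])
    note iw = weighted_\<kappa>(1)[OF less_imp_le[OF h(1)]]
    have Ep: "E p n = (\<Sum>i\<le>N. c i * E (\<lambda>s. s ^ i) n)" and ipn: "integrable (\<kappa> (h n)) (\<lambda>u. weight u * p (exp u))" for n
    proof -
      have pt: "weight u * p (exp u) = (\<Sum>i\<le>N. c i * (weight u * exp u ^ i))" for u
        by (simp add: p_def sum_distrib_left ac_simps)
      show "integrable (\<kappa> (h n)) (\<lambda>u. weight u * p (exp u))" unfolding pt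
        by (intro Bochner_Integration.integrable_sum integrable_mult_right iw)
      show "E p n = (\<Sum>i\<le>N. c i * E (\<lambda>s. s ^ i) n)"
        unfolding E_def pt by (subst Bochner_Integration.integral_sum)
          (auto intro!: integrable_mult_right iw simp: sum_divide_distrib)
    qed
    have "(\<lambda>n. E p n) \<longlonglongrightarrow> (\<Sum>i\<le>N. c i * weighted_moment i)"
      unfolding Ep by (intro tendsto_intros Ej)
    then have ev1: "\<forall>\<^sub>F n in sequentially. \<bar>E p n - (\<Sum>i\<le>N. c i * weighted_moment i)\<bar> < d"
      using d by (simp add: tendsto_iff dist_real_def)
    have ev2: "\<forall>\<^sub>F n in sequentially. E (\<lambda>s. s ^ j) n < m1 + 1" for j
      using order_tendstoD(2)[OF Ej, of j "m1 + 1"] mj[of j] by simp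
    have "\<forall>\<^sub>F n in sequentially. norm ((\<integral>u. g u \<partial>\<kappa> (h n)) / h n - (\<integral>u. g u \<partial>\<nu>)) < e"
      using ev1 ev2[of 0] ev2[of "N + i"]
    proof eventually_elim
      case (elim n)
      have [measurable]: "g \<in> borel_measurable borel"
        using g by (intro borel_measurable_continuous_onI) (simp add: continuous_at_imp_continuous_on)
      have dom': "\<bar>weight u * p (exp u) - g u\<bar> \<le> d * (weight u * exp u ^ 0) + d * (weight u * exp u ^ (N + i))" for u
      proof -
        have "\<bar>weight u * p (exp u) - g u\<bar> = weight u * \<bar>k (exp u) - p (exp u)\<bar>"
          unfolding gk[of u] right_diff_distrib[symmetric] abs_mult by (simp add: abs_minus_commute)
        also have "\<dots> \<le> weight u * (d + d * exp u ^ (N + i))"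
          by (intro mult_left_mono dom) auto
        finally show ?thesis by (simp add: algebra_simps)
      qed
      have idom: "integrable (\<kappa> (h n)) (\<lambda>u. d * (weight u * exp u ^ 0) + d * (weight u * exp u ^ (N + i)))"
        by (intro Bochner_Integration.integrable_add integrable_mult_right iw)
      have idiff: "integrable (\<kappa> (h n)) (\<lambda>u. weight u * p (exp u) - g u)"
      proof (rule Bochner_Integration.integrable_bound[OF idom])
        show "(\<lambda>u. weight u * p (exp u) - g u) \<in> borel_measurable (\<kappa> (h n))"
          by (simp add: measurable_cong_sets[OF sets_\<kappa>' refl])
        show "AE u in \<kappa> (h n). norm (weight u * p (exp u) - g u)
            \<le> norm (d * (weight u * exp u ^ 0) + d * (weight u * exp u ^ (N + i)))"
          unfolding real_norm_def by (intro AE_I2 order_trans[OF dom' abs_ge_self])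
      qed
      have ig: "integrable (\<kappa> (h n)) g"
        using Bochner_Integration.integrable_diff[OF ipn idiff] by simp
      have "\<bar>(\<integral>u. weight u * p (exp u) \<partial>\<kappa> (h n)) - (\<integral>u. g u \<partial>\<kappa> (h n))\<bar> = \<bar>\<integral>u. weight u * p (exp u) - g u \<partial>\<kappa> (h n)\<bar>"
        using ipn ig by simp
      also have "\<dots> \<le> (\<integral>u. \<bar>weight u * p (exp u) - g u\<bar> \<partial>\<kappa> (h n))" by (rule integral_abs_bound)
      also have "\<dots> \<le> (\<integral>u. d * (weight u * exp u ^ 0) + d * (weight u * exp u ^ (N + i)) \<partial>\<kappa> (h n))"
        using idiff idom dom' by (intro integral_mono) auto
      also have "\<dots> = d * (\<integral>u. weight u * exp u ^ 0 \<partial>\<kappa> (h n)) + d * (\<integral>u. weight u * exp u ^ (N + i) \<partial>\<kappa> (h n))"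
        by (subst Bochner_Integration.integral_add) (auto simp only: integral_mult_right_zero intro!: integrable_mult_right iw)
      finally have "\<bar>E p n - (\<integral>u. g u \<partial>\<kappa> (h n)) / h n\<bar> \<le> d * E (\<lambda>s. s ^ 0) n + d * E (\<lambda>s. s ^ (N + i)) n"
        unfolding E_def by (rule abs_diff_divide_le) (rule h(1))
      also have "\<dots> \<le> d * (m1 + 1) + d * (m1 + 1)"
        using elim d by (intro add_mono mult_left_mono) auto
      finally have "\<bar>E p n - (\<integral>u. g u \<partial>\<kappa> (h n)) / h n\<bar> \<le> d * (m1 + 1) + d * (m1 + 1)" .
      moreover have "d \<le> d * (m1 + 1)" "d * m1 < d * (m1 + 1)" using d m1 by simp_all
      ultimately show ?case unfolding real_norm_def using elim(1) lim_err d by linarith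
    qed
    then show "\<exists>no. \<forall>n\<ge>no. norm ((\<integral>u. g u \<partial>\<kappa> (h n)) / h n - (\<integral>u. g u \<partial>\<nu>)) < e"
      by (simp add: eventually_sequentially)
  qed
qed

lemma weight_lower:
  assumes "u \<le> w" "w < 0"
  shows "weight w \<le> weight u"
  using assms by (intro power_mono) auto

text \<open>From \<open>y \<ge> 0\<close> the support of \<open>f\<close> is reached only by
  increments \<open>u \<le> w2 < 0\<close>. Their mass under \<open>\<kappa> (h n)\<close> is of
  order \<open>h n\<close> by the weighted moments. This gives the bound, and with uniform
  continuity of \<open>f\<close> it also allows the starting point to move with
  \<open>n\<close>.\<close>

lemma increment_limit:
  fixes f :: "real \<Rightarrow> real"
  assumes h: "\<And>n. 0 < h n" "h \<longlonglongrightarrow> 0"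
    and f: "continuous_on UNIV f" and supp: "\<And>w. f w \<noteq> 0 \<Longrightarrow> w1 \<le> w \<and> w \<le> w2" and w2: "w2 < 0"
  shows "\<exists>C\<ge>0. \<forall>n y. 0 \<le> y \<longrightarrow> (\<integral>u. f (y + u) \<partial>\<kappa> (h n)) / h n \<le> C"
    and "(\<And>n. 0 \<le> s n) \<Longrightarrow> 0 \<le> y \<Longrightarrow> s \<longlonglongrightarrow> y \<Longrightarrow>
      (\<lambda>n. (\<integral>u. f (s n + u) \<partial>\<kappa> (h n)) / h n) \<longlonglongrightarrow> (\<integral>u. f (y + u) \<partial>\<nu>)"
proof -
  have [measurable]: "f \<in> borel_measurable borel" using f by (rule borel_measurable_continuous_onI)
  have "bounded (f ` {w1..w2})"
    using f by (intro compact_imp_bounded compact_continuous_image) (auto intro: continuous_on_subset)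
  then obtain B0 where B0: "\<And>w. w \<in> {w1..w2} \<Longrightarrow> \<bar>f w\<bar> \<le> B0"
    unfolding bounded_iff by (metis image_eqI real_norm_def)
  define B where "B = max B0 0"
  have B: "\<bar>f w\<bar> \<le> B" "0 \<le> B" for w
    using B0[of w] supp[of w] by (cases "f w = 0"; force simp: B_def)+
  have ww: "0 < weight w2" using w2 by simp
  note iw = weighted_\<kappa>(1)[OF less_imp_le[OF h(1)], where j = 0]
  define E where "E n = (\<integral>u. weight u * exp u ^ 0 \<partial>\<kappa> (h n)) / h n" for n
  have El: "E \<longlonglongrightarrow> weighted_moment 0" unfolding E_def[abs_def] by (rule weighted_\<kappa>_LIMSEQ[OF h])
  then have "Bseq E" by (intro convergent_imp_Bseq convergentI)
  then obtain K where K: "0 < K" "\<And>n. \<bar>E n\<bar> \<le> K" by (auto simp: Bseq_def)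
  \<comment> \<open>A Markov inequality: \<open>weight\<close> is at least \<open>weight w2\<close>
    on \<open>{..w2}\<close>.\<close>
  have tail: "\<bar>\<integral>u. g u \<partial>\<kappa> (h n)\<bar> / h n \<le> D / weight w2 * E n" and ig: "integrable (\<kappa> (h n)) g"
    if g: "g \<in> borel_measurable borel" "\<And>u. \<bar>g u\<bar> \<le> D * indicator {..w2} u" and D: "0 \<le> D" for g D n
  proof -
    have b: "\<bar>g u\<bar> \<le> D / weight w2 * (weight u * exp u ^ 0)" for u
    proof (cases "u \<le> w2")
      case True
      have "D * weight w2 \<le> D * weight u" using weight_lower[OF True w2] D by (rule mult_left_mono)
      then have "D \<le> D / weight w2 * weight u" using ww by (simp add: pos_le_divide_eq)
      then show ?thesis using g(2)[of u] True by simp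
    next
      case False
      then have "\<bar>g u\<bar> \<le> 0" using g(2)[of u] by simp
      also have "0 \<le> D / weight w2 * (weight u * exp u ^ 0)" using D by simp
      finally show ?thesis .
    qed
    have id: "integrable (\<kappa> (h n)) (\<lambda>u. D / weight w2 * (weight u * exp u ^ 0))" by (intro integrable_mult_right iw)
    show ig: "integrable (\<kappa> (h n)) g"
    proof (rule Bochner_Integration.integrable_bound[OF id])
      show "g \<in> borel_measurable (\<kappa> (h n))" using g(1) by (simp add: measurable_cong_sets[OF sets_\<kappa>' refl])
      show "AE u in \<kappa> (h n). norm (g u) \<le> norm (D / weight w2 * (weight u * exp u ^ 0))"
        unfolding real_norm_def by (intro AE_I2 order_trans[OF b abs_ge_self])
    qed
    have "\<bar>\<integral>u. g u \<partial>\<kappa> (h n)\<bar> \<le> (\<integral>u. \<bar>g u\<bar> \<partial>\<kappa> (h n))" by (rule integral_abs_bound)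
    also have "\<dots> \<le> (\<integral>u. D / weight w2 * (weight u * exp u ^ 0) \<partial>\<kappa> (h n))"
      using ig id b by (intro integral_mono) auto
    also have "\<dots> = D / weight w2 * (\<integral>u. weight u * exp u ^ 0 \<partial>\<kappa> (h n))" by (rule integral_mult_right_zero)
    finally show "\<bar>\<integral>u. g u \<partial>\<kappa> (h n)\<bar> / h n \<le> D / weight w2 * E n"
      unfolding E_def times_divide_eq_right[of _ _ "h n"] using h(1)[of n] by (intro divide_right_mono) auto
  qed
  have fb: "\<bar>f (y + u)\<bar> \<le> B * indicator {..w2} u" if "0 \<le> y" for y u
    using B supp[of "y + u"] that by (cases "f (y + u) = 0") (auto simp: indicator_def)
  show "\<exists>C\<ge>0. \<forall>n y. 0 \<le> y \<longrightarrow> (\<integral>u. f (y + u) \<partial>\<kappa> (h n)) / h n \<le> C"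
  proof (intro exI conjI allI impI)
    show "0 \<le> B / weight w2 * K" using B(2) K(1) by simp
    fix n y :: real assume "0 \<le> y"
    fix n :: nat
    have "(\<integral>u. f (y + u) \<partial>\<kappa> (h n)) / h n \<le> \<bar>\<integral>u. f (y + u) \<partial>\<kappa> (h n)\<bar> / h n"
      using h(1)[of n] by (intro divide_right_mono) auto
    also have "\<dots> \<le> B / weight w2 * E n" using fb[OF \<open>0 \<le> y\<close>] B(2) by (intro tail) auto
    also have "\<dots> \<le> B / weight w2 * K" using K(2)[of n] B(2) by (intro mult_left_mono) auto
    finally show "(\<integral>u. f (y + u) \<partial>\<kappa> (h n)) / h n \<le> B / weight w2 * K" .
  qed
  assume s: "\<And>n. 0 \<le> s n" "s \<longlonglongrightarrow> y" and y: "0 \<le> y"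
  have fixed: "(\<lambda>n. (\<integral>u. f (y + u) \<partial>\<kappa> (h n)) / h n) \<longlonglongrightarrow> (\<integral>u. f (y + u) \<partial>\<nu>)"
  proof (rule small_time_limit[OF h, where \<epsilon> = "y - w2" and R = "y - w1"])
    show "isCont (\<lambda>u. f (y + u)) x" for x
      by (rule isCont_o2[where f = "\<lambda>u. y + u" and g = f])
        (use f in \<open>auto simp: continuous_on_eq_continuous_at\<close>)
    show "0 < y - w2" using y w2 by simp
    show "- (y - w1) \<le> u \<and> u \<le> - (y - w2)" if "f (y + u) \<noteq> 0" for u using supp[OF that] by simp
  qed
  have unif: "uniformly_continuous_on {w1 - 1..w2 + 1} f"
    using f by (intro compact_uniformly_continuous) (auto intro: continuous_on_subset)
  have "(\<lambda>n. (\<integral>u. f (s n + u) \<partial>\<kappa> (h n)) / h n - (\<integral>u. f (y + u) \<partial>\<kappa> (h n)) / h n) \<longlonglongrightarrow> 0"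
  proof (rule LIMSEQ_I)
    fix e :: real assume e: "0 < e"
    \<comment> \<open>Chosen so that \<open>d / weight w2 * K\<close> equals
      \<open>e / 2\<close>.\<close>
    define d where "d = e * weight w2 / (2 * K)"
    have d: "0 < d" "d / weight w2 * K < e" using e K(1) w2 by (auto simp: d_def)
    obtain r where r: "0 < r" "\<forall>v\<in>{w1 - 1..w2 + 1}. \<forall>v'\<in>{w1 - 1..w2 + 1}. \<bar>v' - v\<bar> < r \<longrightarrow> \<bar>f v' - f v\<bar> < d"
      using unif d(1) unfolding uniformly_continuous_on_def dist_real_def by blast
    \<comment> \<open>Within distance 1, a pair with one point off the enlarged interval has both
      points off the support.\<close>
    have osc: "\<bar>f v' - f v\<bar> \<le> d" if "\<bar>v' - v\<bar> < min r 1" for v v'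
    proof (cases "v \<in> {w1 - 1..w2 + 1} \<and> v' \<in> {w1 - 1..w2 + 1}")
      case True
      then have "\<bar>f v' - f v\<bar> < d" using r(2) that by (simp only: min_less_iff_conj)
      then show ?thesis by simp
    next
      case False
      then have "v \<notin> {w1..w2}" "v' \<notin> {w1..w2}" using that by auto
      then have "f v = 0" "f v' = 0" using supp by auto
      then show ?thesis using d by simp
    qed
    have "0 < min r 1" using r by simp
    from LIMSEQ_D[OF s(2) this] obtain N where N: "\<And>n. N \<le> n \<Longrightarrow> \<bar>s n - y\<bar> < min r 1" by auto
    show "\<exists>no. \<forall>n\<ge>no. norm ((\<integral>u. f (s n + u) \<partial>\<kappa> (h n)) / h n - (\<integral>u. f (y + u) \<partial>\<kappa> (h n)) / h n - 0) < e"
    proof (intro exI[of _ N] allI impI)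
      fix n assume n: "N \<le> n"
      have db: "\<bar>f (s n + u) - f (y + u)\<bar> \<le> d * indicator {..w2} u" for u
      proof (cases "u \<le> w2")
        case True
        then show ?thesis using osc[of "s n + u" "y + u"] N[OF n] by simp
      next
        case False
        then have "\<not> s n + u \<le> w2" "\<not> y + u \<le> w2" using s(1)[of n] y by linarith+
        then have "f (s n + u) = 0" "f (y + u) = 0" using supp by blast+
        then show ?thesis using d by simp
      qed
      have i: "integrable (\<kappa> (h n)) (\<lambda>u. f (z + u))" if "0 \<le> z" for z
        by (rule ig[OF _ fb[OF that] B(2)]) measurable
      have "(\<integral>u. f (s n + u) \<partial>\<kappa> (h n)) / h n - (\<integral>u. f (y + u) \<partial>\<kappa> (h n)) / h n
          = (\<integral>u. f (s n + u) - f (y + u) \<partial>\<kappa> (h n)) / h n"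
        unfolding Bochner_Integration.integral_diff[OF i[OF s(1)] i[OF y]] by (rule diff_divide_distrib[symmetric])
      also have "\<bar>\<dots>\<bar> = \<bar>\<integral>u. f (s n + u) - f (y + u) \<partial>\<kappa> (h n)\<bar> / h n" using h(1)[of n] by simp
      also have "\<dots> \<le> d / weight w2 * E n" using db d by (intro tail) auto
      also have "\<dots> \<le> d / weight w2 * K" using K(2)[of n] d(1) by (intro mult_left_mono) auto
      also have "\<dots> < e" by (rule d(2))
      finally show "norm ((\<integral>u. f (s n + u) \<partial>\<kappa> (h n)) / h n - (\<integral>u. f (y + u) \<partial>\<kappa> (h n)) / h n - 0) < e" by simp
    qed
  qed
  from tendsto_add[OF this fixed]
  show "(\<lambda>n. (\<integral>u. f (s n + u) \<partial>\<kappa> (h n)) / h n) \<longlonglongrightarrow> (\<integral>u. f (y + u) \<partial>\<nu>)" by simp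
qed

end

section \<open>The ruin time\<close>

text \<open>The exit from \<open>[0, a]\<close> covers ruin and passage above \<open>a\<close>
  alike; test functions \<open>f2\<close> supported on negative positions select ruin.\<close>

definition ruin_val ::
  "real \<Rightarrow> (real \<Rightarrow> real) \<Rightarrow> (real \<Rightarrow> real) \<Rightarrow> ((real \<Rightarrow> real) \<Rightarrow> real) \<Rightarrow> (real \<Rightarrow> real) \<Rightarrow> real \<Rightarrow> real" where
  "ruin_val q f1 f2 \<Theta> p a = (if exit_set p 0 a = {} then 0 else
     exp (- q * exit_time p 0 a) * f1 (left_limit p (exit_time p 0 a)) * f2 (p (exit_time p 0 a))
       * \<Theta> (shift_path p (exit_time p 0 a)))"

text \<open>Recovery is modelled by an exit of \<open>[-c, -d]\<close> at the top.\<close>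

definition recovery_weight :: "real \<Rightarrow> real \<Rightarrow> real \<Rightarrow> (real \<Rightarrow> real) \<Rightarrow> real" where
  "recovery_weight \<beta> c d p = exit_val \<beta> (top_weight (- c) (- d)) p (- c) (- d)"

lemma recovery_weight_bounds:
  assumes "0 \<le> \<beta>"
  shows "0 \<le> recovery_weight \<beta> c d p" "recovery_weight \<beta> c d p \<le> 1"
proof -
  show "0 \<le> recovery_weight \<beta> c d p"
    unfolding recovery_weight_def by (rule exit_val_nonneg) (rule top_weight_nonneg)
  show "recovery_weight \<beta> c d p \<le> 1"
  proof (cases "exit_set p (- c) (- d) = {}")
    case False
    have "0 \<le> \<beta> * exit_time p (- c) (- d)" using exit_time_nonneg[OF False] assms by simp
    then show ?thesis unfolding recovery_weight_def exit_val_def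
      using top_weight_nonneg top_weight_le_1 False by (auto intro!: mult_le_one)
  qed (simp add: recovery_weight_def exit_val_def)
qed

lemma ennreal_mult_right_cancel:
  assumes "a * ennreal r = b * ennreal r" "0 < r" shows "a = b"
proof -
  have "c * ennreal r * ennreal (1 / r) = c" for c
    using assms(2) by (simp add: mult.assoc flip: ennreal_mult)
  from this[of a] this[of b] show ?thesis unfolding assms(1) by simp
qed

lemma shift_path_shift_path: "shift_path (shift_path p s) t = shift_path p (s + t)"
  by (simp add: shift_path_def fun_eq_iff add.assoc)

text \<open>Where \<open>f2\<close> does not vanish, ruin is a crossing to a strictly negative level
  inside \<open>(- c, - d)\<close>. The last mesh point before it then lies strictly to the left,
  which produces the left limit, and the recovery functional is continuous in the delay of the
  mesh.\<close>

lemma ruin_grid_LIMSEQ: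
  assumes p: "cadlag p" "p 0 \<in> {0..a}" and h: "\<And>n. 0 < h n" "h \<longlonglongrightarrow> 0"
    and q: "0 \<le> q" and \<beta>: "0 \<le> \<beta>"
    and f1: "\<And>x. isCont f1 x" and f2: "\<And>x. isCont f2 x"
    and B1: "\<And>y. y \<in> {0..a} \<Longrightarrow> \<bar>f1 y\<bar> \<le> B1"
    and supp: "\<And>w. f2 w \<noteq> 0 \<Longrightarrow> - c < w \<and> w < - d" and d: "0 \<le> d"
  shows "(\<lambda>n. \<Sum>k. if first_exit p 0 a (h n) (Suc k) then
        ennreal (exp (- q * (real k * h n)) * f1 (p (real k * h n)) * f2 (p (real (Suc k) * h n))
          * recovery_weight \<beta> c d (shift_path p (real (Suc k) * h n))) else 0)
     \<longlonglongrightarrow> ennreal (ruin_val q f1 f2 (recovery_weight \<beta> c d) p a)"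
proof (cases "exit_set p 0 a = {}")
  case True
  then have "\<not> first_exit p 0 a (h n) k" for n k
    using first_exit_in_exit_set h(1)[of n] by (metis empty_iff less_imp_le)
  then show ?thesis using True by (simp add: ruin_val_def)
next
  case False
  note rc = cadlag_right_continuous[OF p(1)]
  let ?D = "exit_time p 0 a" and ?\<Theta> = "recovery_weight \<beta> c d"
  have D0: "0 \<le> ?D" by (rule exit_time_nonneg[OF False])
  obtain K s where Ks: "\<forall>\<^sub>F n in sequentially. first_exit p 0 a (h n) (K n) \<and> s n = real (K n) * h n"
    and s: "\<And>n. ?D \<le> s n" "s \<longlonglongrightarrow> ?D"
    by (rule grid_exit_times[OF rc False h]) blast
  define v where "v n = exp (- q * (s n - h n)) * f1 (p (s n - h n)) * f2 (p (s n)) * ?\<Theta> (shift_path p (s n))" for n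
  have ev: "\<forall>\<^sub>F n in sequentially. (\<Sum>k. if first_exit p 0 a (h n) (Suc k) then
        ennreal (exp (- q * (real k * h n)) * f1 (p (real k * h n)) * f2 (p (real (Suc k) * h n))
          * ?\<Theta> (shift_path p (real (Suc k) * h n))) else 0) = ennreal (v n)
      \<and> 0 \<le> s n - h n \<and> p (s n - h n) \<in> {0..a}"
    using Ks
  proof eventually_elim
    case (elim n)
    \<comment> \<open>The start lies in \<open>[0, a]\<close>, so a mesh exit has a preceding mesh
      point.\<close>
    have "K n \<noteq> 0" using elim p(2) by (cases "K n") (auto simp: first_exit_def)
    then obtain j where j: "K n = Suc j" by (cases "K n") auto
    have fe: "first_exit p 0 a (h n) (Suc j)" and sn: "s n = real (Suc j) * h n" using elim j by auto
    have sj: "s n - h n = real j * h n" unfolding sn by (simp add: algebra_simps)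
    have eq: "first_exit p 0 a (h n) (Suc k) \<longleftrightarrow> k = j" for k
      using fe first_exit_unique by blast
    have in_: "p (real j * h n) \<in> {0..a}" using fe by (simp add: first_exit_def)
    show ?case unfolding eq suminf_delta v_def sj sn[symmetric] using h(1)[of n] in_ by simp
  qed
  have ps: "(\<lambda>n. p (s n)) \<longlonglongrightarrow> p ?D" by (rule right_continuousD[OF rc D0 s])
  have f2s: "(\<lambda>n. f2 (p (s n))) \<longlonglongrightarrow> f2 (p ?D)" by (rule isCont_tendsto_compose[OF f2 ps])
  have sh: "(\<lambda>n. s n - h n) \<longlonglongrightarrow> ?D" using tendsto_diff[OF s(2) h(2)] by simp
  have "v \<longlonglongrightarrow> ruin_val q f1 f2 ?\<Theta> p a"
  \<comment> \<open>The recovery functional may jump unless the position is strictly inside its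
    interval, so the case \<open>f2 (p ?D) = 0\<close> uses only the bound by 1.\<close>
  proof (cases "f2 (p ?D) = 0")
    case True
    have B0: "0 \<le> B1" using B1[OF p(2)] by simp
    have "(\<lambda>n. B1 * \<bar>f2 (p (s n))\<bar>) \<longlonglongrightarrow> B1 * \<bar>0\<bar>" using f2s True by (intro tendsto_intros) simp
    then have lim0: "(\<lambda>n. B1 * \<bar>f2 (p (s n))\<bar>) \<longlonglongrightarrow> 0" by simp
    have "v \<longlonglongrightarrow> 0"
    proof (rule Lim_null_comparison[OF _ lim0])
      show "\<forall>\<^sub>F n in sequentially. norm (v n) \<le> B1 * \<bar>f2 (p (s n))\<bar>"
        using ev
      proof eventually_elim
        case (elim n)
        have "exp (- q * (s n - h n)) \<le> 1" using elim q by simp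
        then have "exp (- q * (s n - h n)) * \<bar>f1 (p (s n - h n))\<bar> \<le> 1 * B1"
          using elim by (intro mult_mono B1) auto
        then have "exp (- q * (s n - h n)) * \<bar>f1 (p (s n - h n))\<bar> * \<bar>f2 (p (s n))\<bar> \<le> B1 * \<bar>f2 (p (s n))\<bar>"
          by (intro mult_right_mono) auto
        moreover have "\<bar>?\<Theta> (shift_path p (s n))\<bar> \<le> 1"
          using recovery_weight_bounds[OF \<beta>, of c d "shift_path p (s n)"] by simp
        ultimately show ?case unfolding v_def
          using B0 mult_mono[of "exp (- q * (s n - h n)) * \<bar>f1 (p (s n - h n))\<bar> * \<bar>f2 (p (s n))\<bar>" "B1 * \<bar>f2 (p (s n))\<bar>"
            "\<bar>?\<Theta> (shift_path p (s n))\<bar>" 1]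
          by (simp add: abs_mult)
      qed
    qed
    then show ?thesis using True by (simp add: ruin_val_def)
  next
    case f2n: False
    have pD: "p ?D \<in> {- c<..<- d}" using supp[OF f2n] by simp
    then have neg: "p ?D < 0" using d by simp
    have Dpos: "0 < ?D" using neg p(2) D0 by (cases "?D = 0") auto
    obtain e where e: "0 < e" "\<And>t. ?D \<le> t \<Longrightarrow> t < ?D + e \<Longrightarrow> p t \<in> {..<0}"
      using right_continuous_exit_nbhd[OF rc D0, of "{..<0}"] neg by auto
    have "\<forall>\<^sub>F n in sequentially. s n < ?D + e" using order_tendstoD(2)[OF s(2)] e by simp
    \<comment> \<open>The preceding mesh point has a position in \<open>[0, a]\<close>, whereas the
      path is negative throughout \<open>[?D, ?D + e)\<close>.\<close>
    with ev have lt: "\<forall>\<^sub>F n in sequentially. s n - h n < ?D"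
    proof eventually_elim
      case (elim n)
      show ?case
      proof (rule ccontr)
        assume "\<not> s n - h n < ?D"
        then have "p (s n - h n) < 0" using e(2)[of "s n - h n"] elim h(1)[of n] by simp
        then show False using elim by simp
      qed
    qed
    \<comment> \<open>The default keeps every term strictly below \<open>?D\<close>, as the left
      limit requires.\<close>
    define r where "r n = (if s n - h n < ?D then s n - h n else ?D - h n)" for n
    have r_ev: "\<forall>\<^sub>F n in sequentially. r n = s n - h n" using lt by eventually_elim (simp add: r_def)
    then have "r \<longlonglongrightarrow> ?D" by (rule Lim_transform_eventually[OF sh, OF eventually_mono]) simp
    moreover have "r n < ?D" for n using h(1)[of n] by (simp add: r_def)
    ultimately have "(\<lambda>n. p (r n)) \<longlonglongrightarrow> left_limit p ?D"
      by (intro left_limit_LIMSEQ[OF p(1) Dpos])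
    then have "(\<lambda>n. p (s n - h n)) \<longlonglongrightarrow> left_limit p ?D"
      by (rule Lim_transform_eventually) (use r_ev in eventually_elim, simp)
    then have f1s: "(\<lambda>n. f1 (p (s n - h n))) \<longlonglongrightarrow> f1 (left_limit p ?D)" by (rule isCont_tendsto_compose[OF f1])
    have rcD: "right_continuous (shift_path p ?D)" by (rule right_continuous_shift[OF rc D0])
    have "shift_path p ?D 0 \<in> {- c<..<- d}" using pD by (simp add: shift_path_def)
    from exit_val_shift[OF rcD this, of \<beta> "top_weight (- c) (- d)"]
    obtain e' where e': "0 < e'" "\<And>t. 0 \<le> t \<Longrightarrow> t < e' \<Longrightarrow>
        ?\<Theta> (shift_path (shift_path p ?D) t) = exp (\<beta> * t) * ?\<Theta> (shift_path p ?D)"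
      unfolding recovery_weight_def by blast
    have "\<forall>\<^sub>F n in sequentially. s n < ?D + e'" using order_tendstoD(2)[OF s(2)] e' by simp
    then have \<Theta>ev: "\<forall>\<^sub>F n in sequentially. exp (\<beta> * (s n - ?D)) * ?\<Theta> (shift_path p ?D) = ?\<Theta> (shift_path p (s n))"
    proof eventually_elim
      case (elim n)
      then show ?case using e'(2)[of "s n - ?D"] s(1)[of n] by (simp add: shift_path_shift_path)
    qed
    have "(\<lambda>n. exp (\<beta> * (s n - ?D)) * ?\<Theta> (shift_path p ?D)) \<longlonglongrightarrow> exp (\<beta> * (?D - ?D)) * ?\<Theta> (shift_path p ?D)"
      by (intro tendsto_intros s(2))
    then have \<Theta>s: "(\<lambda>n. ?\<Theta> (shift_path p (s n))) \<longlonglongrightarrow> ?\<Theta> (shift_path p ?D)"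
      using Lim_transform_eventually[OF _ \<Theta>ev] by simp
    have "v \<longlonglongrightarrow> exp (- q * ?D) * f1 (left_limit p ?D) * f2 (p ?D) * ?\<Theta> (shift_path p ?D)"
      unfolding v_def by (intro tendsto_intros sh f1s f2s \<Theta>s)
    then show ?thesis using False by (simp add: ruin_val_def)
  qed
  then have "(\<lambda>n. ennreal (v n)) \<longlonglongrightarrow> ennreal (ruin_val q f1 f2 ?\<Theta> p a)" by (rule tendsto_ennrealI)
  then show ?thesis by (rule Lim_transform_eventually) (use ev in eventually_elim, simp)
qed

locale levy_exit = levy_semigroup \<mu> \<sigma> \<nu> \<kappa> + exit_process M F Y \<kappa> "laplace_exponent \<mu> \<sigma> \<nu>"
  for M :: "'a measure" and F and Y :: "real \<Rightarrow> 'a \<Rightarrow> real" and \<mu> \<sigma> \<nu> \<kappa>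
begin

text \<open>The compensation formula for continuous test functions. Each mesh term is conditioned
  twice: at the mesh point after ruin, which turns recovery into the quotient of scale functions in
  \<open>f\<close>; then at the point before it, which turns the crossing into an integral against
  \<open>\<kappa> (h n)\<close>.\<close>

lemma ruin_core:
  assumes Y0: "\<And>\<omega>. \<omega> \<in> space M \<Longrightarrow> Y 0 \<omega> \<in> {0..a}" and a: "0 < a" and q: "0 \<le> q" and \<beta>: "0 \<le> \<beta>"
    and d: "0 \<le> d" "d < c" and W: "is_scale_function \<psi> \<beta> W" and Wpos: "0 < W (c - d)"
    and f1: "continuous_on UNIV f1" "\<And>y. 0 \<le> f1 y"
    and f2: "continuous_on UNIV f2" "\<And>y. 0 \<le> f2 y"
    and supp: "\<And>w. f2 w \<noteq> 0 \<Longrightarrow> w1 \<le> w \<and> w \<le> w2" "- c < w1" "w2 < - d"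
  defines "f \<equiv> \<lambda>w. f2 w * (W (w + c) / W (c - d))"
  shows "(\<lambda>\<omega>. ennreal (ruin_val q f1 f2 (recovery_weight \<beta> c d) (path \<omega>) a)) \<in> borel_measurable M"
    and "(\<integral>\<^sup>+\<omega>. ennreal (ruin_val q f1 f2 (recovery_weight \<beta> c d) (path \<omega>) a) \<partial>M)
      = (\<integral>\<^sup>+y. ennreal (f1 y) * (\<integral>\<^sup>+u. ennreal (f (y + u)) \<partial>\<nu>) \<partial>potential q 0 a)"
proof -
  obtain t0 where t0: "0 < t0" "emeasure (\<kappa> t0) {..a - 0} < 1"
    using exit_mesh_exists[of "a - 0"] a by auto
  define h where "h n = t0 / 2 ^ n" for n
  have h: "0 < h n" for n using t0 by (simp add: h_def)
  have h0: "h \<longlonglongrightarrow> 0" unfolding h_def by (rule mesh_LIMSEQ)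
  have [measurable]: "f1 \<in> borel_measurable borel" "f2 \<in> borel_measurable borel"
    using f1 f2 by (auto intro: borel_measurable_continuous_onI)
  have W0: "0 \<le> W x" for x using W by (simp add: is_scale_function_def)
  have "bounded (f1 ` {0..a})"
    using f1 by (intro compact_imp_bounded compact_continuous_image) (auto intro: continuous_on_subset)
  then obtain B1 where B1: "\<And>y. y \<in> {0..a} \<Longrightarrow> \<bar>f1 y\<bar> \<le> B1"
    unfolding bounded_iff by (metis image_eqI real_norm_def)
  have B1_0: "0 \<le> B1" using B1[of 0] a by simp
  have "bounded (f2 ` {w1..w2})"
    using f2 by (intro compact_imp_bounded compact_continuous_image) (auto intro: continuous_on_subset)
  then obtain B2' where B2': "\<And>y. y \<in> {w1..w2} \<Longrightarrow> \<bar>f2 y\<bar> \<le> B2'"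
    unfolding bounded_iff by (metis image_eqI real_norm_def)
  define B2 where "B2 = max 0 B2'"
  have B2: "f2 w \<le> B2" "0 \<le> B2" for w
    using B2'[of w] supp(1)[of w] by (cases "f2 w = 0"; force simp: B2_def)+
  have f0: "0 \<le> f w" for w unfolding f_def using f2(2) W0 by simp
  have fsupp: "w1 \<le> w \<and> w \<le> w2" if "f w \<noteq> 0" for w using that supp(1)[of w] by (auto simp: f_def)
  have w2: "w2 < 0" using supp(3) d by simp
  \<comment> \<open>\<open>W\<close> is continuous at positive arguments only; as
    \<open>- c < w1\<close>, \<open>f\<close> vanishes near every
    \<open>w \<le> - c\<close>.\<close>
  have fcont: "continuous_on UNIV f"
  proof -
    have "isCont f w" for w
    proof (cases "- c < w")
      case True
      have "isCont W (w + c)" using True by (intro scale_isCont[OF W]) simp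
      then have "isCont (\<lambda>w. W (w + c)) w" by (intro isCont_o2[where f = "\<lambda>w. w + c" and g = W]) auto
      then show ?thesis unfolding f_def using f2(1) Wpos
        by (intro continuous_intros) (auto simp: continuous_on_eq_continuous_at)
    next
      case False
      then have "\<forall>\<^sub>F v in nhds w. v < w1" using supp(2) by (intro eventually_nhds_in_open[of "{..<w1}", simplified]) auto
      then have "\<forall>\<^sub>F v in nhds w. f v = 0" by eventually_elim (use fsupp in force)
      moreover from this have "f w = 0" by (rule eventually_nhds_x_imp_x)
      ultimately have "\<forall>\<^sub>F v in at w. f v = f w" by (simp add: eventually_at_filter eventually_mono)
      then show ?thesis unfolding isCont_def by (rule tendsto_eventually)
    qed
    then show ?thesis by (simp add: continuous_at_imp_continuous_on)
  qed
  then have [measurable]: "f \<in> borel_measurable borel" by (rule borel_measurable_continuous_onI)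
  let ?\<Theta> = "recovery_weight \<beta> c d"
  have Ym[measurable]: "Y (real k * h n) \<in> borel_measurable M" "Y (real (Suc k) * h n) \<in> borel_measurable M" for k n
    using h[of n] by (auto intro!: Y_measurable)
  have \<Theta>m[measurable]: "(\<lambda>\<omega>. ?\<Theta> (shift_path (path \<omega>) (real (Suc k) * h n))) \<in> borel_measurable M" for k n
    unfolding recovery_weight_def using h[of n] by (intro exit_val_shift_measurable) auto
  note [measurable] = alive_measurable[OF less_imp_le[OF h]]
  define Z where "Z n k \<omega> = alive 0 a (h n) k \<omega> * ennreal (exp (- q * (real k * h n)) * f1 (Y (real k * h n) \<omega>) * f2 (Y (real (Suc k) * h n) \<omega>))" for n k \<omega>
  have ZF: "Z n k \<in> borel_measurable (F (real (Suc k) * h n))" for n k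
  proof -
    have le: "0 \<le> real k * h n" "real k * h n \<le> real (Suc k) * h n" using h[of n] by auto
    have [measurable]: "alive 0 a (h n) k \<in> borel_measurable (F (real (Suc k) * h n))"
      by (rule F_measurable_mono[OF le alive_measurable_F[OF less_imp_le[OF h]]])
    have [measurable]: "Y (real k * h n) \<in> borel_measurable (F (real (Suc k) * h n))"
      by (rule F_measurable_mono[OF le adapted[OF le(1)]])
    have [measurable]: "Y (real (Suc k) * h n) \<in> borel_measurable (F (real (Suc k) * h n))"
      using h[of n] by (intro adapted) auto
    show ?thesis unfolding Z_def by measurable
  qed
  have [measurable]: "Z n k \<in> borel_measurable M" for n k
    using F_measurable_M[OF _ ZF] h[of n] by simp
  have ZB: "Z n k \<omega> \<le> ennreal (B1 * B2)" for n k \<omega>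
  proof (cases "stays (path \<omega>) 0 a (h n) k")
    case True
    then have "Y (real k * h n) \<omega> \<in> {0..a}" by (simp add: stays_def)
    then have "f1 (Y (real k * h n) \<omega>) \<le> B1" using B1 by fastforce
    moreover have "exp (- q * (real k * h n)) \<le> 1" using q h[of n] by simp
    ultimately have "exp (- q * (real k * h n)) * f1 (Y (real k * h n) \<omega>) * f2 (Y (real (Suc k) * h n) \<omega>) \<le> 1 * B1 * B2"
      using f1(2) f2(2) B2 B1_0 by (intro mult_mono) auto
    then show ?thesis using True by (simp add: Z_def alive_def ennreal_leI)
  qed (simp add: Z_def alive_def)
  define R where "R n \<omega> = (\<Sum>k. Z n k \<omega> * ennreal (?\<Theta> (shift_path (path \<omega>) (real (Suc k) * h n))))" for n \<omega>
  have Rm[measurable]: "R n \<in> borel_measurable M" for n unfolding R_def by measurable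
  \<comment> \<open>Where \<open>f2\<close> does not vanish the next mesh position is negative, so
    survival up to \<open>k\<close> is the same as a first exit at \<open>Suc k\<close>.\<close>
  have R_eq: "R n \<omega> = (\<Sum>k. if first_exit (path \<omega>) 0 a (h n) (Suc k) then
        ennreal (exp (- q * (real k * h n)) * f1 (Y (real k * h n) \<omega>) * f2 (Y (real (Suc k) * h n) \<omega>)
          * ?\<Theta> (shift_path (path \<omega>) (real (Suc k) * h n))) else 0)" for n \<omega>
    unfolding R_def
  proof (rule arg_cong[where f = suminf], rule ext)
    fix k
    show "Z n k \<omega> * ennreal (?\<Theta> (shift_path (path \<omega>) (real (Suc k) * h n))) = (if first_exit (path \<omega>) 0 a (h n) (Suc k) then
        ennreal (exp (- q * (real k * h n)) * f1 (Y (real k * h n) \<omega>) * f2 (Y (real (Suc k) * h n) \<omega>)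
          * ?\<Theta> (shift_path (path \<omega>) (real (Suc k) * h n))) else 0)"
    proof (cases "f2 (Y (real (Suc k) * h n) \<omega>) = 0")
      case False
      then have "Y (real (Suc k) * h n) \<omega> \<notin> {0..a}" using supp(1)[OF False] w2 by auto
      then have "first_exit (path \<omega>) 0 a (h n) (Suc k) \<longleftrightarrow> stays (path \<omega>) 0 a (h n) k"
        by (simp add: stays_first_exit del: of_nat_Suc)
      then show ?thesis
        using f1(2) f2(2) recovery_weight_bounds[OF \<beta>] by (simp add: Z_def alive_def ennreal_mult del: of_nat_Suc)
    qed (simp add: Z_def del: of_nat_Suc)
  qed
  have RB: "R n \<omega> \<le> ennreal (B1 * B2)" for n \<omega>
  proof (cases "\<exists>k. first_exit (path \<omega>) 0 a (h n) (Suc k)")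
    case True
    then obtain j where j: "first_exit (path \<omega>) 0 a (h n) (Suc j)" by blast
    have eq: "first_exit (path \<omega>) 0 a (h n) (Suc k) \<longleftrightarrow> k = j" for k
      using j first_exit_unique by blast
    have st: "stays (path \<omega>) 0 a (h n) j" using j by (simp add: stays_first_exit)
    let ?z = "exp (- q * (real j * h n)) * f1 (Y (real j * h n) \<omega>) * f2 (Y (real (Suc j) * h n) \<omega>)"
    have z: "0 \<le> ?z" using f1(2) f2(2) by simp
    have "R n \<omega> = ennreal (?z * ?\<Theta> (shift_path (path \<omega>) (real (Suc j) * h n)))"
      unfolding R_eq eq suminf_delta ..
    also have "\<dots> \<le> ennreal ?z"
      using z recovery_weight_bounds[OF \<beta>, of c d "shift_path (path \<omega>) (real (Suc j) * h n)"]
      by (intro ennreal_leI mult_left_le) auto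
    also have "\<dots> \<le> ennreal (B1 * B2)" using ZB[of n j \<omega>] st by (simp add: Z_def alive_def del: of_nat_Suc)
    finally show ?thesis .
  qed (simp add: R_eq)
  have lim: "(\<lambda>n. R n \<omega>) \<longlonglongrightarrow> ennreal (ruin_val q f1 f2 ?\<Theta> (path \<omega>) a)" if \<omega>: "\<omega> \<in> space M" for \<omega>
    unfolding R_eq
  proof (rule ruin_grid_LIMSEQ[OF cadlag_path[OF \<omega>] Y0[OF \<omega>] h h0 q \<beta>])
    show "isCont f1 x" "isCont f2 x" for x using f1 f2 by (auto simp: continuous_on_eq_continuous_at)
    show "\<bar>f1 y\<bar> \<le> B1" if "y \<in> {0..a}" for y using B1 that .
    show "- c < w \<and> w < - d" if "f2 w \<noteq> 0" for w using supp(1)[OF that] supp(2,3) by simp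
  qed (use d in auto)
  show meas: "(\<lambda>\<omega>. ennreal (ruin_val q f1 f2 ?\<Theta> (path \<omega>) a)) \<in> borel_measurable M"
    by (rule borel_measurable_LIMSEQ_order[OF lim Rm])
  have "(\<lambda>n. \<integral>\<^sup>+\<omega>. R n \<omega> \<partial>M) \<longlonglongrightarrow> (\<integral>\<^sup>+\<omega>. ennreal (ruin_val q f1 f2 ?\<Theta> (path \<omega>) a) \<partial>M)"
    by (rule nn_integral_dominated_convergence[where w = "\<lambda>_. ennreal (B1 * B2)"])
      (use lim RB meas in \<open>auto simp: ennreal_mult_eq_top_iff less_top[symmetric]\<close>)
  moreover
  \<comment> \<open>The rate per unit time of jumping into the support of \<open>f\<close>, measured
    over one mesh width.\<close>
  define g where "g n y = f1 y * ((\<integral>u. f (y + u) \<partial>\<kappa> (h n)) / h n)" for n y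
  have kap: "(\<integral>\<^sup>+u. ennreal (f (y + u)) \<partial>\<kappa> (h n)) = ennreal (h n) * ennreal ((\<integral>u. f (y + u) \<partial>\<kappa> (h n)) / h n)" for n y
  proof -
    interpret K: prob_space "\<kappa> (h n)" using prob_\<kappa> h[of n] by simp
    have "bounded (f ` {w1..w2})"
      using fcont by (intro compact_imp_bounded compact_continuous_image) (auto intro: continuous_on_subset)
    then obtain B where B: "\<And>w. w \<in> {w1..w2} \<Longrightarrow> \<bar>f w\<bar> \<le> B"
      unfolding bounded_iff by (metis image_eqI real_norm_def)
    have "\<bar>f w\<bar> \<le> max 0 B" for w using B[of w] fsupp[of w] by (cases "f w = 0") auto
    then have "integrable (\<kappa> (h n)) (\<lambda>u. f (y + u))"
      by (intro K.integrable_const_bound[where B = "max 0 B"]) (auto simp: measurable_cong_sets[OF sets_\<kappa> refl])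
    then have "(\<integral>\<^sup>+u. ennreal (f (y + u)) \<partial>\<kappa> (h n)) = ennreal (\<integral>u. f (y + u) \<partial>\<kappa> (h n))"
      using f0 by (intro nn_integral_eq_integral) auto
    also have "\<dots> = ennreal (h n) * ennreal ((\<integral>u. f (y + u) \<partial>\<kappa> (h n)) / h n)"
      using h[of n] f0 by (subst ennreal_mult[symmetric]) (auto intro!: divide_nonneg_pos integral_nonneg)
    finally show ?thesis .
  qed
  define T where "T n k = (\<integral>\<^sup>+\<omega>. alive 0 a (h n) k \<omega> * ennreal (exp (- q * (real k * h n)) * g n (Y (real k * h n) \<omega>)) * ennreal (h n) \<partial>M)" for n k
  have step: "(\<integral>\<^sup>+\<omega>. Z n k \<omega> * ennreal (?\<Theta> (shift_path (path \<omega>) (real (Suc k) * h n))) \<partial>M) = T n k" for n k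
  proof -
    let ?s = "real k * h n" and ?s' = "real (Suc k) * h n"
    have s: "0 \<le> ?s" "?s + h n = ?s'" using h[of n] by (auto simp: algebra_simps)
    have s': "0 \<le> ?s'" using h[of n] by simp
    \<comment> \<open>The lower end is \<open>w1\<close>, written so that \<open>w1 + c\<close> is
      the distance \<open>\<delta>\<close> of \<open>scale_exit_shift\<close>.\<close>
    have sp: "Y ?s' \<omega> \<in> {- c + (w1 + c)..- d}" if "Z n k \<omega> \<noteq> 0" for \<omega>
    proof -
      have "f2 (Y ?s' \<omega>) \<noteq> 0" using that by (auto simp: Z_def)
      from supp(1)[OF this] show ?thesis using supp(3) by (simp del: of_nat_Suc)
    qed
    have ex: "(\<integral>\<^sup>+\<omega>. Z n k \<omega> * ennreal (?\<Theta> (shift_path (path \<omega>) ?s')) \<partial>M) * ennreal (W (c - d))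
        = (\<integral>\<^sup>+\<omega>. Z n k \<omega> * ennreal (W (Y ?s' \<omega> + c)) \<partial>M)" if "w1 \<le> w2"
    proof -
      have l: "- c < - d" "0 < w1 + c" "- c + (w1 + c) \<le> - d" using that d supp(2,3) by auto
      have "(\<integral>\<^sup>+\<omega>. Z n k \<omega> * ennreal (?\<Theta> (shift_path (path \<omega>) ?s')) \<partial>M) * ennreal (W (- d - - c))
        = (\<integral>\<^sup>+\<omega>. Z n k \<omega> * ennreal (W (Y ?s' \<omega> - - c)) \<partial>M)"
        unfolding recovery_weight_def by (rule scale_exit_shift[OF l(1) \<beta> l(2,3) W s' ZF ZB sp])
      moreover have "- d + c = c - d" by simp
      ultimately show ?thesis by simp
    qed
    have "(\<integral>\<^sup>+\<omega>. Z n k \<omega> * ennreal (?\<Theta> (shift_path (path \<omega>) ?s')) \<partial>M)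
        = (\<integral>\<^sup>+\<omega>. Z n k \<omega> * ennreal (pos_part_scale W (Y ?s' \<omega> + c) / W (c - d)) \<partial>M)"
    proof (cases "w1 \<le> w2")
      case True
      note [measurable] = scale_measurable[OF W]
      have "(\<integral>\<^sup>+\<omega>. Z n k \<omega> * ennreal (W (Y ?s' \<omega> + c)) \<partial>M) = (\<integral>\<^sup>+\<omega>. Z n k \<omega> * ennreal (pos_part_scale W (Y ?s' \<omega> + c)) \<partial>M)"
      proof (rule nn_integral_cong)
        fix \<omega>
        show "Z n k \<omega> * ennreal (W (Y ?s' \<omega> + c)) = Z n k \<omega> * ennreal (pos_part_scale W (Y ?s' \<omega> + c))"
        proof (cases "Z n k \<omega> = 0")
          case False
          then have "0 < Y ?s' \<omega> + c" using sp[OF False] supp(2) by (simp del: of_nat_Suc)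
          then show ?thesis by (simp only: pos_part_scale_pos)
        qed simp
      qed
      also have "\<dots> = (\<integral>\<^sup>+\<omega>. Z n k \<omega> * ennreal (pos_part_scale W (Y ?s' \<omega> + c) / W (c - d)) * ennreal (W (c - d)) \<partial>M)"
      proof (rule nn_integral_cong)
        fix \<omega>
        have "ennreal (pos_part_scale W (Y ?s' \<omega> + c)) = ennreal (pos_part_scale W (Y ?s' \<omega> + c) / W (c - d)) * ennreal (W (c - d))"
          using Wpos pos_part_scale_nonneg[OF W] by (subst ennreal_mult[symmetric]) auto
        then show "Z n k \<omega> * ennreal (pos_part_scale W (Y ?s' \<omega> + c))
          = Z n k \<omega> * ennreal (pos_part_scale W (Y ?s' \<omega> + c) / W (c - d)) * ennreal (W (c - d))"
          by (simp only: mult.assoc)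
      qed
      also have "\<dots> = (\<integral>\<^sup>+\<omega>. Z n k \<omega> * ennreal (pos_part_scale W (Y ?s' \<omega> + c) / W (c - d)) \<partial>M) * ennreal (W (c - d))"
        by (rule nn_integral_multc) measurable
      finally have "(\<integral>\<^sup>+\<omega>. Z n k \<omega> * ennreal (?\<Theta> (shift_path (path \<omega>) ?s')) \<partial>M) * ennreal (W (c - d))
          = (\<integral>\<^sup>+\<omega>. Z n k \<omega> * ennreal (pos_part_scale W (Y ?s' \<omega> + c) / W (c - d)) \<partial>M) * ennreal (W (c - d))"
        unfolding ex[OF True] .
      then show ?thesis by (rule ennreal_mult_right_cancel[OF _ Wpos])
    next
      case False
      have "f2 w = 0" for w
      proof (rule ccontr)
        assume "f2 w \<noteq> 0"
        from supp(1)[OF this] False show False by simp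
      qed
      then show ?thesis by (simp add: Z_def)
    qed
    also have "\<dots> = (\<integral>\<^sup>+\<omega>. (alive 0 a (h n) k \<omega> * ennreal (exp (- q * ?s) * f1 (Y ?s \<omega>))) * ennreal (f (Y (?s + h n) \<omega>)) \<partial>M)"
    proof (rule nn_integral_cong)
      fix \<omega>
      show "Z n k \<omega> * ennreal (pos_part_scale W (Y ?s' \<omega> + c) / W (c - d))
        = (alive 0 a (h n) k \<omega> * ennreal (exp (- q * ?s) * f1 (Y ?s \<omega>))) * ennreal (f (Y (?s + h n) \<omega>))"
      proof (cases "f2 (Y ?s' \<omega>) = 0")
        case True
        then show ?thesis unfolding s(2) by (simp add: Z_def f_def del: of_nat_Suc)
      next
        case False
        have "- c < Y ?s' \<omega>" using supp(1)[OF False] supp(2) by simp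
        then have "ennreal (f (Y ?s' \<omega>)) = ennreal (f2 (Y ?s' \<omega>)) * ennreal (pos_part_scale W (Y ?s' \<omega> + c) / W (c - d))"
          unfolding f_def using f2(2) W0 Wpos by (subst ennreal_mult) (simp_all add: pos_part_scale_pos del: of_nat_Suc)
        moreover have "ennreal (exp (- q * ?s) * f1 (Y ?s \<omega>) * f2 (Y ?s' \<omega>)) = ennreal (exp (- q * ?s) * f1 (Y ?s \<omega>)) * ennreal (f2 (Y ?s' \<omega>))"
          using f1(2) f2(2) by (intro ennreal_mult) auto
        ultimately show ?thesis unfolding s(2) Z_def by (simp only: mult.assoc)
      qed
    qed
    also have "\<dots> = (\<integral>\<^sup>+\<omega>. (alive 0 a (h n) k \<omega> * ennreal (exp (- q * ?s) * f1 (Y ?s \<omega>))) * (\<integral>\<^sup>+u. ennreal (f (Y ?s \<omega> + u)) \<partial>\<kappa> (h n)) \<partial>M)"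
    proof (rule nn_integral_step[OF s(1) less_imp_le[OF h], where g = "\<lambda>_ y. ennreal (f y)"])
      have [measurable]: "alive 0 a (h n) k \<in> borel_measurable (F ?s)" "Y ?s \<in> borel_measurable (F ?s)"
        using alive_measurable_F[OF less_imp_le[OF h]] adapted[OF s(1)] by auto
      show "(\<lambda>\<omega>. alive 0 a (h n) k \<omega> * ennreal (exp (- q * ?s) * f1 (Y ?s \<omega>))) \<in> borel_measurable (F ?s)" by measurable
    qed measurable
    also have "\<dots> = T n k"
      unfolding T_def
    proof (rule nn_integral_cong)
      fix \<omega>
      have "ennreal (exp (- q * ?s) * g n (Y ?s \<omega>)) = ennreal (exp (- q * ?s) * f1 (Y ?s \<omega>)) * ennreal ((\<integral>u. f (Y ?s \<omega> + u) \<partial>\<kappa> (h n)) / h n)"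
        unfolding g_def mult.assoc[symmetric] using h[of n] f1(2) f0
        by (intro ennreal_mult) (auto intro!: divide_nonneg_pos integral_nonneg)
      then show "(alive 0 a (h n) k \<omega> * ennreal (exp (- q * ?s) * f1 (Y ?s \<omega>))) * (\<integral>\<^sup>+u. ennreal (f (Y ?s \<omega> + u)) \<partial>\<kappa> (h n))
        = alive 0 a (h n) k \<omega> * ennreal (exp (- q * ?s) * g n (Y ?s \<omega>)) * ennreal (h n)"
        unfolding kap by (simp only: ac_simps)
    qed
    finally show ?thesis .
  qed
  obtain C where C: "0 \<le> C" "\<And>n y. 0 \<le> y \<Longrightarrow> (\<integral>u. f (y + u) \<partial>\<kappa> (h n)) / h n \<le> C"
    using increment_limit(1)[OF h h0 fcont fsupp w2] by blast
  have gm[measurable]: "g n \<in> borel_measurable borel" for n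
  proof -
    interpret K: prob_space "\<kappa> (h n)" using prob_\<kappa> h[of n] by simp
    note [measurable_cong] = sets_\<kappa>
    show ?thesis unfolding g_def by measurable
  qed
  have gC: "g n y \<le> B1 * C" if "y \<in> {0..a}" for n y
    unfolding g_def using that B1[OF that] C h[of n] f0 B1_0
    by (intro mult_mono) (auto intro!: divide_nonneg_pos integral_nonneg)
  \<comment> \<open>Set to 0 off \<open>[0, a]\<close>, where no convergence is available; thus
    \<open>G\<close> is everywhere a limit of measurable functions.\<close>
  define G where "G y = (if y \<in> {0..a} then f1 y * (\<integral>u. f (y + u) \<partial>\<nu>) else 0)" for y
  have glim: "(\<lambda>n. g n (s n)) \<longlonglongrightarrow> G y" if "y \<in> {0..a}" "\<And>n. s n \<in> {0..a}" "s \<longlonglongrightarrow> y" for y s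
  proof -
    have "isCont f1 y" using f1(1) by (simp add: continuous_on_eq_continuous_at)
    then have "(\<lambda>n. f1 (s n)) \<longlonglongrightarrow> f1 y" using that(3) by (rule isCont_tendsto_compose)
    moreover have "(\<lambda>n. (\<integral>u. f (s n + u) \<partial>\<kappa> (h n)) / h n) \<longlonglongrightarrow> (\<integral>u. f (y + u) \<partial>\<nu>)"
      by (rule increment_limit(2)[OF h h0 fcont fsupp w2]) (use that in auto)
    moreover have "G y = f1 y * (\<integral>u. f (y + u) \<partial>\<nu>)" using that(1) by (simp add: G_def)
    ultimately show ?thesis unfolding g_def by (simp only: tendsto_mult)
  qed
  have Gm[measurable]: "G \<in> borel_measurable borel"
  proof (rule borel_measurable_LIMSEQ_metric)
    show "(\<lambda>y. indicator {0..a} y * g n y) \<in> borel_measurable borel" for n by measurable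
    fix y :: real
    show "(\<lambda>n. indicator {0..a} y * g n y) \<longlonglongrightarrow> G y"
      using glim[of y "\<lambda>_. y"] by (cases "y \<in> {0..a}") (auto simp: G_def)
  qed
  have "(\<lambda>n. \<integral>\<^sup>+\<omega>. R n \<omega> \<partial>M) \<longlonglongrightarrow> (\<integral>\<^sup>+y. ennreal (G y) \<partial>potential q 0 a)"
  proof -
    \<comment> \<open>The Riemann sums of \<open>potential_LIMSEQ\<close> begin with the second mesh
      point; the term of the first is of order \<open>h n\<close>.\<close>
    have RT: "(\<integral>\<^sup>+\<omega>. R n \<omega> \<partial>M) = T n 0 + (\<Sum>k. T n (Suc k))" for n
    proof -
      have "(\<integral>\<^sup>+\<omega>. R n \<omega> \<partial>M) = (\<Sum>k. T n k)"
        unfolding R_def step[symmetric] by (rule nn_integral_suminf) measurable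
      then show ?thesis using suminf_offset[of "T n" 1] by (simp add: add.commute)
    qed
    have TS: "(\<Sum>k. T n (Suc k)) = (\<integral>\<^sup>+\<omega>. (\<Sum>k. alive 0 a (h n) (Suc k) \<omega> *
      ennreal (exp (- q * (real (Suc k) * h n)) * g n (Y (real (Suc k) * h n) \<omega>)) * ennreal (h n)) \<partial>M)" for n
      unfolding T_def by (rule nn_integral_suminf[symmetric]) measurable
    have 1: "(\<lambda>n. (\<Sum>k. T n (Suc k))) \<longlonglongrightarrow> (\<integral>\<^sup>+y. ennreal (G y) \<partial>potential q 0 a)"
      unfolding TS h_def
      by (rule potential_LIMSEQ(1)[OF less_imp_le[OF a] q t0 gm Gm gC _ glim]) (use B1_0 C in auto)
    have T0: "T n 0 \<le> ennreal (B1 * C * h n) * emeasure M (space M)" for n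
    proof -
      have "T n 0 \<le> (\<integral>\<^sup>+\<omega>. ennreal (B1 * C * h n) \<partial>M)"
        unfolding T_def
      proof (rule nn_integral_mono)
        fix \<omega> assume "\<omega> \<in> space M"
        then have "g n (Y 0 \<omega>) \<le> B1 * C" by (intro gC Y0)
        then have "ennreal (g n (Y 0 \<omega>)) * ennreal (h n) \<le> ennreal (B1 * C) * ennreal (h n)"
          by (intro mult_right_mono ennreal_leI) auto
        then show "alive 0 a (h n) 0 \<omega> * ennreal (exp (- q * (real 0 * h n)) * g n (Y (real 0 * h n) \<omega>)) * ennreal (h n) \<le> ennreal (B1 * C * h n)"
          using h[of n] B1_0 C by (auto simp: alive_def ennreal_mult)
      qed
      then show ?thesis by simp
    qed
    have "(\<lambda>n. ennreal (B1 * C * h n) * emeasure M (space M)) \<longlonglongrightarrow> ennreal (B1 * C * 0) * emeasure M (space M)"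
      by (intro tendsto_mult_ennreal tendsto_ennrealI tendsto_mult tendsto_const h0) auto
    then have "(\<lambda>n. ennreal (B1 * C * h n) * emeasure M (space M)) \<longlonglongrightarrow> 0" by simp
    then have "(\<lambda>n. T n 0) \<longlonglongrightarrow> 0"
      by (intro tendsto_sandwich[OF _ _ tendsto_const \<open>(\<lambda>n. ennreal (B1 * C * h n) * emeasure M (space M)) \<longlonglongrightarrow> 0\<close>])
        (use T0 in auto)
    from tendsto_add[OF this 1] show ?thesis unfolding RT by simp
  qed
  ultimately have "(\<integral>\<^sup>+\<omega>. ennreal (ruin_val q f1 f2 ?\<Theta> (path \<omega>) a) \<partial>M) = (\<integral>\<^sup>+y. ennreal (G y) \<partial>potential q 0 a)"
    by (rule LIMSEQ_unique)
  also have "\<dots> = (\<integral>\<^sup>+y. ennreal (f1 y) * (\<integral>\<^sup>+u. ennreal (f (y + u)) \<partial>\<nu>) \<partial>potential q 0 a)"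
  proof (rule nn_integral_cong_AE)
    show "AE y in potential q 0 a. ennreal (G y) = ennreal (f1 y) * (\<integral>\<^sup>+u. ennreal (f (y + u)) \<partial>\<nu>)"
      using AE_potential
    proof eventually_elim
      case (elim y)
      have "bounded (f ` {w1..w2})"
        using fcont by (intro compact_imp_bounded compact_continuous_image) (auto intro: continuous_on_subset)
      then obtain B where B: "\<And>w. w \<in> {w1..w2} \<Longrightarrow> \<bar>f w\<bar> \<le> B"
        unfolding bounded_iff by (metis image_eqI real_norm_def)
      have B': "\<bar>f w\<bar> \<le> max 0 B" for w
      proof (cases "f w = 0")
        case False
        then have "w \<in> {w1..w2}" using fsupp by simp
        from B[OF this] show ?thesis by simp
      qed simp
      have ww: "0 < weight w2" using w2 by simp
      \<comment> \<open>For \<open>y \<ge> 0\<close> the numerator lives on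
        \<open>u \<le> w2\<close>, where \<open>weight\<close> is bounded away from 0, so the
        quotient is bounded.\<close>
      define k where "k u = f (y + u) / weight u" for u
      have km: "k \<in> borel_measurable borel" unfolding k_def by measurable
      have kb: "\<bar>k u\<bar> \<le> max 0 B / weight w2" if "u < 0" for u
      proof (cases "f (y + u) = 0")
        case True
        then show ?thesis using ww by (simp add: k_def)
      next
        case False
        then have "u \<le> w2" using fsupp[OF False] elim by simp
        from weight_lower[OF this w2] B'[of "y + u"] ww show ?thesis
          unfolding k_def abs_divide by (intro frac_le) auto
      qed
      have "integrable \<nu> (\<lambda>u. weight u * k u)" by (rule integrable_weight[OF km kb])
      moreover have "weight u * k u = f (y + u)" for u
      proof (cases "u = 0")
        case True
        then have "f (y + u) = 0" using fsupp[of "y + u"] elim w2 by force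
        then show ?thesis by (simp add: k_def)
      qed (simp add: k_def)
      ultimately have "integrable \<nu> (\<lambda>u. f (y + u))" by simp
      then have "(\<integral>\<^sup>+u. ennreal (f (y + u)) \<partial>\<nu>) = ennreal (\<integral>u. f (y + u) \<partial>\<nu>)"
        using f0 by (intro nn_integral_eq_integral) auto
      then show ?case using elim f1(2) f0 by (simp add: G_def ennreal_mult integral_nonneg)
    qed
  qed
  finally show "(\<integral>\<^sup>+\<omega>. ennreal (ruin_val q f1 f2 ?\<Theta> (path \<omega>) a) \<partial>M)
      = (\<integral>\<^sup>+y. ennreal (f1 y) * (\<integral>\<^sup>+u. ennreal (f (y + u)) \<partial>\<nu>) \<partial>potential q 0 a)" .
qed

end

text \<open>The subtracted 1 keeps the support at distance \<open>1 / n\<close> from both ends, as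
  \<open>ruin_core\<close> demands, while the limit is still the indicator of the open
  interval.\<close>

definition tent :: "nat \<Rightarrow> real \<Rightarrow> real \<Rightarrow> real \<Rightarrow> real" where
  "tent n l u x = min 1 (max 0 (real n * min (x - l) (u - x) - 1))"

lemma tent_continuous: "continuous_on UNIV (tent n l u)"
  unfolding tent_def[abs_def] by (intro continuous_intros)

lemma tent_nonneg: "0 \<le> tent n l u x"
  by (simp add: tent_def)

lemma tent_incseq: "n \<le> m \<Longrightarrow> tent n l u x \<le> tent m l u x"
proof -
  assume nm: "n \<le> m"
  show ?thesis
  proof (cases "0 \<le> min (x - l) (u - x)")
    case True
    then have "real n * min (x - l) (u - x) \<le> real m * min (x - l) (u - x)" using nm by (intro mult_right_mono) auto
    then show ?thesis unfolding tent_def by linarith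
  next
    case False
    then have "real n * min (x - l) (u - x) \<le> 0" by (intro mult_nonneg_nonpos) auto
    then show ?thesis unfolding tent_def by linarith
  qed
qed

lemma tent_support:
  assumes "tent n l u x \<noteq> 0"
  shows "0 < n" "l + 1 / real n \<le> x" "x \<le> u - 1 / real n"
proof -
  have 1: "1 < real n * min (x - l) (u - x)" using assms unfolding tent_def by linarith
  then show n: "0 < n" by (cases n) auto
  then have n': "0 < real n" by simp
  have "1 \<le> min (x - l) (u - x) * real n" using 1 by (simp only: mult.commute[of "real n"] less_imp_le)
  then have "1 / real n \<le> min (x - l) (u - x)" unfolding pos_divide_le_eq[OF n'] .
  then show "l + 1 / real n \<le> x" "x \<le> u - 1 / real n" by auto
qed

lemma tent_LIMSEQ: "(\<lambda>n. tent n l u x) \<longlonglongrightarrow> indicator {l<..<u} x"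
proof (cases "x \<in> {l<..<u}")
  case True
  then have m: "0 < min (x - l) (u - x)" by simp
  obtain N :: nat where N: "2 / min (x - l) (u - x) \<le> real N" using real_arch_simple by blast
  have "tent n l u x = 1" if "N \<le> n" for n
  proof -
    have "2 \<le> real N * min (x - l) (u - x)" using N m by (simp only: pos_divide_le_eq)
    also have "\<dots> \<le> real n * min (x - l) (u - x)" using that m by (intro mult_right_mono) auto
    finally show ?thesis unfolding tent_def by linarith
  qed
  then show ?thesis using True by (intro tendsto_eventually) (auto simp: eventually_sequentially)
next
  case False
  then have m: "min (x - l) (u - x) \<le> 0" by auto
  have "tent n l u x = 0" for n
  proof -
    have "real n * min (x - l) (u - x) \<le> 0" using m by (intro mult_nonneg_nonpos) auto
    then show ?thesis unfolding tent_def by linarith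
  qed
  then show ?thesis using False by simp
qed

text \<open>For paths started in \<open>[0, a]\<close>, an exit time of \<open>[0, a]\<close> with a negative position is the ruin time.\<close>

definition ruin_ind ::
  "real \<Rightarrow> ((real \<Rightarrow> real) \<Rightarrow> real) \<Rightarrow> (real \<times> real) set \<Rightarrow> (real \<Rightarrow> real) \<Rightarrow> real \<Rightarrow> ennreal" where
  "ruin_ind q \<Theta> A p a = (if exit_set p 0 a = {} then 0 else
     ennreal (exp (- q * exit_time p 0 a) * \<Theta> (shift_path p (exit_time p 0 a)))
       * indicator A (left_limit p (exit_time p 0 a), - p (exit_time p 0 a)))"

text \<open>For \<open>c = b\<close> and \<open>d = 0\<close> this is the integrand of the theorem
  up to null sets; where the first factor is negative, \<open>ennreal\<close> replaces it by
  0.\<close>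

definition ruin_density ::
  "(real \<Rightarrow> real) \<Rightarrow> (real \<Rightarrow> real) \<Rightarrow> (real \<Rightarrow> real) \<Rightarrow> real \<Rightarrow> real \<Rightarrow> real \<Rightarrow> real \<Rightarrow> real \<times> real \<Rightarrow> ennreal" where
  "ruin_density \<pi> W W' x a c d = (\<lambda>(y, z).
     ennreal (W x / W a * pos_part_scale W (a - y) - pos_part_scale W (x - y))
       * ennreal (\<pi> (- z - y)) * ennreal (pos_part_scale W' (c - z) / W' (c - d)))"

section \<open>The joint law of the positions before and at ruin\<close>

context levy_exit
begin

text \<open>For a deterministic start \<open>scale_exit\<close> evaluates \<open>top_mass\<close> as
  \<open>W x / W a\<close>, and the resolvent identity becomes a density on \<open>(0, a)\<close>.
  Nonnegativity holds almost everywhere because a measure cannot be negative.\<close>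

lemma potential_density:
  assumes x: "x \<in> {0<..<a}" and Y0: "\<And>\<omega>. \<omega> \<in> space M \<Longrightarrow> Y 0 \<omega> = x" and M1: "emeasure M (space M) = 1"
    and q: "0 \<le> q" and W: "is_scale_function \<psi> q W" and Wa: "0 < W a"
  defines "K \<equiv> \<lambda>y. W x / W a * pos_part_scale W (a - y) - pos_part_scale W (x - y)"
  shows "AE y in lborel. y \<in> {0<..<a} \<longrightarrow> 0 \<le> K y"
    and "f \<in> borel_measurable borel \<Longrightarrow> (\<And>y. y \<notin> {0<..<a} \<Longrightarrow> f y = 0) \<Longrightarrow>
      (\<integral>\<^sup>+y. f y \<partial>potential q 0 a) = (\<integral>\<^sup>+y. f y * ennreal (K y) \<partial>lborel)"
proof -
  have a: "0 < a" using x by auto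
  note [measurable] = scale_measurable[OF W]
  have W0: "0 \<le> W v" "0 \<le> pos_part_scale W v" for v
    using W pos_part_scale_nonneg[OF W] by (auto simp: is_scale_function_def)
  have AE0: "AE \<omega> in M. Y 0 \<omega> \<in> {0..a}" using Y0 x by (intro AE_I2) auto
  define p where "p = W x / W a"
  have p0: "0 \<le> p" using W0 Wa by (simp add: p_def)
  have top: "top_mass q 0 a = ennreal p"
  proof -
    have "top_mass q 0 a * ennreal (W (a - 0)) = (\<integral>\<^sup>+\<omega>. ennreal (W (Y 0 \<omega> - 0)) \<partial>M)"
      by (rule scale_exit[OF a q, where \<delta> = x]) (use Y0 x W in auto)
    also have "\<dots> = (\<integral>\<^sup>+\<omega>. ennreal (W x) \<partial>M)" using Y0 by (intro nn_integral_cong) simp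
    also have "\<dots> = ennreal (W x)" by (simp add: M1)
    finally have "top_mass q 0 a * ennreal (W a) = ennreal p * ennreal (W a)"
      using Wa W0 by (simp add: p_def ennreal_mult[symmetric])
    then show ?thesis by (rule ennreal_mult_right_cancel[OF _ Wa])
  qed
  have res: "emeasure (potential q 0 a) S + (\<integral>\<^sup>+y\<in>S. ennreal (pos_part_scale W (x - y)) \<partial>lborel)
      = (\<integral>\<^sup>+y\<in>S. ennreal (p * pos_part_scale W (a - y)) \<partial>lborel)" if "S \<in> sets borel" "S \<subseteq> {0<..}" for S
  proof -
    have "(\<integral>\<^sup>+\<omega>. ennreal (pos_part_scale W (Y 0 \<omega> - y)) \<partial>M) = ennreal (pos_part_scale W (x - y))" for y
    proof -
      have "(\<integral>\<^sup>+\<omega>. ennreal (pos_part_scale W (Y 0 \<omega> - y)) \<partial>M) = (\<integral>\<^sup>+\<omega>. ennreal (pos_part_scale W (x - y)) \<partial>M)"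
        using Y0 by (intro nn_integral_cong) simp
      then show ?thesis by (simp add: M1)
    qed
    then show ?thesis
      using scale_resolvent[OF a q AE0 W that] p0 W0 by (simp add: top ennreal_mult)
  qed
  \<comment> \<open>Continuity leaves the behaviour of \<open>W\<close> at 0 open. Integrability
    over \<open>(0, a)\<close> comes from the Laplace transform at \<open>c\<close>, since
    \<open>exp (c * (a - v)) \<ge> 1\<close> there.\<close>
  have fin: "(\<integral>\<^sup>+y\<in>{0<..<a}. ennreal (p * pos_part_scale W (a - y)) \<partial>lborel) < \<infinity>"
  proof -
    obtain c where c: "0 \<le> c" "\<And>\<alpha>. c \<le> \<alpha> \<Longrightarrow> q < \<psi> \<alpha>"
      "\<And>\<alpha>. c \<le> \<alpha> \<Longrightarrow> (\<integral>\<^sup>+x. ennreal (exp (- \<alpha> * x) * pos_part_scale W x) \<partial>lborel) = ennreal (1 / (\<psi> \<alpha> - q))"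
      by (rule scale_laplace[OF W \<phi>_at_top]) blast
    have "(\<integral>\<^sup>+y\<in>{0<..<a}. ennreal (p * pos_part_scale W (a - y)) \<partial>lborel)
        = (\<integral>\<^sup>+v. ennreal (p * pos_part_scale W v) * indicator {0<..<a} (a - v) \<partial>lborel)"
      by (subst nn_integral_real_affine[where c = "-1" and t = a]) auto
    also have "\<dots> \<le> (\<integral>\<^sup>+v. ennreal (p * exp (c * a)) * ennreal (exp (- c * v) * pos_part_scale W v) \<partial>lborel)"
    proof (rule nn_integral_mono)
      fix v
      show "ennreal (p * pos_part_scale W v) * indicator {0<..<a} (a - v)
        \<le> ennreal (p * exp (c * a)) * ennreal (exp (- c * v) * pos_part_scale W v)"
      proof (cases "a - v \<in> {0<..<a}")
        case True
        then have "0 \<le> c * (a - v)" using c by simp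
        then have "1 \<le> exp (c * a) * exp (- c * v)" by (simp add: exp_add[symmetric] right_diff_distrib)
        then have "p * pos_part_scale W v * 1 \<le> p * pos_part_scale W v * (exp (c * a) * exp (- c * v))"
          using p0 W0 by (intro mult_left_mono) auto
        then show ?thesis using True p0 W0 by (simp add: ennreal_mult[symmetric] ac_simps ennreal_leI)
      qed simp
    qed
    also have "\<dots> = ennreal (p * exp (c * a)) * ennreal (1 / (\<psi> c - q))"
      unfolding c(3)[OF order_refl, symmetric] by (rule nn_integral_cmult) measurable
    also have "\<dots> < \<infinity>" by (simp add: ennreal_mult_less_top)
    finally show ?thesis .
  qed
  have finS: "(\<integral>\<^sup>+y\<in>S. ennreal (p * pos_part_scale W (a - y)) \<partial>lborel) < \<infinity>" if "S \<subseteq> {0<..<a}" for S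
    using that by (intro le_less_trans[OF _ fin] nn_integral_mono) (auto simp: indicator_def)
  show nonneg: "AE y in lborel. y \<in> {0<..<a} \<longrightarrow> 0 \<le> K y"
  proof -
    \<comment> \<open>On a set of positive measure with \<open>K < 0\<close> the integrated identity
      would produce a point where \<open>K \<ge> 0\<close>.\<close>
    define N where "N = {y \<in> {0<..<a}. K y < 0}"
    have Nm[measurable]: "N \<in> sets borel" unfolding N_def K_def by measurable
    have "emeasure lborel N = 0"
    proof (rule ccontr)
      assume "emeasure lborel N \<noteq> 0"
      have "\<exists>y\<in>N. ennreal (pos_part_scale W (x - y)) \<le> ennreal (p * pos_part_scale W (a - y))"
      proof (rule exists_le_of_set_nn_integral_le)
        have NS: "N \<subseteq> {0<..}" by (auto simp: N_def)
        show "(\<integral>\<^sup>+y\<in>N. ennreal (pos_part_scale W (x - y)) \<partial>lborel) \<le> (\<integral>\<^sup>+y\<in>N. ennreal (p * pos_part_scale W (a - y)) \<partial>lborel)"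
          unfolding res[OF Nm NS, symmetric] by (simp add: add_increasing)
        show "(\<integral>\<^sup>+y\<in>N. ennreal (p * pos_part_scale W (a - y)) \<partial>lborel) \<noteq> \<infinity>"
        proof -
          have "N \<subseteq> {0<..<a}" by (auto simp: N_def)
          from finS[OF this] show ?thesis by simp
        qed
        show "0 < emeasure lborel N" using \<open>emeasure lborel N \<noteq> 0\<close> by (simp add: zero_less_iff_neq_zero)
      qed measurable
      then obtain y where "y \<in> N" "pos_part_scale W (x - y) \<le> p * pos_part_scale W (a - y)"
        using p0 W0 by (auto simp: ennreal_le_iff)
      then show False by (simp add: N_def K_def p_def)
    qed
    show ?thesis
    proof (rule AE_I)
      show "{y \<in> space lborel. \<not> (y \<in> {0<..<a} \<longrightarrow> 0 \<le> K y)} \<subseteq> N" by (auto simp: N_def)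
    qed (use Nm \<open>emeasure lborel N = 0\<close> in auto)
  qed
  assume f[measurable]: "f \<in> borel_measurable borel" and f0: "\<And>y. y \<notin> {0<..<a} \<Longrightarrow> f y = 0"
  have Km[measurable]: "K \<in> borel_measurable borel" unfolding K_def by measurable
  have "density (potential q 0 a) (indicator {0<..<a}) = density lborel (\<lambda>y. indicator {0<..<a} y * ennreal (K y))"
    (is "?A = ?B")
  proof (rule measure_eqI)
    show "sets ?A = sets ?B" by (simp add: sets_potential)
    fix S assume "S \<in> sets ?A"
    then have S[measurable]: "S \<in> sets borel" by (simp add: sets_potential)
    let ?S = "S \<inter> {0<..<a}"
    have Sm: "?S \<in> sets borel" by measurable
    have A: "emeasure ?A S = emeasure (potential q 0 a) ?S"
    proof -
      have "emeasure ?A S = (\<integral>\<^sup>+y. indicator {0<..<a} y * indicator S y \<partial>potential q 0 a)"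
        by (subst emeasure_density) (auto simp: measurable_cong_sets[OF sets_potential refl] sets_potential)
      also have "\<dots> = (\<integral>\<^sup>+y. indicator ?S y \<partial>potential q 0 a)"
        by (intro nn_integral_cong) (auto simp: indicator_def)
      finally show ?thesis using Sm by (simp add: sets_potential)
    qed
    have B: "emeasure ?B S = (\<integral>\<^sup>+y\<in>?S. ennreal (K y) \<partial>lborel)"
      by (subst emeasure_density) (auto simp: indicator_def intro!: nn_integral_cong)
    \<comment> \<open>Added to both sides and cancelled afterwards, which its finiteness
      permits.\<close>
    let ?I = "\<integral>\<^sup>+y\<in>?S. ennreal (pos_part_scale W (x - y)) \<partial>lborel"
    have "(\<integral>\<^sup>+y\<in>?S. ennreal (K y) \<partial>lborel) + ?I = (\<integral>\<^sup>+y. ennreal (K y) * indicator ?S y + ennreal (pos_part_scale W (x - y)) * indicator ?S y \<partial>lborel)"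
      by (rule nn_integral_add[symmetric]) measurable
    also have "\<dots> = (\<integral>\<^sup>+y\<in>?S. ennreal (p * pos_part_scale W (a - y)) \<partial>lborel)"
    proof (rule nn_integral_cong_AE)
      show "AE y in lborel. ennreal (K y) * indicator ?S y + ennreal (pos_part_scale W (x - y)) * indicator ?S y
          = ennreal (p * pos_part_scale W (a - y)) * indicator ?S y"
        using nonneg
      proof eventually_elim
        case (elim y)
        show ?case
        proof (cases "y \<in> ?S")
          case True
          then have "0 \<le> K y" using elim by auto
          then have "ennreal (K y) + ennreal (pos_part_scale W (x - y)) = ennreal (p * pos_part_scale W (a - y))"
            using W0 by (subst ennreal_plus[symmetric]) (auto simp: K_def p_def)
          then show ?thesis using True by simp
        qed simp
      qed
    qed
    also have "\<dots> = emeasure (potential q 0 a) ?S + ?I"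
      by (rule res[symmetric]) (use Sm in auto)
    finally have "?I + (\<integral>\<^sup>+y\<in>?S. ennreal (K y) \<partial>lborel) = ?I + emeasure (potential q 0 a) ?S"
      by (simp add: add.commute)
    moreover have "?I \<noteq> \<infinity>"
    proof -
      have "?S \<subseteq> {0<..}" by auto
      from res[OF Sm this] have "?I \<le> (\<integral>\<^sup>+y\<in>?S. ennreal (p * pos_part_scale W (a - y)) \<partial>lborel)"
        by (rule subst) (rule add_increasing, simp_all)
      also have "\<dots> < \<infinity>" by (rule finS) auto
      finally show ?thesis by simp
    qed
    ultimately show "emeasure ?A S = emeasure ?B S" unfolding A B by (simp add: ennreal_add_left_cancel)
  qed
  then have "(\<integral>\<^sup>+y. f y \<partial>?A) = (\<integral>\<^sup>+y. f y \<partial>?B)" by simp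
  moreover have "(\<integral>\<^sup>+y. f y \<partial>?A) = (\<integral>\<^sup>+y. f y \<partial>potential q 0 a)"
  proof -
    have "(\<integral>\<^sup>+y. f y \<partial>?A) = (\<integral>\<^sup>+y. indicator {0<..<a} y * f y \<partial>potential q 0 a)"
      by (rule nn_integral_density) (auto simp: measurable_cong_sets[OF sets_potential refl] sets_potential)
    also have "\<dots> = (\<integral>\<^sup>+y. f y \<partial>potential q 0 a)"
      using f0 by (intro nn_integral_cong) (auto simp: indicator_def)
    finally show ?thesis .
  qed
  moreover have "(\<integral>\<^sup>+y. f y \<partial>?B) = (\<integral>\<^sup>+y. f y * ennreal (K y) \<partial>lborel)"
  proof -
    have "(\<integral>\<^sup>+y. f y \<partial>?B) = (\<integral>\<^sup>+y. indicator {0<..<a} y * ennreal (K y) * f y \<partial>lborel)"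
      by (rule nn_integral_density) measurable
    also have "\<dots> = (\<integral>\<^sup>+y. f y * ennreal (K y) \<partial>lborel)"
      using f0 by (intro nn_integral_cong) (auto simp: indicator_def mult.commute)
    finally show ?thesis .
  qed
  ultimately show "(\<integral>\<^sup>+y. f y \<partial>potential q 0 a) = (\<integral>\<^sup>+y. f y * ennreal (K y) \<partial>lborel)" by simp
qed

lemma ruin_density_measurable:
  assumes "is_scale_function \<psi> q W" "is_scale_function \<psi> \<beta> W'" and [measurable]: "\<pi> \<in> borel_measurable borel"
  shows "ruin_density \<pi> W W' x a c d \<in> borel_measurable borel"
proof -
  note [measurable] = scale_measurable[OF assms(1)] scale_measurable[OF assms(2)]
  have "ruin_density \<pi> W W' x a c d \<in> borel_measurable (borel \<Otimes>\<^sub>M borel)"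
    unfolding ruin_density_def by measurable
  then show ?thesis by (simp add: borel_prod)
qed

text \<open>Products of tents increase to indicators of open boxes, so \<open>ruin_core\<close>
  extends to boxes by monotone convergence. Boxes form a generator stable under intersection, and
  finite total mass carries the identity through complements and disjoint unions.\<close>

lemma ruin_formula:
  assumes x: "x \<in> {0<..<a}" and Y0: "\<And>\<omega>. \<omega> \<in> space M \<Longrightarrow> Y 0 \<omega> = x" and M1: "emeasure M (space M) = 1"
    and q: "0 \<le> q" and W: "is_scale_function \<psi> q W" and Wa: "0 < W a"
    and \<beta>: "0 \<le> \<beta>" and d: "0 \<le> d" "d < c" and W': "is_scale_function \<psi> \<beta> W'" and W'pos: "0 < W' (c - d)"
    and \<pi>: "\<pi> \<in> borel_measurable borel" and \<nu>: "\<nu> = density lborel (\<lambda>u. ennreal (\<pi> u))"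
    and A: "A \<in> sets borel"
  defines "\<Omega> \<equiv> {0<..<a} \<times> {d<..<c}"
  shows "(\<lambda>\<omega>. ruin_ind q (recovery_weight \<beta> c d) (A \<inter> \<Omega>) (path \<omega>) a) \<in> borel_measurable M \<and>
    (\<integral>\<^sup>+\<omega>. ruin_ind q (recovery_weight \<beta> c d) (A \<inter> \<Omega>) (path \<omega>) a \<partial>M)
     = (\<integral>\<^sup>+z\<in>A \<inter> \<Omega>. ruin_density \<pi> W W' x a c d z \<partial>lborel)"
proof -
  let ?\<Theta> = "recovery_weight \<beta> c d"
  define K where "K y = W x / W a * pos_part_scale W (a - y) - pos_part_scale W (x - y)" for y
  define L where "L p = left_limit p (exit_time p 0 a)" for p
  define E where "E p = p (exit_time p 0 a)" for p :: "real \<Rightarrow> real"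
  define V where "V p = (if exit_set p 0 a = {} then 0 else exp (- q * exit_time p 0 a) * ?\<Theta> (shift_path p (exit_time p 0 a)))" for p
  have V0: "0 \<le> V p" for p unfolding V_def using recovery_weight_bounds[OF \<beta>] by simp
  have V1: "V p \<le> 1" for p
  proof (cases "exit_set p 0 a = {}")
    case False
    have "0 \<le> q * exit_time p 0 a" using q exit_time_nonneg[OF False] by simp
    then show ?thesis unfolding V_def using False recovery_weight_bounds[OF \<beta>] by (auto intro!: mult_le_one)
  qed (simp add: V_def)
  have ind: "ruin_ind q ?\<Theta> S p a = ennreal (V p) * indicator S (L p, - E p)" for S p
    by (simp add: ruin_ind_def V_def L_def E_def)
  have val: "ruin_val q f1 f2 ?\<Theta> p a = V p * (f1 (L p) * f2 (E p))" for f1 f2 p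
    by (simp add: ruin_val_def V_def L_def E_def)
  have [measurable]: "\<pi> \<in> borel_measurable borel" by (rule \<pi>)
  note [measurable] = scale_measurable[OF W] scale_measurable[OF W']
  note dm[measurable] = ruin_density_measurable[OF W W' \<pi>, of x a c d]
  have Km[measurable]: "K \<in> borel_measurable borel" unfolding K_def by measurable
  have \<Omega>m[measurable]: "\<Omega> \<in> sets borel"
    unfolding \<Omega>_def by (intro borel_open open_Times) auto
  have W'0: "0 \<le> W' v" "0 \<le> pos_part_scale W' v" for v
    using W' pos_part_scale_nonneg[OF W'] by (auto simp: is_scale_function_def)
  have rect: "(\<lambda>\<omega>. ennreal (V (path \<omega>) * (f1 (L (path \<omega>)) * f2 (- E (path \<omega>))))) \<in> borel_measurable M \<and>
      (\<integral>\<^sup>+\<omega>. ennreal (V (path \<omega>) * (f1 (L (path \<omega>)) * f2 (- E (path \<omega>)))) \<partial>M)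
      = (\<integral>\<^sup>+(y, z). ennreal (f1 y * f2 z) * ruin_density \<pi> W W' x a c d (y, z) \<partial>lborel)"
    if f1: "continuous_on UNIV f1" "\<And>y. 0 \<le> f1 y" "\<And>y. y \<notin> {0<..<a} \<Longrightarrow> f1 y = 0"
      and f2: "continuous_on UNIV f2" "\<And>y. 0 \<le> f2 y" "\<And>z. f2 z \<noteq> 0 \<Longrightarrow> z1 \<le> z \<and> z \<le> z2" "d < z1" "z2 < c"
    for f1 f2 :: "real \<Rightarrow> real" and z1 z2
  proof -
    have [measurable]: "f1 \<in> borel_measurable borel" "f2 \<in> borel_measurable borel"
      using f1 f2 by (auto intro: borel_measurable_continuous_onI)
    have f2': "continuous_on UNIV (\<lambda>w. f2 (- w))"
      by (intro continuous_on_compose2[OF f2(1)] continuous_intros) auto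
    have supp: "- z2 \<le> w \<and> w \<le> - z1" if "f2 (- w) \<noteq> 0" for w using f2(3)[OF that] by auto
    have a: "0 < a" using x by auto
    have Y0': "Y 0 \<omega> \<in> {0..a}" if "\<omega> \<in> space M" for \<omega> using Y0[OF that] x by auto
    have z: "- c < - z2" "- z1 < - d" using f2(4,5) by auto
    note core = ruin_core[OF Y0' a q \<beta> d W' W'pos f1(1,2) f2' f2(2) supp z]
    have inner: "(\<integral>\<^sup>+u. ennreal (f2 (- (y + u)) * (W' (y + u + c) / W' (c - d))) \<partial>\<nu>)
        = (\<integral>\<^sup>+z. ennreal (f2 z) * (ennreal (\<pi> (- z - y)) * ennreal (pos_part_scale W' (c - z) / W' (c - d))) \<partial>lborel)" for y
    proof -
      have eq: "ennreal (f2 (- w) * (W' (w + c) / W' (c - d))) = ennreal (f2 (- w)) * ennreal (pos_part_scale W' (w + c) / W' (c - d))" for w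
      proof (cases "f2 (- w) = 0")
        case False
        then have "0 < w + c" using f2(3)[OF False] f2(5) by simp
        then show ?thesis using f2(2) W'0 W'pos by (subst ennreal_mult) (auto simp: pos_part_scale_pos)
      qed simp
      have "(\<integral>\<^sup>+u. ennreal (f2 (- (y + u)) * (W' (y + u + c) / W' (c - d))) \<partial>\<nu>)
        = (\<integral>\<^sup>+u. ennreal (\<pi> u) * (ennreal (f2 (- (y + u))) * ennreal (pos_part_scale W' (y + u + c) / W' (c - d))) \<partial>lborel)"
        unfolding eq \<nu> by (rule nn_integral_density) measurable
      \<comment> \<open>The jump is \<open>u = - y - z\<close>, so that \<open>y + u = - z\<close>
        is the position at ruin.\<close>
      also have "\<dots> = (\<integral>\<^sup>+z. ennreal (\<pi> (- y - z)) * (ennreal (f2 z) * ennreal (pos_part_scale W' (- z + c) / W' (c - d))) \<partial>lborel)"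
        by (subst nn_integral_real_affine[where c = "-1" and t = "- y"]) auto
      also have "\<dots> = (\<integral>\<^sup>+z. ennreal (f2 z) * (ennreal (\<pi> (- z - y)) * ennreal (pos_part_scale W' (c - z) / W' (c - d))) \<partial>lborel)"
      proof (rule nn_integral_cong)
        fix z :: real
        have "- y - z = - z - y" "- z + c = c - z" by auto
        then show "ennreal (\<pi> (- y - z)) * (ennreal (f2 z) * ennreal (pos_part_scale W' (- z + c) / W' (c - d)))
          = ennreal (f2 z) * (ennreal (\<pi> (- z - y)) * ennreal (pos_part_scale W' (c - z) / W' (c - d)))"
          by (simp only: mult.left_commute)
      qed
      finally show ?thesis .
    qed
    define J where "J y = (\<integral>\<^sup>+z. ennreal (f2 z) * (ennreal (\<pi> (- z - y)) * ennreal (pos_part_scale W' (c - z) / W' (c - d))) \<partial>lborel)" for y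
    have Jm[measurable]: "J \<in> borel_measurable borel" unfolding J_def by measurable
    have e: "ruin_val q f1 (\<lambda>w. f2 (- w)) ?\<Theta> p a = V p * (f1 (L p) * f2 (- E p))" for p by (rule val)
    have "(\<integral>\<^sup>+\<omega>. ennreal (V (path \<omega>) * (f1 (L (path \<omega>)) * f2 (- E (path \<omega>)))) \<partial>M)
        = (\<integral>\<^sup>+y. ennreal (f1 y) * J y \<partial>potential q 0 a)"
      using core(2) unfolding e inner J_def .
    also have "\<dots> = (\<integral>\<^sup>+y. ennreal (f1 y) * J y * ennreal (K y) \<partial>lborel)"
      unfolding K_def by (rule potential_density(2)[OF x Y0 M1 q W Wa]) (use f1(3) in auto)
    also have "\<dots> = (\<integral>\<^sup>+y. \<integral>\<^sup>+z. ennreal (f1 y * f2 z) * ruin_density \<pi> W W' x a c d (y, z) \<partial>lborel \<partial>lborel)"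
    proof (rule nn_integral_cong)
      fix y :: real
      have "ennreal (f1 y) * J y * ennreal (K y) = ennreal (f1 y) * ennreal (K y) * J y" by (simp only: ac_simps)
      also have "\<dots> = (\<integral>\<^sup>+z. ennreal (f1 y) * ennreal (K y) * (ennreal (f2 z) * (ennreal (\<pi> (- z - y)) * ennreal (pos_part_scale W' (c - z) / W' (c - d)))) \<partial>lborel)"
        unfolding J_def by (rule nn_integral_cmult[symmetric]) measurable
      also have "\<dots> = (\<integral>\<^sup>+z. ennreal (f1 y * f2 z) * ruin_density \<pi> W W' x a c d (y, z) \<partial>lborel)"
        using f1(2) f2(2) by (intro nn_integral_cong) (simp add: ruin_density_def K_def ennreal_mult ac_simps)
      finally show "ennreal (f1 y) * J y * ennreal (K y) = (\<integral>\<^sup>+z. ennreal (f1 y * f2 z) * ruin_density \<pi> W W' x a c d (y, z) \<partial>lborel)" .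
    qed
    also have "\<dots> = (\<integral>\<^sup>+(y, z). ennreal (f1 y * f2 z) * ruin_density \<pi> W W' x a c d (y, z) \<partial>(lborel \<Otimes>\<^sub>M lborel))"
    proof -
      have "(\<lambda>(y, z). ennreal (f1 y * f2 z) * ruin_density \<pi> W W' x a c d (y, z)) \<in> borel_measurable (borel \<Otimes>\<^sub>M borel)"
        using dm[folded borel_prod] by measurable
      then have m: "(\<lambda>(y, z). ennreal (f1 y * f2 z) * ruin_density \<pi> W W' x a c d (y, z)) \<in> borel_measurable (lborel \<Otimes>\<^sub>M lborel)"
        by (simp add: borel_prod lborel_prod)
      show ?thesis using lborel.nn_integral_fst[OF m] by simp
    qed
    finally show ?thesis using core(1) unfolding e by (simp add: lborel_prod)
  qed
  define P where "P S \<longleftrightarrow> (\<lambda>\<omega>. ruin_ind q ?\<Theta> (S \<inter> \<Omega>) (path \<omega>) a) \<in> borel_measurable M \<and>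
    (\<integral>\<^sup>+\<omega>. ruin_ind q ?\<Theta> (S \<inter> \<Omega>) (path \<omega>) a \<partial>M) = (\<integral>\<^sup>+z\<in>S \<inter> \<Omega>. ruin_density \<pi> W W' x a c d z \<partial>lborel)" for S
  have box: "P (box v w)" for v w :: "real \<times> real"
  proof -
    define y1 where "y1 = max 0 (fst v)"
    define y2 where "y2 = min a (fst w)"
    define z1 where "z1 = max d (snd v)"
    define z2 where "z2 = min c (snd w)"
    have b: "(y, z) \<in> box v w \<inter> \<Omega> \<longleftrightarrow> y \<in> {y1<..<y2} \<and> z \<in> {z1<..<z2}" for y z
      unfolding box_prod \<Omega>_def y1_def y2_def z1_def z2_def by (auto simp: box_real)
    define f1 where "f1 n = tent n y1 y2" for n
    define f2 where "f2 n = tent n z1 z2" for n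
    have f10: "0 \<le> f1 n y" and f20: "0 \<le> f2 n y" for n y by (auto simp: f1_def f2_def tent_nonneg)
    have R: "(\<lambda>\<omega>. ennreal (V (path \<omega>) * (f1 n (L (path \<omega>)) * f2 n (- E (path \<omega>))))) \<in> borel_measurable M \<and>
      (\<integral>\<^sup>+\<omega>. ennreal (V (path \<omega>) * (f1 n (L (path \<omega>)) * f2 n (- E (path \<omega>)))) \<partial>M)
      = (\<integral>\<^sup>+(y, z). ennreal (f1 n y * f2 n z) * ruin_density \<pi> W W' x a c d (y, z) \<partial>lborel)" for n
    \<comment> \<open>At \<open>n = 0\<close> there is no margin \<open>1 / n\<close>, but the tent
      itself is 0.\<close>
    proof (cases "n = 0")
      case True
      then show ?thesis by (simp add: f1_def tent_def case_prod_unfold)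
    next
      case False
      show ?thesis
      proof (rule rect)
        show "continuous_on UNIV (f1 n)" "continuous_on UNIV (f2 n)"
          by (auto simp: f1_def f2_def tent_continuous)
        show "f1 n y = 0" if "y \<notin> {0<..<a}" for y
        proof (rule ccontr)
          assume "f1 n y \<noteq> 0"
          note t = tent_support[OF this[unfolded f1_def]]
          have "0 < 1 / real n" using False by simp
          then have "y1 < y" "y < y2" using t(2,3) by linarith+
          then show False using that by (auto simp: y1_def y2_def)
        qed
        show "z1 + 1 / real n \<le> z \<and> z \<le> z2 - 1 / real n" if "f2 n z \<noteq> 0" for z
          using tent_support[OF that[unfolded f2_def]] by simp
        have "0 < 1 / real n" using False by simp
        then show "d < z1 + 1 / real n" "z2 - 1 / real n < c" unfolding z1_def z2_def by linarith+
      qed (simp_all add: f10 f20)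
    qed
    have prod_mono: "f1 n y * f2 n z \<le> f1 m y * f2 m z" if "n \<le> m" for n m y z
      unfolding f1_def f2_def using that by (intro mult_mono tent_incseq) (auto simp: tent_nonneg)
    have prod_lim: "(\<lambda>n. f1 n y * f2 n z) \<longlonglongrightarrow> indicator (box v w \<inter> \<Omega>) (y, z)" for y z
    proof -
      have "(\<lambda>n. f1 n y * f2 n z) \<longlonglongrightarrow> indicator {y1<..<y2} y * indicator {z1<..<z2} z"
        unfolding f1_def f2_def by (intro tendsto_mult tent_LIMSEQ)
      also have "indicator {y1<..<y2} y * indicator {z1<..<z2} z = (indicator (box v w \<inter> \<Omega>) (y, z) :: real)"
        using b[of y z] by (simp add: indicator_def del: greaterThanLessThan_iff)
      finally show ?thesis .
    qed
    have ind': "ruin_ind q ?\<Theta> S p a = ennreal (V p * indicator S (L p, - E p))" for S p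
      using V0 by (simp add: ind ennreal_mult ennreal_indicator)
    have lim1: "(\<lambda>n. ennreal (V p * (f1 n (L p) * f2 n (- E p)))) \<longlonglongrightarrow> ruin_ind q ?\<Theta> (box v w \<inter> \<Omega>) p a" for p
      unfolding ind' by (intro tendsto_ennrealI tendsto_mult tendsto_const prod_lim)
    have m1: "(\<lambda>\<omega>. ruin_ind q ?\<Theta> (box v w \<inter> \<Omega>) (path \<omega>) a) \<in> borel_measurable M"
      by (rule borel_measurable_LIMSEQ_order[OF lim1]) (use R in blast)
    have i1: "(\<lambda>n. \<integral>\<^sup>+\<omega>. ennreal (V (path \<omega>) * (f1 n (L (path \<omega>)) * f2 n (- E (path \<omega>)))) \<partial>M)
        \<longlonglongrightarrow> (\<integral>\<^sup>+\<omega>. ruin_ind q ?\<Theta> (box v w \<inter> \<Omega>) (path \<omega>) a \<partial>M)"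
    proof (rule nn_integral_LIMSEQ)
      show "incseq (\<lambda>n \<omega>. ennreal (V (path \<omega>) * (f1 n (L (path \<omega>)) * f2 n (- E (path \<omega>)))))"
        unfolding incseq_def le_fun_def using prod_mono V0 by (auto intro!: ennreal_leI mult_left_mono)
    qed (use R lim1 in auto)
    have i2: "(\<lambda>n. \<integral>\<^sup>+(y, z). ennreal (f1 n y * f2 n z) * ruin_density \<pi> W W' x a c d (y, z) \<partial>lborel)
        \<longlonglongrightarrow> (\<integral>\<^sup>+z\<in>box v w \<inter> \<Omega>. ruin_density \<pi> W W' x a c d z \<partial>lborel)"
    proof (rule nn_integral_LIMSEQ)
      show "incseq (\<lambda>n (y, z). ennreal (f1 n y * f2 n z) * ruin_density \<pi> W W' x a c d (y, z))"
        unfolding incseq_def le_fun_def using prod_mono by (auto intro!: mult_right_mono ennreal_leI)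
      show "(\<lambda>(y, z). ennreal (f1 n y * f2 n z) * ruin_density \<pi> W W' x a c d (y, z)) \<in> borel_measurable lborel" for n
      proof -
        have [measurable]: "f1 n \<in> borel_measurable borel" "f2 n \<in> borel_measurable borel"
          by (auto simp: f1_def f2_def intro!: borel_measurable_continuous_onI tent_continuous)
        have "(\<lambda>(y, z). ennreal (f1 n y * f2 n z) * ruin_density \<pi> W W' x a c d (y, z)) \<in> borel_measurable (borel \<Otimes>\<^sub>M borel)"
          using dm[folded borel_prod] by measurable
        then show ?thesis by (simp add: borel_prod)
      qed
      fix v' :: "real \<times> real"
      obtain y z where v': "v' = (y, z)" by fastforce
      have "ruin_density \<pi> W W' x a c d (y, z) \<noteq> \<top>"
        by (simp add: ruin_density_def ennreal_mult_eq_top_iff)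
      then have "(\<lambda>n. ennreal (f1 n y * f2 n z) * ruin_density \<pi> W W' x a c d (y, z))
          \<longlonglongrightarrow> ennreal (indicator (box v w \<inter> \<Omega>) (y, z)) * ruin_density \<pi> W W' x a c d (y, z)"
        by (intro tendsto_mult_ennreal[OF tendsto_ennrealI[OF prod_lim] tendsto_const]) auto
      then show "(\<lambda>n. case v' of (y, z) \<Rightarrow> ennreal (f1 n y * f2 n z) * ruin_density \<pi> W W' x a c d (y, z))
          \<longlonglongrightarrow> ruin_density \<pi> W W' x a c d v' * indicator (box v w \<inter> \<Omega>) v'"
        by (simp add: v' ennreal_indicator mult.commute)
    qed
    have "(\<integral>\<^sup>+\<omega>. ruin_ind q ?\<Theta> (box v w \<inter> \<Omega>) (path \<omega>) a \<partial>M)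
        = (\<integral>\<^sup>+z\<in>box v w \<inter> \<Omega>. ruin_density \<pi> W W' x a c d z \<partial>lborel)"
      using LIMSEQ_unique[OF i1] i2 R by simp
    then show ?thesis unfolding P_def using m1 by blast
  qed
  have top: "P UNIV"
  proof -
    have "box (0, d) (a, c) \<inter> \<Omega> = UNIV \<inter> \<Omega>" by (auto simp: box_prod \<Omega>_def box_real)
    then show ?thesis using box[of "(0, d)" "(a, c)"] unfolding P_def by simp
  qed
  have fin: "(\<integral>\<^sup>+\<omega>. ruin_ind q ?\<Theta> S (path \<omega>) a \<partial>M) < \<infinity>" for S
  proof -
    have "(\<integral>\<^sup>+\<omega>. ruin_ind q ?\<Theta> S (path \<omega>) a \<partial>M) \<le> (\<integral>\<^sup>+\<omega>. 1 \<partial>M)"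
    proof (rule nn_integral_mono)
      fix \<omega>
      have "ennreal (V (path \<omega>)) \<le> 1" using V1[of "path \<omega>"] by (simp add: ennreal_leI flip: ennreal_1)
      then show "ruin_ind q ?\<Theta> S (path \<omega>) a \<le> 1" unfolding ind by (simp add: indicator_def)
    qed
    then show ?thesis by (simp add: M1 le_less_trans[OF _ ennreal_one_less_top])
  qed
  have "Int_stable (range (\<lambda>(v, w). box v w :: (real \<times> real) set))"
    unfolding Int_stable_def
  proof safe
    fix v1 w1 v2 w2 :: "real \<times> real"
    show "box v1 w1 \<inter> box v2 w2 \<in> range (\<lambda>(v, w). box v w)"
      unfolding box_Int_box by (rule range_eqI[where x = "(_, _)"]) auto
  qed
  moreover have "range (\<lambda>(v, w). box v w :: (real \<times> real) set) \<subseteq> Pow UNIV" by simp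
  moreover have "A \<in> sigma_sets UNIV (range (\<lambda>(v, w). box v w :: (real \<times> real) set))"
    using A unfolding borel_eq_box by simp
  ultimately have "P A"
  proof (induction A rule: sigma_sets_induct_disjoint)
    case (basic S)
    then show ?case using box by auto
  next
    case empty
    show ?case by (simp add: P_def ind)
  next
    case (compl S)
    have Sm: "S \<in> sets borel" using compl(1) unfolding borel_eq_box by simp
    let ?r = "\<lambda>S \<omega>. ruin_ind q ?\<Theta> (S \<inter> \<Omega>) (path \<omega>) a" and ?g = "ruin_density \<pi> W W' x a c d"
    \<comment> \<open>In \<open>ennreal\<close> infinity minus infinity is not 0, so finiteness of
      the density is used.\<close>
    have g0: "?g z - ?g z = 0" for z
      by (rule ennreal_diff_self) (simp add: ruin_density_def case_prod_unfold ennreal_mult_eq_top_iff)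
    have rd: "?r (UNIV - S) \<omega> = ?r UNIV \<omega> - ?r S \<omega>" for \<omega>
      unfolding ind by (auto simp: indicator_def)
    have rm: "?r UNIV \<in> borel_measurable M" "?r S \<in> borel_measurable M" using top compl(2) unfolding P_def by auto
    have "?r (UNIV - S) \<in> borel_measurable M" unfolding rd using rm by measurable
    moreover have "(\<integral>\<^sup>+\<omega>. ?r (UNIV - S) \<omega> \<partial>M) = (\<integral>\<^sup>+\<omega>. ?r UNIV \<omega> \<partial>M) - (\<integral>\<^sup>+\<omega>. ?r S \<omega> \<partial>M)"
      unfolding rd
    proof (rule nn_integral_diff[OF rm])
      show "(\<integral>\<^sup>+\<omega>. ?r S \<omega> \<partial>M) \<noteq> \<infinity>" using fin[of "S \<inter> \<Omega>"] by simp
      show "AE \<omega> in M. ?r S \<omega> \<le> ?r UNIV \<omega>" unfolding ind by (auto simp: indicator_def)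
    qed
    moreover have "(\<integral>\<^sup>+z\<in>(UNIV - S) \<inter> \<Omega>. ?g z \<partial>lborel) = (\<integral>\<^sup>+z\<in>UNIV \<inter> \<Omega>. ?g z \<partial>lborel) - (\<integral>\<^sup>+z\<in>S \<inter> \<Omega>. ?g z \<partial>lborel)"
    proof -
      have "(\<integral>\<^sup>+z\<in>(UNIV - S) \<inter> \<Omega>. ?g z \<partial>lborel) = (\<integral>\<^sup>+z. ?g z * indicator (UNIV \<inter> \<Omega>) z - ?g z * indicator (S \<inter> \<Omega>) z \<partial>lborel)"
        by (intro nn_integral_cong) (auto simp: indicator_def g0)
      also have "\<dots> = (\<integral>\<^sup>+z\<in>UNIV \<inter> \<Omega>. ?g z \<partial>lborel) - (\<integral>\<^sup>+z\<in>S \<inter> \<Omega>. ?g z \<partial>lborel)"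
      proof (rule nn_integral_diff)
        have "(\<integral>\<^sup>+z\<in>S \<inter> \<Omega>. ?g z \<partial>lborel) = (\<integral>\<^sup>+\<omega>. ?r S \<omega> \<partial>M)" using compl(2) unfolding P_def by simp
        then show "(\<integral>\<^sup>+z\<in>S \<inter> \<Omega>. ?g z \<partial>lborel) \<noteq> \<infinity>" using fin[of "S \<inter> \<Omega>"] by simp
        show "(\<lambda>z. ?g z * indicator (UNIV \<inter> \<Omega>) z) \<in> borel_measurable lborel"
          "(\<lambda>z. ?g z * indicator (S \<inter> \<Omega>) z) \<in> borel_measurable lborel"
          using Sm by measurable
        show "AE z in lborel. ?g z * indicator (S \<inter> \<Omega>) z \<le> ?g z * indicator (UNIV \<inter> \<Omega>) z"
          by (intro AE_I2 mult_left_mono) (auto simp: indicator_def)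
      qed
      finally show ?thesis .
    qed
    ultimately show ?case using top compl(2) unfolding P_def by simp
  next
    case (union S)
    have Sm: "S i \<in> sets borel" for i using union(2) unfolding borel_eq_box by auto
    let ?r = "\<lambda>S \<omega>. ruin_ind q ?\<Theta> (S \<inter> \<Omega>) (path \<omega>) a" and ?g = "ruin_density \<pi> W W' x a c d"
    have dis: "disjoint_family (\<lambda>i. S i \<inter> \<Omega>)" using union(1) by (auto simp: disjoint_family_on_def)
    have si: "(\<Sum>i. indicator (S i \<inter> \<Omega>) z) = (indicator ((\<Union>i. S i) \<inter> \<Omega>) z :: ennreal)" for z
    proof -
      have "(\<Union>i. S i \<inter> \<Omega>) = (\<Union>i. S i) \<inter> \<Omega>" by blast
      then show ?thesis using suminf_indicator[OF dis, of z] by argo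
    qed
    have rs: "?r (\<Union>i. S i) \<omega> = (\<Sum>i. ?r (S i) \<omega>)" for \<omega>
      unfolding ind si[symmetric] by (rule ennreal_suminf_cmult[symmetric])
    have rm: "?r (S i) \<in> borel_measurable M" for i using union(3)[of i] unfolding P_def by auto
    have "?r (\<Union>i. S i) \<in> borel_measurable M" unfolding rs using rm by measurable
    moreover have "(\<integral>\<^sup>+\<omega>. ?r (\<Union>i. S i) \<omega> \<partial>M) = (\<Sum>i. \<integral>\<^sup>+\<omega>. ?r (S i) \<omega> \<partial>M)"
      unfolding rs by (rule nn_integral_suminf[OF rm])
    moreover have "(\<integral>\<^sup>+z\<in>(\<Union>i. S i) \<inter> \<Omega>. ?g z \<partial>lborel) = (\<Sum>i. \<integral>\<^sup>+z\<in>S i \<inter> \<Omega>. ?g z \<partial>lborel)"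
    proof -
      have "(\<integral>\<^sup>+z\<in>(\<Union>i. S i) \<inter> \<Omega>. ?g z \<partial>lborel) = (\<integral>\<^sup>+z. (\<Sum>i. ?g z * indicator (S i \<inter> \<Omega>) z) \<partial>lborel)"
        unfolding si[symmetric] ennreal_suminf_cmult[symmetric] ..
      also have "\<dots> = (\<Sum>i. \<integral>\<^sup>+z\<in>S i \<inter> \<Omega>. ?g z \<partial>lborel)"
        by (rule nn_integral_suminf) (use Sm in measurable)
      finally show ?thesis .
    qed
    ultimately show ?case using union(3) unfolding P_def by simp
  qed
  then show ?thesis unfolding P_def .
qed

end

section \<open>Ruin and recovery\<close>

text \<open>One-sided limits bound the path near each time, and bisection makes the bound global.
  Only for bounded paths do the real \<open>INF\<close> and \<open>SUP\<close> in
  \<open>running_inf\<close> and \<open>running_sup\<close> constrain every value.\<close>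

lemma cadlag_bounded:
  assumes p: "cadlag p" and t: "0 \<le> t"
  obtains B where "\<And>s. s \<in> {0..t} \<Longrightarrow> \<bar>p s\<bar> \<le> B"
proof -
  define P where "P u v \<longleftrightarrow> (\<exists>B. \<forall>s. 0 \<le> s \<longrightarrow> u \<le> s \<longrightarrow> s \<le> v \<longrightarrow> \<bar>p s\<bar> \<le> B)" for u v
  have "P 0 t"
  proof (rule Bolzano[OF t])
    fix u v w assume "P u v" "P v w" "u \<le> v" "v \<le> w"
    then obtain B C where "\<And>s. 0 \<le> s \<Longrightarrow> u \<le> s \<Longrightarrow> s \<le> v \<Longrightarrow> \<bar>p s\<bar> \<le> B"
      "\<And>s. 0 \<le> s \<Longrightarrow> v \<le> s \<Longrightarrow> s \<le> w \<Longrightarrow> \<bar>p s\<bar> \<le> C" unfolding P_def by blast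
    then show "P u w" unfolding P_def by (intro exI[of _ "max B C"]) (meson le_max_iff_disj linear)
  next
    fix r assume r: "0 \<le> r" "r \<le> t"
    have "(p \<longlongrightarrow> p r) (at_right r)"
      using p r by (auto simp: cadlag_def continuous_within)
    then have "\<forall>\<^sub>F s in at_right r. p s \<in> {p r - 1<..<p r + 1}"
      by (rule topological_tendstoD) auto
    then obtain v where v: "r < v" "\<And>s. r < s \<Longrightarrow> s < v \<Longrightarrow> p s \<in> {p r - 1<..<p r + 1}"
      unfolding eventually_at_right_field by auto
    have "\<exists>u<r. \<exists>B. \<forall>s. 0 \<le> s \<longrightarrow> u < s \<longrightarrow> s < r \<longrightarrow> \<bar>p s\<bar> \<le> B"
    proof (cases "r = 0")
      case True
      then show ?thesis by (intro exI[of _ "-1"]) auto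
    next
      case False
      then have "0 < r" using r by simp
      then obtain l where "(p \<longlongrightarrow> l) (at_left r)" using p unfolding cadlag_def by blast
      then have "\<forall>\<^sub>F s in at_left r. p s \<in> {l - 1<..<l + 1}"
        by (rule topological_tendstoD) auto
      then obtain u where u: "u < r" "\<And>s. u < s \<Longrightarrow> s < r \<Longrightarrow> p s \<in> {l - 1<..<l + 1}"
        unfolding eventually_at_left_field by auto
      have "\<bar>p s\<bar> \<le> \<bar>l\<bar> + 1" if "u < s" "s < r" for s using u(2)[OF that] by auto
      then show ?thesis using u(1) by blast
    qed
    then obtain u B where u: "u < r" "\<And>s. 0 \<le> s \<Longrightarrow> u < s \<Longrightarrow> s < r \<Longrightarrow> \<bar>p s\<bar> \<le> B" by blast
    show "\<exists>d>0. \<forall>u v. u \<le> r \<and> r \<le> v \<and> v - u < d \<longrightarrow> P u v"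
    proof (intro exI[of _ "min (r - u) (v - r)"] conjI allI impI)
      show "0 < min (r - u) (v - r)" using u(1) v(1) by simp
      fix u' v' assume uv: "u' \<le> r \<and> r \<le> v' \<and> v' - u' < min (r - u) (v - r)"
      have "\<bar>p s\<bar> \<le> max B (\<bar>p r\<bar> + 1)" if s: "0 \<le> s" "u' \<le> s" "s \<le> v'" for s
      proof -
        have s': "u < s" "s < v" using uv s by auto
        consider "s < r" | "s = r" | "r < s" by linarith
        then show ?thesis
        proof cases
          case 1
          then show ?thesis using u(2)[OF s(1) s'(1)] by simp
        next
          case 2
          then show ?thesis by simp
        next
          case 3
          then show ?thesis using v(2)[OF 3 s'(2)] by auto
        qed
      qed
      then show "P u' v'" unfolding P_def by blast
    qed
  qed
  then show thesis using that unfolding P_def by auto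
qed

lemma ruin_time_exit_time:
  assumes ne: "exit_set p 0 a \<noteq> {}" and neg: "p (exit_time p 0 a) < 0"
  shows "ruin_time p = ereal (exit_time p 0 a)"
  unfolding ruin_time_def
proof (rule antisym)
  show "Inf {ereal t |t. 0 \<le> t \<and> p t < 0} \<le> ereal (exit_time p 0 a)"
    using exit_time_nonneg[OF ne] neg by (intro Inf_lower) auto
  show "ereal (exit_time p 0 a) \<le> Inf {ereal t |t. 0 \<le> t \<and> p t < 0}"
    by (intro Inf_greatest) (auto intro!: exit_time_le simp: exit_set_def)
qed

text \<open>Zeros approach the infimum from the right, so right continuity makes it a zero; it
  differs from \<open>T\<close> because \<open>p T < 0\<close>.\<close>

lemma recovery_time_attained:
  assumes p: "cadlag p" and T: "ruin_time p = ereal T" "0 \<le> T" "p T < 0" and fin: "recovery_time p < \<infinity>"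
  obtains T0 where "recovery_time p = ereal T0" "T < T0" "p T0 = 0"
proof -
  define Z where "Z = {t. T < t \<and> p t = 0}"
  have rt: "recovery_time p = Inf (ereal ` Z)"
    unfolding recovery_time_def T Z_def by (rule arg_cong[where f = Inf]) auto
  have ne: "Z \<noteq> {}" using fin unfolding rt by (auto simp: top_ereal_def)
  have bdd: "bdd_below Z" unfolding Z_def by (rule bdd_belowI[of _ T]) auto
  have eq: "recovery_time p = ereal (Inf Z)"
    unfolding rt using ereal_Inf'[OF bdd ne] by simp
  have le: "T \<le> Inf Z" using ne by (rule cInf_greatest) (auto simp: Z_def)
  have "\<exists>s\<in>Z. s < Inf Z + 1 / real (Suc n)" for n
    using cInf_less_iff[OF ne bdd, of "Inf Z + 1 / real (Suc n)"] by auto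
  then obtain s where s: "\<And>n. s n \<in> Z" "\<And>n. s n < Inf Z + 1 / real (Suc n)" by metis
  have lo: "Inf Z \<le> s n" for n by (rule cInf_lower[OF s(1) bdd])
  have "(\<lambda>n. Inf Z + 1 / real (Suc n)) \<longlonglongrightarrow> Inf Z + 0"
    by (intro tendsto_intros LIMSEQ_Suc lim_1_over_n)
  then have lim: "s \<longlonglongrightarrow> Inf Z"
    by (intro tendsto_sandwich[OF always_eventually[OF allI[OF lo]] always_eventually[OF allI[OF less_imp_le[OF s(2)]]] tendsto_const])
      simp
  have "(\<lambda>n. p (s n)) \<longlonglongrightarrow> p (Inf Z)"
    using le T by (intro right_continuousD[OF cadlag_right_continuous[OF p] _ lo lim]) auto
  moreover have "p (s n) = 0" for n using s(1)[of n] by (simp add: Z_def)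
  ultimately have "p (Inf Z) = 0" by (simp add: LIMSEQ_const_iff)
  then show thesis using eq le T(3) by (intro that[of "Inf Z"]) (auto simp: le_less)
qed

text \<open>It decodes the functional into pathwise facts: the bound \<open>a\<close> up to recovery
  makes the ruin time the exit time of \<open>[0, a]\<close>.\<close>

lemma ruin_functional_nonzero:
  assumes p: "cadlag p" "no_positive_jumps p" and x: "0 < p 0" and A: "A \<subseteq> {(y, z). 0 < z}"
    and nz: "ruin_functional q \<beta> a b A p \<noteq> 0"
  obtains T T0 where "T = exit_time p 0 a" "exit_set p 0 a \<noteq> {}" "p T < 0" "(left_limit p T, - p T) \<in> A"
    "T < T0" "p T0 = 0" "\<And>t. t \<in> {0..T0} \<Longrightarrow> - b < p t"
    "ruin_functional q \<beta> a b A p = exp (- q * T - \<beta> * (T0 - T))"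
proof -
  define T where "T = real_of_ereal (ruin_time p)"
  have R: "recovery_time p < \<infinity>" "(left_limit p T, \<bar>p T\<bar>) \<in> A"
    and inf: "running_inf p (real_of_ereal (recovery_time p)) > - b"
    and sup: "running_sup p (real_of_ereal (recovery_time p)) \<le> a"
    and val: "ruin_functional q \<beta> a b A p = exp (- q * T - \<beta> * (real_of_ereal (recovery_time p) - T))"
    using nz unfolding ruin_functional_def Let_def T_def by (auto split: if_splits)
  have "ruin_time p < \<infinity>"
  proof (rule ccontr)
    assume "\<not> ruin_time p < \<infinity>"
    then have "recovery_time p = \<infinity>" unfolding recovery_time_def by (simp add: top_ereal_def)
    then show False using R(1) by simp
  qed
  moreover have "0 \<le> ruin_time p" unfolding ruin_time_def by (intro Inf_greatest) auto
  ultimately have rt: "ruin_time p = ereal T" and T0: "0 \<le> T"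
    unfolding T_def by (cases "ruin_time p"; simp)+
  have before: "0 \<le> p t" if "0 \<le> t" "t < T" for t
  proof (rule ccontr)
    assume "\<not> 0 \<le> p t"
    then have "ruin_time p \<le> ereal t" unfolding ruin_time_def using that by (intro Inf_lower) auto
    then show False using rt that by simp
  qed
  have "p T \<le> 0"
  proof (rule ccontr)
    assume "\<not> p T \<le> 0"
    then have pos: "p T \<in> {0<..}" by simp
    obtain e where e: "0 < e" "\<And>s. T \<le> s \<Longrightarrow> s < T + e \<Longrightarrow> p s \<in> {0<..}"
      using right_continuous_exit_nbhd[OF cadlag_right_continuous[OF p(1)] T0 _ pos] by auto
    have "ereal (T + e) \<le> ruin_time p" unfolding ruin_time_def
    proof (rule Inf_greatest)
      fix t' assume "t' \<in> {ereal t |t. 0 \<le> t \<and> p t < 0}"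
      then obtain t where t: "t' = ereal t" "0 \<le> t" "p t < 0" by auto
      then have "\<not> t < T" using before[of t] by auto
      then have "\<not> t < T + e" using e(2)[of t] t(3) by auto
      then show "ereal (T + e) \<le> t'" using t by simp
    qed
    then show False using rt e(1) by simp
  qed
  \<comment> \<open>\<open>A\<close> lies in \<open>z > 0\<close>, which excludes a path sitting at
    0 at the ruin time.\<close>
  moreover have "p T \<noteq> 0" using R(2) A by auto
  ultimately have neg: "p T < 0" by simp
  obtain T0' where T0': "recovery_time p = ereal T0'" "T < T0'" "p T0' = 0"
    using recovery_time_attained[OF p(1) rt T0 neg R(1)] .
  have T0'0: "0 \<le> T0'" using T0 T0' by simp
  obtain B where B: "\<And>s. s \<in> {0..T0'} \<Longrightarrow> \<bar>p s\<bar> \<le> B" using cadlag_bounded[OF p(1) T0'0] by blast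
  have bdd: "bdd_above (p ` {0..T0'})" "bdd_below (p ` {0..T0'})"
    using B by (auto intro!: bdd_aboveI2[where M = B] bdd_belowI2[where m = "- B"] simp: abs_le_iff minus_le_iff)
  have lo: "- b < p t" if "t \<in> {0..T0'}" for t
    using cINF_lower[OF bdd(2) that] inf T0' by (simp add: running_inf_def)
  have hi: "p t \<le> a" if "t \<in> {0..T0'}" for t
    using cSUP_upper[OF that bdd(1)] sup T0' by (simp add: running_sup_def)
  have TE: "T \<in> exit_set p 0 a" using neg T0 by (simp add: exit_set_def)
  have D: "exit_time p 0 a = T"
  proof (rule exit_time_eqI[OF T0])
    show "p t \<in> {0..a}" if "0 \<le> t" "t < T" for t using before[OF that] hi[of t] that T0' by auto
    show "\<exists>t\<in>exit_set p 0 a. t < T + e" if "0 < e" for e using TE that by (intro bexI[of _ T]) auto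
  qed
  show thesis
  proof (rule that[of T T0'])
    show "(left_limit p T, - p T) \<in> A" using R(2) neg by simp
    show "ruin_functional q \<beta> a b A p = exp (- q * T - \<beta> * (T0' - T))" unfolding val T0' by simp
    show "exit_set p 0 a \<noteq> {}" using TE by auto
  qed (use D neg T0' lo in auto)
qed

text \<open>To reach 0 from below \<open>- d\<close> the path must leave \<open>[- b, - d]\<close>
  first, and as it stays above \<open>- b\<close>, it leaves at the top. This happens no later than
  recovery, so it is discounted less.\<close>

lemma ruin_ind_upper:
  assumes p: "cadlag p" "no_positive_jumps p" and x: "0 < p 0" and \<beta>: "0 \<le> \<beta>"
    and A: "A \<subseteq> {(y, z). 0 < y \<and> y < a \<and> 0 < z \<and> z < b}" and nz: "ruin_functional q \<beta> a b A p \<noteq> 0"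
    and d: "0 < d" "d < - p (exit_time p 0 a)"
  shows "ennreal (ruin_functional q \<beta> a b A p) \<le> ruin_ind q (recovery_weight \<beta> b d) (A \<inter> ({0<..<a} \<times> {d<..<b})) p a"
proof -
  have "A \<subseteq> {(y, z). 0 < z}" using A by auto
  from ruin_functional_nonzero[OF p x this nz] obtain T T0
    where T: "T = exit_time p 0 a" "exit_set p 0 a \<noteq> {}" "p T < 0" "(left_limit p T, - p T) \<in> A"
    "T < T0" "p T0 = 0" and lo: "\<And>t. t \<in> {0..T0} \<Longrightarrow> - b < p t"
    and val: "ruin_functional q \<beta> a b A p = exp (- q * T - \<beta> * (T0 - T))" by blast
  have T0: "0 \<le> T" using exit_time_nonneg[OF T(2)] T(1) by simp
  let ?s = "shift_path p T"
  have e: "T0 - T \<in> exit_set ?s (- b) (- d)" using T d by (simp add: exit_set_def shift_path_def)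
  then have ne: "exit_set ?s (- b) (- d) \<noteq> {}" by auto
  let ?D = "exit_time ?s (- b) (- d)"
  have D: "0 \<le> ?D" "?D \<le> T0 - T" using exit_time_nonneg[OF ne] exit_time_le[OF e] by auto
  have "- b < p T" using lo[of T] T0 T by simp
  then have bd: "d < b" using d T by simp
  have "?s ?D \<le> - b \<or> ?s ?D = - d"
    using bd d T by (intro exit_position[OF cadlag_shift[OF p(1) T0] no_positive_jumps_shift[OF p(2) T0] _ ne])
      (auto simp: shift_path_def)
  moreover have "- b < ?s ?D" using lo[of "T + ?D"] D T0 by (simp add: shift_path_def)
  ultimately have "?s ?D = - d" by simp
  then have rw: "recovery_weight \<beta> b d ?s = exp (- \<beta> * ?D)"
    using ne bd by (simp add: recovery_weight_def exit_val_def top_weight_top)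
  have "(left_limit p T, - p T) \<in> A \<inter> ({0<..<a} \<times> {d<..<b})" using T d A by auto
  then have ind: "ruin_ind q (recovery_weight \<beta> b d) (A \<inter> ({0<..<a} \<times> {d<..<b})) p a = ennreal (exp (- q * T) * exp (- \<beta> * ?D))"
    using T(2) by (simp add: ruin_ind_def rw T(1)[symmetric])
  have "\<beta> * ?D \<le> \<beta> * (T0 - T)" using \<beta> D by (intro mult_left_mono) auto
  then show ?thesis unfolding ind val by (intro ennreal_leI) (simp flip: exp_add)
qed

text \<open>Leaving \<open>[- c, 0]\<close> at the top means being at 0, hence recovery has occurred
  by then. Until then the path stays at or above \<open>- c > - b\<close> and at or below
  \<open>a\<close>; the strict inequality for the infimum is the reason for
  \<open>c < b\<close>.\<close>

lemma ruin_ind_lower: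
  assumes p: "cadlag p" "no_positive_jumps p" and \<beta>: "0 \<le> \<beta>" and a: "0 < a" and c: "0 < c" "c < b"
  shows "ruin_ind q (recovery_weight \<beta> c 0) (A \<inter> ({0<..<a} \<times> {0<..<c})) p a \<le> ennreal (ruin_functional q \<beta> a b A p)"
proof (cases "ruin_ind q (recovery_weight \<beta> c 0) (A \<inter> ({0<..<a} \<times> {0<..<c})) p a = 0")
  case False
  let ?T = "exit_time p 0 a"
  let ?s = "shift_path p ?T"
  have T: "exit_set p 0 a \<noteq> {}" "recovery_weight \<beta> c 0 ?s \<noteq> 0" "(left_limit p ?T, - p ?T) \<in> A" "p ?T < 0"
    using False by (auto simp: ruin_ind_def indicator_def split: if_splits)
  have T0: "0 \<le> ?T" using exit_time_nonneg[OF T(1)] .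
  have rt: "ruin_time p = ereal ?T" using ruin_time_exit_time T by blast
  have ne: "exit_set ?s (- c) 0 \<noteq> {}" using T(2) by (auto simp: recovery_weight_def exit_val_def)
  let ?D = "exit_time ?s (- c) 0"
  have D: "0 \<le> ?D" using exit_time_nonneg[OF ne] .
  have "?s ?D \<le> - c \<or> ?s ?D = 0"
    using c T by (intro exit_position[OF cadlag_shift[OF p(1) T0] no_positive_jumps_shift[OF p(2) T0] _ ne])
      (auto simp: shift_path_def)
  moreover have "\<not> ?s ?D \<le> - c"
    using T(2) ne c top_weight_bot[of "- c" 0] by (auto simp: recovery_weight_def exit_val_def)
  ultimately have sD: "?s ?D = 0" by simp
  then have rw: "recovery_weight \<beta> c 0 ?s = exp (- \<beta> * ?D)"
    using ne c top_weight_top[of "- c" 0] by (simp add: recovery_weight_def exit_val_def)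
  have D0: "?D \<noteq> 0"
  proof
    assume "?D = 0"
    then show False using sD T(4) by (simp add: shift_path_def)
  qed
  have rec: "recovery_time p \<le> ereal (?T + ?D)"
    unfolding recovery_time_def rt using D D0 sD by (intro Inf_lower) (auto simp: shift_path_def)
  then have fin: "recovery_time p < \<infinity>" by (rule le_less_trans) simp
  obtain T0' where T0': "recovery_time p = ereal T0'" "?T < T0'" "p T0' = 0"
    using recovery_time_attained[OF p(1) rt T0 T(4) fin] .
  have le: "T0' \<le> ?T + ?D" using rec T0' by simp
  have bnd: "p t \<in> {- c..a}" if t: "t \<in> {0..T0'}" for t
  proof (cases "t < ?T")
    case True
    then show ?thesis using before_exit_time[of t p 0 a] t c by auto
  next
    case False
    show ?thesis
    proof (cases "t - ?T < ?D")
      case True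
      then show ?thesis using before_exit_time[of "t - ?T" ?s "- c" 0] False a by (auto simp: shift_path_def)
    next
      case F: False
      then have "t = ?T + ?D" using t le by auto
      then show ?thesis using sD c a by (simp add: shift_path_def)
    qed
  qed
  have ne0: "{0..T0'} \<noteq> {}" using T0 T0' by auto
  have "- c \<le> running_inf p T0'" unfolding running_inf_def
    by (rule cINF_greatest[OF ne0]) (use bnd in auto)
  then have inf: "- b < running_inf p T0'" using c by simp
  have sup: "running_sup p T0' \<le> a" unfolding running_sup_def
    by (rule cSUP_least[OF ne0]) (use bnd in auto)
  have val: "ruin_functional q \<beta> a b A p = exp (- q * ?T - \<beta> * (T0' - ?T))"
    using inf sup T by (simp add: ruin_functional_def rt T0' Let_def)
  have "\<beta> * (T0' - ?T) \<le> \<beta> * ?D" using \<beta> le by (intro mult_left_mono) auto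
  moreover have "ruin_ind q (recovery_weight \<beta> c 0) (A \<inter> ({0<..<a} \<times> {0<..<c})) p a \<le> ennreal (exp (- q * ?T) * exp (- \<beta> * ?D))"
    using T(1) by (auto simp: ruin_ind_def rw indicator_def)
  ultimately show ?thesis unfolding val
    by (elim order_trans) (intro ennreal_leI, simp flip: exp_add)
qed simp

section \<open>A regular version, growth of the exponent, positivity of scale functions\<close>

context spectrally_negative_levy
begin

definition regular_paths :: "'a set" where
  "regular_paths = {\<omega>\<in>space M. X 0 \<omega> = 0 \<and> cadlag (\<lambda>t. X t \<omega>) \<and> no_positive_jumps (\<lambda>t. X t \<omega>)}"

text \<open>A version of the process under \<open>P\<^sub>x\<close> all of whose paths are regular; it is adapted because the filtration is complete.\<close>

definition started :: "real \<Rightarrow> real \<Rightarrow> 'a \<Rightarrow> real" where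
  "started x t \<omega> = (if \<omega> \<in> regular_paths then x + X t \<omega> else x)"

definition law :: "real \<Rightarrow> real measure" where
  "law t = distr M borel (\<lambda>\<omega>. X t \<omega> - X 0 \<omega>)"

lemma AE_regular: "AE \<omega> in M. \<omega> \<in> regular_paths"
  using start cadlag_paths spectrally_negative AE_space unfolding regular_paths_def by eventually_elim simp

lemma regular_sets: assumes "0 \<le> t" shows "regular_paths \<in> sets (F t)"
proof -
  have sp: "space (F t) = space M" using space_F by simp
  obtain N where N: "{\<omega>\<in>space M. \<omega> \<notin> regular_paths} \<subseteq> N" "N \<in> null_sets M"
    using AE_regular by (auto elim!: AE_E2 simp: eventually_ae_filter)
  then have "{\<omega>\<in>space M. \<omega> \<notin> regular_paths} \<in> null_sets M" using complete2 by blast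
  then have "{\<omega>\<in>space M. \<omega> \<notin> regular_paths} \<in> sets (F t)"
    using complete_F sets_F_mono[OF assms] by blast
  then have "space (F t) - {\<omega>\<in>space M. \<omega> \<notin> regular_paths} \<in> sets (F t)" by (rule sets.compl_sets)
  moreover have "space (F t) - {\<omega>\<in>space M. \<omega> \<notin> regular_paths} = regular_paths"
    unfolding sp by (auto simp: regular_paths_def)
  ultimately show ?thesis by simp
qed

lemma X_measurable: "0 \<le> t \<Longrightarrow> X t \<in> borel_measurable M"
  using measurable_from_subalg[OF subalgebra_F adapted] .

lemma left_limit_add:
  assumes "cadlag p" "0 < t" shows "left_limit (\<lambda>t. x + p t) t = x + left_limit p t"
proof -
  obtain l where l: "(p \<longlongrightarrow> l) (at_left t)" using assms by (auto simp: cadlag_def)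
  then have "((\<lambda>t. x + p t) \<longlongrightarrow> x + l) (at_left t)" by (intro tendsto_intros)
  then show ?thesis using l unfolding left_limit_def by (simp add: tendsto_Lim)
qed

lemma cadlag_add: assumes "cadlag p" shows "cadlag (\<lambda>t. x + p t)"
  unfolding cadlag_def
proof (intro conjI allI impI)
  show "continuous (at_right t) (\<lambda>t. x + p t)" if "0 \<le> t" for t
    using assms that by (intro continuous_add continuous_const) (simp add: cadlag_def)
  show "\<exists>l. ((\<lambda>t. x + p t) \<longlongrightarrow> l) (at_left t)" if t: "0 < t" for t
  proof -
    obtain l where "(p \<longlongrightarrow> l) (at_left t)" using assms t unfolding cadlag_def by blast
    from tendsto_add[OF tendsto_const this] show ?thesis by blast
  qed
qed

lemma cadlag_const: "cadlag (\<lambda>t. x)"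
  unfolding cadlag_def by (intro conjI allI impI exI[of _ x] tendsto_const continuous_const)

lemma started_path:
  "cadlag (\<lambda>t. started x t \<omega>)" "no_positive_jumps (\<lambda>t. started x t \<omega>)" "started x 0 \<omega> = x"
proof -
  show "cadlag (\<lambda>t. started x t \<omega>)"
  proof (cases "\<omega> \<in> regular_paths")
    case True
    then have "cadlag (\<lambda>t. X t \<omega>)" by (simp add: regular_paths_def)
    from cadlag_add[OF this] show ?thesis using True by (simp add: started_def)
  qed (simp add: started_def cadlag_const)
  show "no_positive_jumps (\<lambda>t. started x t \<omega>)"
  proof (cases "\<omega> \<in> regular_paths")
    case True
    then show ?thesis by (auto simp: started_def regular_paths_def no_positive_jumps_def left_limit_add)
  next
    case False
    have "left_limit (\<lambda>t. x) t = x" for t :: real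
      unfolding left_limit_def by (intro tendsto_Lim) auto
    then show ?thesis using False by (simp add: started_def no_positive_jumps_def)
  qed
  show "started x 0 \<omega> = x" by (auto simp: started_def regular_paths_def)
qed

lemma AE_started: "AE \<omega> in M. \<forall>t. started x t \<omega> = x + X t \<omega>"
  using AE_regular by eventually_elim (simp add: started_def)

lemma sets_law [simp]: "sets (law t) = sets borel"
  by (simp add: law_def)

lemma prob_law: "0 \<le> t \<Longrightarrow> prob_space (law t)"
  unfolding law_def by (intro prob_space_distr borel_measurable_diff X_measurable) auto

lemma increment_law:
  assumes "0 \<le> s" "s \<le> t" "B \<in> sets borel"
  shows "emeasure M {\<omega>\<in>space M. X t \<omega> - X s \<omega> \<in> B} = emeasure (law (t - s)) B"
proof -
  have "emeasure (distr M borel (\<lambda>\<omega>. X t \<omega> - X s \<omega>)) B = emeasure (law (t - s)) B"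
    using stationary_increments[OF assms(1,2)] by (simp add: law_def)
  moreover have "(\<lambda>\<omega>. X t \<omega> - X s \<omega>) \<in> borel_measurable M"
    using assms by (intro borel_measurable_diff X_measurable) auto
  ultimately show ?thesis using assms(3) by (simp add: emeasure_distr vimage_def Int_def conj_commute)
qed

lemma law_laplace:
  assumes \<alpha>: "0 \<le> \<alpha>" and t: "0 \<le> t"
  shows "(\<integral>\<^sup>+u. ennreal (exp (\<alpha> * u)) \<partial>law t) = ennreal (exp (t * laplace_exponent \<mu> \<sigma> \<nu> \<alpha>))"
proof -
  note [measurable] = X_measurable[OF t] X_measurable[OF order_refl]
  have "(\<integral>\<^sup>+u. ennreal (exp (\<alpha> * u)) \<partial>law t) = (\<integral>\<^sup>+\<omega>. ennreal (exp (\<alpha> * (X t \<omega> - X 0 \<omega>))) \<partial>M)"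
    unfolding law_def by (subst nn_integral_distr) auto
  also have "\<dots> = (\<integral>\<^sup>+\<omega>. ennreal (exp (\<alpha> * X t \<omega>)) \<partial>M)"
    by (intro nn_integral_cong_AE) (use start in eventually_elim, simp)
  also have "\<dots> = ennreal (expectation (\<lambda>\<omega>. exp (\<alpha> * X t \<omega>)))"
  proof (rule nn_integral_eq_integral)
    \<comment> \<open>A non-integrable function would have integral 0, whereas the exponential is
      positive.\<close>
    have "expectation (\<lambda>\<omega>. exp (\<alpha> * X t \<omega>)) \<noteq> 0" unfolding laplace[OF \<alpha> t] by simp
    then show "integrable M (\<lambda>\<omega>. exp (\<alpha> * X t \<omega>))" using not_integrable_integral_eq by blast
  qed simp
  finally show ?thesis unfolding laplace[OF \<alpha> t] .
qed

text \<open>Otherwise all increments are almost surely at most 0. Over rational times this holds for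
  all pairs at once, and right continuity extends it to all times, against
  \<open>not_decreasing\<close>.\<close>

lemma upward_increment: "\<exists>t\<ge>0. \<exists>\<delta>>0. emeasure (law t) {\<delta><..} \<noteq> 0"
proof (rule ccontr)
  assume "\<not> ?thesis"
  then have z: "emeasure (law t) {\<delta><..} = 0" if "0 \<le> t" "0 < \<delta>" for t \<delta> using that by blast
  have z0: "emeasure (law t) {0<..} = 0" if t: "0 \<le> t" for t
  proof -
    have "(\<Union>n. {1 / real (Suc n)<..}) \<in> null_sets (law t)"
      using z[OF t] by (intro null_sets_UN) (auto simp: null_sets_def)
    moreover have "(\<Union>n. {1 / real (Suc n)<..}) = {0::real<..}"
    proof safe
      fix n and r :: real assume "1 / real (Suc n) < r"
      moreover have "0 < 1 / real (Suc n)" by simp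
      ultimately show "0 < r" by (rule less_trans[rotated])
    next
      fix r :: real assume "0 < r"
      then obtain n where "inverse (real (Suc n)) < r" using reals_Archimedean by blast
      then show "r \<in> (\<Union>n. {1 / real (Suc n)<..})" by (auto simp: inverse_eq_divide)
    qed
    ultimately show ?thesis by (simp add: null_sets_def)
  qed
  have "AE \<omega> in M. X t \<omega> \<le> X s \<omega>" if st: "0 \<le> s" "s \<le> t" for s t
  proof -
    have [measurable]: "X s \<in> borel_measurable M" "X t \<in> borel_measurable M" using st by (auto intro: X_measurable)
    have "{\<omega>\<in>space M. X t \<omega> - X s \<omega> \<in> {0<..}} \<in> sets M" by measurable
    moreover have "emeasure M {\<omega>\<in>space M. X t \<omega> - X s \<omega> \<in> {0<..}} = 0"
      using z0[of "t - s"] st increment_law[OF st, of "{0<..}"] by simp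
    ultimately show ?thesis by (intro AE_I[of _ _ "{\<omega>\<in>space M. X t \<omega> - X s \<omega> \<in> {0<..}}"]) auto
  qed
  then have "AE \<omega> in M. \<forall>(s, t)\<in>{(s, t). s \<in> \<rat> \<and> t \<in> \<rat> \<and> 0 \<le> s \<and> s \<le> t}. X t \<omega> \<le> X s \<omega>"
  proof (intro AE_ball_countable[THEN iffD2] ballI)
    have "countable (\<rat> \<times> \<rat> :: (real \<times> real) set)" using countable_rat by (intro countable_SIGMA) auto
    then show "countable {(s, t :: real). s \<in> \<rat> \<and> t \<in> \<rat> \<and> 0 \<le> s \<and> s \<le> t}"
      by (rule countable_subset[rotated]) auto
  qed auto
  then have "AE \<omega> in M. antimono_on {0..} (\<lambda>t. X t \<omega>)"
    using cadlag_paths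
  proof eventually_elim
    case (elim \<omega>)
    show ?case
    proof (rule monotone_onI)
      fix s t :: real assume st: "s \<in> {0..}" "t \<in> {0..}" "s \<le> t"
      show "X t \<omega> \<le> X s \<omega>"
      proof (cases "s = t")
        case False
        then have lt: "s < t" using st by simp
        have ex: "\<exists>r\<in>\<rat>. u < r \<and> r < v" if "u < v" for u v :: real using Rats_dense_in_real[OF that] by blast
        \<comment> \<open>Rationals decreasing to \<open>s\<close> but below \<open>t\<close>, and
          others decreasing to \<open>t\<close>: both limits are from the right and the order is
          preserved.\<close>
        have "\<exists>r\<in>\<rat>. s < r \<and> r < min t (s + 1 / real (Suc n))" for n using lt by (intro ex) simp
        then obtain r where r: "\<And>n. r n \<in> \<rat>" "\<And>n. s < r n" "\<And>n. r n < min t (s + 1 / real (Suc n))" by metis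
        have "\<exists>r\<in>\<rat>. t < r \<and> r < t + 1 / real (Suc n)" for n by (intro ex) simp
        then obtain r' where r': "\<And>n. r' n \<in> \<rat>" "\<And>n. t < r' n" "\<And>n. r' n < t + 1 / real (Suc n)" by metis
        have lim: "(\<lambda>n. v + 1 / real (Suc n)) \<longlonglongrightarrow> v" for v
          using tendsto_add[OF tendsto_const[of v] LIMSEQ_Suc[OF lim_1_over_n]] by simp
        have conv: "w \<longlonglongrightarrow> v" if "\<And>n. v < w n" "\<And>n. w n < v + 1 / real (Suc n)" for w and v :: real
          by (rule tendsto_sandwich[OF always_eventually[OF allI[OF less_imp_le[OF that(1)]]]
                always_eventually[OF allI[OF less_imp_le[OF that(2)]]] tendsto_const lim])
        have rs: "r \<longlonglongrightarrow> s" using r by (intro conv) auto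
        have rt: "r' \<longlonglongrightarrow> t" using r' by (intro conv) auto
        note rc = cadlag_right_continuous[OF elim(2)]
        have "(\<lambda>n. X (r n) \<omega>) \<longlonglongrightarrow> X s \<omega>"
          by (rule right_continuousD[OF rc _ less_imp_le[OF r(2)] rs]) (use st in simp)
        moreover have "(\<lambda>n. X (r' n) \<omega>) \<longlonglongrightarrow> X t \<omega>"
          by (rule right_continuousD[OF rc _ less_imp_le[OF r'(2)] rt]) (use st in simp)
        moreover have "X (r' n) \<omega> \<le> X (r n) \<omega>" for n
        proof -
          have "r n < t" using r(3)[of n] by simp
          then have "r n \<le> r' n" using r'(2)[of n] by simp
          moreover have "0 \<le> r n" using r(2)[of n] st by simp
          ultimately show ?thesis using elim(1) r(1) r'(1) by auto
        qed
        ultimately show ?thesis by (intro LIMSEQ_le) auto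
      qed simp
    qed
  qed
  then show False using not_decreasing by simp
qed

text \<open>Increments above \<open>\<delta>\<close> have positive probability \<open>P\<close> for
  some \<open>t\<close>, so the exponential moment is at least
  \<open>P * exp (\<alpha> * \<delta>)\<close>; taking logarithms, the exponent grows at least
  linearly.\<close>

lemma laplace_exponent_at_top: "filterlim (laplace_exponent \<mu> \<sigma> \<nu>) at_top at_top"
proof -
  obtain t \<delta> where t: "0 \<le> t" and \<delta>: "0 < \<delta>" and nz: "emeasure (law t) {\<delta><..} \<noteq> 0" using upward_increment by blast
  interpret L: prob_space "law t" using prob_law[OF t] .
  define P where "P = measure (law t) {\<delta><..}"
  have P: "0 < P" using nz unfolding P_def measure_def
    by (simp add: enn2real_positive_iff less_top[symmetric] zero_less_iff_neq_zero)
  have bnd: "\<alpha> * \<delta> + ln P \<le> t * laplace_exponent \<mu> \<sigma> \<nu> \<alpha>" if \<alpha>: "0 \<le> \<alpha>" for \<alpha>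
  proof -
    have "ennreal (exp (\<alpha> * \<delta>) * P) = (\<integral>\<^sup>+u. ennreal (exp (\<alpha> * \<delta>)) * indicator {\<delta><..} u \<partial>law t)"
      by (simp add: nn_integral_cmult_indicator P_def ennreal_mult L.emeasure_eq_measure)
    also have "\<dots> \<le> (\<integral>\<^sup>+u. ennreal (exp (\<alpha> * u)) \<partial>law t)"
      using \<alpha> by (intro nn_integral_mono) (auto simp: indicator_def intro!: ennreal_leI mult_left_mono)
    also have "\<dots> = ennreal (exp (t * laplace_exponent \<mu> \<sigma> \<nu> \<alpha>))" by (rule law_laplace[OF \<alpha> t])
    finally have "exp (\<alpha> * \<delta>) * P \<le> exp (t * laplace_exponent \<mu> \<sigma> \<nu> \<alpha>)" by simp
    then have "ln (exp (\<alpha> * \<delta>) * P) \<le> ln (exp (t * laplace_exponent \<mu> \<sigma> \<nu> \<alpha>))" using P by (subst ln_le_cancel_iff) auto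
    then show ?thesis using P by (simp add: ln_mult)
  qed
  \<comment> \<open>At \<open>t = 0\<close> the bound would keep
    \<open>\<alpha> * \<delta> + ln P\<close> nonpositive for all
    \<open>\<alpha> \<ge> 0\<close>.\<close>
  have t0: "0 < t"
  proof (rule ccontr)
    assume "\<not> 0 < t"
    then have "\<alpha> * \<delta> + ln P \<le> 0" if "0 \<le> \<alpha>" for \<alpha> using bnd[OF that] t by simp
    from this[of "(\<bar>ln P\<bar> + 1) / \<delta>"] show False using \<delta> by simp
  qed
  have "0 < \<delta> / t" using \<delta> t0 by simp
  from filterlim_tendsto_pos_mult_at_top[OF tendsto_const this filterlim_ident]
  have "filterlim (\<lambda>\<alpha>. ln P / t + (\<delta> / t) * \<alpha>) at_top at_top"
    by (rule filterlim_tendsto_add_at_top[OF tendsto_const])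
  then show ?thesis
  proof (rule filterlim_at_top_mono)
    show "\<forall>\<^sub>F \<alpha> in at_top. ln P / t + (\<delta> / t) * \<alpha> \<le> laplace_exponent \<mu> \<sigma> \<nu> \<alpha>"
      using eventually_ge_at_top[of 0]
    proof eventually_elim
      case (elim \<alpha>)
      have "ln P / t + (\<delta> / t) * \<alpha> = (\<alpha> * \<delta> + ln P) / t" by (simp add: add_divide_distrib mult.commute add.commute)
      also have "\<dots> \<le> laplace_exponent \<mu> \<sigma> \<nu> \<alpha>" using bnd[OF elim] t0 by (simp add: pos_divide_le_eq mult.commute)
      finally show ?case .
    qed
  qed
qed

lemma levy_exit_started: "levy_exit M F (started x) \<mu> \<sigma> \<nu> law"
proof (intro levy_exit.intro levy_semigroup.intro exit_process.intro exit_process_axioms.intro)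
  show "sets (F s) \<subseteq> sets (F t)" if "0 \<le> s" "s \<le> t" for s t using sets_F_mono[OF that(2)] by simp
  show "started x t \<in> borel_measurable (F t)" if t: "0 \<le> t" for t
    unfolding started_def[abs_def] using adapted[OF t] regular_sets[OF t] by measurable
  show "emeasure M (A \<inter> {\<omega>\<in>space M. started x (s + t) \<omega> - started x s \<omega> \<in> B}) = emeasure M A * emeasure (law t) B"
    if s: "0 \<le> s" and t: "0 \<le> t" and A: "A \<in> sets (F s)" and B: "B \<in> sets borel" for s t A B
  proof -
    let ?E = "{\<omega>\<in>space M. X (s + t) \<omega> - X s \<omega> \<in> B}"
    have st: "s \<le> s + t" using t by simp
    have [measurable]: "A \<in> sets M" using A subalgebra_F[OF s] by (auto simp: subalgebra_def)
    have [measurable]: "X s \<in> borel_measurable M" "X (s + t) \<in> borel_measurable M" using s t by (auto intro: X_measurable)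
    have sm: "started x u \<in> borel_measurable M" if "0 \<le> u" for u
      unfolding started_def[abs_def]
      using X_measurable[OF that] regular_sets[OF that] subalgebra_F[OF that] by (auto simp: subalgebra_def intro!: measurable_If_set)
    have "0 \<le> s + t" using s t by simp
    note [measurable] = sm[OF s] sm[OF this] B
    have E: "?E \<in> sets (vimage_algebra (space M) (\<lambda>\<omega>. X (s + t) \<omega> - X s \<omega>) borel)"
      using in_vimage_algebra[OF B, of "\<lambda>\<omega>. X (s + t) \<omega> - X s \<omega>" "space M"] by (simp add: vimage_def Int_def conj_commute)
    have "emeasure M (A \<inter> {\<omega>\<in>space M. started x (s + t) \<omega> - started x s \<omega> \<in> B}) = emeasure M (A \<inter> ?E)"
    proof (rule emeasure_eq_AE)
      show "AE \<omega> in M. (\<omega> \<in> A \<inter> {\<omega>\<in>space M. started x (s + t) \<omega> - started x s \<omega> \<in> B}) = (\<omega> \<in> A \<inter> ?E)"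
        using AE_started[of x] by eventually_elim simp
      show "A \<inter> {\<omega>\<in>space M. started x (s + t) \<omega> - started x s \<omega> \<in> B} \<in> sets M"
        by (rule sets.Int) measurable
    qed measurable
    also have "\<dots> = emeasure M A * emeasure M ?E"
      using indep_setD[OF independent_increments[OF s st] A E] by (simp add: emeasure_eq_measure ennreal_mult)
    also have "emeasure M ?E = emeasure (law t) B" using increment_law[OF s st B] by simp
    finally show ?thesis .
  qed
qed (rule sets_Levy_measure Levy_measure_support Levy_measure_finite prob_law sets_law law_laplace
    subalgebra_F started_path laplace_exponent_at_top finite_measure_axioms | assumption)+

text \<open>Some \<open>y\<close> below \<open>v\<close> has \<open>W y \<noteq> 0\<close>. Starting
  at \<open>y\<close>, the exit identity on \<open>[0, v]\<close> equates a multiple of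
  \<open>W v\<close> with \<open>W y\<close>, so \<open>W v\<close> is not 0 either.\<close>

lemma scale_pos:
  assumes W: "is_scale_function (laplace_exponent \<mu> \<sigma> \<nu>) q W" and q: "0 \<le> q" and v: "0 < v"
  shows "0 < W v"
proof -
  interpret E: levy_exit M F "started x" \<mu> \<sigma> \<nu> law for x by (rule levy_exit_started)
  have "v / 2 \<in> {0<..<v}" using v by simp
  from E.scale_not_zero[OF v q this started_path(3) W]
  obtain y where y: "0 < y" "y < v" "W y \<noteq> 0" by (auto simp: emeasure_space_1)
  have "E.top_mass y q 0 v * ennreal (W (v - 0)) = (\<integral>\<^sup>+\<omega>. ennreal (W (started y 0 \<omega> - 0)) \<partial>M)"
    using y by (intro E.scale_exit[OF v q y(1) _ _ W]) (auto simp: started_path)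
  also have "\<dots> = ennreal (W y)" by (simp add: started_path emeasure_space_1)
  finally have "W v \<noteq> 0" using y W by (auto simp: is_scale_function_def ennreal_eq_0_iff order_antisym)
  then show ?thesis using W by (auto simp: is_scale_function_def less_le)
qed

end

lemma (in complete_measure) borel_measurable_AE_eq:
  fixes f g :: "'a \<Rightarrow> real"
  assumes g: "g \<in> borel_measurable M" and eq: "AE \<omega> in M. f \<omega> = g \<omega>"
  shows "f \<in> borel_measurable M"
proof (rule measurableI)
  obtain N where N: "{\<omega>\<in>space M. f \<omega> \<noteq> g \<omega>} \<subseteq> N" "N \<in> null_sets M" using eq by (auto simp: eventually_ae_filter)
  fix S :: "real set" assume S: "S \<in> sets borel"
  have "f -` S \<inter> space M = (g -` S \<inter> space M - N) \<union> (f -` S \<inter> space M \<inter> N)" using N(1) by auto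
  moreover have "f -` S \<inter> space M \<inter> N \<in> sets M" by (rule complete[OF Int_lower2 N(2)])
  moreover have "g -` S \<inter> space M - N \<in> sets M" using N(2) measurable_sets[OF g S] by (intro sets.Diff) auto
  ultimately show "f -` S \<inter> space M \<in> sets M" by (metis sets.Un)
qed simp

lemma AE_eq_of_nn_integral_le:
  assumes m: "f \<in> borel_measurable M" "g \<in> borel_measurable M" and le: "\<And>\<omega>. \<omega> \<in> space M \<Longrightarrow> f \<omega> \<le> g \<omega>"
    and int: "(\<integral>\<^sup>+\<omega>. g \<omega> \<partial>M) \<le> (\<integral>\<^sup>+\<omega>. f \<omega> \<partial>M)" "(\<integral>\<^sup>+\<omega>. f \<omega> \<partial>M) < \<infinity>"
  shows "AE \<omega> in M. f \<omega> = g \<omega>"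
proof -
  have "(\<integral>\<^sup>+\<omega>. g \<omega> - f \<omega> \<partial>M) = (\<integral>\<^sup>+\<omega>. g \<omega> \<partial>M) - (\<integral>\<^sup>+\<omega>. f \<omega> \<partial>M)"
    using int le by (intro nn_integral_diff m) auto
  also have "\<dots> = 0" using int by (intro diff_eq_0_ennreal) auto
  finally have "AE \<omega> in M. g \<omega> - f \<omega> = 0" using m by (subst (asm) nn_integral_0_iff_AE) auto
  moreover have "AE \<omega> in M. f \<omega> \<noteq> \<infinity>" using int m by (intro nn_integral_PInf_AE) auto
  ultimately show ?thesis using AE_space
  proof eventually_elim
    case (elim \<omega>)
    have "g \<omega> \<le> f \<omega>" using elim(1,2) by (simp add: diff_eq_0_iff_ennreal)
    then show ?case using le[OF elim(3)] by (rule antisym[rotated])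
  qed
qed

lemma pos_part_scale_eq: "is_scale_function \<phi> q W \<Longrightarrow> v \<noteq> 0 \<Longrightarrow> pos_part_scale W v = W v"
  by (cases "0 < v") (auto simp: pos_part_scale_pos pos_part_scale_neg is_scale_function_def)

lemma scale_borel_measurable:
  assumes "is_scale_function \<phi> q W" shows "W \<in> borel_measurable borel"
proof -
  have "W = (\<lambda>v. if v = 0 then W 0 else pos_part_scale W v)" using pos_part_scale_eq[OF assms] by auto
  also have "\<dots> \<in> borel_measurable borel" using scale_measurable[OF assms] by measurable
  finally show ?thesis .
qed

lemma AE_lborel_fst:
  fixes P :: "real \<Rightarrow> bool"
  assumes "AE y in lborel. P y" and [measurable]: "Measurable.pred borel P"
  shows "AE v in (lborel :: (real \<times> real) measure). P (fst v)"
proof -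
  have "AE v in lborel \<Otimes>\<^sub>M lborel. P (fst (v :: real \<times> real))"
  proof (rule lborel_pair.AE_pair_measure)
    show "{v \<in> space (lborel \<Otimes>\<^sub>M lborel). P (fst (v :: real \<times> real))} \<in> sets (lborel \<Otimes>\<^sub>M lborel)"
      by measurable
    show "AE y in lborel. AE z in lborel :: real measure. P (fst (y :: real, z))"
      using assms(1) by eventually_elim simp
  qed
  then show ?thesis unfolding lborel_prod .
qed

lemma ruin_functional_bounds:
  assumes p: "cadlag p" "no_positive_jumps p" "0 < p 0" and A: "A \<subseteq> {(y, z). 0 < z}" and q: "0 \<le> q" "0 \<le> \<beta>"
  shows "ruin_functional q \<beta> a b A p \<le> 1"
proof (cases "ruin_functional q \<beta> a b A p = 0")
  case False
  obtain T T0 where T: "T = exit_time p 0 a" "exit_set p 0 a \<noteq> {}" "T < T0"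
      and val: "ruin_functional q \<beta> a b A p = exp (- q * T - \<beta> * (T0 - T))"
    by (rule ruin_functional_nonzero[OF p A False])
  have "0 \<le> q * T" "0 \<le> \<beta> * (T0 - T)" using exit_time_nonneg[OF T(2)] T q by auto
  then show ?thesis unfolding val by simp
qed simp

lemma ruin_functional_nonneg: "0 \<le> ruin_functional q \<beta> a b A p"
  by (simp add: ruin_functional_def Let_def)

section \<open>The squeeze between lower and upper functionals\<close>

context spectrally_negative_levy
begin

lemma ruin_identity:
  fixes A :: "(real \<times> real) set"
  assumes \<pi>: "\<pi> \<in> borel_measurable borel" "\<And>u. 0 \<le> \<pi> u" and \<nu>: "\<nu> = density lborel (\<lambda>u. ennreal (\<pi> u))"
    and q: "0 \<le> q" and \<beta>: "0 \<le> \<beta>"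
    and W: "is_scale_function (laplace_exponent \<mu> \<sigma> \<nu>) q W"
    and W': "is_scale_function (laplace_exponent \<mu> \<sigma> \<nu>) \<beta> W'"
    and x: "0 < x" "x < a" and b: "0 < b" and A: "A \<in> sets borel"
    and A': "A \<subseteq> {(y, z). 0 < y \<and> y < a \<and> 0 < z \<and> z < b}"
  defines "R \<equiv> \<lambda>\<omega>. ruin_functional q \<beta> a b A (\<lambda>t. x + X t \<omega>)"
    and "f \<equiv> \<lambda>(y, z). ruin_kernel \<pi> W x y z a * (W' (- z + b) / W' b)"
  shows "integrable M R" "set_integrable lborel A f" "expectation R = set_lebesgue_integral lborel A f"
proof -
  interpret E: levy_exit M F "started x" \<mu> \<sigma> \<nu> law by (rule levy_exit_started)
  have Wpos: "0 < W v" "0 < W' v" if "0 < v" for v using scale_pos[OF W q that] scale_pos[OF W' \<beta> that] by auto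
  have xa: "x \<in> {0<..<a}" using x by simp
  note M1 = emeasure_space_1
  \<comment> \<open>The double \<open>Suc\<close> gives \<open>d n < b\<close> already for
    \<open>n = 0\<close>.\<close>
  define d where "d n = b / real (Suc (Suc n))" for n
  have d: "0 < d n" "d n < b" for n
  proof -
    show "0 < d n" unfolding d_def using b by simp
    have "b * 1 < b * real (Suc (Suc n))" using b by (intro mult_strict_left_mono) auto
    then show "d n < b" unfolding d_def by (subst pos_divide_less_eq) auto
  qed
  have d0: "d \<longlonglongrightarrow> 0"
    unfolding d_def using LIMSEQ_Suc[OF LIMSEQ_Suc[OF lim_const_over_n[of b]]] .
  have W'lim: "(\<lambda>n. W' (b - d n)) \<longlonglongrightarrow> W' b"
    using tendsto_diff[OF tendsto_const[of b] d0] by (intro isCont_tendsto_compose[OF scale_isCont[OF W' b]]) simp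
  define G where "G = ruin_density \<pi> W W' x a b 0"
  define I where "I = (\<integral>\<^sup>+v\<in>A. G v \<partial>lborel)"
  define Ru where "Ru \<omega> = ennreal (ruin_functional q \<beta> a b A (\<lambda>t. started x t \<omega>))" for \<omega>
  define U where "U n \<omega> = ruin_ind q (recovery_weight \<beta> b (d n)) (A \<inter> ({0<..<a} \<times> {d n<..<b})) (\<lambda>t. started x t \<omega>) a" for n \<omega>
  define L where "L n \<omega> = ruin_ind q (recovery_weight \<beta> (b - d n) 0) (A \<inter> ({0<..<a} \<times> {0<..<b - d n})) (\<lambda>t. started x t \<omega>) a" for n \<omega>
  \<comment> \<open>\<open>Ls\<close> and \<open>Ui\<close> are the measurable minorant and majorant
    of the functional; only then is the functional itself seen to be measurable.\<close>
  define Ls where "Ls \<omega> = (SUP n. L n \<omega>)" for \<omega>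
  define Ui where "Ui \<omega> = liminf (\<lambda>n. U n \<omega>)" for \<omega>
  have U: "U n \<in> borel_measurable M"
    "(\<integral>\<^sup>+\<omega>. U n \<omega> \<partial>M) = (\<integral>\<^sup>+v\<in>A \<inter> ({0<..<a} \<times> {d n<..<b}). ruin_density \<pi> W W' x a b (d n) v \<partial>lborel)" for n
    using E.ruin_formula[OF xa started_path(3) M1 q W _ \<beta> less_imp_le[OF d(1)] d(2) W' _ \<pi>(1) \<nu> A, of n] Wpos d[of n] x
    unfolding U_def[abs_def] by auto
  have L: "L n \<in> borel_measurable M"
    "(\<integral>\<^sup>+\<omega>. L n \<omega> \<partial>M) = (\<integral>\<^sup>+v\<in>A \<inter> ({0<..<a} \<times> {0<..<b - d n}). ruin_density \<pi> W W' x a (b - d n) 0 v \<partial>lborel)" for n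
    using E.ruin_formula[OF xa started_path(3) M1 q W _ \<beta> order_refl _ W' _ \<pi>(1) \<nu> A, of "b - d n"] Wpos d[of n] x
    unfolding L_def[abs_def] by auto
  note dm = E.ruin_density_measurable[OF W W' \<pi>(1)]
  note [measurable] = dm[of x a b 0, folded G_def] A U(1) L(1)
  have Lsm[measurable]: "Ls \<in> borel_measurable M" unfolding Ls_def by measurable
  have Uim[measurable]: "Ui \<in> borel_measurable M" unfolding Ui_def by measurable
  have A0: "A \<subseteq> {(y, z). 0 < z}" using A' by auto
  have p0: "0 < started x 0 \<omega>" for \<omega> using x by (simp add: started_path)
  have LR: "Ls \<omega> \<le> Ru \<omega>" for \<omega>
    unfolding Ls_def L_def Ru_def using d b x
    by (intro SUP_least ruin_ind_lower started_path \<beta>) auto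
  have RU: "Ru \<omega> \<le> Ui \<omega>" for \<omega>
  proof (cases "ruin_functional q \<beta> a b A (\<lambda>t. started x t \<omega>) = 0")
    case False
    let ?p = "\<lambda>t. started x t \<omega>"
    have "0 < - ?p (exit_time ?p 0 a)"
      using ruin_functional_nonzero[OF started_path(1,2) p0 A0 False] by (metis neg_0_less_iff_less)
    then have "\<forall>\<^sub>F n in sequentially. d n < - ?p (exit_time ?p 0 a)" by (rule order_tendstoD(2)[OF d0])
    then have "\<forall>\<^sub>F n in sequentially. Ru \<omega> \<le> U n \<omega>"
    proof eventually_elim
      case (elim n)
      show ?case unfolding Ru_def U_def
        by (rule ruin_ind_upper[OF started_path(1,2) p0 \<beta> A' False d(1) elim])
    qed
    then show ?thesis unfolding Ui_def by (rule Liminf_bounded)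
  qed (simp add: Ru_def)
  \<comment> \<open>Fatou's lemma on the plane: the densities for \<open>b - d n\<close> converge
    pointwise on \<open>A\<close>, where \<open>z < b - d n\<close> eventually.\<close>
  have I_le: "I \<le> (\<integral>\<^sup>+\<omega>. Ls \<omega> \<partial>M)"
  proof -
    have "I \<le> (\<integral>\<^sup>+v. liminf (\<lambda>n. ruin_density \<pi> W W' x a (b - d n) 0 v * indicator (A \<inter> ({0<..<a} \<times> {0<..<b - d n})) v) \<partial>lborel)"
      unfolding I_def
    proof (rule nn_integral_mono)
      fix v :: "real \<times> real"
      obtain y z where v: "v = (y, z)" by fastforce
      show "G v * indicator A v \<le> liminf (\<lambda>n. ruin_density \<pi> W W' x a (b - d n) 0 v * indicator (A \<inter> ({0<..<a} \<times> {0<..<b - d n})) v)"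
      proof (cases "v \<in> A")
        case True
        then have yz: "0 < y" "y < a" "0 < z" "z < b" using A' v by auto
        have "\<forall>\<^sub>F n in sequentially. d n < b - z" using yz by (intro order_tendstoD(2)[OF d0]) simp
        then have ev: "\<forall>\<^sub>F n in sequentially.
          ennreal (W x / W a * pos_part_scale W (a - y) - pos_part_scale W (x - y)) * ennreal (\<pi> (- z - y)) * ennreal (W' (b - d n - z) / W' (b - d n))
          = ruin_density \<pi> W W' x a (b - d n) 0 v * indicator (A \<inter> ({0<..<a} \<times> {0<..<b - d n})) v"
        proof eventually_elim
          case (elim n)
          have z: "0 < b - d n - z" using elim by linarith
          then have "(y, z) \<in> A \<inter> ({0<..<a} \<times> {0<..<b - d n})" using yz True unfolding v by simp
          then show ?case unfolding v ruin_density_def by (simp only: pos_part_scale_pos[OF z] indicator_simps prod.case mult_1_right diff_0_right)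
        qed
        have lim1: "(\<lambda>n. W' (b - d n - z)) \<longlonglongrightarrow> W' (b - z)"
        proof (rule isCont_tendsto_compose[OF scale_isCont[OF W']])
          show "(\<lambda>n. b - d n - z) \<longlonglongrightarrow> b - z" using tendsto_diff[OF tendsto_diff[OF tendsto_const[of b] d0] tendsto_const[of z]] by simp
        qed (use yz in simp)
        have "(\<lambda>n. W' (b - d n - z) / W' (b - d n)) \<longlonglongrightarrow> W' (b - z) / W' b"
          using Wpos(2)[OF b] by (intro tendsto_divide lim1 W'lim) auto
        then have "(\<lambda>n. ennreal (W x / W a * pos_part_scale W (a - y) - pos_part_scale W (x - y)) * ennreal (\<pi> (- z - y)) * ennreal (W' (b - d n - z) / W' (b - d n)))
          \<longlonglongrightarrow> ennreal (W x / W a * pos_part_scale W (a - y) - pos_part_scale W (x - y)) * ennreal (\<pi> (- z - y)) * ennreal (W' (b - z) / W' b)"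
          by (intro ennreal_tendsto_cmult tendsto_ennrealI) (auto simp: ennreal_mult_less_top)
        from Lim_transform_eventually[OF this ev]
        have "(\<lambda>n. ruin_density \<pi> W W' x a (b - d n) 0 v * indicator (A \<inter> ({0<..<a} \<times> {0<..<b - d n})) v) \<longlonglongrightarrow> G v"
          using yz by (simp add: G_def v ruin_density_def pos_part_scale_pos)
        from lim_imp_Liminf[OF _ this] show ?thesis using True by simp
      qed simp
    qed
    also have "\<dots> \<le> liminf (\<lambda>n. \<integral>\<^sup>+\<omega>. L n \<omega> \<partial>M)"
      unfolding L(2)
    proof (rule nn_integral_liminf)
      fix n
      have "({0<..<a} \<times> {0<..<b - d n}) \<in> sets borel" by (intro borel_open open_Times) auto
      note [measurable] = this dm[of x a "b - d n" 0]
      show "(\<lambda>v. ruin_density \<pi> W W' x a (b - d n) 0 v * indicator (A \<inter> ({0<..<a} \<times> {0<..<b - d n})) v) \<in> borel_measurable lborel"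
        by measurable
    qed
    also have "\<dots> \<le> liminf (\<lambda>n. \<integral>\<^sup>+\<omega>. Ls \<omega> \<partial>M)"
      unfolding Ls_def by (intro Liminf_mono always_eventually allI nn_integral_mono SUP_upper) simp
    finally show ?thesis by (simp add: Liminf_const)
  qed
  have Ls1: "(\<integral>\<^sup>+\<omega>. Ls \<omega> \<partial>M) < \<infinity>"
  proof -
    have "Ls \<omega> \<le> 1" for \<omega>
      using LR[of \<omega>] ruin_functional_bounds[OF started_path(1,2) p0 A0 q \<beta>]
      unfolding Ru_def by (elim order_trans) (simp add: ennreal_leI flip: ennreal_1)
    then have "(\<integral>\<^sup>+\<omega>. Ls \<omega> \<partial>M) \<le> (\<integral>\<^sup>+\<omega>. 1 \<partial>M)" by (intro nn_integral_mono)
    then show ?thesis using le_less_trans by (fastforce simp: M1)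
  qed
  have Ifin: "I < \<infinity>" using I_le Ls1 by (rule le_less_trans)
  \<comment> \<open>Fatou's lemma on the probability space. The densities of the upper functionals
    are \<open>G\<close> times a constant that tends to 1.\<close>
  have Ui_le: "(\<integral>\<^sup>+\<omega>. Ui \<omega> \<partial>M) \<le> I"
  proof -
    have "(\<integral>\<^sup>+\<omega>. Ui \<omega> \<partial>M) \<le> liminf (\<lambda>n. \<integral>\<^sup>+\<omega>. U n \<omega> \<partial>M)"
      unfolding Ui_def by (rule nn_integral_liminf) (rule U)
    also have "\<dots> \<le> liminf (\<lambda>n. I * ennreal (W' b / W' (b - d n)))"
    proof (intro Liminf_mono always_eventually allI)
      fix n
      have e: "ruin_density \<pi> W W' x a b (d n) v = G v * ennreal (W' b / W' (b - d n))" for v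
      proof -
        have bd: "0 < W' b" "0 < W' (b - d n)" using Wpos b d by auto
        have "pos_part_scale W' (b - z) / W' (b - d n) = pos_part_scale W' (b - z) / W' b * (W' b / W' (b - d n))" for z
          using bd by simp
        then have "ennreal (pos_part_scale W' (b - z) / W' (b - d n)) = ennreal (pos_part_scale W' (b - z) / W' b) * ennreal (W' b / W' (b - d n))" for z
          using bd pos_part_scale_nonneg[OF W'] by (simp only: ennreal_mult divide_nonneg_pos less_imp_le)
        then show ?thesis by (simp add: ruin_density_def G_def case_prod_unfold mult.assoc)
      qed
      have "(\<integral>\<^sup>+\<omega>. U n \<omega> \<partial>M) \<le> (\<integral>\<^sup>+v. G v * indicator A v * ennreal (W' b / W' (b - d n)) \<partial>lborel)"
        unfolding U(2) e by (intro nn_integral_mono) (auto simp: indicator_def)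
      also have "\<dots> = I * ennreal (W' b / W' (b - d n))"
        unfolding I_def by (rule nn_integral_multc) measurable
      finally show "(\<integral>\<^sup>+\<omega>. U n \<omega> \<partial>M) \<le> I * ennreal (W' b / W' (b - d n))" .
    qed
    also have "\<dots> = I"
    proof (rule lim_imp_Liminf)
      have "(\<lambda>n. W' b / W' (b - d n)) \<longlonglongrightarrow> W' b / W' b"
        using Wpos(2)[OF b] by (intro tendsto_divide W'lim tendsto_const) auto
      then have "(\<lambda>n. I * ennreal (W' b / W' (b - d n))) \<longlonglongrightarrow> I * ennreal (W' b / W' b)"
        using Ifin by (intro ennreal_tendsto_cmult tendsto_ennrealI) auto
      then show "(\<lambda>n. I * ennreal (W' b / W' (b - d n))) \<longlonglongrightarrow> I" using Wpos(2)[OF b] by simp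
    qed simp
    finally show ?thesis .
  qed
  have AE_eq: "AE \<omega> in M. Ls \<omega> = Ui \<omega>"
    using LR RU by (intro AE_eq_of_nn_integral_le order_trans[OF Ui_le I_le] Ls1) (auto intro: order_trans)
  have Ls_I: "(\<integral>\<^sup>+\<omega>. Ls \<omega> \<partial>M) = I"
    using I_le Ui_le nn_integral_cong_AE[OF AE_eq] by simp
  have RLs: "AE \<omega> in M. ennreal (R \<omega>) = Ls \<omega>"
    using AE_eq AE_started[of x]
  proof eventually_elim
    case (elim \<omega>)
    have "Ru \<omega> = ennreal (R \<omega>)" using elim(2) by (simp add: Ru_def R_def)
    then show ?case using LR[of \<omega>] RU[of \<omega>] unfolding elim(1) by (simp only: antisym)
  qed
  have R0: "0 \<le> R \<omega>" for \<omega> unfolding R_def by (rule ruin_functional_nonneg)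
  \<comment> \<open>\<open>R\<close> agrees almost everywhere with a measurable function;
    completeness of \<open>M\<close> does the rest.\<close>
  have Rm: "R \<in> borel_measurable M"
  proof (rule borel_measurable_AE_eq)
    show "(\<lambda>\<omega>. enn2real (Ls \<omega>)) \<in> borel_measurable M" by measurable
    show "AE \<omega> in M. R \<omega> = enn2real (Ls \<omega>)" using RLs by eventually_elim (metis R0 enn2real_ennreal)
  qed
  have RI: "(\<integral>\<^sup>+\<omega>. ennreal (R \<omega>) \<partial>M) = I" using nn_integral_cong_AE[OF RLs] Ls_I by simp
  show "integrable M R" using Rm R0 RI Ifin by (intro integrableI_nonneg) auto
  have [measurable]: "W \<in> borel_measurable borel" "W' \<in> borel_measurable borel" "\<pi> \<in> borel_measurable borel"
    using scale_borel_measurable[OF W] scale_borel_measurable[OF W'] \<pi> by auto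
  note [measurable] = scale_measurable[OF W]
  have "(\<lambda>(y, z). ruin_kernel \<pi> W x y z a * (W' (- z + b) / W' b)) \<in> borel_measurable (borel \<Otimes>\<^sub>M borel)"
    unfolding ruin_kernel_def by measurable
  then have fm[measurable]: "f \<in> borel_measurable borel" unfolding f_def by (simp add: borel_prod)
  define K where "K y = W x / W a * pos_part_scale W (a - y) - pos_part_scale W (x - y)" for y
  \<comment> \<open>At \<open>y = x\<close> the kernel involves the arbitrary value
    \<open>W 0\<close>, where \<open>pos_part_scale\<close> has 0.\<close>
  have "AE y in lborel. y \<noteq> x" by (rule AE_lborel_singleton)
  moreover have "AE y in lborel. y \<in> {0<..<a} \<longrightarrow> 0 \<le> K y"
    unfolding K_def by (rule E.potential_density(1)[OF xa started_path(3) M1 q W]) (use Wpos x in auto)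
  ultimately have "AE y in lborel. y \<noteq> x \<and> (y \<in> {0<..<a} \<longrightarrow> 0 \<le> K y)" by eventually_elim simp
  then have "AE v in (lborel :: (real \<times> real) measure). fst v \<noteq> x \<and> (fst v \<in> {0<..<a} \<longrightarrow> 0 \<le> K (fst v))"
    by (rule AE_lborel_fst) (unfold K_def, measurable)
  then have AEf: "AE v in lborel. 0 \<le> indicator A v *\<^sub>R f v \<and> ennreal (indicator A v *\<^sub>R f v) = G v * indicator A v"
  proof eventually_elim
    case (elim v)
    show ?case
    proof (cases "v \<in> A")
      case True
      obtain y z where v: "v = (y, z)" by fastforce
      have yz: "0 < y" "y < a" "0 < z" "z < b" using A' True v by auto
      have Ky: "W x / W a * W (a - y) - W (x - y) = K y" "0 \<le> K y"
        using elim yz v x by (auto simp: K_def pos_part_scale_eq[OF W])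
      have Wz: "0 \<le> W' (b - z) / W' b" using Wpos(2)[of "b - z"] Wpos(2)[OF b] yz by simp
      define k where "k = K y * \<pi> (- z - y) * (W' (b - z) / W' b)"
      have k0: "0 \<le> k" unfolding k_def using Ky(2) \<pi>(2) Wz by (intro mult_nonneg_nonneg)
      have bz: "0 < b - z" "- z + b = b - z" using yz by auto
      have fv: "f v = k"
        unfolding f_def v ruin_kernel_def prod.case Ky(1) k_def bz(2) by (simp only: ac_simps)
      have "G v = ennreal k"
        unfolding G_def v ruin_density_def prod.case K_def[symmetric] pos_part_scale_pos[OF bz(1)] k_def diff_0_right
        using Ky(2) \<pi>(2) Wz by (simp only: ennreal_mult mult_nonneg_nonneg)
      then show ?thesis using True k0 fv by simp
    qed simp
  qed
  have nn: "AE v in lborel. 0 \<le> indicator A v *\<^sub>R f v"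
    using AEf by eventually_elim (rule conjunct1)
  have eqG: "AE v in lborel. ennreal (indicator A v *\<^sub>R f v) = G v * indicator A v"
    using AEf by eventually_elim (rule conjunct2)
  have fI: "(\<integral>\<^sup>+v. ennreal (indicator A v *\<^sub>R f v) \<partial>lborel) = I"
    unfolding I_def by (rule nn_integral_cong_AE[OF eqG])
  have m: "(\<lambda>v. indicator A v *\<^sub>R f v) \<in> borel_measurable lborel" by measurable
  show "set_integrable lborel A f"
    unfolding set_integrable_def using m nn fI Ifin by (intro integrableI_nonneg) auto
  have "expectation R = enn2real I" using integral_eq_nn_integral[OF Rm] R0 RI by simp
  also have "\<dots> = set_lebesgue_integral lborel A f"
    unfolding set_lebesgue_integral_def using integral_eq_nn_integral[OF m nn] fI by simp
  finally show "expectation R = set_lebesgue_integral lborel A f" .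
qed

end

theorem theorem3p2:
  fixes M :: "'a measure" and F :: "real \<Rightarrow> 'a measure" and X :: "real \<Rightarrow> 'a \<Rightarrow> real"
    and \<mu> \<sigma> :: real and \<nu> :: "real measure" and \<pi> :: "real \<Rightarrow> real"
    and Wq W\<beta> :: "real \<Rightarrow> real" and q \<beta> x a b :: real and A :: "(real \<times> real) set"
  assumes "spectrally_negative_levy M F X \<mu> \<sigma> \<nu>"
    and "\<pi> \<in> borel_measurable borel" and "\<And>u. 0 \<le> \<pi> u"
    and "\<nu> = density lborel (\<lambda>u. ennreal (\<pi> u))"
    and "0 \<le> q" and "0 \<le> \<beta>"
    and "is_scale_function (laplace_exponent \<mu> \<sigma> \<nu>) q Wq"
    and "is_scale_function (laplace_exponent \<mu> \<sigma> \<nu>) \<beta> W\<beta>"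
    and "0 < x" and "0 < a" and "0 < b" and "x < a"
    and "A \<in> sets borel"
    and "A \<subseteq> {(y, z). 0 < y \<and> 0 < z \<and> z < b \<and> b \<le> min a (min x y) \<and> y < a}"
  shows "integrable M (\<lambda>\<omega>. ruin_functional q \<beta> a b A (\<lambda>t. x + X t \<omega>))
    \<and> set_integrable lborel A
           (\<lambda>(y, z). ruin_kernel \<pi> Wq x y z a * (W\<beta> (- z + b) / W\<beta> b))
    \<and> prob_space.expectation M (\<lambda>\<omega>. ruin_functional q \<beta> a b A (\<lambda>t. x + X t \<omega>))
         = set_lebesgue_integral lborel A
             (\<lambda>(y, z). ruin_kernel \<pi> Wq x y z a * (W\<beta> (- z + b) / W\<beta> b))"
proof -
  interpret spectrally_negative_levy M F X \<mu> \<sigma> \<nu> by (rule assms(1))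
  have "A \<subseteq> {(y, z). 0 < y \<and> y < a \<and> 0 < z \<and> z < b}" using assms(14) by auto
  note R = ruin_identity[OF assms(2,3,4,5,6,7,8,9,12,11,13) this]
  show ?thesis using R by blast
qed

end
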